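(* Let $\gamma,r>0$ and let $\Lambda^{(2)}$ be the multiplier operator associated with $\lambda^{(2)}_{m,n}=e^{-\gamma(\max\{m,n\})^r}$, $m,n\in\mathbb{N}$. Let $\phi_k=\dim\mathcal{T}_k$ and $\mathcal{R}=\gamma\big(d!\,(d-1)!/2\big)^{r/(2d-1)}$. Then for $0<r\le1$, $1\le p\le\infty$, $2\le q\le\infty$ and all $k\in\mathbb{N}$, $$d_k(\Lambda^{(2)}U_p,L^q)\ll e^{-\mathcal{R}k^{r/(2d-1)}}k^{(1-r/(2d-1))(1/p-1/2)_+}\begin{cases}1,&2\le q<\infty,\\(\ln k)^{1/2},&q=\infty,\end{cases}$$ and for all $r>1$ and all $k\in\mathbb{N}$, $$d_{\phi_k}(\Lambda^{(2)}U_p,L^q)\ll e^{-\gamma k^r}\begin{cases}k^{(2d-2)(1/p-1/q)},&1\le p\le2\le q\le\infty,\\k^{(2d-2)(1/2-1/q)},&2\le p,q\le\infty.\end{cases}$$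
   Context: $\mathbb{N}=\{0,1,2,\dots\}$; $d\ge2$ is a fixed integer. $(a)_+=a$ if $a>0$ and $(a)_+=0$ if $a\le0$. The notation $a_k\ll b_k$ means that there is a constant $C>0$, independent of $k$, with $a_k\le Cb_k$; here it is understood for $k\ge2$. $\Omega_d$ is the unit sphere of $\mathbb{C}^d$ with surface measure $\sigma_d$ (the Lebesgue surface measure of $S^{2d-1}\subset\mathbb{R}^{2d}$ under $\mathbb{C}^d\cong\mathbb{R}^{2d}$). $L^p=L^p(\Omega_d)$ is the usual space of complex-valued functions, with closed unit ball $U_p$. $\mathcal{H}_{m,n}$ is the space of restrictions to $\Omega_d$ of polynomials in $z,\bar z$ homogeneous of degree $m$ in $z$ and degree $n$ in $\bar z$ and in the kernel of $4\sum_j\partial^2/\partial z_j\partial\bar z_j$. $\mathcal{T}_N=\bigoplus_{\max\{m,n\}\le N}\mathcal{H}_{m,n}$. Let $Z_w^{(m,n)}$ be the reproducing kernel of $\mathcal{H}_{m,n}$ at $w\in\Omega_d$, and $(\varphi*\widetilde Z^{(m,n)})(w)=\int_{\Omega_d}\varphi\,\overline{Z_w^{(m,n)}}\,d\sigma_d$ (the orthogonal projection onto $\mathcal{H}_{m,n}$ on $L^2$). The multiplier operator $\Lambda$ associated with $\{\lambda_{m,n}\}$ sends $\varphi$ to the function $\Lambda\varphi$ with formal expansion $\Lambda\varphi\sim\sum_{m,n}\lambda_{m,n}\varphi*\widetilde Z^{(m,n)}$. Kolmogorov width: $d_n(A,X)=\inf_{X_n}\sup_{x\in A}\inf_{y\in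 X_n}\|x-y\|_X$, $X_n$ ranging over the subspaces of $X$ of dimension $n$. *)

theory Defs
  imports
    "HOL-Analysis.Analysis"
    "HOL-Probability.Essential_Supremum"
    "HOL-Library.Function_Algebras"
begin

section \<open>Complex function spaces\<close>

global_interpretation cfun:
  vector_space "\<lambda>(c::complex) (f::'a \<Rightarrow> complex) x. c * f x"
  by unfold_locales (auto simp: fun_eq_iff algebra_simps)

text \<open>Elements of an \<open>L\<^sup>p\<close> space are represented by functions, not by
  classes modulo null sets. The exponent \<open>p \<in> [1, \<infinity>]\<close> is an extended real, and norms take
  values in \<open>[0, \<infinity>]\<close>.\<close>

definition Lp_norm :: "'a measure \<Rightarrow> ennreal \<Rightarrow> ('a \<Rightarrow> complex) \<Rightarrow> ennreal" where
  "Lp_norm M p f =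
     (if p = \<infinity> then esssup M (\<lambda>x. ennreal (cmod (f x)))
      else (let I = (\<integral>\<^sup>+ x. ennreal (cmod (f x) powr enn2real p) \<partial>M)
            in if I = \<infinity> then \<infinity> else ennreal (enn2real I powr (1 / enn2real p))))"

definition Lp_space :: "'a measure \<Rightarrow> ennreal \<Rightarrow> ('a \<Rightarrow> complex) set" where
  "Lp_space M p = {f \<in> borel_measurable M. Lp_norm M p f < \<infinity>}"

definition Lp_ball :: "'a measure \<Rightarrow> ennreal \<Rightarrow> ('a \<Rightarrow> complex) set" where
  "Lp_ball M p = {f \<in> borel_measurable M. Lp_norm M p f \<le> 1}"

text \<open>The \<open>n\<close>-dimensional complex subspaces of \<open>L\<^sup>q\<close>, each given by a span of
  representatives. As elements of \<open>L\<^sup>q\<close> are functions up to null sets, the linear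
  independence of the basis is required modulo null sets.\<close>

definition Lp_subspaces :: "'a measure \<Rightarrow> ennreal \<Rightarrow> nat \<Rightarrow> ('a \<Rightarrow> complex) set set" where
  "Lp_subspaces M q n =
     {cfun.span B | B. B \<subseteq> Lp_space M q \<and> finite B \<and> card B = n \<and>
        (\<forall>c. (AE x in M. (\<Sum>b\<in>B. c b * b x) = 0) \<longrightarrow> (\<forall>b\<in>B. c b = 0))}"

definition kolmogorov_width ::
    "nat \<Rightarrow> ('a \<Rightarrow> complex) set \<Rightarrow> 'a measure \<Rightarrow> ennreal \<Rightarrow> ennreal" where
  "kolmogorov_width n A M q =
     (INF X\<in>Lp_subspaces M q n. SUP f\<in>A. INF g\<in>X. Lp_norm M q (\<lambda>x. f x - g x))"

section \<open>The unit sphere\<close>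

text \<open>Surface measure on the unit sphere of a Euclidean space of dimension \<open>N\<close>, normalised by
  polar coordinates: the measure of \<open>A\<close> is \<open>N\<close> times the Lebesgue measure of the cone
  \<open>{t x | x \<in> A, 0 < t < 1}\<close>, since the latter is the area of \<open>A\<close> times the integral of
  \<open>t\<^bsup>N - 1\<^esup>\<close> over \<open>(0, 1)\<close>. The space of the measure is the sphere itself. On
  \<open>complex ^ 'd\<close> the real dimension is \<open>2 * CARD('d)\<close>.\<close>

definition sphere_measure :: "'a::euclidean_space measure" where
  "sphere_measure =
     scale_measure (of_nat DIM('a))
       (distr (restrict_space lborel (ball 0 1 - {0})) (restrict_space borel (sphere 0 1))
         (\<lambda>x. x /\<^sub>R norm x))"

lemma emeasure_sphere_measure:
  fixes A :: "'a::euclidean_space set"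
  assumes "A \<in> sets borel" "A \<subseteq> sphere 0 1"
  shows "emeasure sphere_measure A =
    of_nat DIM('a) * emeasure lborel {t *\<^sub>R x | t x. x \<in> A \<and> 0 < t \<and> t < 1}"
proof -
  have A: "A \<in> sets (restrict_space borel (sphere 0 1))"
    using assms by (auto simp: sets_restrict_space)
  have m: "(\<lambda>x::'a. x /\<^sub>R norm x) \<in>
      restrict_space lborel (ball 0 1 - {0}) \<rightarrow>\<^sub>M restrict_space borel (sphere 0 1)"
    by (intro measurable_restrict_space2 measurable_restrict_space1)
       (auto simp: space_restrict_space)
  have eq: "(\<lambda>x. x /\<^sub>R norm x) -` A \<inter> (ball 0 1 - {0}) =
      {t *\<^sub>R x | t x. x \<in> A \<and> 0 < t \<and> t < 1}" (is "?L = ?R")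
  proof (intro equalityI subsetI)
    fix y assume y: "y \<in> ?L"
    have "y = norm y *\<^sub>R (y /\<^sub>R norm y)" using y by simp
    then show "y \<in> ?R"
      using y by (auto intro!: exI[of _ "norm y"] exI[of _ "y /\<^sub>R norm y"])
  next
    fix y assume "y \<in> ?R"
    then obtain t x where "y = t *\<^sub>R x" "x \<in> A" "0 < t" "t < 1" by auto
    moreover have "norm x = 1" using assms(2) \<open>x \<in> A\<close> by auto
    ultimately show "y \<in> ?L" by auto
  qed
  show ?thesis
    unfolding sphere_measure_def emeasure_scale_measure
    by (subst emeasure_distr[OF m A], subst emeasure_restrict_space)
       (auto simp: space_restrict_space eq[symmetric])
qed

text \<open>Functions on the sphere are functions on the ambient space; restriction to the sphere
  extends by \<open>0\<close>, which makes the restriction map linear.\<close>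

definition sphere_restrict :: "('a::euclidean_space \<Rightarrow> complex) \<Rightarrow> 'a \<Rightarrow> complex" where
  "sphere_restrict f = (\<lambda>z. if z \<in> sphere 0 1 then f z else 0)"

section \<open>Complex spherical harmonics\<close>

definition bihom_polys :: "nat \<Rightarrow> nat \<Rightarrow> (complex ^ 'd::finite \<Rightarrow> complex) set" where
  "bihom_polys m n = cfun.span
     {(\<lambda>z. (\<Prod>j\<in>UNIV. (z $ j) ^ \<alpha> j) * (\<Prod>j\<in>UNIV. (cnj (z $ j)) ^ \<beta> j)) | \<alpha> \<beta>.
        (\<Sum>j\<in>UNIV. \<alpha> j) = m \<and> (\<Sum>j\<in>UNIV. \<beta> j) = n}"

text \<open>Wirtinger derivatives
  \<open>\<partial>/\<partial>z\<^sub>j = (\<partial>/\<partial>x\<^sub>j - \<i> \<partial>/\<partial>y\<^sub>j) / 2\<close> and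
  \<open>\<partial>/\<partial>(cnj z\<^sub>j) = (\<partial>/\<partial>x\<^sub>j + \<i> \<partial>/\<partial>y\<^sub>j) / 2\<close>, where
  \<open>z\<^sub>j = x\<^sub>j + \<i> y\<^sub>j\<close>.\<close>

definition wirtinger ::
    "'d::finite \<Rightarrow> (complex ^ 'd \<Rightarrow> complex) \<Rightarrow> complex ^ 'd \<Rightarrow> complex" where
  "wirtinger j f z =
     (frechet_derivative f (at z) (axis j 1) - \<i> * frechet_derivative f (at z) (axis j \<i>)) / 2"

definition wirtinger_cnj ::
    "'d::finite \<Rightarrow> (complex ^ 'd \<Rightarrow> complex) \<Rightarrow> complex ^ 'd \<Rightarrow> complex" where
  "wirtinger_cnj j f z =
     (frechet_derivative f (at z) (axis j 1) + \<i> * frechet_derivative f (at z) (axis j \<i>)) / 2"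

definition complex_laplacian ::
    "(complex ^ 'd::finite \<Rightarrow> complex) \<Rightarrow> complex ^ 'd \<Rightarrow> complex" where
  "complex_laplacian f z = 4 * (\<Sum>j\<in>UNIV. wirtinger j (wirtinger_cnj j f) z)"

definition harmonic_space :: "nat \<Rightarrow> nat \<Rightarrow> (complex ^ 'd::finite \<Rightarrow> complex) set" where
  "harmonic_space m n =
     sphere_restrict ` {P \<in> bihom_polys m n. \<forall>z. complex_laplacian P z = 0}"

definition harmonic_sum :: "nat \<Rightarrow> (complex ^ 'd::finite \<Rightarrow> complex) set" where
  "harmonic_sum N = cfun.span (\<Union>{harmonic_space m n | m n. max m n \<le> N})"

definition reproducing_kernel ::
    "nat \<Rightarrow> nat \<Rightarrow> complex ^ 'd::finite \<Rightarrow> complex ^ 'd \<Rightarrow> complex" where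
  "reproducing_kernel m n w =
     (THE Z. Z \<in> harmonic_space m n \<and>
        (\<forall>f\<in>harmonic_space m n. f w = (\<integral>z. f z * cnj (Z z) \<partial>sphere_measure)))"

definition harmonic_proj ::
    "nat \<Rightarrow> nat \<Rightarrow> (complex ^ 'd::finite \<Rightarrow> complex) \<Rightarrow> complex ^ 'd \<Rightarrow> complex" where
  "harmonic_proj m n \<phi> w =
     (\<integral>z. \<phi> z * cnj (reproducing_kernel m n w z) \<partial>sphere_measure)"

section \<open>Multiplier operators\<close>

text \<open>An integrable \<open>\<psi>\<close> has the formal expansion \<open>\<Sum>m n. c m n\<close>, with
  \<open>c m n \<in> harmonic_space m n\<close>, if \<open>c m n\<close> is its \<open>(m, n)\<close>-component for all \<open>m, n\<close>; no
  convergence is meant. The expansion determines \<open>\<psi>\<close> up to a null set, so that the choice below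
  only concerns the representative.\<close>

definition has_formal_expansion ::
    "(complex ^ 'd::finite \<Rightarrow> complex) \<Rightarrow> (nat \<Rightarrow> nat \<Rightarrow> complex ^ 'd \<Rightarrow> complex) \<Rightarrow> bool" where
  "has_formal_expansion \<psi> c \<longleftrightarrow>
     \<psi> \<in> Lp_space sphere_measure 1 \<and> (\<forall>m n. \<forall>w\<in>sphere 0 1. harmonic_proj m n \<psi> w = c m n w)"

definition multiplier_operator ::
    "(nat \<Rightarrow> nat \<Rightarrow> complex) \<Rightarrow> (complex ^ 'd::finite \<Rightarrow> complex) \<Rightarrow> complex ^ 'd \<Rightarrow> complex"
    where
  "multiplier_operator l \<phi> =
     (SOME \<psi>. has_formal_expansion \<psi> (\<lambda>m n w. l m n * harmonic_proj m n \<phi> w))"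

definition exp_multiplier :: "real \<Rightarrow> real \<Rightarrow> nat \<Rightarrow> nat \<Rightarrow> complex" where
  "exp_multiplier \<gamma> r m n = complex_of_real (exp (- \<gamma> * real (max m n) powr r))"

end

theory Submission
  imports Defs "HOL-Real_Asymp.Real_Asymp"
begin

text \<open>Group the harmonics by the \<^emph>\<open>shell\<close> \<open>j = max m n\<close>. The multiplier is the constant
  \<open>a j = exp (- \<gamma> * j powr r)\<close> on the \<open>j\<close>-th shell, the union of the shells up to \<open>N\<close> spans the
  space \<open>harmonic_sum N\<close>, and the \<open>j\<close>-th shell has dimension \<open>O(j^(2d-2))\<close>. The spaces at issue
  contain \<open>harmonic_sum N\<close>, so an image \<open>\<Lambda>\<phi>\<close> only has to be approximated beyond shell \<open>N\<close>. It is
  split there into the shells in \<open>{N<..2 * N}\<close> and a tail, and the tail is uniformly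
  \<open>O(exp (- \<gamma> * N powr r))\<close> (\<open>multiplier_decomposition\<close>).

  On the middle shells distribute the square roots of \<open>a\<close>: there \<open>\<Lambda>\<phi>\<close> is a sum of terms
  \<open>x e * \<alpha> e * e\<close> over an orthonormal basis, with weights \<open>\<alpha> e\<close> equal to the root of \<open>a\<close> and coefficients
  \<open>x e = \<alpha> e * \<langle>\<phi>, e\<rangle>\<close>. Every shell has a reproducing kernel that is constant on the diagonal, by invariance under unitary
  maps. Hence \<open>(\<Sum>e. (\<alpha> e)^2 * |e w|^2)\<close> does not exceed \<open>A^2 = C * exp (- \<gamma> * N powr r) * s\<close>, where
  \<open>s = N powr (2d - 1 - min 1 r)\<close>: for \<open>r < 1\<close> the exponential stays comparable to its value at \<open>N\<close>
  over \<open>N powr (1 - r)\<close> shells, for \<open>r \<ge> 1\<close> over boundedly many. A duality argument with a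
  splitting of \<open>\<phi>\<close> into its large and its small values bounds the \<open>l2\<close> norm of \<open>x\<close> by
  \<open>b = C * exp (- \<gamma> / 2 * N powr r) * s powr (1/p - 1/2)_+\<close> (\<open>coefficient_bound\<close>).

  For \<open>r > 1\<close> the space \<open>harmonic_sum k\<close> itself is used with \<open>N = k\<close>. The remainder is at most
  \<open>A * b\<close> in the supremum norm and \<open>exp (- \<gamma> / 2 * N powr r) * b\<close> in \<open>L2\<close>, up to the tail, and
  interpolation between both gives the \<open>Lq\<close> bound (\<open>width_fast_decay\<close>).

  For \<open>r \<le> 1\<close> that would lose a power of \<open>s\<close>. Instead about \<open>s\<close> additional dimensions are
  spent on the middle shells, which changes the dimension count only in the second order term and
  the exponential by a bounded factor (\<open>dimension_count_bound\<close>, \<open>choose_level\<close>). The additional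
  functions are random sign combinations of the \<open>\<alpha> e * e\<close>. By a lemma on random sections
  (\<open>random_sections\<close>), proved by symmetrisation and contraction, and by moment bounds for random signs, \<open>m\<close> of them approximate every
  weighted sum with \<open>l2\<close> norm of coefficients at most \<open>b\<close> up to \<open>C * sqrt (j / m) * A * b\<close> in
  \<open>L^(2j)\<close> (\<open>random_approximation\<close>). With \<open>m\<close> about \<open>s\<close> the factor \<open>sqrt s\<close> in \<open>A\<close> is cancelled.
  A fixed \<open>j\<close> settles \<open>q < \<infinity>\<close>. For \<open>q = \<infinity>\<close> one takes \<open>j\<close> about \<open>ln N\<close>; then the \<open>L^(2j)\<close> norm and the
  supremum norm are equivalent on \<open>harmonic_sum (2 * N)\<close> with a bounded constant, and \<open>sqrt j\<close> becomes
  the factor \<open>sqrt (ln k)\<close> (\<open>width_slow_decay\<close>).\<close>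

type_synonym 'd fn = "complex ^ 'd \<Rightarrow> complex"

abbreviation \<mu> :: "'a::euclidean_space measure" where
  "\<mu> \<equiv> sphere_measure"

section \<open>Approximation in a seminorm by random rows\<close>

definition sublinear :: "(('i => real) => real) => bool" where
  "sublinear p \<longleftrightarrow> (\<forall>x y. p (%i. x i + y i) <= p x + p y) \<and>
     (\<forall>t\<ge>0. \<forall>x. p (%i. t * x i) = t * p x)"

lemma sublinearI:
  assumes "!!x y. p (%i. x i + y i) <= p x + p y" "!!x. p (%i. 0 * x i) = 0"
    "!!t x. t > 0 ==> p (%i. t * x i) <= t * p x"
  shows "sublinear p"
  unfolding sublinear_def
proof (intro conjI allI impI)
  fix t :: real and x :: "'a => real" assume t: "0 <= t"
  show "p (%i. t * x i) = t * p x"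
  proof (cases "t = 0")
    case True then show ?thesis using assms(2)[of x] by simp
  next
    case False
    with t have t': "t > 0" by simp
    have "p (%i. (1/t) * (t * x i)) <= (1/t) * p (%i. t * x i)"
      using t' by (intro assms(3)) simp
    moreover have "(%i. (1/t) * (t * x i)) = x" using t' by auto
    ultimately have "p x <= (1/t) * p (%i. t * x i)" by simp
    hence "t * p x <= p (%i. t * x i)" using t' by (simp add: field_simps)
    with assms(3)[OF t', of x] show ?thesis by simp
  qed
qed (rule assms(1))

lemma sublinear_add: "sublinear p ==> p (%i. x i + y i) <= p x + p y"
  and sublinear_scale: "sublinear p ==> t >= 0 ==> p (%i. t * x i) = t * p x"
  by (auto simp: sublinear_def)

lemma sublinear_zero: "sublinear p ==> p (%i. 0) = 0"
  using sublinear_scale[of p 0 "%_. 0"] by simp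

lemma sublinear_neg: "sublinear p ==> - p (%i. - x i) <= p x"
  using sublinear_add[of p x "%i. - x i"] sublinear_zero[of p] by simp

text \<open>The step of the Hahn-Banach argument: the infimum of \<open>p (x + t * v) - t * p v\<close> over \<open>t \<ge> 0\<close> is
  again sublinear, below \<open>p\<close>, and linear in the direction \<open>v\<close>.\<close>

lemma sublinear_linear_along:
  assumes p: "sublinear p"
  shows "\<exists>q. sublinear q \<and> (\<forall>x. q x <= p x) \<and> q v = p v \<and> q (%i. - v i) = - p v"
proof -
  define q where "q x = (INF t\<in>{0..}. p (%i. x i + t * v i) - t * p v)" for x
  have low: "- p (%i. - x i) <= p (%i. x i + t * v i) - t * p v" if "t >= 0" for x and t :: real
    using sublinear_add[OF p, of "%i. - x i" "%i. x i + t * v i"]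
      sublinear_scale[OF p that, of v] by simp
  have bdd: "bdd_below ((%t. p (%i. x i + t * v i) - t * p v) ` {0..})" for x
    by (rule bdd_belowI2[where m="- p (%i. - x i)"]) (use low in auto)
  have qle: "q x <= p (%i. x i + t * v i) - t * p v" if "t >= 0" for x and t :: real
    unfolding q_def by (rule cINF_lower[OF bdd]) (use that in auto)
  have qge: "c <= q x" if "!!t. t >= 0 ==> c <= p (%i. x i + t * v i) - t * p v" for c x
    unfolding q_def by (rule cINF_greatest) (use that in auto)
  have qp: "q x <= p x" for x using qle[of 0 x] by simp
  have eq: "p (%i. t * v i) = t * p v" if "t >= 0" for t using sublinear_scale[OF p that] .
  have q0: "q (%i. 0) = 0"
    by (intro antisym qge) (use qp[of "%i. 0"] sublinear_zero[OF p] eq in auto)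
  have sub: "sublinear q"
  proof (rule sublinearI)
    fix x y
    have "q (%i. x i + y i) - (p (%i. x i + s * v i) - s * p v) <= q y" if s: "s >= 0" for s
    proof (rule qge)
      fix t :: real assume t: "t >= 0"
      have "q (%i. x i + y i) <= p (%i. (x i + y i) + (s + t) * v i) - (s + t) * p v"
        using s t by (intro qle) auto
      also have "(%i. (x i + y i) + (s + t) * v i) = (%i. (x i + s * v i) + (y i + t * v i))"
        by (auto simp: algebra_simps)
      also have "p ... <= p (%i. x i + s * v i) + p (%i. y i + t * v i)"
        by (rule sublinear_add[OF p])
      finally show "q (%i. x i + y i) - (p (%i. x i + s * v i) - s * p v)
         <= p (%i. y i + t * v i) - t * p v" by (simp add: algebra_simps)
    qed
    hence "q (%i. x i + y i) - q y <= q x"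
      by (intro qge) (simp add: algebra_simps)
    thus "q (%i. x i + y i) <= q x + q y" by simp
  next
    fix t :: real and x assume t: "t > 0"
    have "q (%i. t * x i) / t <= q x"
    proof (rule qge)
      fix s :: real assume s: "s >= 0"
      have "q (%i. t * x i) <= p (%i. t * x i + (t * s) * v i) - (t * s) * p v"
        using s t by (intro qle) auto
      also have "(%i. t * x i + (t * s) * v i) = (%i. t * (x i + s * v i))"
        by (auto simp: algebra_simps)
      also have "p ... = t * p (%i. x i + s * v i)" using t by (intro sublinear_scale[OF p]) auto
      finally show "q (%i. t * x i) / t <= p (%i. x i + s * v i) - s * p v"
        using t by (simp add: field_simps)
    qed
    thus "q (%i. t * x i) <= t * q x" using t by (simp add: field_simps)
  qed (simp add: q0)
  have "p (%i. v i + t * v i) - t * p v = p v" if "t >= 0" for t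
    using eq[of "1 + t"] that by (simp add: algebra_simps)
  hence qv: "q v = p v" by (intro antisym qge qp) auto
  have "q (%i. - v i) <= - p v"
    using qle[of 1 "%i. - v i"] sublinear_zero[OF p] by simp
  moreover have "- q (%i. - v i) <= q v" by (rule sublinear_neg[OF sub])
  ultimately have "q (%i. - v i) = - p v" using qv by simp
  with sub qp qv show ?thesis by blast
qed

text \<open>Making \<open>p\<close> linear along \<open>c0\<close> and then along every coordinate vector in \<open>J\<close> leaves a linear
  functional below \<open>p\<close> that still agrees with \<open>p\<close> at \<open>c0\<close>.\<close>

lemma supporting_functional:
  assumes p: "sublinear p" and J: "finite J" and c0: "!!i. i \<notin> J ==> c0 i = 0"
  obtains x where "!!c. (!!i. i \<notin> J ==> c i = 0) ==> (\<Sum>i\<in>J. x i * c i) <= p c"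
    "(\<Sum>i\<in>J. x i * c0 i) = p c0"
proof -
  define \<delta> :: "'a => 'a => real" where "\<delta> k = (%i. if i = k then 1 else 0)" for k
  have "\<exists>q. sublinear q \<and> (\<forall>x. q x <= p x) \<and> q c0 = p c0 \<and> q (%i. - c0 i) = - p c0 \<and>
     (\<forall>k\<in>K. q (%i. - \<delta> k i) = - q (\<delta> k))" if "finite K" for K
    using that
  proof (induction K rule: finite_induct)
    case empty
    show ?case using sublinear_linear_along[OF p, of c0] by simp
  next
    case (insert k K)
    then obtain q where q: "sublinear q" "!!x. q x <= p x" "q c0 = p c0" "q (%i. - c0 i) = - p c0"
      "!!k. k \<in> K ==> q (%i. - \<delta> k i) = - q (\<delta> k)" by blast
    obtain q' where q': "sublinear q'" "!!x. q' x <= q x" "q' (\<delta> k) = q (\<delta> k)"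
      "q' (%i. - \<delta> k i) = - q (\<delta> k)"
      using sublinear_linear_along[OF q(1), of "\<delta> k"] by blast
    have pres: "q' v = q v \<and> q' (%i. - v i) = - q v" if "q (%i. - v i) = - q v" for v
      using q'(2)[of v] q'(2)[of "%i. - v i"] that sublinear_neg[OF q'(1), of v] by linarith
    show ?case
    proof (intro exI[of _ q'] conjI allI ballI)
      show "q' x <= p x" for x using q'(2)[of x] q(2)[of x] by linarith
      show "q' c0 = p c0" "q' (%i. - c0 i) = - p c0" using pres[of c0] q(3,4) by auto
      show "q' (%i. - \<delta> l i) = - q' (\<delta> l)" if "l \<in> insert k K" for l
        using that q'(3,4) pres[of "\<delta> l"] q(5)[of l] by (cases "l = k") auto
    qed (rule q'(1))
  qed
  from this[OF J] obtain q where q: "sublinear q" "!!x. q x <= p x" "q c0 = p c0"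
      "!!k. k \<in> J ==> q (%i. - \<delta> k i) = - q (\<delta> k)" by blast
  have scale: "q (%i. t * \<delta> k i) = t * q (\<delta> k)" if "k \<in> J" for t k
  proof (cases "t >= 0")
    case True then show ?thesis by (rule sublinear_scale[OF q(1)])
  next
    case False
    have "(%i. t * \<delta> k i) = (%i. (- t) * (- \<delta> k i))" by auto
    hence "q (%i. t * \<delta> k i) = (- t) * q (%i. - \<delta> k i)"
      using False sublinear_scale[OF q(1), of "- t" "%i. - \<delta> k i"] by simp
    thus ?thesis using q(4)[OF that] by simp
  qed
  have sumle: "q (%i. \<Sum>k\<in>K. c k * \<delta> k i) <= (\<Sum>k\<in>K. c k * q (\<delta> k))" if "finite K" "K \<subseteq> J" for K c
    using that
  proof (induction K rule: finite_induct)
    case empty thus ?case using sublinear_zero[OF q(1)] by simp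
  next
    case (insert k K)
    have "q (%i. \<Sum>k\<in>insert k K. c k * \<delta> k i) = q (%i. c k * \<delta> k i + (\<Sum>k\<in>K. c k * \<delta> k i))"
      using insert by simp
    also have "... <= q (%i. c k * \<delta> k i) + q (%i. \<Sum>k\<in>K. c k * \<delta> k i)"
      by (rule sublinear_add[OF q(1)])
    also have "... <= (\<Sum>k\<in>insert k K. c k * q (\<delta> k))"
      using insert scale[of k "c k"] by auto
    finally show ?case .
  qed
  have rep: "(%i. \<Sum>k\<in>J. c k * \<delta> k i) = c" if "!!i. i \<notin> J ==> c i = 0" for c
  proof
    fix i show "(\<Sum>k\<in>J. c k * \<delta> k i) = c i"
      using that[of i] J by (cases "i \<in> J") (auto simp: \<delta>_def if_distrib sum.delta cong: if_cong)
  qed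
  have lin: "q c = (\<Sum>k\<in>J. q (\<delta> k) * c k)" if c: "!!i. i \<notin> J ==> c i = 0" for c
  proof (rule antisym)
    show "q c <= (\<Sum>k\<in>J. q (\<delta> k) * c k)"
      using sumle[OF J subset_refl, of c] rep[OF c] by (simp add: mult.commute)
    have "q (%i. - c i) <= - (\<Sum>k\<in>J. q (\<delta> k) * c k)"
      using sumle[OF J subset_refl, of "%i. - c i"] rep[of "%i. - c i"] c
      by (simp add: mult.commute sum_negf)
    thus "(\<Sum>k\<in>J. q (\<delta> k) * c k) <= q c" using sublinear_neg[OF q(1), of c] by linarith
  qed
  show thesis
  proof (rule that[of "%k. q (\<delta> k)"])
    show "(\<Sum>i\<in>J. q (\<delta> i) * c i) <= p c" if "!!i. i \<notin> J ==> c i = 0" for c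
      using lin[OF that] q(2)[of c] by simp
    show "(\<Sum>i\<in>J. q (\<delta> i) * c0 i) = p c0" using lin[OF c0] q(3) by simp
  qed
qed

text \<open>The expectation of a function of \<open>m\<close> independent rows drawn uniformly from \<open>S\<close>; the recursion
  makes Fubini's theorem definitional.\<close>

primrec row_avg :: "'s set => nat => ('s list => real) => real" where
  "row_avg S 0 F = F []"
| "row_avg S (Suc m) F = (\<Sum>s\<in>S. row_avg S m (%rs. F (s # rs))) / card S"

lemma row_avg_mono:
  assumes "!!rs. length rs = m ==> set rs \<subseteq> S ==> F rs <= G rs"
  shows "row_avg S m F <= row_avg S m G"
  using assms
proof (induction m arbitrary: F G)
  case (Suc m)
  have "row_avg S m (%rs. F (s # rs)) <= row_avg S m (%rs. G (s # rs))" if "s \<in> S" for s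
    using that by (intro Suc.IH Suc.prems) auto
  then show ?case by (auto intro!: divide_right_mono sum_mono)
qed auto

lemma row_avg_add: "row_avg S m (%rs. F rs + G rs) = row_avg S m F + row_avg S m G"
  by (induction m arbitrary: F G) (auto simp: sum.distrib add_divide_distrib)

lemma row_avg_cmult: "row_avg S m (%rs. c * F rs) = c * row_avg S m F"
  by (induction m arbitrary: F) (auto simp: sum_distrib_left[symmetric])

lemma row_avg_const: "finite S ==> S ~= {} ==> row_avg S m (%rs. c) = c"
  by (induction m) auto

lemma row_avg_sum: "row_avg S m (%rs. \<Sum>a\<in>A. F a rs) = (\<Sum>a\<in>A. row_avg S m (F a))"
proof (induction m arbitrary: F)
  case (Suc m)
  show ?case by (simp add: Suc sum_divide_distrib[symmetric] sum.swap[of _ A S])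
qed auto

lemma row_avg_exists:
  assumes "finite S" "S ~= {}"
  shows "\<exists>rs. length rs = m \<and> set rs \<subseteq> S \<and> F rs <= row_avg S m F"
proof (rule ccontr)
  assume neg: "\<not> ?thesis"
  have "\<exists>rs. length rs = m \<and> set rs \<subseteq> S \<and> F rs <= row_avg S m F"
  proof (induction m arbitrary: F)
    case (Suc m)
    have "\<exists>s\<in>S. row_avg S m (%rs. F (s # rs)) <= row_avg S (Suc m) F"
    proof (rule ccontr)
      assume "\<not> ?thesis"
      hence "(\<Sum>s\<in>S. row_avg S (Suc m) F) < (\<Sum>s\<in>S. row_avg S m (%rs. F (s # rs)))"
        using assms by (intro sum_strict_mono) auto
      thus False using assms by (simp add: field_simps)
    qed
    then obtain s where s: "s \<in> S" "row_avg S m (%rs. F (s # rs)) <= row_avg S (Suc m) F" by blast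
    obtain rs where "length rs = m" "set rs \<subseteq> S" "F (s # rs) <= row_avg S m (%rs. F (s # rs))"
      using Suc[of "%rs. F (s # rs)"] by blast
    with s show ?case by (intro exI[of _ "s # rs"]) auto
  qed auto
  with neg show False by blast
qed

text \<open>Symmetrisation with contraction for a single row, without a measure: the left side compares
  \<open>\<bar>b s x\<bar>\<close> with its average over an independent copy \<open>s'\<close>. For a pair \<open>s, s'\<close>, the two suprema
  belonging to \<open>(s, s')\<close> and \<open>(s', s)\<close> are dominated together by the four suprema of \<open>h + 2 * b\<close>
  at \<open>s, s'\<close> and their negatives, because \<open>\<bar>u\<bar> - \<bar>v\<bar>\<close> is at most \<open>\<bar>u - v\<bar>\<close>.\<close>

lemma one_row_comparison:
  fixes b :: "'s => 'k => real" and h :: "'k => real"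
  assumes S: "finite S" "S ~= {}" and K: "K ~= {}"
    and bd: "!!s x. s \<in> S ==> x \<in> K ==> \<bar>b s x\<bar> <= B"
    and hb: "!!x. x \<in> K ==> \<bar>h x\<bar> <= H"
    and \<nu>: "bij_betw \<nu> S S" "!!s x. s \<in> S ==> x \<in> K ==> b (\<nu> s) x = - b s x"
  shows "(\<Sum>s\<in>S. SUP x\<in>K. h x + ((\<Sum>s'\<in>S. \<bar>b s' x\<bar>) / card S - \<bar>b s x\<bar>))
      <= (\<Sum>s\<in>S. SUP x\<in>K. h x + 2 * b s x)"
proof -
  define g where "g s = (SUP x\<in>K. h x + 2 * b s x)" for s
  \<comment> \<open>the supremum for a row \<open>s\<close> and a single independent copy \<open>s'\<close>\<close>
  define \<Phi> where "\<Phi> s s' = (SUP x\<in>K. h x + (\<bar>b s' x\<bar> - \<bar>b s x\<bar>))" for s s'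
  have card: "real (card S) > 0" using S by (simp add: card_gt_0_iff)
  have bddg: "bdd_above ((%x. h x + 2 * b s x) ` K)" if "s \<in> S" for s
    by (rule bdd_aboveI2[where M="H + 2 * B"]) (use hb bd[OF that] in \<open>smt (verit)\<close>)
  have g: "h x + 2 * b s x <= g s" if "s \<in> S" "x \<in> K" for s x
    unfolding g_def by (rule cSUP_upper[OF that(2) bddg[OF that(1)]])
  have \<nu>S: "\<nu> s \<in> S" if "s \<in> S" for s using \<nu>(1) that by (auto simp: bij_betw_def)
  have pair: "h x + h y + 2 * \<bar>b s x - b s y\<bar> <= g s + g (\<nu> s)" if "s \<in> S" "x \<in> K" "y \<in> K" for s x y
    using g[OF that(1,2)] g[OF that(1,3)] g[OF \<nu>S[OF that(1)] that(2)] g[OF \<nu>S[OF that(1)] that(3)]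
      \<nu>(2)[OF that(1,2)] \<nu>(2)[OF that(1,3)] by (simp add: abs_if)
  have bdd\<Phi>: "bdd_above ((%x. h x + (\<bar>b s' x\<bar> - \<bar>b s x\<bar>)) ` K)" if "s \<in> S" "s' \<in> S" for s s'
    by (rule bdd_aboveI2[where M="H + B"]) (use hb bd[OF that(1)] bd[OF that(2)] in \<open>smt (verit)\<close>)
  have \<Phi>sum: "\<Phi> s s' + \<Phi> s' s <= (g s + g (\<nu> s) + g s' + g (\<nu> s')) / 2" (is "_ <= ?R")
    if s: "s \<in> S" "s' \<in> S" for s s'
  proof -
    define R where "R = ?R"
    have ptw: "h x + (\<bar>b s' x\<bar> - \<bar>b s x\<bar>) + (h y + (\<bar>b s y\<bar> - \<bar>b s' y\<bar>)) <= R"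
      if "x \<in> K" "y \<in> K" for x y
    proof -
      have aux: "u + e' + e <= (P + P') / 2"
        if "u + 2 * D <= P" "u + 2 * D' <= P'" "e' <= D'" "e <= D" for u D D' e e' P P' :: real
        using that by (simp add: field_simps)
      have "\<bar>b s' x\<bar> - \<bar>b s' y\<bar> <= \<bar>b s' y - b s' x\<bar>"
        using abs_triangle_ineq2[of "b s' x" "b s' y"] by (simp add: abs_minus_commute)
      from aux[OF pair[OF s(1) that(2,1)] pair[OF s(2) that(2,1)] this abs_triangle_ineq2]
      show ?thesis unfolding R_def by (simp add: algebra_simps)
    qed
    have "\<Phi> s s' <= R - (h y + (\<bar>b s y\<bar> - \<bar>b s' y\<bar>))" if "y \<in> K" for y
      unfolding \<Phi>_def
    proof (rule cSUP_least[OF K])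
      show "h x + (\<bar>b s' x\<bar> - \<bar>b s x\<bar>) <= R - (h y + (\<bar>b s y\<bar> - \<bar>b s' y\<bar>))" if "x \<in> K" for x
        using ptw[OF that \<open>y \<in> K\<close>] by simp
    qed
    note * = this
    have "\<Phi> s' s <= R - \<Phi> s s'"
      unfolding \<Phi>_def[of s' s]
    proof (rule cSUP_least[OF K])
      show "h y + (\<bar>b s y\<bar> - \<bar>b s' y\<bar>) <= R - \<Phi> s s'" if "y \<in> K" for y
        using *[OF that] by simp
    qed
    hence "\<Phi> s s' + \<Phi> s' s <= R" by simp
    thus ?thesis unfolding R_def .
  qed
  have sup: "(SUP x\<in>K. h x + ((\<Sum>s'\<in>S. \<bar>b s' x\<bar>) / card S - \<bar>b s x\<bar>)) <= (\<Sum>s'\<in>S. \<Phi> s s') / card S"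
    if s: "s \<in> S" for s
  proof (rule cSUP_least[OF K])
    fix x assume x: "x \<in> K"
    have "(\<Sum>s'\<in>S. h x + (\<bar>b s' x\<bar> - \<bar>b s x\<bar>)) <= (\<Sum>s'\<in>S. \<Phi> s s')"
      unfolding \<Phi>_def by (intro sum_mono cSUP_upper[OF x] bdd\<Phi> s)
    moreover have "(\<Sum>s'\<in>S. h x + (\<bar>b s' x\<bar> - \<bar>b s x\<bar>))
        = card S * (h x + ((\<Sum>s'\<in>S. \<bar>b s' x\<bar>) / card S - \<bar>b s x\<bar>))"
      using card by (simp add: sum.distrib sum_subtractf algebra_simps)
    moreover have "X <= Y / c" if "Z <= Y" "Z = c * X" "c > 0" for X Y Z c :: real
      using that by (simp add: field_simps)
    ultimately show "h x + ((\<Sum>s'\<in>S. \<bar>b s' x\<bar>) / card S - \<bar>b s x\<bar>) <= (\<Sum>s'\<in>S. \<Phi> s s') / card S"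
      using card by blast
  qed
  have g\<nu>: "(\<Sum>s\<in>S. g (\<nu> s)) = (\<Sum>s\<in>S. g s)"
    by (rule sum.reindex_bij_betw[OF \<nu>(1)])
  have "2 * (\<Sum>s\<in>S. \<Sum>s'\<in>S. \<Phi> s s') = (\<Sum>s\<in>S. \<Sum>s'\<in>S. \<Phi> s s') + (\<Sum>s\<in>S. \<Sum>s'\<in>S. \<Phi> s' s)"
    by (subst (3) sum.swap) simp
  also have "... = (\<Sum>s\<in>S. \<Sum>s'\<in>S. \<Phi> s s' + \<Phi> s' s)" by (simp add: sum.distrib)
  also have "... <= (\<Sum>s\<in>S. \<Sum>s'\<in>S. (g s + g (\<nu> s) + g s' + g (\<nu> s')) / 2)"
    by (intro sum_mono \<Phi>sum)
  also have "... = 2 * (card S * (\<Sum>s\<in>S. g s))"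
    by (simp add: sum.distrib sum_divide_distrib[symmetric] sum_distrib_left[symmetric] g\<nu>)
  finally have main: "(\<Sum>s\<in>S. \<Sum>s'\<in>S. \<Phi> s s') <= card S * (\<Sum>s\<in>S. g s)" by simp
  have "(\<Sum>s\<in>S. SUP x\<in>K. h x + ((\<Sum>s'\<in>S. \<bar>b s' x\<bar>) / card S - \<bar>b s x\<bar>))
      <= (\<Sum>s\<in>S. (\<Sum>s'\<in>S. \<Phi> s s') / card S)" by (intro sum_mono sup)
  also have "... <= (\<Sum>s\<in>S. g s)"
    using main card by (simp add: sum_divide_distrib[symmetric] field_simps)
  finally show ?thesis unfolding g_def .
qed

text \<open>The rows are exchanged one at a time; the part that belongs to the other rows is the function \<open>h\<close> of
  the one-row statement.\<close>

lemma rows_comparison: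
  fixes b :: "'s => 'k => real" and h :: "'k => real"
  assumes S: "finite S" "S ~= {}" and K: "K ~= {}"
    and bd: "!!s x. s \<in> S ==> x \<in> K ==> \<bar>b s x\<bar> <= B"
    and \<nu>: "bij_betw \<nu> S S" "!!s x. s \<in> S ==> x \<in> K ==> b (\<nu> s) x = - b s x"
    and hb: "!!x. x \<in> K ==> \<bar>h x\<bar> <= H"
  shows "row_avg S m (%rs. SUP x\<in>K. h x + (\<Sum>s\<leftarrow>rs. (\<Sum>s'\<in>S. \<bar>b s' x\<bar>) / card S - \<bar>b s x\<bar>))
      <= row_avg S m (%rs. SUP x\<in>K. h x + 2 * (\<Sum>s\<leftarrow>rs. b s x))"
  using hb
proof (induction m arbitrary: h H)
  case (Suc m)
  define f where "f x = (\<Sum>s'\<in>S. \<bar>b s' x\<bar>) / card S" for x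
  have card: "real (card S) > 0" using S by (simp add: card_gt_0_iff)
  have fb: "\<bar>f x\<bar> <= B" if "x \<in> K" for x
  proof -
    have "(\<Sum>s'\<in>S. \<bar>b s' x\<bar>) <= card S * B" using bd that by (intro sum_bounded_above) auto
    moreover have "0 <= (\<Sum>s'\<in>S. \<bar>b s' x\<bar>)" by (intro sum_nonneg) auto
    ultimately show ?thesis unfolding f_def using card by (simp add: field_simps)
  qed
  have listb: "\<bar>\<Sum>s\<leftarrow>rs. b s x\<bar> <= real (length rs) * B" if "set rs \<subseteq> S" "x \<in> K" for rs x
    using that
  proof (induction rs)
    case (Cons a rs)
    then show ?case using bd[of a x] by (auto simp: algebra_simps abs_le_iff)
  qed auto
  have "row_avg S (Suc m) (%rs. SUP x\<in>K. h x + (\<Sum>s\<leftarrow>rs. f x - \<bar>b s x\<bar>))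
     = (\<Sum>s\<in>S. row_avg S m (%rs. SUP x\<in>K. (h x + (f x - \<bar>b s x\<bar>)) + (\<Sum>s\<leftarrow>rs. f x - \<bar>b s x\<bar>))) / card S"
    by (simp add: add.assoc)
  also have "... <= (\<Sum>s\<in>S. row_avg S m (%rs. SUP x\<in>K. (h x + (f x - \<bar>b s x\<bar>)) + 2 * (\<Sum>s\<leftarrow>rs. b s x))) / card S"
  proof (intro divide_right_mono sum_mono)
    fix s assume s: "s \<in> S"
    show "row_avg S m (%rs. SUP x\<in>K. (h x + (f x - \<bar>b s x\<bar>)) + (\<Sum>s\<leftarrow>rs. f x - \<bar>b s x\<bar>))
      <= row_avg S m (%rs. SUP x\<in>K. (h x + (f x - \<bar>b s x\<bar>)) + 2 * (\<Sum>s\<leftarrow>rs. b s x))"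
      unfolding f_def
    proof (rule Suc.IH[of _ "H + B + B"])
      fix x assume "x \<in> K"
      then show "\<bar>h x + ((\<Sum>s'\<in>S. \<bar>b s' x\<bar>) / card S - \<bar>b s x\<bar>)\<bar> <= H + B + B"
        using Suc.prems[of x] fb[of x] bd[OF s, of x] unfolding f_def by linarith
    qed
  qed simp
  also have "... = row_avg S m (%rs. \<Sum>s\<in>S. SUP x\<in>K. (h x + 2 * (\<Sum>s\<leftarrow>rs. b s x)) + (f x - \<bar>b s x\<bar>)) / card S"
    by (simp add: row_avg_sum algebra_simps)
  also have "... <= row_avg S m (%rs. \<Sum>s\<in>S. SUP x\<in>K. (h x + 2 * (\<Sum>s\<leftarrow>rs. b s x)) + 2 * b s x) / card S"
  proof (intro divide_right_mono row_avg_mono)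
    fix rs assume rs: "length rs = m" "set rs \<subseteq> S"
    show "(\<Sum>s\<in>S. SUP x\<in>K. (h x + 2 * (\<Sum>s\<leftarrow>rs. b s x)) + (f x - \<bar>b s x\<bar>))
       <= (\<Sum>s\<in>S. SUP x\<in>K. (h x + 2 * (\<Sum>s\<leftarrow>rs. b s x)) + 2 * b s x)"
      unfolding f_def
    proof (rule one_row_comparison[where b=b and \<nu>=\<nu> and H="H + 2 * (real m * B)", OF S K bd])
      show "\<bar>h x + 2 * (\<Sum>s\<leftarrow>rs. b s x)\<bar> <= H + 2 * (real m * B)" if "x \<in> K" for x
        using Suc.prems[OF that] listb[OF rs(2) that] rs(1) by (simp add: abs_le_iff)
    qed (use \<nu> in auto)
  qed simp
  also have "... = row_avg S (Suc m) (%rs. SUP x\<in>K. h x + 2 * (\<Sum>s\<leftarrow>rs. b s x))"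
    by (simp add: row_avg_sum algebra_simps)
  finally show ?case unfolding f_def .
qed auto

text \<open>Let \<open>K\<close> be the polar body of \<open>N\<close>. The deviation of \<open>\<Sum>\<bar>b s x\<bar>\<close> from its mean, uniformly over
  \<open>x \<in> K\<close>, is at most twice the mean of \<open>N\<close> at the sum of the rows. So for some choice of rows every
  \<open>x \<in> K\<close> orthogonal to all of them has small Euclidean norm, by the lower bound \<open>\<kappa>\<close>. The distance of \<open>c\<close> from
  the span of the rows in \<open>N\<close> is sublinear; its supporting functional at \<open>c\<close> is such an \<open>x\<close>, which
  turns the estimate of the section into one of the distance. The \<open>\<eta>\<close> pays for an infimum
  that need not be attained.\<close>

lemma random_sections:
  fixes N :: "('i => real) => real"
  assumes J: "finite J" and N: "sublinear N" and N0: "!!c. N c >= 0"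
    and local: "!!c c'. (!!i. i \<in> J ==> c i = c' i) ==> N c = N c'"
    and S: "finite S" "S ~= {}"
    and \<nu>: "bij_betw \<nu> S S" "!!s i. s \<in> S ==> i \<in> J ==> \<nu> s i = - s i"
    and \<kappa>: "\<kappa> > 0"
      "!!x. \<kappa> * sqrt (\<Sum>i\<in>J. (x i)\<^sup>2) <= (\<Sum>s\<in>S. \<bar>\<Sum>i\<in>J. s i * x i\<bar>) / card S"
    and m: "m > 0" and \<eta>: "\<eta> > 0"
  obtains rs where "length rs = m" "set rs \<subseteq> S"
    "!!c. \<exists>t. N (%i. c i - (\<Sum>l<m. t l * (rs ! l) i))
       <= 2 / (\<kappa> * m) * row_avg S m (%rs. N (%i. \<Sum>s\<leftarrow>rs. s i)) * sqrt (\<Sum>i\<in>J. (c i)\<^sup>2) + \<eta>"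
proof -
  define L where "L = row_avg S m (%rs. N (%i. \<Sum>s\<leftarrow>rs. s i))"
  define K where "K = {x :: 'i => real. \<forall>c. (\<Sum>i\<in>J. x i * c i) <= N c}"
  define b :: "('i => real) => ('i => real) => real" where "b s x = (\<Sum>i\<in>J. s i * x i)" for s x
  define f where "f x = (\<Sum>s\<in>S. \<bar>b s x\<bar>) / card S" for x
  have K0: "(%_. 0) \<in> K" using N0 by (simp add: K_def)
  hence Kne: "K ~= {}" by blast
  have bN: "b s x <= N s" if "x \<in> K" for s x
    using that by (auto simp: K_def b_def mult.commute)
  have bN': "\<bar>b s x\<bar> <= N s + N (%i. - s i)" if "x \<in> K" for s x
    using bN[OF that, of s] bN[OF that, of "%i. - s i"] N0[of s] N0[of "%i. - s i"]
    by (simp add: b_def sum_negf abs_le_iff)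
  define B where "B = (\<Sum>s\<in>S. N s + N (%i. - s i))"
  have bB: "\<bar>b s x\<bar> <= B" if "s \<in> S" "x \<in> K" for s x
  proof -
    have "N s + N (%i. - s i) <= B" unfolding B_def
      by (rule member_le_sum) (use that S N0 in \<open>auto intro: add_nonneg_nonneg\<close>)
    with bN'[OF that(2), of s] show ?thesis by linarith
  qed
  have b\<nu>: "b (\<nu> s) x = - b s x" if "s \<in> S" for s x
    using \<nu>(2)[OF that] by (simp add: b_def sum_negf[symmetric])
  have bsum: "(\<Sum>s\<leftarrow>rs. b s x) = b (%i. \<Sum>s\<leftarrow>rs. s i) x" for rs x
    by (induction rs) (auto simp: b_def sum.distrib algebra_simps)
  have "row_avg S m (%rs. SUP x\<in>K. 0 + (\<Sum>s\<leftarrow>rs. f x - \<bar>b s x\<bar>))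
      <= row_avg S m (%rs. SUP x\<in>K. 0 + 2 * (\<Sum>s\<leftarrow>rs. b s x))"
    unfolding f_def
    by (rule rows_comparison[where b=b and \<nu>=\<nu> and B=B and h="%_. 0" and H=0, OF S Kne bB \<nu>(1) b\<nu>]) auto
  also have "... <= row_avg S m (%rs. 2 * N (%i. \<Sum>s\<leftarrow>rs. s i))"
  proof (rule row_avg_mono)
    fix rs show "(SUP x\<in>K. 0 + 2 * (\<Sum>s\<leftarrow>rs. b s x)) <= 2 * N (%i. \<Sum>s\<leftarrow>rs. s i)"
      by (rule cSUP_least[OF Kne]) (use bN bsum in auto)
  qed
  also have "... = 2 * L" unfolding L_def by (rule row_avg_cmult)
  finally have avg: "row_avg S m (%rs. SUP x\<in>K. 0 + (\<Sum>s\<leftarrow>rs. f x - \<bar>b s x\<bar>)) <= 2 * L" .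
  obtain rs where rs: "length rs = m" "set rs \<subseteq> S"
    and le: "(SUP x\<in>K. 0 + (\<Sum>s\<leftarrow>rs. f x - \<bar>b s x\<bar>))
      <= row_avg S m (%rs. SUP x\<in>K. 0 + (\<Sum>s\<leftarrow>rs. f x - \<bar>b s x\<bar>))"
    using row_avg_exists[OF S, of m "%rs. SUP x\<in>K. 0 + (\<Sum>s\<leftarrow>rs. f x - \<bar>b s x\<bar>)"] by blast
  have rs_le: "(SUP x\<in>K. 0 + (\<Sum>s\<leftarrow>rs. f x - \<bar>b s x\<bar>)) <= 2 * L"
    using le avg by (rule order_trans)
  have card: "real (card S) > 0" using S by (simp add: card_gt_0_iff)
  have fB: "f x <= B" if "x \<in> K" for x
  proof -
    have "(\<Sum>s\<in>S. \<bar>b s x\<bar>) <= card S * B" using bB that by (intro sum_bounded_above) auto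
    thus ?thesis unfolding f_def using card by (simp add: field_simps)
  qed
  have list_le: "(\<Sum>s\<leftarrow>rs'. f x - \<bar>b s x\<bar>) <= real (length rs') * B" if "x \<in> K" for x rs'
    using fB[OF that] by (induction rs') (auto simp: algebra_simps)
  have bdd: "bdd_above ((%x. 0 + (\<Sum>s\<leftarrow>rs. f x - \<bar>b s x\<bar>)) ` K)"
    by (rule bdd_aboveI2[where M="real (length rs) * B"]) (use list_le in auto)
  have sect: "sqrt (\<Sum>i\<in>J. (x i)\<^sup>2) <= 2 / (\<kappa> * m) * L"
    if x: "x \<in> K" and zero: "!!s. s \<in> set rs ==> b s x = 0" for x
  proof -
    have "(\<Sum>s\<leftarrow>rs. f x - \<bar>b s x\<bar>) = (\<Sum>s\<leftarrow>rs. f x)"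
      by (rule arg_cong[where f=sum_list], rule map_cong) (use zero in auto)
    also have "... = m * f x" using rs(1) by (simp add: sum_list_triv)
    finally have "m * f x <= 2 * L" using cSUP_upper[OF x bdd] rs_le by simp
    moreover have "\<kappa> * sqrt (\<Sum>i\<in>J. (x i)\<^sup>2) <= f x" using \<kappa>(2)[of x] by (simp add: f_def b_def)
    hence "m * (\<kappa> * sqrt (\<Sum>i\<in>J. (x i)\<^sup>2)) <= m * f x" by (intro mult_left_mono) auto
    ultimately have "m * (\<kappa> * sqrt (\<Sum>i\<in>J. (x i)\<^sup>2)) <= 2 * L" by linarith
    thus ?thesis using m \<kappa>(1) by (simp add: field_simps)
  qed
  \<comment> \<open>the distance, in the sense of \<open>N\<close>, from the span of the rows\<close>
  define p where "p c = (INF t. N (%i. c i - (\<Sum>l<m. t l * (rs ! l) i)))" for c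
  have bddp: "bdd_below (range (%t. N (%i. c i - (\<Sum>l<m. t l * (rs ! l) i))))" for c
    by (rule bdd_belowI2[where m=0]) (use N0 in auto)
  have p_le: "p c <= N (%i. c i - (\<Sum>l<m. t l * (rs ! l) i))" for c t
    unfolding p_def by (rule cINF_lower[OF bddp]) auto
  have p_ge: "z <= p c" if "!!t. z <= N (%i. c i - (\<Sum>l<m. t l * (rs ! l) i))" for z c
    unfolding p_def by (rule cINF_greatest) (use that in auto)
  have p0: "0 <= p c" for c by (rule p_ge) (rule N0)
  have sub: "sublinear p"
  proof (rule sublinearI)
    fix x y
    have "p (%i. x i + y i) - N (%i. x i - (\<Sum>l<m. t l * (rs ! l) i)) <= p y" for t
    proof (rule p_ge)
      fix u
      have "p (%i. x i + y i) <= N (%i. (x i + y i) - (\<Sum>l<m. (t l + u l) * (rs ! l) i))" by (rule p_le)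
      also have "(%i. (x i + y i) - (\<Sum>l<m. (t l + u l) * (rs ! l) i)) =
         (%i. (x i - (\<Sum>l<m. t l * (rs ! l) i)) + (y i - (\<Sum>l<m. u l * (rs ! l) i)))"
        by (auto simp: algebra_simps sum.distrib)
      also have "N ... <= N (%i. x i - (\<Sum>l<m. t l * (rs ! l) i)) + N (%i. y i - (\<Sum>l<m. u l * (rs ! l) i))"
        by (rule sublinear_add[OF N])
      finally show "p (%i. x i + y i) - N (%i. x i - (\<Sum>l<m. t l * (rs ! l) i))
         <= N (%i. y i - (\<Sum>l<m. u l * (rs ! l) i))" by simp
    qed
    hence "p (%i. x i + y i) - p y <= p x" by (intro p_ge) (simp add: algebra_simps)
    thus "p (%i. x i + y i) <= p x + p y" by simp
  next
    show "p (%i. 0 * x i) = 0" for x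
      using p_le[of "%_. 0" "%_. 0"] p0[of "%_. 0"] sublinear_zero[OF N] by simp
  next
    fix r :: real and x assume r: "r > 0"
    have "p (%i. r * x i) / r <= p x"
    proof (rule p_ge)
      fix t
      have "p (%i. r * x i) <= N (%i. r * x i - (\<Sum>l<m. (r * t l) * (rs ! l) i))" by (rule p_le)
      also have "(%i. r * x i - (\<Sum>l<m. (r * t l) * (rs ! l) i)) = (%i. r * (x i - (\<Sum>l<m. t l * (rs ! l) i)))"
        by (auto simp: algebra_simps sum_distrib_left)
      also have "N ... = r * N (%i. x i - (\<Sum>l<m. t l * (rs ! l) i))" using r by (intro sublinear_scale[OF N]) auto
      finally show "p (%i. r * x i) / r <= N (%i. x i - (\<Sum>l<m. t l * (rs ! l) i))"
        using r by (simp add: field_simps)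
    qed
    thus "p (%i. r * x i) <= r * p x" using r by (simp add: field_simps)
  qed
  have main: "p c <= 2 / (\<kappa> * m) * L * sqrt (\<Sum>i\<in>J. (c i)\<^sup>2)" for c
  proof -
    define c0 where "c0 i = (if i \<in> J then c i else 0)" for i
    have loc: "p c' = p c''" if "!!i. i \<in> J ==> c' i = c'' i" for c' c''
      unfolding p_def using that by (intro arg_cong[where f=Inf] image_cong refl local) auto
    obtain x where x: "!!c. (!!i. i \<notin> J ==> c i = 0) ==> (\<Sum>i\<in>J. x i * c i) <= p c"
        "(\<Sum>i\<in>J. x i * c0 i) = p c0"
      by (rule supporting_functional[OF sub J, of c0]) (auto simp: c0_def)
    have x': "(\<Sum>i\<in>J. x i * c' i) <= p c'" for c'
      using x(1)[of "%i. if i \<in> J then c' i else 0"] loc[of "%i. if i \<in> J then c' i else 0" c'] by simp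
    have pN: "p c' <= N c'" for c' using p_le[of c' "%_. 0"] by simp
    have xK: "x \<in> K" unfolding K_def using x' pN by (auto intro: order_trans)
    have "b s x = 0" if s: "s \<in> set rs" for s
    proof -
      obtain l where l: "l < m" "s = rs ! l" using s unfolding in_set_conv_nth rs(1) by blast
      have z: "(\<Sum>k<m. (if k = l then \<tau> else 0) * (rs ! k) i) = \<tau> * s i" for \<tau> i
        using l by (simp add: if_distrib[of "%u. u * _"] sum.delta cong: if_cong)
      have pz: "p (%i. \<tau> * s i) <= 0" for \<tau>
        using p_le[of "%i. \<tau> * s i" "%k. if k = l then \<tau> else 0"] sublinear_zero[OF N] by (simp add: z)
      have "\<tau> * b s x <= 0" for \<tau>
        using x'[of "%i. \<tau> * s i"] pz[of \<tau>] by (simp add: b_def sum_distrib_left mult_ac)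
      from this[of 1] this[of "-1"] show ?thesis by simp
    qed
    hence nx: "sqrt (\<Sum>i\<in>J. (x i)\<^sup>2) <= 2 / (\<kappa> * m) * L" by (rule sect[OF xK])
    have "p c = p c0" by (rule loc) (simp add: c0_def)
    also have "... = (\<Sum>i\<in>J. x i * c i)" using x(2) by (simp add: c0_def)
    also have "... <= (\<Sum>i\<in>J. \<bar>x i\<bar> * \<bar>c i\<bar>)"
      by (intro sum_mono) (simp add: abs_mult[symmetric])
    also have "... <= sqrt (\<Sum>i\<in>J. (x i)\<^sup>2) * sqrt (\<Sum>i\<in>J. (c i)\<^sup>2)"
      using L2_set_mult_ineq[of x c J] unfolding L2_set_def .
    also have "... <= (2 / (\<kappa> * m) * L) * sqrt (\<Sum>i\<in>J. (c i)\<^sup>2)"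
      using nx by (intro mult_right_mono) (auto intro: sum_nonneg)
    finally show ?thesis .
  qed
  show thesis
  proof (rule that[OF rs])
    fix c
    have "p c < 2 / (\<kappa> * m) * L * sqrt (\<Sum>i\<in>J. (c i)\<^sup>2) + \<eta>" using main[of c] \<eta> by linarith
    hence "\<exists>t. N (%i. c i - (\<Sum>l<m. t l * (rs ! l) i)) < 2 / (\<kappa> * m) * L * sqrt (\<Sum>i\<in>J. (c i)\<^sup>2) + \<eta>"
      unfolding p_def by (subst (asm) cINF_less_iff[OF _ bddp[of c]]) auto
    thus "\<exists>t. N (%i. c i - (\<Sum>l<m. t l * (rs ! l) i))
       <= 2 / (\<kappa> * m) * row_avg S m (%rs. N (%i. \<Sum>s\<leftarrow>rs. s i)) * sqrt (\<Sum>i\<in>J. (c i)\<^sup>2) + \<eta>"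
      unfolding L_def by (auto intro: less_imp_le)
  qed
qed

section \<open>Moments of sums of random signs\<close>

lemma sum_PiE_insert:
  assumes "x \<notin> A"
  shows "(\<Sum>g\<in>PiE (insert x A) B. F g) = (\<Sum>y\<in>B x. \<Sum>g\<in>PiE A B. F (g(x := y)))"
proof -
  have inj: "inj_on (%(y, g). g(x := y)) (B x \<times> PiE A B)"
  proof (rule inj_onI, clarify)
    fix y g y' g'
    assume g: "g \<in> PiE A B" "g' \<in> PiE A B" and eq: "g(x := y) = g'(x := y')"
    have "g i = g' i" for i
      using g fun_cong[OF eq, of i] assms by (cases "i = x") (auto simp: PiE_def extensional_def)
    thus "y = y' \<and> g = g'" using fun_cong[OF eq, of x] by auto
  qed
  show ?thesis
    unfolding PiE_insert_eq
    by (subst sum.reindex[OF inj]) (simp add: case_prod_unfold o_def sum.cartesian_product)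
qed

text \<open>Functions are undefined outside \<open>J\<close>, which makes the set finite; sums over \<open>J\<close> do not see this.\<close>

definition signs :: "'i set => ('i => real) set" where
  "signs J = PiE J (%_. {-1, 1})"

lemma signs_finite: "finite J ==> finite (signs J)"
  unfolding signs_def by (intro finite_PiE) auto

lemma signs_card: "finite J ==> card (signs J) = 2 ^ card J"
  unfolding signs_def by (subst card_PiE) (auto simp: card_insert_if numeral_2_eq_2)

lemma signs_ne: "signs J ~= {}"
  unfolding signs_def by (auto simp: PiE_eq_empty_iff)

lemma signs_negate:
  "bij_betw (%s. restrict (%i. - s i) J) (signs J) (signs J)"
  by (rule bij_betwI[where g="%s. restrict (%i. - s i) J"])
     (auto simp: signs_def fun_eq_iff PiE_def extensional_def Pi_def restrict_def)

lemma signs_exp: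
  assumes "finite J"
  shows "(\<Sum>s\<in>signs J. exp (\<Sum>i\<in>J. s i * a i)) / card (signs J) = (\<Prod>i\<in>J. cosh (a i))"
proof -
  have "(\<Sum>s\<in>signs J. exp (\<Sum>i\<in>J. s i * a i)) = (\<Sum>s\<in>PiE J (%_. {-1, 1}). \<Prod>i\<in>J. exp (s i * a i))"
    unfolding signs_def using assms by (simp add: exp_sum)
  also have "... = (\<Prod>i\<in>J. \<Sum>y\<in>{-1, 1}. exp (y * a i))"
    by (rule prod_sum_PiE[symmetric]) (use assms in auto)
  also have "... = (\<Prod>i\<in>J. 2 * cosh (a i))"
    by (intro prod.cong) (auto simp: cosh_field_def)
  also have "... = 2 ^ card J * (\<Prod>i\<in>J. cosh (a i))"
    by (simp add: prod.distrib)
  finally show ?thesis using signs_card[OF assms] by simp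
qed

lemma signs_second_moment:
  assumes "finite J"
  shows "(\<Sum>s\<in>signs J. (\<Sum>i\<in>J. s i * a i)\<^sup>2) / card (signs J) = (\<Sum>i\<in>J. (a i)\<^sup>2)"
proof -
  have "(\<Sum>s\<in>signs J. (\<Sum>i\<in>J. s i * a i)\<^sup>2) = 2 ^ card J * (\<Sum>i\<in>J. (a i)\<^sup>2)"
    using assms
  proof (induction J rule: finite_induct)
    case empty then show ?case by (simp add: signs_def)
  next
    case (insert x J)
    define X where "X s = (\<Sum>i\<in>J. s i * a i)" for s
    have *: "(\<Sum>i\<in>insert x J. (s(x := y)) i * a i) = y * a x + X s" for s y
    proof -
      have "(\<Sum>i\<in>J. (s(x := y)) i * a i) = X s"
        unfolding X_def using insert by (intro sum.cong) auto
      thus ?thesis using insert by simp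
    qed
    have "(\<Sum>s\<in>signs (insert x J). (\<Sum>i\<in>insert x J. s i * a i)\<^sup>2)
        = (\<Sum>y\<in>{-1, 1}. \<Sum>s\<in>signs J. (y * a x + X s)\<^sup>2)"
      unfolding signs_def sum_PiE_insert[OF insert(2)] * ..
    also have "... = (\<Sum>s\<in>signs J. 2 * (a x)\<^sup>2 + 2 * (X s)\<^sup>2)"
      by (simp add: sum.distrib[symmetric] power2_eq_square algebra_simps)
    also have "... = 2 ^ card (insert x J) * (\<Sum>i\<in>insert x J. (a i)\<^sup>2)"
      using insert by (simp add: sum.distrib sum_distrib_left[symmetric] signs_card X_def algebra_simps)
    finally show ?case .
  qed
  thus ?thesis using signs_card[OF assms] by simp
qed

lemma even_power_le_cosh: "x ^ (2 * j) <= fact (2 * j) * cosh (x::real)"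
proof -
  let ?f = "%n. if even n then x ^ n /\<^sub>R fact n else 0"
  have "?f (2 * j) <= cosh x"
    using sum_le_suminf[OF sums_summable[OF cosh_converges[of x]], of "{2 * j}"]
      sums_unique[OF cosh_converges[of x]]
    by (auto simp: zero_le_even_power)
  thus ?thesis by (simp add: field_simps)
qed

lemma fact_double_ge: "2 ^ n * fact n <= (fact (2 * n) :: real)"
proof (induction n)
  case (Suc n)
  have "2 ^ Suc n * fact (Suc n) = (2 * real (Suc n)) * (2 ^ n * fact n :: real)" by simp
  also have "... <= (2 * real (Suc n)) * fact (2 * n)" using Suc by (intro mult_left_mono) auto
  also have "... <= ((2 * real (Suc n)) * (2 * n + 1)) * fact (2 * n)"
    by (intro mult_right_mono) auto
  also have "... = fact (2 * Suc n)" by (simp add: algebra_simps)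
  finally show ?case .
qed auto

lemma cosh_le_exp_half_square: "cosh x <= exp (x\<^sup>2 / 2)" for x :: real
proof (rule sums_le)
  have "strict_mono (%n::nat. 2 * n)" by (auto simp: strict_mono_def)
  hence "(%n. (%n. if even n then x ^ n /\<^sub>R fact n else 0) (2 * n)) sums cosh x"
    using cosh_converges[of x] by (subst sums_mono_reindex) auto
  thus "(%n. x ^ (2 * n) / fact (2 * n)) sums cosh x" by (simp add: field_simps)
  show "(%n. (x\<^sup>2 / 2) ^ n / fact n) sums exp (x\<^sup>2 / 2)"
    using exp_converges[of "x\<^sup>2 / 2"] by (simp add: field_simps)
  show "x ^ (2 * n) / fact (2 * n) <= (x\<^sup>2 / 2) ^ n / fact n" for n
  proof -
    have "x ^ (2 * n) / fact (2 * n) <= x ^ (2 * n) / (2 ^ n * fact n)"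
      by (intro divide_left_mono fact_double_ge) (auto simp: zero_le_even_power)
    thus ?thesis by (simp add: power_mult power_divide)
  qed
qed

lemma row_avg_exp:
  assumes "finite J"
  shows "row_avg (signs J) m (%rs. exp (\<Sum>s\<leftarrow>rs. \<Sum>i\<in>J. s i * a i)) = (\<Prod>i\<in>J. cosh (a i)) ^ m"
proof (induction m)
  case (Suc m)
  have "row_avg (signs J) (Suc m) (%rs. exp (\<Sum>s\<leftarrow>rs. \<Sum>i\<in>J. s i * a i))
     = (\<Sum>s\<in>signs J. exp (\<Sum>i\<in>J. s i * a i)) / card (signs J) * (\<Prod>i\<in>J. cosh (a i)) ^ m"
    by (simp add: exp_add row_avg_cmult Suc sum_distrib_right)
  thus ?case using signs_exp[OF assms] by simp
qed auto

lemma row_avg_exp_le: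
  assumes "finite J"
  shows "row_avg (signs J) m (%rs. exp (\<Sum>s\<leftarrow>rs. \<Sum>i\<in>J. s i * a i)) <= exp (m * (\<Sum>i\<in>J. (a i)\<^sup>2) / 2)"
proof -
  have "(\<Prod>i\<in>J. cosh (a i)) <= (\<Prod>i\<in>J. exp ((a i)\<^sup>2 / 2))"
    by (intro prod_mono) (auto simp: cosh_le_exp_half_square)
  also have "... = exp ((\<Sum>i\<in>J. (a i)\<^sup>2) / 2)" using assms by (simp add: exp_sum sum_divide_distrib)
  finally have "(\<Prod>i\<in>J. cosh (a i)) ^ m <= exp ((\<Sum>i\<in>J. (a i)\<^sup>2) / 2) ^ m"
    by (intro power_mono prod_nonneg) auto
  also have "... = exp (m * ((\<Sum>i\<in>J. (a i)\<^sup>2) / 2))" by (simp only: exp_of_nat_mult)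
  finally show ?thesis by (simp add: row_avg_exp[OF assms])
qed

text \<open>Sub-Gaussian moments: \<open>x^(2j) \<le> (2j)! * cosh x\<close> reduces to exponential moments, which factor into
  hyperbolic cosines, and \<open>t = sqrt (2 * j / V)\<close> is the optimal scaling.\<close>

lemma row_avg_even_moment:
  assumes J: "finite J" and j: "j > 0"
  shows "row_avg (signs J) m (%rs. (\<Sum>s\<leftarrow>rs. \<Sum>i\<in>J. s i * a i) ^ (2 * j))
     <= (2 * j * exp 1 * (m * (\<Sum>i\<in>J. (a i)\<^sup>2))) ^ j"
proof -
  define V where "V = m * (\<Sum>i\<in>J. (a i)\<^sup>2)"
  define X where "X rs = (\<Sum>s\<leftarrow>rs. \<Sum>i\<in>J. s i * a i)" for rs
  have V0: "V >= 0" unfolding V_def by (intro mult_nonneg_nonneg sum_nonneg) auto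
  show ?thesis
  proof (cases "V = 0")
    case True
    have "X rs ^ (2 * j) <= 0" if "length rs = m" for rs
    proof (cases "m = 0")
      case True thus ?thesis using that j by (simp add: X_def power_0_left)
    next
      case False
      hence "!!i. i \<in> J ==> a i = 0" using True J by (simp add: V_def sum_nonneg_eq_0_iff)
      hence "X rs = 0" unfolding X_def by (induction rs) auto
      thus ?thesis using j by (simp add: power_0_left)
    qed
    hence "row_avg (signs J) m (%rs. X rs ^ (2 * j)) <= row_avg (signs J) m (%rs. 0)"
      by (intro row_avg_mono) auto
    also have "... = 0" by (rule row_avg_const[OF signs_finite[OF J] signs_ne])
    also have "0 <= (2 * j * exp 1 * V) ^ j" using V0 by simp
    finally show ?thesis unfolding X_def V_def by simp
  next
    case False
    with V0 have V: "V > 0" by simp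
    define t where "t = sqrt (2 * j / V)"
    have t: "t > 0" "t\<^sup>2 = 2 * j / V" using V j by (auto simp: t_def)
    have X_eq: "(\<Sum>s\<leftarrow>rs. \<Sum>i\<in>J. s i * (r * a i)) = r * X rs" for r rs
      unfolding X_def by (induction rs) (auto simp: sum_distrib_left algebra_simps)
    have ex: "row_avg (signs J) m (%rs. exp (r * X rs)) <= exp (r\<^sup>2 * V / 2)" for r
      using row_avg_exp_le[OF J, of m "%i. r * a i"] unfolding X_eq
      by (simp add: V_def power_mult_distrib sum_distrib_left[symmetric] mult_ac)
    have "row_avg (signs J) m (%rs. (t * X rs) ^ (2 * j))
       <= row_avg (signs J) m (%rs. (fact (2 * j) / 2) * (exp (t * X rs) + exp ((- t) * X rs)))"
      by (intro row_avg_mono) (use even_power_le_cosh[of "t * X _" j] in \<open>simp add: cosh_field_def field_simps\<close>)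
    also have "... = fact (2 * j) / 2 * (row_avg (signs J) m (%rs. exp (t * X rs)) + row_avg (signs J) m (%rs. exp ((- t) * X rs)))"
      by (simp only: row_avg_cmult row_avg_add)
    also have "... <= fact (2 * j) / 2 * (exp (t\<^sup>2 * V / 2) + exp ((- t)\<^sup>2 * V / 2))"
      by (intro mult_left_mono add_mono ex) auto
    also have "... = fact (2 * j) * exp j" using t V by simp
    also have "(fact (2 * j) :: real) <= (2 * j) ^ (2 * j)" using fact_le_power[of "2 * j", where 'a=real] by simp
    finally have "row_avg (signs J) m (%rs. (t * X rs) ^ (2 * j)) <= (2 * j) ^ (2 * j) * exp j"
      by (simp add: mult_right_mono)
    moreover have "(t * X rs) ^ (2 * j) = (2 * j / V) ^ j * X rs ^ (2 * j)" for rs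
      by (simp only: power_mult power_mult_distrib t(2))
    hence "row_avg (signs J) m (%rs. (t * X rs) ^ (2 * j)) = (2 * j / V) ^ j * row_avg (signs J) m (%rs. X rs ^ (2 * j))"
      by (simp only: row_avg_cmult)
    moreover have "(2 * j) ^ (2 * j) * exp (real j) = (2 * j / V) ^ j * (2 * j * exp 1 * V) ^ j"
    proof -
      have "(2 * j / V) ^ j * (2 * j * exp 1 * V) ^ j = ((2 * j / V) * (2 * j * exp 1 * V)) ^ j"
        by (simp only: power_mult_distrib)
      also have "(2 * j / V) * (2 * j * exp 1 * V) = (2 * j)\<^sup>2 * exp 1"
        using V by (simp add: power2_eq_square)
      also have "(real ((2 * j)\<^sup>2) * exp 1) ^ j = (2 * j) ^ (2 * j) * exp (real j)"
        by (simp add: power_mult_distrib power_mult exp_of_nat_mult[symmetric])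
      finally show ?thesis by simp
    qed
    ultimately have "(2 * j / V) ^ j * row_avg (signs J) m (%rs. X rs ^ (2 * j)) <= (2 * j / V) ^ j * (2 * j * exp 1 * V) ^ j"
      by simp
    moreover have "(2 * j / V) ^ j > 0" using V j by simp
    ultimately have "row_avg (signs J) m (%rs. X rs ^ (2 * j)) <= (2 * j * exp 1 * V) ^ j"
      using mult_le_cancel_left_pos by blast
    thus ?thesis unfolding X_def V_def by simp
  qed
qed

text \<open>Second and fourth moments determine the first up to constants: average the pointwise inequality
  \<open>x^2 - x^4 / b^2 \<le> b * \<bar>x\<bar>\<close> with \<open>b\<close> chosen so that the fourth moment costs half of the second.\<close>

lemma khinchine_L1:
  assumes J: "finite J"
  shows "1 / (2 * sqrt (32 * exp 2)) * sqrt (\<Sum>i\<in>J. (a i)\<^sup>2)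
     <= (\<Sum>s\<in>signs J. \<bar>\<Sum>i\<in>J. s i * a i\<bar>) / card (signs J)"
proof -
  define V where "V = (\<Sum>i\<in>J. (a i)\<^sup>2)"
  define X where "X s = (\<Sum>i\<in>J. s i * a i)" for s
  define n where "n = real (card (signs J))"
  have n: "n > 0" using signs_card[OF J] by (simp add: n_def)
  have V0: "V >= 0" unfolding V_def by (intro sum_nonneg) auto
  show ?thesis
  proof (cases "V = 0")
    case True thus ?thesis unfolding V_def using n by (auto simp: n_def intro!: divide_nonneg_nonneg sum_nonneg)
  next
    case False
    with V0 have V: "V > 0" by simp
    define C :: real where "C = 16 * exp 2"
    define b where "b = sqrt (2 * C * V)"
    have b: "b > 0" "b\<^sup>2 = 2 * C * V" using V by (auto simp: b_def C_def)
    have m2: "(\<Sum>s\<in>signs J. (X s)\<^sup>2) / n = V"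
      using signs_second_moment[OF J] by (simp add: X_def n_def V_def)
    have "(exp 1)\<^sup>2 = (exp 2 :: real)" by (simp add: power2_eq_square exp_add[symmetric])
    hence m4: "(\<Sum>s\<in>signs J. (X s) ^ 4) / n <= C * V\<^sup>2"
      using row_avg_even_moment[OF J, of 2 1 a] by (simp add: X_def n_def V_def C_def power_mult_distrib)
    have pt: "x\<^sup>2 - x ^ 4 / b\<^sup>2 <= b * \<bar>x\<bar>" for x
    proof -
      define y where "y = \<bar>x\<bar> / b"
      have y: "y >= 0" "\<bar>x\<bar> = b * y" using b by (auto simp: y_def)
      have "y\<^sup>2 - y ^ 4 <= y"
      proof (cases "y <= 1")
        case True
        have "y * y <= y * 1" using True y(1) by (intro mult_left_mono) auto
        moreover have "0 <= y ^ 4" using y(1) by simp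
        ultimately show ?thesis unfolding power2_eq_square by linarith
      next
        case False
        have "y\<^sup>2 <= y ^ 4" using False by (intro power_increasing) auto
        thus ?thesis using y(1) by linarith
      qed
      hence "b\<^sup>2 * (y\<^sup>2 - y ^ 4) <= b\<^sup>2 * y" by (intro mult_left_mono) auto
      moreover have "x\<^sup>2 = (b * y)\<^sup>2" "x ^ 4 = (b * y) ^ 4" using y(2) by (metis power2_abs, metis power_even_abs_numeral even_numeral)
      hence "x\<^sup>2 = b\<^sup>2 * y\<^sup>2" "x ^ 4 / b\<^sup>2 = b\<^sup>2 * y ^ 4"
        using b(1) by (simp_all add: power_mult_distrib power4_eq_xxxx power2_eq_square)
      moreover have "b * \<bar>x\<bar> = b\<^sup>2 * y" using y(2) by (simp add: power2_eq_square)
      ultimately show ?thesis by (simp only: right_diff_distrib)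
    qed
    have "V / 2 <= V - C * V\<^sup>2 / b\<^sup>2" using V b(2) by (simp add: C_def power2_eq_square field_simps)
    also have "... <= (\<Sum>s\<in>signs J. (X s)\<^sup>2) / n - ((\<Sum>s\<in>signs J. (X s) ^ 4) / n) / b\<^sup>2"
      unfolding m2 using m4 b(1) by (intro diff_left_mono divide_right_mono) auto
    also have "... = (\<Sum>s\<in>signs J. (X s)\<^sup>2 - (X s) ^ 4 / b\<^sup>2) / n"
      by (simp add: sum_subtractf sum_divide_distrib[symmetric] diff_divide_distrib)
    also have "... <= (\<Sum>s\<in>signs J. b * \<bar>X s\<bar>) / n" using n by (intro divide_right_mono sum_mono pt) auto
    also have "... = b * ((\<Sum>s\<in>signs J. \<bar>X s\<bar>) / n)" by (simp add: sum_distrib_left)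
    finally have "V / 2 / b <= (\<Sum>s\<in>signs J. \<bar>X s\<bar>) / n" using b(1) by (simp add: field_simps)
    moreover have "V / 2 / b = 1 / (2 * sqrt (32 * exp 2)) * sqrt V"
    proof -
      have "b = sqrt (32 * exp 2) * sqrt V" by (simp add: b_def C_def real_sqrt_mult[symmetric])
      moreover have "V = sqrt V * sqrt V" using V by simp
      ultimately show ?thesis using V by (simp add: field_simps)
    qed
    ultimately show ?thesis by (simp add: V_def X_def n_def)
  qed
qed

section \<open>The surface measure of the sphere\<close>

lemma nn_integral_lborel_translate:
  fixes f :: "'a::euclidean_space => ennreal"
  assumes [measurable]: "f \<in> borel_measurable borel"
  shows "(\<integral>\<^sup>+x. f (c + x) \<partial>lborel) = (\<integral>\<^sup>+x. f x \<partial>lborel)"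
proof -
  have "(\<integral>\<^sup>+x. f x \<partial>lborel) = (\<integral>\<^sup>+x. f x \<partial>distr lborel borel ((+) c))"
    by (simp add: lborel_distr_plus)
  also have "... = (\<integral>\<^sup>+x. f (c + x) \<partial>lborel)" by (subst nn_integral_distr) auto
  finally show ?thesis ..
qed

text \<open>Uniqueness of translation-invariant measures: integrate the product of the indicators of the unit
  ball and of \<open>A\<close> in two ways. Since \<open>U\<close> preserves the ball, both orders of integration produce the
  same factor.\<close>

lemma lborel_distr_isometry:
  fixes U :: "'a::euclidean_space => 'a"
  assumes U: "orthogonal_transformation U"
  shows "distr lborel borel U = lborel"
proof (rule measure_eqI)
  have lin: "linear U" and nrm: "norm (U x) = norm x" for x
    using U by (auto simp: orthogonal_transformation_linear orthogonal_transformation_norm)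
  have [measurable]: "U \<in> borel_measurable borel"
    using lin by (intro borel_measurable_continuous_onI linear_continuous_on linear_conv_bounded_linear[THEN iffD1])
  obtain V where V: "!!x. U (V x) = x"
    using orthogonal_transformation_surj[OF U] by (metis surj_def)
  fix A assume "A \<in> sets (distr lborel borel U)"
  hence A[measurable]: "A \<in> sets borel" by simp
  let ?B = "ball 0 1 :: 'a set"
  have [measurable]: "?B \<in> sets borel" by simp
  let ?m = "emeasure lborel ?B"
  have B0: "?m ~= 0" "?m ~= \<infinity>"
    using content_ball_pos[of 1 "0::'a"] emeasure_lborel_ball_finite[of "0::'a" 1]
    by (auto simp: measure_def)
  have shift: "(\<integral>\<^sup>+z. indicator A (U z + y) \<partial>lborel) = emeasure (distr lborel borel U) A" for y
  proof -
    have "(\<integral>\<^sup>+z. indicator A (U z + y) \<partial>lborel) = (\<integral>\<^sup>+z. indicator A (U (V y + z)) \<partial>lborel)"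
      using linear_add[OF lin] V by (simp add: add.commute)
    also have "... = (\<integral>\<^sup>+z. indicator A (U z) \<partial>lborel)"
      by (rule nn_integral_lborel_translate[where f="%z. indicator A (U z)"]) measurable
    also have "... = (\<integral>\<^sup>+z. indicator A z \<partial>distr lborel borel U)"
      by (subst nn_integral_distr) auto
    finally show ?thesis by simp
  qed
  have ballV: "(\<integral>\<^sup>+z. indicator ?B (y - U z) \<partial>lborel) = ?m" for y
  proof -
    have "y - U z \<in> ?B \<longleftrightarrow> z \<in> ball (V y) 1" for z
    proof -
      have "y - U z = U (V y - z)" using V linear_diff[OF lin] by simp
      thus ?thesis using nrm by (simp add: dist_norm)
    qed
    hence "(\<integral>\<^sup>+z. indicator ?B (y - U z) \<partial>lborel) = (\<integral>\<^sup>+z. indicator (ball (V y) 1) z \<partial>lborel)"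
      by (intro nn_integral_cong) (auto simp: indicator_def)
    also have "... = (\<integral>\<^sup>+z. indicator (ball (V y) 1) (V y + z) \<partial>lborel)"
      by (rule nn_integral_lborel_translate[symmetric]) (rule borel_measurable_indicator, simp)
    also have "... = (\<integral>\<^sup>+z. indicator ?B z \<partial>lborel)"
      by (intro nn_integral_cong) (auto simp: indicator_def dist_norm)
    also have "... = ?m" by simp
    finally show ?thesis .
  qed
  have "emeasure (distr lborel borel U) A * ?m
      = (\<integral>\<^sup>+y. indicator ?B y * (\<integral>\<^sup>+z. indicator A (U z + y) \<partial>lborel) \<partial>lborel)"
    unfolding shift by (subst nn_integral_multc) (auto simp: mult.commute)
  also have "... = (\<integral>\<^sup>+y. (\<integral>\<^sup>+z. indicator ?B y * indicator A (U z + y) \<partial>lborel) \<partial>lborel)"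
    by (simp add: nn_integral_cmult)
  also have "... = (\<integral>\<^sup>+z. (\<integral>\<^sup>+y. indicator ?B y * indicator A (U z + y) \<partial>lborel) \<partial>lborel)"
    by (rule lborel_pair.Fubini') measurable
  also have "... = (\<integral>\<^sup>+z. (\<integral>\<^sup>+y. indicator ?B (y - U z) * indicator A y \<partial>lborel) \<partial>lborel)"
  proof (rule nn_integral_cong)
    fix z :: 'a
    show "(\<integral>\<^sup>+y. indicator ?B y * indicator A (U z + y) \<partial>lborel) = (\<integral>\<^sup>+y. indicator ?B (y - U z) * indicator A y \<partial>lborel)"
      using nn_integral_lborel_translate[of "%y. indicator ?B (y - U z) * indicator A y" "U z"] by simp
  qed
  also have "... = (\<integral>\<^sup>+y. (\<integral>\<^sup>+z. indicator ?B (y - U z) * indicator A y \<partial>lborel) \<partial>lborel)"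
    by (rule lborel_pair.Fubini') measurable
  also have "... = (\<integral>\<^sup>+y. ?m * indicator A y \<partial>lborel)"
    by (subst nn_integral_multc) (auto simp: ballV)
  also have "... = emeasure lborel A * ?m" by (subst nn_integral_cmult) (auto simp: mult.commute)
  finally show "emeasure (distr lborel borel U) A = emeasure lborel A"
    using B0 by (metis ennreal_mult_right_cong ennreal_times_divide mult.commute mult_divide_eq_ennreal infinity_ennreal_def)
qed simp

lemma space_sphere_measure [simp]: "space (\<mu> :: 'a::euclidean_space measure) = sphere 0 1"
  by (simp add: sphere_measure_def space_restrict_space space_scale_measure)

lemma sets_sphere_measure [measurable_cong]:
  "sets (\<mu> :: 'a::euclidean_space measure) = sets (restrict_space borel (sphere 0 1))"
  by (simp add: sphere_measure_def)

lemma sets_sphere_measure_iff: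
  "A \<in> sets (\<mu> :: 'a::euclidean_space measure) \<longleftrightarrow> A \<in> sets borel \<and> A \<subseteq> sphere 0 1"
  by (auto simp: sets_sphere_measure sets_restrict_space_iff)

lemma cone_vimage:
  fixes A :: "'a::euclidean_space set"
  assumes "A \<subseteq> sphere 0 1"
  shows "{t *\<^sub>R x | t x. x \<in> A \<and> 0 < t \<and> t < 1} = (%x. x /\<^sub>R norm x) -` A \<inter> (ball 0 1 - {0})"
    (is "?R = ?L")
proof (intro equalityI subsetI)
  fix y assume y: "y \<in> ?L"
  have "y = norm y *\<^sub>R (y /\<^sub>R norm y)" using y by simp
  then show "y \<in> ?R"
    using y by (auto intro!: exI[of _ "norm y"] exI[of _ "y /\<^sub>R norm y"])
next
  fix y assume "y \<in> ?R"
  then obtain t x where "y = t *\<^sub>R x" "x \<in> A" "0 < t" "t < 1" by auto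
  moreover have "norm x = 1" using assms \<open>x \<in> A\<close> by auto
  ultimately show "y \<in> ?L" by auto
qed

lemma finite_measure_sphere: "finite_measure (\<mu> :: 'a::euclidean_space measure)"
proof
  have "emeasure (\<mu> :: 'a measure) (sphere 0 1)
     = of_nat DIM('a) * emeasure lborel {t *\<^sub>R x | t x. x \<in> sphere (0::'a) 1 \<and> 0 < t \<and> t < 1}"
    by (rule emeasure_sphere_measure) auto
  also have "... <= of_nat DIM('a) * emeasure lborel (ball (0::'a) 1)"
    by (intro mult_left_mono emeasure_mono) auto
  also have "... < \<infinity>" using emeasure_lborel_ball_finite[of "0::'a" 1]
    by (auto simp: ennreal_mult_less_top of_nat_less_top)
  finally show "emeasure \<mu> (space (\<mu> :: 'a measure)) ~= \<infinity>" by simp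
qed

interpretation sphere: finite_measure \<mu> by (rule finite_measure_sphere)

lemma sphere_measure_isometry:
  fixes U :: "'a::euclidean_space => 'a"
  assumes U: "orthogonal_transformation U"
  shows "U \<in> \<mu> \<rightarrow>\<^sub>M \<mu>" "distr \<mu> \<mu> U = \<mu>"
proof -
  have lin: "linear U" and nrm: "norm (U x) = norm x" for x
    using U by (auto simp: orthogonal_transformation_linear orthogonal_transformation_norm)
  have Um[measurable]: "U \<in> borel_measurable borel"
    using lin by (intro borel_measurable_continuous_onI linear_continuous_on linear_conv_bounded_linear[THEN iffD1])
  have "U \<in> restrict_space borel (sphere 0 1) \<rightarrow>\<^sub>M restrict_space borel (sphere 0 1)"
    by (intro measurable_restrict_space2 measurable_restrict_space1) (auto simp: space_restrict_space nrm)
  thus Us: "U \<in> \<mu> \<rightarrow>\<^sub>M \<mu>"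
    by (simp add: measurable_cong_sets[OF sets_sphere_measure sets_sphere_measure])
  show "distr \<mu> \<mu> U = \<mu>"
  proof (rule measure_eqI)
    fix A assume "A \<in> sets (distr \<mu> \<mu> U)"
    hence As: "A \<in> sets \<mu>" by simp
    hence A: "A \<in> sets borel" "A \<subseteq> sphere 0 1" by (auto simp: sets_sphere_measure_iff)
    let ?A = "U -` A \<inter> sphere 0 1"
    have A': "?A \<in> sets \<mu>" using measurable_sets[OF Us As] by simp
    hence A'': "?A \<in> sets borel" "?A \<subseteq> sphere 0 1" by (auto simp: sets_sphere_measure_iff)
    let ?C = "(%x::'a. x /\<^sub>R norm x) -` A \<inter> (ball 0 1 - {0})"
    have nm: "(%x::'a. x /\<^sub>R norm x) \<in> borel_measurable borel" by measurable
    have C: "?C \<in> sets borel"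
      using measurable_sets[OF nm A(1)] by (intro sets.Int sets.Diff) auto
    have U0: "U x = 0 \<longleftrightarrow> x = 0" for x using nrm[of x] by (metis norm_eq_zero)
    have "x \<in> (%x::'a. x /\<^sub>R norm x) -` ?A \<inter> (ball 0 1 - {0}) \<longleftrightarrow> x \<in> U -` ?C" for x
      by (cases "x = 0") (auto simp: linear_scale[OF lin] nrm U0)
    hence "(%x::'a. x /\<^sub>R norm x) -` ?A \<inter> (ball 0 1 - {0}) = U -` ?C" by blast
    hence "emeasure lborel ((%x::'a. x /\<^sub>R norm x) -` ?A \<inter> (ball 0 1 - {0})) = emeasure lborel (U -` ?C)"
      by simp
    also have "... = emeasure (distr lborel borel U) ?C"
      using C by (subst emeasure_distr) auto
    also have "... = emeasure lborel ?C" by (simp add: lborel_distr_isometry[OF U])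
    finally have "emeasure \<mu> ?A = emeasure \<mu> A"
      using emeasure_sphere_measure[OF A''] emeasure_sphere_measure[OF A] cone_vimage[OF A''(2)] cone_vimage[OF A(2)]
      by simp
    thus "emeasure (distr \<mu> \<mu> U) A = emeasure \<mu> A"
      by (simp add: emeasure_distr[OF Us As])
  qed simp
qed

lemma integral_sphere_isometry:
  fixes U :: "'a::euclidean_space => 'a" and f :: "'a => 'b::{banach, second_countable_topology}"
  assumes U: "orthogonal_transformation U" and f: "f \<in> borel_measurable \<mu>"
  shows "(\<integral>z. f (U z) \<partial>\<mu>) = (\<integral>z. f z \<partial>\<mu>)"
proof -
  have "(\<integral>z. f z \<partial>\<mu>) = (\<integral>z. f z \<partial>distr \<mu> \<mu> U)"
    by (simp add: sphere_measure_isometry[OF U])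
  also have "... = (\<integral>z. f (U z) \<partial>\<mu>)"
    by (rule integral_distr[OF sphere_measure_isometry(1)[OF U] f])
  finally show ?thesis ..
qed

lemma emeasure_sphere_open_pos:
  fixes T :: "'a::euclidean_space set"
  assumes "open T" "w \<in> T" "norm w = 1"
  shows "emeasure \<mu> (T \<inter> sphere 0 1) > 0"
proof -
  let ?C = "(%x::'a. x /\<^sub>R norm x) -` (T \<inter> sphere 0 1) \<inter> (ball 0 1 - {0})"
  have eq: "?C = (ball 0 1 - {0}) \<inter> (%x::'a. x /\<^sub>R norm x) -` T" by auto
  have "open ?C" unfolding eq
    by (intro continuous_open_preimage continuous_intros assms(1) open_Diff) auto
  have "w /\<^sub>R 2 \<in> ?C" using assms by (auto simp: dist_norm)
  from openE[OF \<open>open ?C\<close> this] obtain e where e: "e > 0" "ball (w /\<^sub>R 2) e \<subseteq> ?C" by blast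
  have "0 < measure lborel (ball (w /\<^sub>R 2) e)" by (rule content_ball_pos[OF e(1)])
  hence "0 < emeasure lborel (ball (w /\<^sub>R 2) e)"
    unfolding measure_def zero_less_iff_neq_zero by (intro notI) simp
  also have "... <= emeasure lborel ?C" using \<open>open ?C\<close> e(2) by (intro emeasure_mono) auto
  finally have "0 < emeasure lborel ?C" .
  moreover have "T \<inter> sphere 0 1 \<in> sets borel" using assms(1) by auto
  ultimately have "emeasure \<mu> (T \<inter> sphere 0 1) = of_nat DIM('a) * emeasure lborel ?C"
    using emeasure_sphere_measure[of "T \<inter> sphere 0 1"] cone_vimage[of "T \<inter> sphere 0 1"] by simp
  thus ?thesis using \<open>0 < emeasure lborel ?C\<close> by (simp add: ennreal_zero_less_mult_iff)
qed

section \<open>Bihomogeneous polynomials and Wirtinger derivatives\<close>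

definition bmono :: "('d::finite => nat) => ('d => nat) => 'd fn" where
  "bmono \<alpha> \<beta> = (%z. (\<Prod>j\<in>UNIV. (z $ j) ^ \<alpha> j) * (\<Prod>j\<in>UNIV. (cnj (z $ j)) ^ \<beta> j))"

lemma bmono_eq: "bmono \<alpha> \<beta> z = (\<Prod>j\<in>UNIV. (z $ j) ^ \<alpha> j * (cnj (z $ j)) ^ \<beta> j)"
  by (simp add: bmono_def prod.distrib)

lemma bihom_polys_eq:
  "bihom_polys m n = cfun.span {bmono \<alpha> \<beta> | \<alpha> \<beta>. sum \<alpha> UNIV = m \<and> sum \<beta> UNIV = n}"
  by (simp add: bihom_polys_def bmono_def)

lemma bmono_in_bihom: "sum \<alpha> UNIV = m ==> sum \<beta> UNIV = n ==> bmono \<alpha> \<beta> \<in> bihom_polys m n"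
  unfolding bihom_polys_eq by (intro cfun.span_base) auto

text \<open>Monomials are added one at a time, so that identities only have to be checked on \<open>bmono\<close>.\<close>

lemma bihom_induct [consumes 1, case_names zero step]:
  assumes "f \<in> bihom_polys m n"
    and "h (%z. 0)"
    and "!!c \<alpha> \<beta> g. sum \<alpha> UNIV = m ==> sum \<beta> UNIV = n ==> g \<in> bihom_polys m n ==> h g ==>
          h (%z. c * bmono \<alpha> \<beta> z + g z)"
  shows "h f"
proof -
  have "f \<in> bihom_polys m n \<and> h f"
    using assms(1) unfolding bihom_polys_eq
  proof (induction rule: cfun.span_induct_alt)
    case base
    then show ?case using assms(2) cfun.span_zero by (simp add: zero_fun_def)
  next
    case (step c x y)
    then obtain \<alpha> \<beta> where x: "x = bmono \<alpha> \<beta>" "sum \<alpha> UNIV = m" "sum \<beta> UNIV = n" by blast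
    have "(%z. c * x z) + y \<in> cfun.span {bmono \<alpha> \<beta> | \<alpha> \<beta>. sum \<alpha> UNIV = m \<and> sum \<beta> UNIV = n}"
      by (rule cfun.span_add[OF cfun.span_scale[OF cfun.span_base[OF step(1)]]]) (use step in blast)
    thus ?case using assms(3)[OF x(2,3), of y c] step x(1)
      by (simp add: plus_fun_def bihom_polys_eq)
  qed
  thus ?thesis by blast
qed

lemma bihom_zero [simp]: "(%z. 0) \<in> bihom_polys m n"
  unfolding bihom_polys_eq using cfun.span_zero by (simp add: zero_fun_def)

lemma bihom_add: "f \<in> bihom_polys m n ==> g \<in> bihom_polys m n ==> (%z. f z + g z) \<in> bihom_polys m n"
  unfolding bihom_polys_eq using cfun.span_add by (fastforce simp: plus_fun_def)

lemma bihom_scale: "f \<in> bihom_polys m n ==> (%z. c * f z) \<in> bihom_polys m n"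
  unfolding bihom_polys_eq by (rule cfun.span_scale)

lemma bihom_minus: "f \<in> bihom_polys m n ==> (%z. - f z) \<in> bihom_polys m n"
  using bihom_scale[of f m n "-1"] by simp

lemma bihom_diff: "f \<in> bihom_polys m n ==> g \<in> bihom_polys m n ==> (%z. f z - g z) \<in> bihom_polys m n"
  using bihom_add[OF _ bihom_minus, of f m n g] by simp

lemma bihom_sum: "(!!i. i \<in> I ==> f i \<in> bihom_polys m n) ==> (%z. \<Sum>i\<in>I. f i z) \<in> bihom_polys m n"
  by (induction I rule: infinite_finite_induct) (auto intro: bihom_add)

lemma bmono_mult: "bmono \<alpha> \<beta> z * bmono \<alpha>' \<beta>' z = bmono (%i. \<alpha> i + \<alpha>' i) (%i. \<beta> i + \<beta>' i) z"
  by (simp add: bmono_eq power_add prod.distrib mult_ac)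

lemma bihom_mult:
  assumes f: "f \<in> bihom_polys m n" and g: "g \<in> bihom_polys a b"
  shows "(%z. f z * g z) \<in> bihom_polys (m + a) (n + b)"
  using f
proof (induction rule: bihom_induct)
  case (step c \<alpha> \<beta> f)
  have "(%z. bmono \<alpha> \<beta> z * g z) \<in> bihom_polys (m + a) (n + b)"
    using g
  proof (induction rule: bihom_induct)
    case (step c' \<alpha>' \<beta>' g)
    have "(%z. bmono \<alpha> \<beta> z * (c' * bmono \<alpha>' \<beta>' z + g z)) =
      (%z. c' * bmono (%i. \<alpha> i + \<alpha>' i) (%i. \<beta> i + \<beta>' i) z + bmono \<alpha> \<beta> z * g z)"
      by (simp add: bmono_mult[symmetric] algebra_simps)
    moreover have "bmono (%i. \<alpha> i + \<alpha>' i) (%i. \<beta> i + \<beta>' i) \<in> bihom_polys (m + a) (n + b)"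
      using step \<open>sum \<alpha> UNIV = m\<close> \<open>sum \<beta> UNIV = n\<close> by (intro bmono_in_bihom) (auto simp: sum.distrib)
    ultimately show ?case using step by (auto intro: bihom_add bihom_scale)
  qed simp
  from bihom_add[OF bihom_scale[OF this, of c] step.IH] show ?case by (simp add: algebra_simps)
qed simp

lemma bihom_one: "(%z. 1) \<in> bihom_polys 0 0"
  using bmono_in_bihom[of "%_. 0" 0 "%_. 0" 0] by (simp add: bmono_def)

lemma bihom_const: "(%z. c) \<in> bihom_polys 0 0"
  using bihom_scale[OF bihom_one, of c] by simp

lemma bihom_coord: "(%z. z $ k) \<in> bihom_polys 1 0"
proof -
  have "bmono (%i. if i = k then 1 else 0) (%_. 0) = (%z. z $ k)"
    by (simp add: fun_eq_iff bmono_def if_distrib[of "%n. _ ^ n"] prod.delta cong: if_cong)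
  moreover have "bmono (%i. if i = k then 1 else 0) (%_. 0) \<in> bihom_polys 1 0"
    by (intro bmono_in_bihom) auto
  ultimately show ?thesis by simp
qed

lemma bmono_cnj: "cnj (bmono \<alpha> \<beta> z) = bmono \<beta> \<alpha> z"
  by (simp add: bmono_def mult.commute)

lemma bihom_cnj: "f \<in> bihom_polys m n ==> (%z. cnj (f z)) \<in> bihom_polys n m"
proof (induction rule: bihom_induct)
  case (step c \<alpha> \<beta> g)
  from bihom_add[OF bihom_scale[OF bmono_in_bihom[OF step(2,1)], of "cnj c"] step.IH] show ?case
    by (simp add: bmono_cnj)
qed simp

lemma bihom_coord_cnj: "(%z. cnj (z $ k)) \<in> bihom_polys 0 1"
  using bihom_cnj[OF bihom_coord] .

lemma bihom_mult_coord: "f \<in> bihom_polys m n ==> (%z. z $ k * f z) \<in> bihom_polys (Suc m) n"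
  using bihom_mult[OF bihom_coord] by fastforce

lemma bihom_mult_coord_cnj: "f \<in> bihom_polys m n ==> (%z. cnj (z $ k) * f z) \<in> bihom_polys m (Suc n)"
  using bihom_mult[OF bihom_coord_cnj] by fastforce

lemma bihom_power: "f \<in> bihom_polys m n ==> (%z. f z ^ k) \<in> bihom_polys (k * m) (k * n)"
  by (induction k) (use bihom_one bihom_mult in auto)

lemma bihom_prod:
  "finite I ==> (!!i. i \<in> I ==> f i \<in> bihom_polys (m i) (n i)) ==>
     (%z. \<Prod>i\<in>I. f i z) \<in> bihom_polys (sum m I) (sum n I)"
proof (induction I rule: finite_induct)
  case (insert x F)
  have "(%z. f x z * (\<Prod>i\<in>F. f i z)) \<in> bihom_polys (m x + sum m F) (n x + sum n F)"
    by (intro bihom_mult insert.IH insert.prems) auto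
  thus ?case using insert by simp
qed (simp add: bihom_one)

text \<open>Used for unitary maps, under which the spaces of bihomogeneous polynomials are therefore invariant.\<close>

lemma bihom_linear_subst:
  assumes f: "f \<in> bihom_polys m n" and U: "!!z j. U z $ j = (\<Sum>k\<in>UNIV. u j k * z $ k)"
  shows "(%z. f (U z)) \<in> bihom_polys m n"
  using f
proof (induction rule: bihom_induct)
  case (step c \<alpha> \<beta> g)
  have lf: "(%z. U z $ j) \<in> bihom_polys 1 0" for j
    unfolding U by (intro bihom_sum bihom_scale bihom_coord)
  have lf': "(%z. cnj (U z $ j)) \<in> bihom_polys 0 1" for j using bihom_cnj[OF lf] .
  have "(%z. (\<Prod>j\<in>UNIV. (U z $ j) ^ \<alpha> j) * (\<Prod>j\<in>UNIV. (cnj (U z $ j)) ^ \<beta> j))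
     \<in> bihom_polys ((\<Sum>j\<in>UNIV. \<alpha> j * 1) + (\<Sum>j\<in>UNIV. \<beta> j * 0)) ((\<Sum>j\<in>UNIV. \<alpha> j * 0) + (\<Sum>j\<in>UNIV. \<beta> j * 1))"
    by (intro bihom_mult bihom_prod bihom_power lf lf') auto
  hence "(%z. bmono \<alpha> \<beta> (U z)) \<in> bihom_polys m n" using step by (simp add: bmono_def)
  from bihom_add[OF bihom_scale[OF this, of c] step.IH] show ?case .
qed simp

lemma bihom_homogeneous:
  assumes "f \<in> bihom_polys m n"
  shows "f (t *\<^sub>R z) = of_real t ^ (m + n) * f z"
  using assms
proof (induction rule: bihom_induct)
  case (step c \<alpha> \<beta> g)
  have "bmono \<alpha> \<beta> (t *\<^sub>R z) = of_real t ^ (m + n) * bmono \<alpha> \<beta> z"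
  proof -
    have "(t *\<^sub>R z) $ j = of_real t * z $ j" for j
      by (rule trans[OF vector_scaleR_component scaleR_conv_of_real])
    thus ?thesis using step(1,2)
      by (simp add: bmono_def power_mult_distrib prod.distrib power_sum[symmetric] power_add mult_ac)
  qed
  thus ?case using step by (simp add: algebra_simps)
qed simp

lemma wirtinger_eqI: "(f has_derivative f') (at z) ==> wirtinger j f z = (f' (axis j 1) - \<i> * f' (axis j \<i>)) / 2"
  and wirtinger_cnj_eqI: "(f has_derivative f') (at z) ==> wirtinger_cnj j f z = (f' (axis j 1) + \<i> * f' (axis j \<i>)) / 2"
  by (simp_all add: wirtinger_def wirtinger_cnj_def frechet_derivative_at[symmetric])

lemma has_derivative_coord_powers:
  "((%z::complex^'d::finite. (z $ i) ^ a * (cnj (z $ i)) ^ b) has_derivative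
     (%h. of_nat a * (z $ i) ^ (a - 1) * (cnj (z $ i)) ^ b * (h $ i) +
          of_nat b * (z $ i) ^ a * (cnj (z $ i)) ^ (b - 1) * cnj (h $ i))) (at z)"
proof -
  have "((%z::complex^'d. z $ i) has_derivative (%h. h $ i)) (at z)"
    by (rule bounded_linear_imp_has_derivative[OF bounded_linear_vec_nth])
  moreover have "((%z::complex^'d. cnj (z $ i)) has_derivative (%h. cnj (h $ i))) (at z)"
    by (intro bounded_linear_imp_has_derivative bounded_linear_compose[OF bounded_linear_cnj bounded_linear_vec_nth])
  ultimately show ?thesis
    by (auto intro!: derivative_eq_intros simp: algebra_simps)
qed

lemma bmono_has_derivative:
  "(bmono \<alpha> \<beta> has_derivative
     (%h. \<Sum>k\<in>UNIV. h $ k * (of_nat (\<alpha> k) * bmono (\<alpha>(k := \<alpha> k - 1)) \<beta> z)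
         + cnj (h $ k) * (of_nat (\<beta> k) * bmono \<alpha> (\<beta>(k := \<beta> k - 1)) z))) (at z)"
proof -
  have eq: "bmono \<alpha> \<beta> = (%z. \<Prod>j\<in>UNIV. (z $ j) ^ \<alpha> j * (cnj (z $ j)) ^ \<beta> j)"
    by (simp add: fun_eq_iff bmono_eq)
  have split: "bmono (\<alpha>(k := a)) (\<beta>(k := b)) z =
      (z $ k) ^ a * (cnj (z $ k)) ^ b * (\<Prod>j\<in>UNIV - {k}. (z $ j) ^ \<alpha> j * (cnj (z $ j)) ^ \<beta> j)" for k a b
    unfolding bmono_eq by (subst prod.remove[of UNIV k]) auto
  have split1: "bmono (\<alpha>(k := \<alpha> k - 1)) \<beta> z =
      (z $ k) ^ (\<alpha> k - 1) * (cnj (z $ k)) ^ \<beta> k * (\<Prod>j\<in>UNIV - {k}. (z $ j) ^ \<alpha> j * (cnj (z $ j)) ^ \<beta> j)" for k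
    using split[of k "\<alpha> k - 1" "\<beta> k"] by (simp only: fun_upd_triv)
  have split2: "bmono \<alpha> (\<beta>(k := \<beta> k - 1)) z =
      (z $ k) ^ \<alpha> k * (cnj (z $ k)) ^ (\<beta> k - 1) * (\<Prod>j\<in>UNIV - {k}. (z $ j) ^ \<alpha> j * (cnj (z $ j)) ^ \<beta> j)" for k
    using split[of k "\<alpha> k" "\<beta> k - 1"] by (simp only: fun_upd_triv)
  have "(bmono \<alpha> \<beta> has_derivative
     (%h. \<Sum>k\<in>UNIV. (of_nat (\<alpha> k) * (z $ k) ^ (\<alpha> k - 1) * (cnj (z $ k)) ^ \<beta> k * (h $ k) +
          of_nat (\<beta> k) * (z $ k) ^ \<alpha> k * (cnj (z $ k)) ^ (\<beta> k - 1) * cnj (h $ k))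
        * (\<Prod>j\<in>UNIV - {k}. (z $ j) ^ \<alpha> j * (cnj (z $ j)) ^ \<beta> j))) (at z)"
    unfolding eq by (intro has_derivative_prod has_derivative_coord_powers)
  also have "(%h. \<Sum>k\<in>UNIV. (of_nat (\<alpha> k) * (z $ k) ^ (\<alpha> k - 1) * (cnj (z $ k)) ^ \<beta> k * (h $ k) +
          of_nat (\<beta> k) * (z $ k) ^ \<alpha> k * (cnj (z $ k)) ^ (\<beta> k - 1) * cnj (h $ k))
        * (\<Prod>j\<in>UNIV - {k}. (z $ j) ^ \<alpha> j * (cnj (z $ j)) ^ \<beta> j)) =
     (%h. \<Sum>k\<in>UNIV. h $ k * (of_nat (\<alpha> k) * bmono (\<alpha>(k := \<alpha> k - 1)) \<beta> z)
         + cnj (h $ k) * (of_nat (\<beta> k) * bmono \<alpha> (\<beta>(k := \<beta> k - 1)) z))"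
    by (intro ext sum.cong refl, unfold split1 split2) (simp add: algebra_simps)
  finally show ?thesis .
qed

lemma sum_axis: "(\<Sum>k\<in>UNIV. (axis j c :: complex ^ 'd::finite) $ k * F k + cnj (axis j c $ k) * G k) = c * F j + cnj c * G j"
proof -
  have "(\<Sum>k\<in>UNIV. (axis j c :: complex ^ 'd) $ k * F k + cnj (axis j c $ k) * G k) =
     (\<Sum>k\<in>UNIV. if k = j then c * F j + cnj c * G j else 0)"
    by (intro sum.cong) (auto simp: axis_def)
  thus ?thesis by simp
qed

lemma wirtinger_bmono: "wirtinger k (bmono \<alpha> \<beta>) z = of_nat (\<alpha> k) * bmono (\<alpha>(k := \<alpha> k - 1)) \<beta> z"
  and wirtinger_cnj_bmono: "wirtinger_cnj k (bmono \<alpha> \<beta>) z = of_nat (\<beta> k) * bmono \<alpha> (\<beta>(k := \<beta> k - 1)) z"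
  unfolding wirtinger_eqI[OF bmono_has_derivative] wirtinger_cnj_eqI[OF bmono_has_derivative] sum_axis
  by (simp_all add: algebra_simps)

lemma wirtinger_const [simp]: "wirtinger k (%z. c) z = 0" "wirtinger_cnj k (%z. c) z = 0"
  by (simp_all add: wirtinger_eqI[OF has_derivative_const] wirtinger_cnj_eqI[OF has_derivative_const])

lemma wirtinger_add:
  assumes "f differentiable (at z)" "g differentiable (at z)"
  shows "wirtinger k (%z. f z + g z) z = wirtinger k f z + wirtinger k g z"
    "wirtinger_cnj k (%z. f z + g z) z = wirtinger_cnj k f z + wirtinger_cnj k g z"
proof -
  obtain f' g' where d: "(f has_derivative f') (at z)" "(g has_derivative g') (at z)"
    using assms by (auto simp: differentiable_def)
  show "wirtinger k (%z. f z + g z) z = wirtinger k f z + wirtinger k g z"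
    "wirtinger_cnj k (%z. f z + g z) z = wirtinger_cnj k f z + wirtinger_cnj k g z"
    unfolding wirtinger_eqI[OF d(1)] wirtinger_eqI[OF d(2)] wirtinger_cnj_eqI[OF d(1)] wirtinger_cnj_eqI[OF d(2)]
      wirtinger_eqI[OF has_derivative_add[OF d]] wirtinger_cnj_eqI[OF has_derivative_add[OF d]]
    by (simp_all add: field_simps)
qed

lemma wirtinger_mult:
  assumes "f differentiable (at z)" "g differentiable (at z)"
  shows "wirtinger k (%z. f z * g z) z = wirtinger k f z * g z + f z * wirtinger k g z"
    "wirtinger_cnj k (%z. f z * g z) z = wirtinger_cnj k f z * g z + f z * wirtinger_cnj k g z"
proof -
  obtain f' g' where d: "(f has_derivative f') (at z)" "(g has_derivative g') (at z)"
    using assms by (auto simp: differentiable_def)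
  show "wirtinger k (%z. f z * g z) z = wirtinger k f z * g z + f z * wirtinger k g z"
    "wirtinger_cnj k (%z. f z * g z) z = wirtinger_cnj k f z * g z + f z * wirtinger_cnj k g z"
    unfolding wirtinger_eqI[OF d(1)] wirtinger_eqI[OF d(2)] wirtinger_cnj_eqI[OF d(1)] wirtinger_cnj_eqI[OF d(2)]
      wirtinger_eqI[OF has_derivative_mult[OF d]] wirtinger_cnj_eqI[OF has_derivative_mult[OF d]]
    by (simp_all add: field_simps)
qed

lemma wirtinger_scale:
  assumes "f differentiable (at z)"
  shows "wirtinger k (%z. c * f z) z = c * wirtinger k f z"
    "wirtinger_cnj k (%z. c * f z) z = c * wirtinger_cnj k f z"
  using wirtinger_mult[OF _ assms, of "%_. c"] by simp_all

lemma wirtinger_of_cnj: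
  assumes "f differentiable (at z)"
  shows "wirtinger k (%z. cnj (f z)) z = cnj (wirtinger_cnj k f z)"
    "wirtinger_cnj k (%z. cnj (f z)) z = cnj (wirtinger k f z)"
proof -
  obtain f' where d: "(f has_derivative f') (at z)" using assms by (auto simp: differentiable_def)
  have d': "((%z. cnj (f z)) has_derivative (%h. cnj (f' h))) (at z)"
    by (rule bounded_linear.has_derivative[OF bounded_linear_cnj d])
  show "wirtinger k (%z. cnj (f z)) z = cnj (wirtinger_cnj k f z)"
    "wirtinger_cnj k (%z. cnj (f z)) z = cnj (wirtinger k f z)"
    unfolding wirtinger_eqI[OF d] wirtinger_cnj_eqI[OF d] wirtinger_eqI[OF d'] wirtinger_cnj_eqI[OF d']
    by simp_all
qed

lemma bihom_differentiable: "f \<in> bihom_polys m n ==> f differentiable (at z)"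
proof (induction rule: bihom_induct)
  case (step c \<alpha> \<beta> g)
  have "bmono \<alpha> \<beta> differentiable (at z)" using bmono_has_derivative by (auto simp: differentiable_def)
  with step show ?case by (intro differentiable_add differentiable_mult) auto
qed simp

lemma bihom_continuous: "f \<in> bihom_polys m n ==> continuous_on S f"
  by (intro continuous_at_imp_continuous_on ballI differentiable_imp_continuous_within) (rule bihom_differentiable)

lemma bihom_derivative:
  assumes "f \<in> bihom_polys m n"
  shows "(f has_derivative (%h. \<Sum>k\<in>UNIV. h $ k * wirtinger k f z + cnj (h $ k) * wirtinger_cnj k f z)) (at z)"
  using assms
proof (induction rule: bihom_induct)
  case (step c \<alpha> \<beta> g)
  have dm: "bmono \<alpha> \<beta> differentiable (at z)" using bmono_has_derivative by (auto simp: differentiable_def)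
  have dg: "g differentiable (at z)" by (rule bihom_differentiable[OF step(3)])
  have dcm: "(%z. c * bmono \<alpha> \<beta> z) differentiable (at z)" using dm by (intro differentiable_mult) auto
  have "((%z. c * bmono \<alpha> \<beta> z + g z) has_derivative
    (%h. c * (\<Sum>k\<in>UNIV. h $ k * wirtinger k (bmono \<alpha> \<beta>) z + cnj (h $ k) * wirtinger_cnj k (bmono \<alpha> \<beta>) z) +
      (\<Sum>k\<in>UNIV. h $ k * wirtinger k g z + cnj (h $ k) * wirtinger_cnj k g z))) (at z)"
    by (intro has_derivative_add has_derivative_mult_right step.IH)
       (simp only: wirtinger_bmono wirtinger_cnj_bmono bmono_has_derivative)
  thus ?case
    unfolding wirtinger_add[OF dcm dg] wirtinger_scale[OF dm]
    by (simp add: sum_distrib_left sum.distrib algebra_simps)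
qed simp

lemma wirtinger_step:
  assumes "g \<in> bihom_polys m n"
  shows "wirtinger k (%z. c * bmono \<alpha> \<beta> z + g z) =
      (%z. (c * of_nat (\<alpha> k)) * bmono (\<alpha>(k := \<alpha> k - 1)) \<beta> z + wirtinger k g z)"
    "wirtinger_cnj k (%z. c * bmono \<alpha> \<beta> z + g z) =
      (%z. (c * of_nat (\<beta> k)) * bmono \<alpha> (\<beta>(k := \<beta> k - 1)) z + wirtinger_cnj k g z)"
proof -
  have dm: "bmono \<alpha> \<beta> differentiable (at z)" for z using bmono_has_derivative by (auto simp: differentiable_def)
  have dcm: "(%z. c * bmono \<alpha> \<beta> z) differentiable (at z)" for z using dm by (intro differentiable_mult) auto
  note * = wirtinger_add[OF dcm bihom_differentiable[OF assms]] wirtinger_scale[OF dm]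
  show "wirtinger k (%z. c * bmono \<alpha> \<beta> z + g z) =
      (%z. (c * of_nat (\<alpha> k)) * bmono (\<alpha>(k := \<alpha> k - 1)) \<beta> z + wirtinger k g z)"
    "wirtinger_cnj k (%z. c * bmono \<alpha> \<beta> z + g z) =
      (%z. (c * of_nat (\<beta> k)) * bmono \<alpha> (\<beta>(k := \<beta> k - 1)) z + wirtinger_cnj k g z)"
    by (simp_all add: fun_eq_iff * wirtinger_bmono wirtinger_cnj_bmono)
qed

lemma sum_decr: "\<alpha> k ~= 0 ==> sum (\<alpha>(k := \<alpha> k - 1)) (UNIV :: 'd::finite set) = sum \<alpha> UNIV - (1::nat)"
  by (simp add: sum.remove[of UNIV k])

lemma bihom_wirtinger: "f \<in> bihom_polys m n ==> wirtinger k f \<in> bihom_polys (m - 1) n"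
proof (induction rule: bihom_induct)
  case zero
  have "wirtinger k (%z. 0) = (%z. 0)" by (simp add: fun_eq_iff)
  then show ?case by simp
next
  case (step c \<alpha> \<beta> g)
  have "(%z. (c * of_nat (\<alpha> k)) * bmono (\<alpha>(k := \<alpha> k - 1)) \<beta> z) \<in> bihom_polys (m - 1) n"
    using step(1,2) sum_decr[of \<alpha> k] by (cases "\<alpha> k = 0") (auto intro!: bihom_scale bmono_in_bihom simp del: fun_upd_apply)
  from bihom_add[OF this step.IH] show ?case unfolding wirtinger_step[OF step(3)] .
qed

lemma bihom_wirtinger_cnj: "f \<in> bihom_polys m n ==> wirtinger_cnj k f \<in> bihom_polys m (n - 1)"
proof (induction rule: bihom_induct)
  case zero
  have "wirtinger_cnj k (%z. 0) = (%z. 0)" by (simp add: fun_eq_iff)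
  then show ?case by simp
next
  case (step c \<alpha> \<beta> g)
  have "(%z. (c * of_nat (\<beta> k)) * bmono \<alpha> (\<beta>(k := \<beta> k - 1)) z) \<in> bihom_polys m (n - 1)"
    using step(1,2) sum_decr[of \<beta> k] by (cases "\<beta> k = 0") (auto intro!: bihom_scale bmono_in_bihom simp del: fun_upd_apply)
  from bihom_add[OF this step.IH] show ?case unfolding wirtinger_step[OF step(3)] .
qed

lemma bmono_incr: "bmono (\<alpha>(k := Suc (\<alpha> k))) \<beta> z = z $ k * bmono \<alpha> \<beta> z"
  "bmono \<alpha> (\<beta>(k := Suc (\<beta> k))) z = cnj (z $ k) * bmono \<alpha> \<beta> z"
proof -
  show "bmono (\<alpha>(k := Suc (\<alpha> k))) \<beta> z = z $ k * bmono \<alpha> \<beta> z"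
    unfolding bmono_eq by (simp add: prod.remove[of UNIV k])
  show "bmono \<alpha> (\<beta>(k := Suc (\<beta> k))) z = cnj (z $ k) * bmono \<alpha> \<beta> z"
    unfolding bmono_eq by (simp add: prod.remove[of UNIV k])
qed

lemma euler_wirtinger:
  assumes "f \<in> bihom_polys m n"
  shows "(\<Sum>k\<in>UNIV. z $ k * wirtinger k f z) = of_nat m * f z"
  using assms
proof (induction rule: bihom_induct)
  case (step c \<alpha> \<beta> g)
  have *: "z $ k * (of_nat (\<alpha> k) * bmono (\<alpha>(k := \<alpha> k - 1)) \<beta> z) = of_nat (\<alpha> k) * bmono \<alpha> \<beta> z" for k
    using bmono_incr(1)[of "\<alpha>(k := \<alpha> k - 1)" k \<beta> z] by (cases "\<alpha> k = 0") (auto simp: fun_upd_idem)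
  have "(\<Sum>k\<in>UNIV. z $ k * wirtinger k (%z. c * bmono \<alpha> \<beta> z + g z) z) =
     (\<Sum>k\<in>UNIV. c * (z $ k * (of_nat (\<alpha> k) * bmono (\<alpha>(k := \<alpha> k - 1)) \<beta> z)) + z $ k * wirtinger k g z)"
    unfolding wirtinger_step[OF step(3)] by (simp add: algebra_simps)
  also have "... = of_nat m * (c * bmono \<alpha> \<beta> z + g z)"
    unfolding * sum.distrib step.IH using step(1)
    by (simp add: sum_distrib_left[symmetric] sum_distrib_right[symmetric] of_nat_sum[symmetric] algebra_simps)
  finally show ?case .
qed simp

lemma euler_wirtinger_cnj:
  assumes "f \<in> bihom_polys m n"
  shows "(\<Sum>k\<in>UNIV. cnj (z $ k) * wirtinger_cnj k f z) = of_nat n * f z"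
proof -
  have "(\<Sum>k\<in>UNIV. z $ k * wirtinger k (%z. cnj (f z)) z) = of_nat n * cnj (f z)"
    by (rule euler_wirtinger[OF bihom_cnj[OF assms]])
  hence "cnj (\<Sum>k\<in>UNIV. z $ k * cnj (wirtinger_cnj k f z)) = cnj (of_nat n * cnj (f z))"
    by (simp add: wirtinger_of_cnj[OF bihom_differentiable[OF assms]])
  thus ?thesis by simp
qed

lemma wirtinger_degree_0: "f \<in> bihom_polys 0 n ==> wirtinger k f z = 0"
proof (induction rule: bihom_induct)
  case (step c \<alpha> \<beta> g)
  hence "\<alpha> k = 0" by simp
  with step show ?case by (simp add: wirtinger_step[OF step(3)])
qed simp

lemma wirtinger_cnj_degree_0: "f \<in> bihom_polys m 0 ==> wirtinger_cnj k f z = 0"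
proof (induction rule: bihom_induct)
  case (step c \<alpha> \<beta> g)
  hence "\<beta> k = 0" by simp
  with step show ?case by (simp add: wirtinger_step[OF step(3)])
qed simp

lemma wirtinger_commute:
  assumes "f \<in> bihom_polys m n"
  shows "wirtinger j (wirtinger_cnj k f) = wirtinger_cnj k (wirtinger j f)"
    "wirtinger j (wirtinger k f) = wirtinger k (wirtinger j f)"
proof -
  have z: "wirtinger k (%z. 0) = (%z. 0)" "wirtinger_cnj k (%z. 0) = (%z. 0)" for k :: 'a
    by (simp_all add: fun_eq_iff)
  have "wirtinger j (wirtinger_cnj k f) = wirtinger_cnj k (wirtinger j f) \<and>
    wirtinger j (wirtinger k f) = wirtinger k (wirtinger j f)"
    using assms
  proof (induction rule: bihom_induct)
    case (step c \<alpha> \<beta> g)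
    show ?case
      unfolding wirtinger_step[OF step(3)] wirtinger_step[OF bihom_wirtinger[OF step(3)]]
        wirtinger_step[OF bihom_wirtinger_cnj[OF step(3)]]
      using step.IH by (auto simp: fun_eq_iff fun_upd_twist mult_ac)
  qed (simp add: z)
  thus "wirtinger j (wirtinger_cnj k f) = wirtinger_cnj k (wirtinger j f)"
    "wirtinger j (wirtinger k f) = wirtinger k (wirtinger j f)" by auto
qed

section \<open>Integration of polynomials over the sphere\<close>

lemma sphere_measurable:
  fixes f :: "'a::euclidean_space => 'b::euclidean_space"
  assumes "continuous_on (sphere 0 1) f"
  shows "f \<in> borel_measurable \<mu>"
  using borel_measurable_continuous_on_restrict[OF assms]
  by (simp add: measurable_cong_sets[OF sets_sphere_measure refl])

lemma sphere_bounded: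
  fixes f :: "'a::euclidean_space => complex"
  assumes "continuous_on (sphere 0 1) f"
  obtains B where "!!x. x \<in> sphere 0 1 ==> norm (f x) <= B"
proof -
  have "bounded (f ` sphere 0 1)"
    by (intro compact_imp_bounded compact_continuous_image assms compact_sphere)
  then obtain B where "\<forall>y\<in>f ` sphere 0 1. norm y <= B" unfolding bounded_iff by blast
  thus thesis using that by blast
qed

lemma sphere_integrable:
  fixes f :: "'a::euclidean_space => complex"
  assumes "continuous_on (sphere 0 1) f"
  shows "integrable \<mu> f"
proof -
  obtain B where B: "!!x. x \<in> sphere 0 1 ==> norm (f x) <= B"
    using sphere_bounded[OF assms] by blast
  show ?thesis
    by (rule sphere.integrable_const_bound[where B=B])
       (use B in \<open>auto intro!: AE_I2 sphere_measurable assms\<close>)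
qed

lemma bihom_integrable [simp]: "f \<in> bihom_polys m n ==> integrable \<mu> f"
  by (intro sphere_integrable bihom_continuous)

lemma sphere_integral_zero_imp:
  fixes f :: "'a::euclidean_space => complex"
  assumes f: "continuous_on (sphere 0 1) f" and z: "(\<integral>z. f z * cnj (f z) \<partial>\<mu>) = 0" and w: "w \<in> sphere 0 1"
  shows "f w = 0"
proof (rule ccontr)
  assume nz: "f w ~= 0"
  define g where "g x = (cmod (f x))\<^sup>2" for x
  have g: "continuous_on (sphere 0 1) g" unfolding g_def by (intro continuous_intros f)
  have fg: "f x * cnj (f x) = complex_of_real (g x)" for x by (simp only: g_def complex_norm_square)
  have "integrable \<mu> (%x. complex_of_real (g x))"
    by (intro sphere_integrable continuous_intros g)
  from integrable_Re[OF this] have gi: "integrable \<mu> g" by simp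
  have "complex_of_real (\<integral>z. g z \<partial>\<mu>) = 0" using z unfolding fg by simp
  hence "(\<integral>z. g z \<partial>\<mu>) = 0" by simp
  hence ae: "AE x in \<mu>. g x = 0"
    using integral_nonneg_eq_0_iff_AE[OF gi] by (auto simp: g_def[symmetric] intro: AE_I2 zero_le_power2[of "cmod (f _)", folded g_def])
  define T where "T = {x \<in> sphere 0 1. g x > 0}"
  have "openin (top_of_set (sphere 0 1)) (sphere 0 1 \<inter> g -` {0<..})"
    by (rule continuous_openin_preimage_gen[OF g]) simp
  then obtain W where W: "open W" "sphere 0 1 \<inter> g -` {0<..} = sphere 0 1 \<inter> W" by (auto simp: openin_open)
  have T0: "T = sphere 0 1 \<inter> g -` {0<..}" by (auto simp: T_def)
  have T_eq: "T = W \<inter> sphere 0 1" unfolding T0 W(2) by (rule Int_commute)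
  have "w \<in> T" using w nz by (simp add: T_def g_def)
  hence wT: "w \<in> W" unfolding T_eq by blast
  have "emeasure \<mu> (W \<inter> sphere 0 1) > 0"
    using emeasure_sphere_open_pos[OF W(1) wT] w by simp
  moreover have "emeasure \<mu> (W \<inter> sphere 0 1) = 0"
  proof -
    have "AE x in \<mu>. x \<notin> W \<inter> sphere 0 1"
      using ae unfolding T_eq[symmetric] by (auto simp: T_def elim!: eventually_mono)
    moreover have "W \<inter> sphere 0 1 \<in> sets \<mu>"
      unfolding sets_sphere_measure_iff using W(1) by auto
    ultimately show ?thesis using AE_iff_null_sets null_setsD1 by blast
  qed
  ultimately show False by simp
qed

definition herm :: "complex ^ 'd::finite => 'd fn" where
  "herm z w = (\<Sum>j\<in>UNIV. z $ j * cnj (w $ j))"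

text \<open>The unitary map that multiplies the component along the unit vector \<open>v\<close> by \<open>c\<close> and fixes the
  orthogonal complement of \<open>v\<close>. These maps suffice everywhere: they act transitively on the sphere.\<close>

definition urot :: "complex => complex ^ 'd::finite => complex ^ 'd => complex ^ 'd" where
  "urot c v z = (\<chi> j. z $ j + (c - 1) * herm z v * v $ j)"

lemma urot_nth [simp]: "urot c v z $ j = z $ j + (c - 1) * herm z v * v $ j"
  by (simp add: urot_def)

lemma herm_self: "herm z z = of_real ((norm z)\<^sup>2)"
  by (simp add: herm_def norm_vec_def L2_set_def sum_nonneg complex_norm_square[symmetric])

lemma herm_add_left: "herm (x + y) v = herm x v + herm y v"
  and herm_scaleR_left: "herm (r *\<^sub>R x) v = of_real r * herm x v"
  and herm_commute: "herm y x = cnj (herm x y)"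
  by (auto simp: herm_def sum.distrib algebra_simps scaleR_conv_of_real[symmetric] scaleR_sum_right)

lemma herm_urot:
  assumes "cmod c = 1" "herm v v = 1"
  shows "herm (urot c v z) v = c * herm z v"
proof -
  define a where "a = (c - 1) * herm z v"
  have u: "urot c v z $ j = z $ j + a * v $ j" for j by (simp add: a_def)
  have "herm (urot c v z) v = herm z v + a * herm v v"
    unfolding herm_def u by (simp add: ring_distribs sum.distrib sum_distrib_left mult_ac)
  thus ?thesis using assms by (simp add: a_def algebra_simps)
qed

lemma norm_urot:
  assumes "cmod c = 1" "herm v v = 1"
  shows "norm (urot c v z) = norm z"
proof -
  define a where "a = (c - 1) * herm z v"
  have cc: "c * cnj c = 1" using assms(1) by (simp add: complex_norm_square[symmetric])
  have "herm (urot c v z) (urot c v z) = herm z z + cnj a * herm z v + a * herm v z + a * cnj a * herm v v"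
  proof -
    have u: "urot c v z $ j = z $ j + a * v $ j" for j by (simp add: a_def)
    show ?thesis unfolding herm_def u by (simp add: ring_distribs sum.distrib sum_distrib_left mult_ac)
  qed
  hence e1: "herm (urot c v z) (urot c v z) = herm z z +
      (cnj a * herm z v + a * cnj (herm z v) + a * cnj a * herm v v)"
    unfolding herm_commute[of v z] by (simp only: add.assoc)
  have e2: "cnj a * herm z v + a * cnj (herm z v) + a * cnj a * herm v v
       = herm z v * cnj (herm z v) * (c * cnj c - 1)"
    using assms(2) by (simp add: a_def algebra_simps)
  have "herm (urot c v z) (urot c v z) = herm z z" unfolding e1 e2 cc by simp
  hence "(norm (urot c v z))\<^sup>2 = (norm z)\<^sup>2" unfolding herm_self of_real_eq_iff .
  thus ?thesis by simp
qed

lemma urot_orthogonal: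
  assumes "cmod c = 1" "herm v v = 1"
  shows "orthogonal_transformation (urot c v)"
  unfolding orthogonal_transformation
proof (intro conjI allI)
  show "linear (urot c v)"
    by (rule linearI) (simp_all add: vec_eq_iff herm_add_left herm_scaleR_left algebra_simps scaleR_conv_of_real[of _ "_::complex"])
qed (rule norm_urot[OF assms])

lemma bihom_urot:
  assumes "f \<in> bihom_polys m n"
  shows "(%z. f (urot c v z)) \<in> bihom_polys m n"
proof (rule bihom_linear_subst[OF assms])
  fix z j
  have "(\<Sum>k\<in>UNIV. ((if k = j then 1 else 0) + (c - 1) * cnj (v $ k) * v $ j) * z $ k)
     = (\<Sum>k\<in>UNIV. (if k = j then z $ k else 0)) + (\<Sum>k\<in>UNIV. (c - 1) * (z $ k * cnj (v $ k)) * v $ j)"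
    unfolding sum.distrib[symmetric] by (intro sum.cong) (auto simp: algebra_simps)
  thus "urot c v z $ j = (\<Sum>k\<in>UNIV. ((if k = j then 1 else 0) + (c - 1) * cnj (v $ k) * v $ j) * z $ k)"
    by (simp add: herm_def sum_distrib_left sum_distrib_right)
qed

text \<open>The derivative at \<open>t = 0\<close> of \<open>F\<close> along the rotations with \<open>c = exp (i t)\<close>.\<close>

definition gen :: "complex ^ 'd::finite => ('d fn) => 'd fn" where
  "gen v F z = (\<Sum>k\<in>UNIV. (\<i> * herm z v * v $ k) * wirtinger k F z + cnj (\<i> * herm z v * v $ k) * wirtinger_cnj k F z)"

lemma continuous_on_herm [continuous_intros]: "continuous_on S (%z. herm z v)"
  unfolding herm_def by (intro continuous_intros)

lemma continuous_on_gen: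
  assumes "F \<in> bihom_polys m n"
  shows "continuous_on S (gen v F)"
  unfolding gen_def
  by (intro continuous_intros bihom_continuous[OF bihom_wirtinger[OF assms]] bihom_continuous[OF bihom_wirtinger_cnj[OF assms]])

lemma urot_path_derivative:
  assumes F: "F \<in> bihom_polys m n" and v: "herm v v = 1"
  shows "((%t. F (urot (cis t) v z)) has_derivative (%h. h *\<^sub>R gen v F (urot (cis t) v z))) (at t)"
proof -
  let ?w = "\<chi> k. (\<i> * herm (urot (cis t) v z) v * v $ k)"
  have "((%t. urot (cis t) v z) has_derivative (%h. h *\<^sub>R ?w)) (at t)"
  proof -
    define A where "A = (\<chi> j. herm z v * v $ j)"
    define B where "B = (\<chi> j. \<i> * (herm z v * v $ j))"
    have cs: "cis t = complex_of_real (cos t) + \<i> * complex_of_real (sin t)" for t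
      by (simp add: complex_eq_iff)
    have path: "urot (cis t) v z = z + ((cos t - 1) *\<^sub>R A + sin t *\<^sub>R B)" for t
      unfolding vec_eq_iff urot_nth cs
      by (simp add: A_def B_def scaleR_conv_of_real[of _ "_::complex"] algebra_simps)
    have "((%t. z + ((cos t - 1) *\<^sub>R A + sin t *\<^sub>R B)) has_derivative
        (%h. h *\<^sub>R ((- sin t) *\<^sub>R A + cos t *\<^sub>R B))) (at t)"
      by (auto intro!: derivative_eq_intros simp: algebra_simps)
    moreover have "(- sin t) *\<^sub>R A + cos t *\<^sub>R B = ?w"
    proof -
      have "herm (urot (cis t) v z) v = cis t * herm z v" by (rule herm_urot) (simp_all add: v)
      thus ?thesis unfolding vec_eq_iff cs
        by (simp add: A_def B_def scaleR_conv_of_real[of _ "_::complex"] algebra_simps)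
    qed
    ultimately show ?thesis by (simp only: path)
  qed
  from has_derivative_compose[OF this bihom_derivative[OF F]]
  have "((%t. F (urot (cis t) v z)) has_derivative (%h. \<Sum>k\<in>UNIV. (h *\<^sub>R ?w) $ k * wirtinger k F (urot (cis t) v z) +
     cnj ((h *\<^sub>R ?w) $ k) * wirtinger_cnj k F (urot (cis t) v z))) (at t)" .
  moreover have "(\<Sum>k\<in>UNIV. (h *\<^sub>R ?w) $ k * wirtinger k F (urot (cis t) v z) +
     cnj ((h *\<^sub>R ?w) $ k) * wirtinger_cnj k F (urot (cis t) v z)) = h *\<^sub>R gen v F (urot (cis t) v z)" for h
    unfolding gen_def scaleR_sum_right
    by (intro sum.cong refl) (simp add: scaleR_conv_of_real[of _ "_::complex"] algebra_simps)
  ultimately show ?thesis by simp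
qed

text \<open>The integral of \<open>F\<close> over the sphere is invariant under rotations, so the difference quotients
  have integral zero; they converge boundedly.\<close>

lemma integral_gen_eq_0:
  assumes F: "F \<in> bihom_polys m n" and v: "herm v v = 1"
  shows "(\<integral>z. gen v F z \<partial>\<mu>) = 0"
proof -
  define \<tau> where "\<tau> k = 1 / real (Suc k)" for k
  have \<tau>: "\<tau> k > 0" for k by (simp add: \<tau>_def)
  have \<tau>0: "\<tau> \<longlonglongrightarrow> 0" unfolding \<tau>_def by (rule LIMSEQ_Suc[OF lim_1_over_n])
  define G where "G k z = (F (urot (cis (\<tau> k)) v z) - F z) /\<^sub>R \<tau> k" for k z
  obtain B where B: "!!x. x \<in> sphere 0 1 ==> norm (gen v F x) <= B"
    using sphere_bounded[OF continuous_on_gen[OF F, of _ v]] by blast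
  have u0: "urot (cis 0) v z = z" for z by (simp add: vec_eq_iff)
  have lim: "(%k. G k z) \<longlonglongrightarrow> gen v F z" for z
  proof -
    have "((%h. norm (F (urot (cis (0 + h)) v z) - F (urot (cis 0) v z) - h *\<^sub>R gen v F (urot (cis 0) v z)) / norm h) \<longlongrightarrow> 0) (at 0)"
      using urot_path_derivative[OF F v, of z 0] unfolding has_derivative_at by blast
    moreover have "filterlim \<tau> (at 0) sequentially"
      using \<tau>0 \<tau> by (auto simp: filterlim_at intro!: always_eventually less_imp_neq[symmetric])
    ultimately have "(%k. norm (F (urot (cis (0 + \<tau> k)) v z) - F (urot (cis 0) v z) - \<tau> k *\<^sub>R gen v F (urot (cis 0) v z)) / norm (\<tau> k)) \<longlonglongrightarrow> 0"
      by (rule filterlim_compose)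
    moreover have "norm (F (urot (cis (0 + \<tau> k)) v z) - F (urot (cis 0) v z) - \<tau> k *\<^sub>R gen v F (urot (cis 0) v z)) / norm (\<tau> k)
       = norm (G k z - gen v F z)" for k
    proof -
      have "G k z - gen v F z = (F (urot (cis (0 + \<tau> k)) v z) - F (urot (cis 0) v z) - \<tau> k *\<^sub>R gen v F (urot (cis 0) v z)) /\<^sub>R \<tau> k"
        unfolding G_def u0 using \<tau>[of k] by (simp add: scaleR_diff_right)
      thus ?thesis by (simp add: divide_inverse mult.commute)
    qed
    ultimately show ?thesis by (simp add: tendsto_norm_zero_iff LIM_zero_iff)
  qed
  have bound: "norm (G k z) <= B" if z: "z \<in> sphere 0 1" for k z
  proof -
    have "norm (F (urot (cis (\<tau> k)) v z) - F (urot (cis 0) v z)) <= B * norm (\<tau> k - 0)"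
    proof (rule differentiable_bound[of UNIV])
      show "((%t. F (urot (cis t) v z)) has_derivative (%h. h *\<^sub>R gen v F (urot (cis t) v z))) (at t within UNIV)" for t
        using urot_path_derivative[OF F v] by simp
      show "onorm (%h. h *\<^sub>R gen v F (urot (cis t) v z)) <= B" for t :: real
      proof (rule onorm_bound)
        have "norm (gen v F (urot (cis t) v z)) <= B"
          using z v by (intro B) (simp add: norm_urot)
        thus "norm (h *\<^sub>R gen v F (urot (cis t) v z)) <= B * norm h" for h
          using mult_right_mono[OF _ abs_ge_zero[of h], of "norm (gen v F (urot (cis t) v z))" B] by (simp add: mult.commute)
        show "0 <= B" using \<open>norm (gen v F (urot (cis t) v z)) <= B\<close> norm_ge_zero order_trans by blast
      qed
    qed auto
    thus ?thesis using \<tau>[of k] unfolding G_def u0 norm_scaleR by (simp add: field_simps)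
  qed
  have Gi: "(\<integral>z. G k z \<partial>\<mu>) = 0" for k
  proof -
    have "(\<integral>z. F (urot (cis (\<tau> k)) v z) \<partial>\<mu>) = (\<integral>z. F z \<partial>\<mu>)"
      by (rule integral_sphere_isometry) (use v in \<open>auto intro!: urot_orthogonal sphere_measurable bihom_continuous[OF F]\<close>)
    thus ?thesis unfolding G_def using F bihom_urot[OF F, of "cis (\<tau> k)" v] by simp
  qed
  have "(%k. \<integral>z. G k z \<partial>\<mu>) \<longlonglongrightarrow> (\<integral>z. gen v F z \<partial>\<mu>)"
  proof (rule integral_dominated_convergence[where w="%_. B"])
    show "gen v F \<in> borel_measurable \<mu>" by (intro sphere_measurable continuous_on_gen[OF F])
    show "G k \<in> borel_measurable \<mu>" for k
      unfolding G_def by (intro sphere_measurable continuous_intros bihom_continuous[OF F] bihom_continuous[OF bihom_urot[OF F]])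
  qed (use lim bound in \<open>auto intro!: AE_I2\<close>)
  thus ?thesis unfolding Gi by (simp add: LIMSEQ_const_iff)
qed

text \<open>Polarise the previous identity in \<open>v\<close>: the generators \<open>v v*\<close> of rank one span all matrices over the complex numbers.\<close>

lemma integral_infinitesimal_unitary:
  assumes F: "F \<in> bihom_polys m n"
  shows "(\<integral>z. z $ j * wirtinger k F z - cnj (z $ k) * wirtinger_cnj j F z \<partial>\<mu>) = 0"
proof -
  define a where "a j k = (\<integral>z. z $ j * wirtinger k F z - cnj (z $ k) * wirtinger_cnj j F z \<partial>\<mu>)" for j k
  have int: "integrable \<mu> (%z. z $ j * wirtinger k F z - cnj (z $ k) * wirtinger_cnj j F z)" for j k
    by (intro sphere_integrable continuous_intros bihom_continuous[OF bihom_wirtinger[OF F]] bihom_continuous[OF bihom_wirtinger_cnj[OF F]])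
  have gen_eq: "gen v F z = \<i> * (\<Sum>j\<in>UNIV. \<Sum>k\<in>UNIV. cnj (v $ j) * v $ k *
      (z $ j * wirtinger k F z - cnj (z $ k) * wirtinger_cnj j F z))" for v z
  proof -
    have "gen v F z = (\<Sum>k\<in>UNIV. \<Sum>j\<in>UNIV. \<i> * (cnj (v $ j) * v $ k * (z $ j * wirtinger k F z)))
         - (\<Sum>k\<in>UNIV. \<Sum>j\<in>UNIV. \<i> * (cnj (v $ k) * v $ j * (cnj (z $ j) * wirtinger_cnj k F z)))"
      unfolding gen_def herm_def
      by (simp add: sum.distrib sum_distrib_left sum_distrib_right sum_negf sum_subtractf mult_ac)
    also have "(\<Sum>k\<in>UNIV. \<Sum>j\<in>UNIV. \<i> * (cnj (v $ j) * v $ k * (z $ j * wirtinger k F z)))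
       = (\<Sum>j\<in>UNIV. \<Sum>k\<in>UNIV. \<i> * (cnj (v $ j) * v $ k * (z $ j * wirtinger k F z)))" by (rule sum.swap)
    finally show ?thesis by (simp add: sum_distrib_left sum_subtractf algebra_simps)
  qed
  have zero: "(\<Sum>j\<in>UNIV. \<Sum>k\<in>UNIV. cnj (v $ j) * v $ k * a j k) = 0" if "herm v v = 1" for v
  proof -
    have "(\<integral>z. gen v F z \<partial>\<mu>) = \<i> * (\<Sum>j\<in>UNIV. \<Sum>k\<in>UNIV. cnj (v $ j) * v $ k * a j k)"
      unfolding gen_eq a_def using int by simp
    thus ?thesis using integral_gen_eq_0[OF F that] by simp
  qed
  have two: "(\<Sum>i\<in>UNIV. (if i = j then s else if i = k then t else 0) * X i) = s * X j + t * X k"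
    if "j ~= k" for s t :: complex and j k :: 'a and X
  proof -
    have "(\<Sum>i\<in>UNIV. (if i = j then s else if i = k then t else 0) * X i)
       = (\<Sum>i\<in>UNIV. (if i = j then s * X j else 0) + (if i = k then t * X k else 0))"
      using that by (intro sum.cong) auto
    thus ?thesis by (simp add: sum.distrib)
  qed
  have diag: "a j j = 0" for j
  proof -
    have "(\<Sum>i\<in>UNIV. \<Sum>k\<in>UNIV. cnj ((axis j 1 :: complex^'a) $ i) * (axis j 1 :: complex^'a) $ k * a i k) = a j j"
      by (simp add: axis_def if_distrib[of cnj] if_distrib[of "%x. x * _"] if_distrib[of "%x. _ * x"] cong: if_cong)
    moreover have "herm (axis j 1) (axis j 1) = (1::complex)" by (simp add: herm_self)
    ultimately show ?thesis using zero[of "axis j 1"] by simp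
  qed
  have off: "c * a j k + cnj c * a k j = 0" if jk: "j ~= k" and c: "cmod c = 1" for j k c
  proof -
    define s where "s = complex_of_real (1 / sqrt 2)"
    have ss: "cnj s = s" "s * s = 1 / 2" by (auto simp: s_def of_real_mult[symmetric] simp del: of_real_mult)
    define v :: "complex^'a" where "v = (\<chi> i. if i = j then s else if i = k then s * c else 0)"
    have cc: "c * cnj c = 1" using c by (simp add: complex_norm_square[symmetric])
    have vi: "v $ i = (if i = j then s else if i = k then s * c else 0)" for i by (simp add: v_def)
    have cvi: "cnj (v $ i) = (if i = j then s else if i = k then s * cnj c else 0)" for i by (simp add: v_def ss)
    have "herm v v = (\<Sum>i\<in>UNIV. (if i = j then s else if i = k then s * c else 0) * cnj (v $ i))"
      by (simp add: herm_def vi)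
    also have "... = s * s + s * s * (c * cnj c)" unfolding two[OF jk] cvi using jk by (simp add: mult_ac)
    finally have "herm v v = 1" using cc by (simp add: ss)
    from zero[OF this] have "(\<Sum>i\<in>UNIV. cnj (v $ i) * (\<Sum>l\<in>UNIV. v $ l * a i l)) = 0"
      by (simp add: sum_distrib_left mult_ac)
    hence "(\<Sum>i\<in>UNIV. (if i = j then s else if i = k then s * cnj c else 0) * (\<Sum>l\<in>UNIV. v $ l * a i l)) = 0"
      by (simp only: cvi)
    hence "s * (s * a j j + s * c * a j k) + s * cnj c * (s * a k j + s * c * a k k) = 0"
      unfolding vi two[OF jk] .
    hence "(s * s) * (c * a j k + cnj c * a k j) = 0" unfolding diag by (simp add: algebra_simps)
    thus ?thesis using ss by simp
  qed
  show ?thesis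
  proof (cases "j = k")
    case False
    from off[OF False, of 1] off[OF False, of \<i>] have "a j k = 0"
      by (auto simp: eq_neg_iff_add_eq_0[symmetric])
    thus ?thesis by (simp add: a_def)
  qed (use diag in \<open>simp add: a_def\<close>)
qed

lemma wirtinger_coord:
  "wirtinger k (%z. z $ j) z = (if k = j then 1 else 0)" "wirtinger_cnj k (%z. z $ j) z = 0"
  "wirtinger k (%z. cnj (z $ j)) z = 0" "wirtinger_cnj k (%z. cnj (z $ j)) z = (if k = j then 1 else 0)"
proof -
  have d: "((%z::complex^'a. z $ j) has_derivative (%h. h $ j)) (at z)" for z
    by (rule bounded_linear_imp_has_derivative[OF bounded_linear_vec_nth])
  show 1: "wirtinger k (%z. z $ j) z = (if k = j then 1 else 0)" "wirtinger_cnj k (%z. z $ j) z = 0"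
    unfolding wirtinger_eqI[OF d] wirtinger_cnj_eqI[OF d] by (auto simp: axis_def)
  show "wirtinger k (%z. cnj (z $ j)) z = 0" "wirtinger_cnj k (%z. cnj (z $ j)) z = (if k = j then 1 else 0)"
    using wirtinger_of_cnj[OF bihom_differentiable[OF bihom_coord], of k j z] 1 by auto
qed

text \<open>This replaces integration by parts on the sphere. Apply the infinitesimal invariance to
  \<open>cnj (z $ j) * H\<close> and sum over \<open>j\<close>; on the sphere \<open>\<Sum>\<bar>z $ j\<bar>^2 = 1\<close>, and Euler's identity turns
  \<open>\<Sum>cnj (z $ j) * wirtinger_cnj j H\<close> into \<open>n * H\<close>.\<close>

lemma integral_wirtinger:
  assumes H: "H \<in> (bihom_polys m n :: 'd::finite fn set)"
  shows "(\<integral>z. wirtinger k H z \<partial>\<mu>) = of_nat (CARD('d) + n) * (\<integral>z. cnj (z $ k) * H z \<partial>\<mu>)"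
proof -
  have Hd: "H differentiable (at z)" for z by (rule bihom_differentiable[OF H])
  have cd: "(%z::complex^'d. cnj (z $ j)) differentiable (at z)" for z j
    by (rule bihom_differentiable[OF bihom_coord_cnj])
  have z: "(\<integral>z. z $ j * cnj (z $ j) * wirtinger k H z - cnj (z $ k) * (H z + cnj (z $ j) * wirtinger_cnj j H z) \<partial>\<mu>) = 0" for j
    using integral_infinitesimal_unitary[OF bihom_mult_coord_cnj[OF H, of j], of j k]
    unfolding wirtinger_mult[OF cd Hd] wirtinger_coord by (simp add: mult_ac)
  have int: "integrable \<mu> (%z. z $ j * cnj (z $ j) * wirtinger k H z - cnj (z $ k) * (H z + cnj (z $ j) * wirtinger_cnj j H z))" for j
    by (intro sphere_integrable continuous_intros bihom_continuous[OF H] bihom_continuous[OF bihom_wirtinger[OF H]] bihom_continuous[OF bihom_wirtinger_cnj[OF H]])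
  have "0 = (\<Sum>j\<in>UNIV. (\<integral>z. z $ j * cnj (z $ j) * wirtinger k H z - cnj (z $ k) * (H z + cnj (z $ j) * wirtinger_cnj j H z) \<partial>\<mu>))"
    unfolding z by simp
  also have "... = (\<integral>z. (\<Sum>j\<in>UNIV. z $ j * cnj (z $ j) * wirtinger k H z - cnj (z $ k) * (H z + cnj (z $ j) * wirtinger_cnj j H z)) \<partial>\<mu>)"
    by (rule Bochner_Integration.integral_sum[symmetric]) (rule int)
  also have "... = (\<integral>z. wirtinger k H z - of_nat (CARD('d) + n) * (cnj (z $ k) * H z) \<partial>\<mu>)"
  proof (rule Bochner_Integration.integral_cong[OF refl])
    fix z :: "complex ^ 'd" assume "z \<in> space \<mu>"
    hence "herm z z = 1" by (simp add: herm_self)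
    hence s1: "(\<Sum>j\<in>UNIV. z $ j * cnj (z $ j)) = 1" by (simp add: herm_def)
    have "(\<Sum>j\<in>UNIV. z $ j * cnj (z $ j) * wirtinger k H z - cnj (z $ k) * (H z + cnj (z $ j) * wirtinger_cnj j H z))
       = (\<Sum>j\<in>UNIV. z $ j * cnj (z $ j)) * wirtinger k H z - cnj (z $ k) * (of_nat CARD('d) * H z + (\<Sum>j\<in>UNIV. cnj (z $ j) * wirtinger_cnj j H z))"
      by (simp add: sum_subtractf sum_distrib_right sum.distrib sum_distrib_left algebra_simps)
    thus "(\<Sum>j\<in>UNIV. z $ j * cnj (z $ j) * wirtinger k H z - cnj (z $ k) * (H z + cnj (z $ j) * wirtinger_cnj j H z))
       = wirtinger k H z - of_nat (CARD('d) + n) * (cnj (z $ k) * H z)"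
      unfolding s1 euler_wirtinger_cnj[OF H] by (simp add: algebra_simps)
  qed
  also have "... = (\<integral>z. wirtinger k H z \<partial>\<mu>) - of_nat (CARD('d) + n) * (\<integral>z. cnj (z $ k) * H z \<partial>\<mu>)"
    by (subst Bochner_Integration.integral_diff) (auto intro!: bihom_integrable[OF bihom_wirtinger[OF H]] integrable_mult_right bihom_integrable[OF bihom_mult_coord_cnj[OF H]])
  finally show ?thesis by simp
qed

lemma integral_wirtinger_cnj:
  assumes H: "H \<in> (bihom_polys m n :: 'd::finite fn set)"
  shows "(\<integral>z. wirtinger_cnj k H z \<partial>\<mu>) = of_nat (CARD('d) + m) * (\<integral>z. z $ k * H z \<partial>\<mu>)"
proof -
  have "cnj (\<integral>z. wirtinger k (%z. cnj (H z)) z \<partial>\<mu>)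
     = cnj (of_nat (CARD('d) + m) * (\<integral>z. cnj (z $ k) * cnj (H z) \<partial>\<mu>))"
    using integral_wirtinger[OF bihom_cnj[OF H]] by simp
  thus ?thesis
    by (simp add: wirtinger_of_cnj[OF bihom_differentiable[OF H]] Bochner_Integration.integral_cnj[symmetric]
        flip: Bochner_Integration.integral_cnj)
qed

section \<open>The Laplacian and orthogonality\<close>

text \<open>The Laplacian without the factor 4.\<close>

definition lap :: "('d::finite fn) => 'd fn" where
  "lap f z = (\<Sum>j\<in>UNIV. wirtinger j (wirtinger_cnj j f) z)"

lemma complex_laplacian_eq: "complex_laplacian f z = 4 * lap f z"
  by (simp add: complex_laplacian_def lap_def)

lemma bihom_lap: "f \<in> bihom_polys m n ==> lap f \<in> bihom_polys (m - 1) (n - 1)"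
  unfolding lap_def[abs_def] by (intro bihom_sum bihom_wirtinger bihom_wirtinger_cnj)

lemma lap_degree_0:
  "f \<in> bihom_polys 0 n ==> lap f z = 0" "f \<in> bihom_polys m 0 ==> lap f z = 0"
proof -
  assume f: "f \<in> bihom_polys 0 n"
  show "lap f z = 0" unfolding lap_def
    by (intro sum.neutral ballI wirtinger_degree_0[OF bihom_wirtinger_cnj[OF f]])
next
  assume f: "f \<in> bihom_polys m 0"
  have "wirtinger_cnj j f = (%_. 0)" for j using wirtinger_cnj_degree_0[OF f] by (simp add: fun_eq_iff)
  thus "lap f z = 0" unfolding lap_def by simp
qed

lemma wirtinger_of_sum:
  assumes "!!i. i \<in> I ==> f i \<in> bihom_polys m n"
  shows "wirtinger k (%z. \<Sum>i\<in>I. f i z) z = (\<Sum>i\<in>I. wirtinger k (f i) z)"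
    "wirtinger_cnj k (%z. \<Sum>i\<in>I. f i z) z = (\<Sum>i\<in>I. wirtinger_cnj k (f i) z)"
proof -
  have "wirtinger k (%z. \<Sum>i\<in>I. f i z) z = (\<Sum>i\<in>I. wirtinger k (f i) z) \<and>
    wirtinger_cnj k (%z. \<Sum>i\<in>I. f i z) z = (\<Sum>i\<in>I. wirtinger_cnj k (f i) z)"
    using assms
  proof (induction I rule: infinite_finite_induct)
    case (insert x F)
    have "(%z. \<Sum>i\<in>F. f i z) \<in> bihom_polys m n" using insert by (intro bihom_sum) auto
    hence d: "f x differentiable (at z)" "(%z. \<Sum>i\<in>F. f i z) differentiable (at z)"
      using insert by (auto intro: bihom_differentiable)
    show ?case using insert by (simp add: wirtinger_add[OF d])
  qed auto
  thus "wirtinger k (%z. \<Sum>i\<in>I. f i z) z = (\<Sum>i\<in>I. wirtinger k (f i) z)"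
    "wirtinger_cnj k (%z. \<Sum>i\<in>I. f i z) z = (\<Sum>i\<in>I. wirtinger_cnj k (f i) z)" by auto
qed

lemma harmonic_wirtinger:
  assumes f: "f \<in> bihom_polys m n" and h: "!!z. lap f z = 0"
  shows "lap (wirtinger k f) z = 0"
proof -
  have "lap (wirtinger k f) z = (\<Sum>j\<in>UNIV. wirtinger k (wirtinger j (wirtinger_cnj j f)) z)"
    unfolding lap_def
    by (intro sum.cong refl) (simp only: wirtinger_commute(1)[OF f, symmetric] wirtinger_commute(2)[OF bihom_wirtinger_cnj[OF f]])
  also have "... = wirtinger k (lap f) z"
    unfolding lap_def[abs_def]
    by (rule wirtinger_of_sum(1)[symmetric, where m="m - 1" and n="n - 1"]) (intro bihom_wirtinger bihom_wirtinger_cnj f)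
  also have "lap f = (%z. 0)" using h by (simp add: fun_eq_iff)
  finally show ?thesis by simp
qed

lemma lap_cnj:
  assumes f: "f \<in> bihom_polys m n"
  shows "lap (%z. cnj (f z)) z = cnj (lap f z)"
proof -
  have "wirtinger_cnj j (%z. cnj (f z)) = (%z. cnj (wirtinger j f z))" for j
    using wirtinger_of_cnj(2)[OF bihom_differentiable[OF f]] by (simp add: fun_eq_iff)
  thus ?thesis unfolding lap_def
    by (simp add: wirtinger_of_cnj[OF bihom_differentiable[OF bihom_wirtinger[OF f]]] wirtinger_commute(1)[OF f])
qed

text \<open>By Euler's identity and \<open>integral_wirtinger_cnj\<close> one derivative moves from \<open>f\<close> to \<open>g\<close>, as
  \<open>lap f\<close> vanishes; the induction
  runs through the derivatives of \<open>f\<close>, which are harmonic of lower degree.\<close>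

lemma integral_harmonic_times_lower:
  fixes f g :: "'d::finite fn"
  assumes "f \<in> bihom_polys m n" "!!z. lap f z = 0" "g \<in> bihom_polys a b" "b < m"
  shows "(\<integral>z. f z * g z \<partial>\<mu>) = 0"
  using assms
proof (induction m arbitrary: f g b)
  case (Suc m)
  note f = Suc.prems(1) and g = Suc.prems(3)
  have df: "wirtinger k f \<in> bihom_polys m n" for k using bihom_wirtinger[OF f] by simp
  have H: "(%z. wirtinger k f z * g z) \<in> bihom_polys (m + a) (n + b)" for k
    by (rule bihom_mult[OF df g])
  let ?N = "of_nat (CARD('d) + (m + a)) :: complex"
  have zero: "(\<integral>z. wirtinger k f z * wirtinger_cnj k g z \<partial>\<mu>) = 0" for k
  proof (cases "b = 0")
    case True
    have "wirtinger_cnj k g z = 0" for z using wirtinger_cnj_degree_0 g True by blast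
    thus ?thesis by simp
  next
    case False
    show ?thesis
      by (rule Suc.IH[OF df harmonic_wirtinger[OF f Suc.prems(2)] bihom_wirtinger_cnj[OF g]])
         (use False Suc.prems(4) in simp)
  qed
  have Hd: "wirtinger_cnj k (%z. wirtinger k f z * g z) z =
      wirtinger k (wirtinger_cnj k f) z * g z + wirtinger k f z * wirtinger_cnj k g z" for k z
    by (simp add: wirtinger_mult[OF bihom_differentiable[OF df] bihom_differentiable[OF g]] wirtinger_commute(1)[OF f])
  have int1: "integrable \<mu> (%z. wirtinger k (wirtinger_cnj k f) z * g z)" for k
    by (rule bihom_integrable[OF bihom_mult[OF bihom_wirtinger[OF bihom_wirtinger_cnj[OF f]] g]])
  have int2: "integrable \<mu> (%z. wirtinger k f z * wirtinger_cnj k g z)" for k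
    by (rule bihom_integrable[OF bihom_mult[OF df bihom_wirtinger_cnj[OF g]]])
  have int3: "integrable \<mu> (%z. z $ k * (wirtinger k f z * g z))" for k
    by (rule bihom_integrable[OF bihom_mult_coord[OF H]])
  have "?N * (of_nat (Suc m) * (\<integral>z. f z * g z \<partial>\<mu>))
     = ?N * (\<integral>z. (\<Sum>k\<in>UNIV. z $ k * (wirtinger k f z * g z)) \<partial>\<mu>)"
  proof -
    have "(\<Sum>k\<in>UNIV. z $ k * (wirtinger k f z * g z)) = of_nat (Suc m) * (f z * g z)" for z
      using euler_wirtinger[OF f, of z] by (simp add: sum_distrib_right[symmetric] mult.assoc[symmetric] del: of_nat_Suc)
    thus ?thesis by simp
  qed
  also have "... = (\<Sum>k\<in>UNIV. ?N * (\<integral>z. z $ k * (wirtinger k f z * g z) \<partial>\<mu>))"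
    using int3 by (subst Bochner_Integration.integral_sum) (auto simp: sum_distrib_left)
  also have "... = (\<Sum>k\<in>UNIV. (\<integral>z. wirtinger_cnj k (%z. wirtinger k f z * g z) z \<partial>\<mu>))"
    unfolding integral_wirtinger_cnj[OF H] ..
  also have "... = (\<Sum>k\<in>UNIV. (\<integral>z. wirtinger k (wirtinger_cnj k f) z * g z \<partial>\<mu>))"
    unfolding Hd using int1 int2 zero by simp
  also have "... = (\<integral>z. (\<Sum>k\<in>UNIV. wirtinger k (wirtinger_cnj k f) z * g z) \<partial>\<mu>)"
    using int1 by (subst Bochner_Integration.integral_sum) auto
  also have "... = (\<integral>z. lap f z * g z \<partial>\<mu>)" by (simp add: lap_def sum_distrib_right)
  also have "... = 0" using Suc.prems(2) by simp
  finally have "?N * (of_nat (Suc m) * (\<integral>z. f z * g z \<partial>\<mu>)) = 0" .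
  moreover have "?N ~= 0" by (simp only: of_nat_eq_0_iff) simp
  ultimately show ?case by (simp del: of_nat_Suc)
qed simp

lemma integral_harmonic_times_other:
  fixes f g :: "'d::finite fn"
  assumes f: "f \<in> bihom_polys m n" "!!z. lap f z = 0" and g: "g \<in> bihom_polys a b" and "b < m \<or> a < n"
  shows "(\<integral>z. f z * g z \<partial>\<mu>) = 0"
proof (cases "b < m")
  case True
  thus ?thesis using integral_harmonic_times_lower f g by blast
next
  case False
  hence "a < n" using assms by simp
  hence "(\<integral>z. cnj (f z) * cnj (g z) \<partial>\<mu>) = 0"
    by (intro integral_harmonic_times_lower[OF bihom_cnj[OF f(1)] _ bihom_cnj[OF g]]) (simp_all add: lap_cnj[OF f(1)] f(2))
  hence "cnj (\<integral>z. cnj (f z * g z) \<partial>\<mu>) = 0" by simp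
  thus ?thesis by (subst (asm) Bochner_Integration.integral_cnj) simp
qed

lemma sphere_norm_sq: "z \<in> sphere 0 1 ==> (\<Sum>j\<in>UNIV. z $ j * cnj (z $ j)) = (1::complex)"
  using herm_self[of z] by (simp add: herm_def)

lemma bihom_mult_norm_sq:
  "f \<in> bihom_polys m n ==> (%z. (\<Sum>j\<in>UNIV. z $ j * cnj (z $ j)) * f z) \<in> bihom_polys (Suc m) (Suc n)"
proof -
  assume f: "f \<in> bihom_polys m n"
  have "(%z. \<Sum>j\<in>UNIV. z $ j * (cnj (z $ j) * f z)) \<in> bihom_polys (Suc m) (Suc n)"
    by (intro bihom_sum bihom_mult_coord bihom_mult_coord_cnj f)
  thus ?thesis by (simp add: sum_distrib_right mult.assoc)
qed

lemma bihom_zero_on_sphere: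
  assumes f: "f \<in> bihom_polys m n" and z: "!!z. z \<in> sphere 0 1 ==> f z = 0" and nz: "z ~= 0"
  shows "f z = 0"
proof -
  have "f z = f (norm z *\<^sub>R (z /\<^sub>R norm z))" using nz by simp
  also have "... = 0" using z[of "z /\<^sub>R norm z"] nz by (subst bihom_homogeneous[OF f]) simp
  finally show ?thesis .
qed

text \<open>Moving both derivatives of \<open>lap P\<close> to \<open>g\<close> shows that \<open>lap P\<close> is orthogonal to all polynomials
  of its own bidegree, hence to itself.\<close>

lemma harmonic_if_orthogonal_to_lower:
  fixes P :: "'d::finite fn"
  assumes P: "P \<in> bihom_polys (Suc m) (Suc n)"
    and orth: "!!g. g \<in> bihom_polys n m ==> (\<integral>z. P z * g z \<partial>\<mu>) = 0"
  shows "lap P z = 0"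
proof -
  have LP: "lap P \<in> bihom_polys m n" using bihom_lap[OF P] by simp
  have key: "(\<integral>z. lap P z * g z \<partial>\<mu>) = 0" if g: "g \<in> bihom_polys n m" for g
  proof -
    have dP: "wirtinger_cnj k P \<in> bihom_polys (Suc m) n" for k using bihom_wirtinger_cnj[OF P] by simp
    have ddP: "wirtinger k (wirtinger_cnj k P) \<in> bihom_polys m n" for k using bihom_wirtinger[OF dP] by simp
    have H1: "(%z. wirtinger_cnj k P z * g z) \<in> bihom_polys (Suc m + n) (n + m)" for k by (rule bihom_mult[OF dP g])
    have dg: "wirtinger k g \<in> bihom_polys (n - 1) m" for k by (rule bihom_wirtinger[OF g])
    have H2: "(%z. P z * wirtinger k g z) \<in> bihom_polys (Suc m + (n - 1)) (Suc n + m)" for k by (rule bihom_mult[OF P dg])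
    have ddg: "wirtinger_cnj k (wirtinger k g) \<in> bihom_polys (n - 1) (m - 1)" for k by (rule bihom_wirtinger_cnj[OF dg])
    have intA: "integrable \<mu> (%z. wirtinger k (wirtinger_cnj k P) z * g z)" for k
      by (rule bihom_integrable[OF bihom_mult[OF ddP g]])
    have intB: "integrable \<mu> (%z. wirtinger_cnj k P z * wirtinger k g z)" for k
      by (rule bihom_integrable[OF bihom_mult[OF dP dg]])
    have intC: "integrable \<mu> (%z. P z * wirtinger_cnj k (wirtinger k g) z)" for k
      by (rule bihom_integrable[OF bihom_mult[OF P ddg]])
    have 1: "(\<Sum>k\<in>UNIV. (\<integral>z. wirtinger k (%z. wirtinger_cnj k P z * g z) z \<partial>\<mu>)) = 0"
    proof -
      have "(\<Sum>k\<in>UNIV. (\<integral>z. cnj (z $ k) * (wirtinger_cnj k P z * g z) \<partial>\<mu>))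
         = (\<integral>z. (\<Sum>k\<in>UNIV. cnj (z $ k) * (wirtinger_cnj k P z * g z)) \<partial>\<mu>)"
        by (rule Bochner_Integration.integral_sum[symmetric]) (rule bihom_integrable[OF bihom_mult_coord_cnj[OF H1]])
      also have "... = (\<integral>z. of_nat (Suc n) * (P z * g z) \<partial>\<mu>)"
        using euler_wirtinger_cnj[OF P] by (simp add: sum_distrib_right[symmetric] mult.assoc[symmetric] del: of_nat_Suc)
      also have "... = 0" using orth[OF g] by simp
      finally show ?thesis unfolding integral_wirtinger[OF H1] sum_distrib_left[symmetric] by simp
    qed
    have 2: "(\<Sum>k\<in>UNIV. (\<integral>z. wirtinger_cnj k (%z. P z * wirtinger k g z) z \<partial>\<mu>)) = 0"
    proof -
      have "(\<Sum>k\<in>UNIV. (\<integral>z. z $ k * (P z * wirtinger k g z) \<partial>\<mu>))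
         = (\<integral>z. (\<Sum>k\<in>UNIV. z $ k * (P z * wirtinger k g z)) \<partial>\<mu>)"
        by (rule Bochner_Integration.integral_sum[symmetric]) (rule bihom_integrable[OF bihom_mult_coord[OF H2]])
      also have "... = (\<integral>z. of_nat n * (P z * g z) \<partial>\<mu>)"
      proof -
        have "(\<Sum>k\<in>UNIV. z $ k * (P z * wirtinger k g z)) = P z * (\<Sum>k\<in>UNIV. z $ k * wirtinger k g z)" for z
          by (simp add: sum_distrib_left mult_ac)
        thus ?thesis unfolding euler_wirtinger[OF g] by (simp add: mult_ac)
      qed
      also have "... = 0" using orth[OF g] by simp
      finally show ?thesis unfolding integral_wirtinger_cnj[OF H2] sum_distrib_left[symmetric] by simp
    qed
    have 3: "(\<Sum>k\<in>UNIV. (\<integral>z. P z * wirtinger_cnj k (wirtinger k g) z \<partial>\<mu>)) = 0"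
    proof -
      have "(\<Sum>k\<in>UNIV. (\<integral>z. P z * wirtinger_cnj k (wirtinger k g) z \<partial>\<mu>))
         = (\<integral>z. (\<Sum>k\<in>UNIV. P z * wirtinger_cnj k (wirtinger k g) z) \<partial>\<mu>)"
        by (rule Bochner_Integration.integral_sum[symmetric]) (rule intC)
      also have "... = (\<integral>z. P z * lap g z \<partial>\<mu>)"
        unfolding lap_def by (simp add: sum_distrib_left wirtinger_commute(1)[OF g])
      also have "... = 0"
      proof (cases "n = 0 \<or> m = 0")
        case True
        hence "lap g z = 0" for z using lap_degree_0 g by auto
        thus ?thesis by simp
      next
        case False
        have "(%z. (\<Sum>j\<in>UNIV. z $ j * cnj (z $ j)) * lap g z) \<in> bihom_polys n m"
          using bihom_mult_norm_sq[OF bihom_lap[OF g]] False by simp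
        from orth[OF this] have "(\<integral>z. P z * ((\<Sum>j\<in>UNIV. z $ j * cnj (z $ j)) * lap g z) \<partial>\<mu>) = 0" .
        moreover have "(\<integral>z. P z * ((\<Sum>j\<in>UNIV. z $ j * cnj (z $ j)) * lap g z) \<partial>\<mu>) = (\<integral>z. P z * lap g z \<partial>\<mu>)"
        proof (rule Bochner_Integration.integral_cong[OF refl])
          fix z :: "complex ^ 'd" assume "z \<in> space \<mu>"
          hence zs: "z \<in> sphere 0 1" by simp
          thus "P z * ((\<Sum>j\<in>UNIV. z $ j * cnj (z $ j)) * lap g z) = P z * lap g z"
            unfolding sphere_norm_sq[OF zs] by simp
        qed
        ultimately show ?thesis by simp
      qed
      finally show ?thesis .
    qed
    have e1: "(\<integral>z. wirtinger k (%z. wirtinger_cnj k P z * g z) z \<partial>\<mu>)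
       = (\<integral>z. wirtinger k (wirtinger_cnj k P) z * g z \<partial>\<mu>) + (\<integral>z. wirtinger_cnj k P z * wirtinger k g z \<partial>\<mu>)" for k
      using intA intB by (simp add: wirtinger_mult[OF bihom_differentiable[OF dP] bihom_differentiable[OF g]])
    have e2: "(\<integral>z. wirtinger_cnj k (%z. P z * wirtinger k g z) z \<partial>\<mu>)
       = (\<integral>z. wirtinger_cnj k P z * wirtinger k g z \<partial>\<mu>) + (\<integral>z. P z * wirtinger_cnj k (wirtinger k g) z \<partial>\<mu>)" for k
      using intB intC by (simp add: wirtinger_mult[OF bihom_differentiable[OF P] bihom_differentiable[OF dg]])
    have "(\<integral>z. lap P z * g z \<partial>\<mu>) = (\<Sum>k\<in>UNIV. (\<integral>z. wirtinger k (wirtinger_cnj k P) z * g z \<partial>\<mu>))"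
      unfolding lap_def sum_distrib_right by (rule Bochner_Integration.integral_sum) (rule intA)
    thus ?thesis using 1 2 3 unfolding e1 e2 sum.distrib by simp
  qed
  have "lap P w = 0" if "w \<in> sphere 0 1" for w
  proof (rule sphere_integral_zero_imp[OF bihom_continuous[OF LP] _ that])
    show "(\<integral>z. lap P z * cnj (lap P z) \<partial>\<mu>) = 0" by (rule key[OF bihom_cnj[OF LP]])
  qed
  hence nz: "lap P z = 0" if "z ~= 0" for z using bihom_zero_on_sphere[OF LP _ that] by blast
  have "lap P 0 = 0"
  proof -
    have "isCont (lap P) 0" using bihom_continuous[OF LP, of UNIV] by (simp add: continuous_on_eq_continuous_at)
    hence "(lap P \<longlongrightarrow> lap P 0) (at 0)" by (simp add: isCont_def)
    moreover have "(lap P \<longlongrightarrow> 0) (at 0)"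
      by (rule Lim_transform_eventually[OF tendsto_const]) (auto simp: eventually_at_filter nz)
    ultimately show ?thesis by (metis LIM_unique)
  qed
  thus ?thesis using nz by (cases "z = 0") auto
qed

section \<open>Finite orthonormal systems of functions on the sphere\<close>

text \<open>The value \<open>0\<close> off the sphere agrees with \<open>sphere_restrict\<close>, so that equality on the sphere is
  equality of functions.\<close>

definition sphere_fun :: "('a::euclidean_space => complex) => bool" where
  "sphere_fun f \<longleftrightarrow> continuous_on (sphere 0 1) f \<and> (\<forall>z. z \<notin> sphere 0 1 --> f z = 0)"

definition ip :: "('a::euclidean_space => complex) => ('a => complex) => complex" where
  "ip f g = (\<integral>z. f z * cnj (g z) \<partial>\<mu>)"

lemma sphere_fun_continuous: "sphere_fun f ==> continuous_on (sphere 0 1) f"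
  by (simp add: sphere_fun_def)

lemma sphere_fun_zero: "sphere_fun (%z. 0)"
  and sphere_fun_add: "sphere_fun f ==> sphere_fun g ==> sphere_fun (%z. f z + g z)"
  and sphere_fun_diff: "sphere_fun f ==> sphere_fun g ==> sphere_fun (%z. f z - g z)"
  and sphere_fun_scale: "sphere_fun f ==> sphere_fun (%z. c * f z)"
  and sphere_fun_sum: "(!!i. i \<in> I ==> sphere_fun (F i)) ==> sphere_fun (%z. \<Sum>i\<in>I. F i z)"
  by (auto simp: sphere_fun_def intro!: continuous_intros)

lemma sphere_fun_span: "G \<subseteq> Collect sphere_fun ==> f \<in> cfun.span G ==> sphere_fun f"
proof -
  assume G: "G \<subseteq> Collect sphere_fun" and f: "f \<in> cfun.span G"
  from f show "sphere_fun f"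
  proof (induction rule: cfun.span_induct_alt)
    case base then show ?case using sphere_fun_zero by (simp add: zero_fun_def)
  next
    case (step c x y)
    then show ?case using G sphere_fun_add[OF sphere_fun_scale[of x c], of y] by (auto simp: plus_fun_def)
  qed
qed

lemma ip_integrable:
  "sphere_fun f ==> sphere_fun g ==> integrable \<mu> (%z. f z * cnj (g z))"
  by (intro sphere_integrable continuous_intros sphere_fun_continuous)

lemma ip_add_left: "sphere_fun f ==> sphere_fun g ==> sphere_fun h ==> ip (%z. f z + g z) h = ip f h + ip g h"
  using ip_integrable[of f h] ip_integrable[of g h] by (simp add: ip_def algebra_simps)

lemma ip_diff_left: "sphere_fun f ==> sphere_fun g ==> sphere_fun h ==> ip (%z. f z - g z) h = ip f h - ip g h"
  using ip_integrable[of f h] ip_integrable[of g h] by (simp add: ip_def algebra_simps)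

lemma ip_scale_left: "ip (%z. c * f z) h = c * ip f h"
  by (simp add: ip_def mult.assoc)

lemma ip_zero_left [simp]: "ip (%z. 0) h = 0"
  by (simp add: ip_def)

lemma ip_sum_left:
  "(!!i. i \<in> I ==> sphere_fun (F i)) ==> sphere_fun h ==> ip (%z. \<Sum>i\<in>I. F i z) h = (\<Sum>i\<in>I. ip (F i) h)"
  by (induction I rule: infinite_finite_induct) (auto simp: ip_add_left sphere_fun_sum)

lemma ip_commute: "ip g f = cnj (ip f g)"
proof -
  have "cnj (ip f g) = (\<integral>z. cnj (f z * cnj (g z)) \<partial>\<mu>)"
    unfolding ip_def by (rule Bochner_Integration.integral_cnj[symmetric])
  thus ?thesis by (simp add: ip_def mult.commute)
qed

lemma ip_scale_right: "ip f (%z. c * g z) = cnj c * ip f g"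
  using ip_commute[of f "%z. c * g z"] ip_commute[of f g] by (simp add: ip_scale_left)

lemma ip_sum_right:
  "(!!i. i \<in> I ==> sphere_fun (F i)) ==> sphere_fun h ==> ip h (%z. \<Sum>i\<in>I. F i z) = (\<Sum>i\<in>I. ip h (F i))"
proof -
  assume F: "!!i. i \<in> I ==> sphere_fun (F i)" and h: "sphere_fun h"
  have "ip h (%z. \<Sum>i\<in>I. F i z) = cnj (\<Sum>i\<in>I. ip (F i) h)"
    by (subst ip_commute) (simp add: ip_sum_left[OF F h])
  also have "... = (\<Sum>i\<in>I. ip h (F i))" by (simp add: ip_commute[of h])
  finally show ?thesis .
qed

lemma ip_self: "ip f f = of_real (\<integral>z. (cmod (f z))\<^sup>2 \<partial>\<mu>)"
  unfolding ip_def by (simp only: complex_norm_square[symmetric] integral_complex_of_real)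

lemma ip_self_eq_0: "sphere_fun f ==> ip f f = 0 ==> f = (%z. 0)"
proof
  fix z assume f: "sphere_fun f" "ip f f = 0"
  show "f z = 0"
    using sphere_integral_zero_imp[OF sphere_fun_continuous[OF f(1)], of z] f
    by (cases "z \<in> sphere 0 1") (auto simp: ip_def sphere_fun_def)
qed

definition orthonormal :: "('a::euclidean_space => complex) set => bool" where
  "orthonormal B \<longleftrightarrow> finite B \<and> B \<subseteq> Collect sphere_fun \<and>
     (\<forall>e\<in>B. \<forall>e'\<in>B. ip e e' = (if e = e' then 1 else 0))"

lemma orthonormal_finite: "orthonormal B ==> finite B"
  and orthonormal_sphere_fun: "orthonormal B ==> e \<in> B ==> sphere_fun e"
  and orthonormal_ip: "orthonormal B ==> e \<in> B ==> e' \<in> B ==> ip e e' = (if e = e' then 1 else 0)"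
  by (auto simp: orthonormal_def)

lemma orthonormal_subset: "orthonormal B ==> A \<subseteq> B ==> orthonormal A"
  unfolding orthonormal_def by (meson finite_subset order_trans subsetD)

lemma span_sum_representation:
  assumes "finite B" "f \<in> cfun.span B"
  obtains c where "f = (%z. \<Sum>e\<in>B. c e * e z)"
proof -
  obtain u where "f = (\<Sum>v\<in>B. (%x. u v * v x))"
    using assms(2) unfolding cfun.span_finite[OF assms(1)] by blast
  moreover have "(\<Sum>v\<in>A. (%x. u v * v x)) = (%z. \<Sum>e\<in>A. u e * e z)" for A
    by (induction A rule: infinite_finite_induct) (auto simp: fun_eq_iff)
  ultimately have "f = (%z. \<Sum>e\<in>B. u e * e z)" by simp
  thus thesis by (rule that)
qed

lemma span_sumI:
  assumes "A \<subseteq> B"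
  shows "(%z. \<Sum>e\<in>A. c e * e z) \<in> cfun.span B"
proof (cases "finite A")
  case True
  have "(\<Sum>v\<in>A. (%x. c v * v x)) \<in> cfun.span B"
    by (intro cfun.span_sum cfun.span_scale cfun.span_base) (use assms in auto)
  moreover have "(\<Sum>v\<in>A. (%x. c v * v x)) = (%z. \<Sum>e\<in>A. c e * e z)" for A
    by (induction A rule: infinite_finite_induct) (auto simp: fun_eq_iff)
  ultimately show ?thesis by simp
qed (use cfun.span_zero in \<open>simp add: zero_fun_def\<close>)

lemma ip_orthonormal_sum:
  assumes B: "orthonormal B" and A: "A \<subseteq> B" and e: "e \<in> B"
  shows "ip (%z. \<Sum>e'\<in>A. c e' * e' z) e = (if e \<in> A then c e else 0)"
proof -
  have fA: "finite A" using A orthonormal_finite[OF B] finite_subset by blast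
  have "ip (%z. \<Sum>e'\<in>A. c e' * e' z) e = (\<Sum>e'\<in>A. ip (%z. c e' * e' z) e)"
    using A e B by (intro ip_sum_left sphere_fun_scale) (auto intro: orthonormal_sphere_fun)
  also have "... = (\<Sum>e'\<in>A. if e' = e then c e else 0)"
    by (intro sum.cong refl) (use A e B in \<open>auto simp: ip_scale_left orthonormal_ip subset_iff\<close>)
  finally show ?thesis using fA by simp
qed

lemma orthonormal_expansion:
  assumes B: "orthonormal B" and f: "f \<in> cfun.span B"
  shows "f = (%z. \<Sum>e\<in>B. ip f e * e z)"
proof -
  obtain c where c: "f = (%z. \<Sum>e\<in>B. c e * e z)"
    using span_sum_representation[OF orthonormal_finite[OF B] f] by blast
  have "ip f e = c e" if "e \<in> B" for e
    unfolding c using ip_orthonormal_sum[OF B subset_refl that] that by simp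
  thus ?thesis by (subst c) (auto intro!: sum.cong)
qed

lemma orthonormal_independent:
  assumes B: "orthonormal B"
  shows "cfun.independent B"
  unfolding cfun.independent_explicit_finite_subsets
proof (intro allI impI ballI)
  fix A u v assume A: "A \<subseteq> B" "finite A" "(\<Sum>v\<in>A. (%x. u v * v x)) = 0" "v \<in> A"
  have "(\<Sum>v\<in>A. (%x. u v * v x)) = (%z. \<Sum>e\<in>A. u e * e z)" for A
    by (induction A rule: infinite_finite_induct) (auto simp: fun_eq_iff)
  hence z: "(%z. \<Sum>e\<in>A. u e * e z) = (%z. 0)" using A(3) by (simp add: zero_fun_def)
  have "ip (%z. \<Sum>e\<in>A. u e * e z) v = u v" using ip_orthonormal_sum[OF B A(1)] A by auto
  thus "u v = 0" unfolding z by simp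
qed

text \<open>The set \<open>B\<close> need not have as many elements as \<open>G\<close>: dependent vectors are dropped.\<close>

lemma gram_schmidt:
  assumes "finite G" "G \<subseteq> Collect sphere_fun"
  obtains B where "orthonormal B" "cfun.span B = cfun.span G"
proof -
  have "\<exists>B. orthonormal B \<and> cfun.span B = cfun.span G"
    using assms
  proof (induction G rule: finite_induct)
    case empty
    show ?case by (rule exI[of _ "{}"]) (simp add: orthonormal_def)
  next
    case (insert g G)
    then obtain B where B: "orthonormal B" "cfun.span B = cfun.span G" by auto
    have sg: "sphere_fun g" using insert by simp
    define p where "p = (%z. \<Sum>e\<in>B. ip g e * e z)"
    define h where "h = (%z. g z - p z)"
    have sp: "sphere_fun p" unfolding p_def by (intro sphere_fun_sum sphere_fun_scale orthonormal_sphere_fun[OF B(1)])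
    have sh: "sphere_fun h" unfolding h_def by (intro sphere_fun_diff sg sp)
    have pB: "p \<in> cfun.span B" unfolding p_def by (rule span_sumI) simp
    have hB: "ip h e = 0" if "e \<in> B" for e
      unfolding h_def using ip_diff_left[OF sg sp orthonormal_sphere_fun[OF B(1) that]]
        ip_orthonormal_sum[OF B(1) subset_refl that, of "ip g"] that by (simp add: p_def)
    show ?case
    proof (cases "h = (%z. 0)")
      case True
      hence "g = p" by (simp add: h_def fun_eq_iff)
      hence "g \<in> cfun.span G" using pB B(2) by simp
      hence "cfun.span (insert g G) = cfun.span G" by (rule cfun.span_redundant)
      thus ?thesis using B by auto
    next
      case False
      define s where "s = sqrt (\<integral>z. (cmod (h z))\<^sup>2 \<partial>\<mu>)"
      have "ip h h ~= 0" using ip_self_eq_0[OF sh] False by blast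
      hence nz: "(\<integral>z. (cmod (h z))\<^sup>2 \<partial>\<mu>) ~= 0" by (simp add: ip_self)
      moreover have "(\<integral>z. (cmod (h z))\<^sup>2 \<partial>\<mu>) >= 0" by (intro Bochner_Integration.integral_nonneg) auto
      ultimately have "(\<integral>z. (cmod (h z))\<^sup>2 \<partial>\<mu>) > 0" by linarith
      hence s: "s > 0" "s\<^sup>2 = (\<integral>z. (cmod (h z))\<^sup>2 \<partial>\<mu>)" by (auto simp: s_def)
      define e0 where "e0 = (%z. of_real (1 / s) * h z)"
      have se: "sphere_fun e0" unfolding e0_def by (intro sphere_fun_scale sh)
      have e00: "ip e0 e0 = 1"
      proof -
        have "ip e0 e0 = of_real (1 / s) * (of_real (1 / s) * of_real (s\<^sup>2))"
          unfolding e0_def ip_scale_left ip_scale_right ip_self s(2) by simp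
        also have "... = of_real ((1 / s) * ((1 / s) * s\<^sup>2))" by (simp only: of_real_mult)
        also have "(1 / s) * ((1 / s) * s\<^sup>2) = 1" using s(1) by (simp add: power2_eq_square)
        finally show ?thesis by simp
      qed
      have e0B: "ip e0 e = 0" if "e \<in> B" for e unfolding e0_def ip_scale_left using hB[OF that] by simp
      have Be0: "ip e e0 = 0" if "e \<in> B" for e using e0B[OF that] ip_commute[of e e0] by simp
      have on: "orthonormal (insert e0 B)"
        unfolding orthonormal_def
      proof (intro conjI ballI)
        show "finite (insert e0 B)" using orthonormal_finite[OF B(1)] by simp
        show "insert e0 B \<subseteq> Collect sphere_fun" using se orthonormal_sphere_fun[OF B(1)] by auto
        fix e e' assume "e \<in> insert e0 B" "e' \<in> insert e0 B"
        thus "ip e e' = (if e = e' then 1 else 0)"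
          using e00 e0B Be0 orthonormal_ip[OF B(1)] by auto
      qed
      have e0_eq: "h = (%z. of_real s * e0 z)" using s by (simp add: e0_def fun_eq_iff)
      have "cfun.span (insert e0 B) = cfun.span (insert g B)"
      proof (rule cfun.span_eq[THEN iffD2], intro conjI)
        have gsp: "g \<in> cfun.span (insert e0 B)"
        proof -
          have "h \<in> cfun.span (insert e0 B)" unfolding e0_eq by (intro cfun.span_scale cfun.span_base) simp
          moreover have "p \<in> cfun.span (insert e0 B)" using pB cfun.span_mono[of B "insert e0 B"] by auto
          moreover have "g = h + p" by (simp add: h_def fun_eq_iff)
          ultimately show ?thesis by (metis cfun.span_add)
        qed
        show "insert g B \<subseteq> cfun.span (insert e0 B)" using gsp by (auto intro: cfun.span_base)
        have "h \<in> cfun.span (insert g B)"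
        proof -
          have "g \<in> cfun.span (insert g B)" by (intro cfun.span_base) simp
          moreover have "p \<in> cfun.span (insert g B)" using pB cfun.span_mono[of B "insert g B"] by auto
          moreover have "h = g - p" by (simp add: h_def fun_eq_iff)
          ultimately show ?thesis by (metis cfun.span_diff)
        qed
        hence "e0 \<in> cfun.span (insert g B)" unfolding e0_def by (rule cfun.span_scale)
        thus "insert e0 B \<subseteq> cfun.span (insert g B)" by (auto intro: cfun.span_base)
      qed
      also have "... = cfun.span (insert g G)"
        by (simp only: cfun.span_insert B(2))
      finally show ?thesis using on by blast
    qed
  qed
  thus thesis using that by blast
qed

lemma bessel:
  assumes B: "orthonormal B" and f: "sphere_fun f"
  shows "(\<Sum>e\<in>B. (cmod (ip f e))\<^sup>2) <= (\<integral>z. (cmod (f z))\<^sup>2 \<partial>\<mu>)"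
proof -
  define p where "p = (%z. \<Sum>e\<in>B. ip f e * e z)"
  define h where "h = (%z. f z - p z)"
  have sp: "sphere_fun p" unfolding p_def by (intro sphere_fun_sum sphere_fun_scale orthonormal_sphere_fun[OF B])
  have sh: "sphere_fun h" unfolding h_def by (intro sphere_fun_diff f sp)
  have pe: "ip p e = ip f e" if "e \<in> B" for e
    using ip_orthonormal_sum[OF B subset_refl that] that by (simp add: p_def)
  have gp: "ip g p = (\<Sum>e\<in>B. cnj (ip f e) * ip g e)" if "sphere_fun g" for g
  proof -
    have "ip g p = (\<Sum>e\<in>B. ip g (%z. ip f e * e z))" unfolding p_def
      by (rule ip_sum_right) (use that orthonormal_sphere_fun[OF B] in \<open>auto intro: sphere_fun_scale\<close>)
    thus ?thesis by (simp add: ip_scale_right)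
  qed
  have hx: "ip h g = ip f g - ip p g" if "sphere_fun g" for g
    unfolding h_def by (rule ip_diff_left[OF f sp that])
  have "ip h h = ip f h - ip p h" by (rule hx[OF sh])
  also have "... = cnj (ip f f - ip p f) - cnj (ip f p - ip p p)"
    unfolding ip_commute[of f h] ip_commute[of p h] hx[OF f] hx[OF sp] by simp
  also have "ip f p - ip p p = 0" unfolding gp[OF f] gp[OF sp] using pe by simp
  also have "ip p f = cnj (ip f p)" by (rule ip_commute)
  also have "ip f p = of_real (\<Sum>e\<in>B. (cmod (ip f e))\<^sup>2)"
    unfolding gp[OF f] by (simp only: of_real_sum complex_norm_square mult.commute)
  finally have "of_real (\<integral>z. (cmod (h z))\<^sup>2 \<partial>\<mu>)
     = complex_of_real ((\<integral>z. (cmod (f z))\<^sup>2 \<partial>\<mu>) - (\<Sum>e\<in>B. (cmod (ip f e))\<^sup>2))"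
    by (simp add: ip_self)
  hence "(\<integral>z. (cmod (h z))\<^sup>2 \<partial>\<mu>) = (\<integral>z. (cmod (f z))\<^sup>2 \<partial>\<mu>) - (\<Sum>e\<in>B. (cmod (ip f e))\<^sup>2)"
    unfolding of_real_eq_iff .
  moreover have "(\<integral>z. (cmod (h z))\<^sup>2 \<partial>\<mu>) >= 0" by (intro Bochner_Integration.integral_nonneg) auto
  ultimately show ?thesis by linarith
qed

lemma parseval:
  assumes B: "orthonormal B"
  shows "(\<integral>z. (cmod (\<Sum>e\<in>B. c e * e z))\<^sup>2 \<partial>\<mu>) = (\<Sum>e\<in>B. (cmod (c e))\<^sup>2)"
proof -
  define p where "p = (%z. \<Sum>e\<in>B. c e * e z)"
  have sp: "sphere_fun p" unfolding p_def by (intro sphere_fun_sum sphere_fun_scale orthonormal_sphere_fun[OF B])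
  have "ip p p = (\<Sum>e\<in>B. ip p (%z. c e * e z))"
    by (subst (2) p_def) (rule ip_sum_right, use sp orthonormal_sphere_fun[OF B] in \<open>auto intro: sphere_fun_scale\<close>)
  also have "... = (\<Sum>e\<in>B. cnj (c e) * c e)"
    using ip_orthonormal_sum[OF B subset_refl, of _ c] by (intro sum.cong) (auto simp: ip_scale_right p_def)
  also have "... = of_real (\<Sum>e\<in>B. (cmod (c e))\<^sup>2)" by (simp only: of_real_sum complex_norm_square mult.commute)
  finally show ?thesis unfolding ip_self of_real_eq_iff p_def .
qed

section \<open>Bases of the spaces of spherical harmonics\<close>

lemma sphere_restrict_simps [simp]: "z \<in> sphere 0 1 ==> sphere_restrict f z = f z"
  "z \<notin> sphere 0 1 ==> sphere_restrict f z = 0"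
  by (auto simp: sphere_restrict_def)

lemma sphere_restrict_add: "sphere_restrict (%z. f z + g z) = (%z. sphere_restrict f z + sphere_restrict g z)"
  and sphere_restrict_scale: "sphere_restrict (%z. c * f z) = (%z. c * sphere_restrict f z)"
  and sphere_restrict_zero: "sphere_restrict (%z. 0) = (%z. 0)"
  by (auto simp: sphere_restrict_def fun_eq_iff)

lemma sphere_restrict_cong: "(!!z. z \<in> sphere 0 1 ==> f z = g z) ==> sphere_restrict f = sphere_restrict g"
  by (auto simp: sphere_restrict_def fun_eq_iff)

lemma sphere_fun_restrict: "continuous_on (sphere 0 1) f ==> sphere_fun (sphere_restrict f)"
proof -
  assume "continuous_on (sphere 0 1) f"
  moreover have "continuous_on (sphere 0 1) (sphere_restrict f) = continuous_on (sphere 0 1) f"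
    by (rule continuous_on_cong) (auto simp: sphere_restrict_def)
  ultimately show ?thesis by (auto simp: sphere_fun_def sphere_restrict_def)
qed

lemma ip_restrict: "ip (sphere_restrict f) (sphere_restrict g) = (\<integral>z. f z * cnj (g z) \<partial>\<mu>)"
  unfolding ip_def by (rule Bochner_Integration.integral_cong) (auto simp: sphere_restrict_def)

lemma harmonic_space_eq:
  "harmonic_space m n = sphere_restrict ` {P \<in> bihom_polys m n. \<forall>z. lap P z = 0}"
  by (simp add: harmonic_space_def complex_laplacian_eq)

lemma lap_zero: "lap (%z. 0) z = 0"
  and lap_add: "f \<in> bihom_polys m n ==> g \<in> bihom_polys m n ==> lap (%z. f z + g z) z = lap f z + lap g z"
  and lap_scale: "f \<in> bihom_polys m n ==> lap (%z. c * f z) z = c * lap f z"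
proof -
  have "wirtinger_cnj j (%z. 0) = (%z. 0)" for j :: "'a::finite" by (simp add: fun_eq_iff)
  thus "lap (%z. 0) z = 0" by (simp add: lap_def)
next
  assume f: "f \<in> bihom_polys m n" and g: "g \<in> bihom_polys m n"
  have "wirtinger_cnj j (%z. f z + g z) = (%z. wirtinger_cnj j f z + wirtinger_cnj j g z)" for j
    by (simp add: fun_eq_iff wirtinger_add[OF bihom_differentiable[OF f] bihom_differentiable[OF g]])
  thus "lap (%z. f z + g z) z = lap f z + lap g z"
    unfolding lap_def by (simp add: sum.distrib
      wirtinger_add[OF bihom_differentiable[OF bihom_wirtinger_cnj[OF f]] bihom_differentiable[OF bihom_wirtinger_cnj[OF g]]])
next
  assume f: "f \<in> bihom_polys m n"
  have "wirtinger_cnj j (%z. c * f z) = (%z. c * wirtinger_cnj j f z)" for j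
    by (simp add: fun_eq_iff wirtinger_scale[OF bihom_differentiable[OF f]])
  thus "lap (%z. c * f z) z = c * lap f z"
    unfolding lap_def by (simp add: sum_distrib_left wirtinger_scale[OF bihom_differentiable[OF bihom_wirtinger_cnj[OF f]]])
qed

text \<open>These spaces increase under \<open>(m, n) \<mapsto> (m + k, n + k)\<close>, since the norm is \<open>1\<close> on the sphere.\<close>

definition rb :: "nat => nat => 'd::finite fn set" where
  "rb m n = sphere_restrict ` bihom_polys m n"

definition rmono :: "('d::finite => nat) \<times> ('d => nat) => 'd fn" where
  "rmono p = sphere_restrict (bmono (fst p) (snd p))"

lemma subspace_rb: "cfun.subspace (rb m n)"
proof (rule cfun.subspaceI)
  have "sphere_restrict (%z. 0) \<in> rb m n" unfolding rb_def by (rule imageI[OF bihom_zero])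
  thus "0 \<in> rb m n" by (simp add: sphere_restrict_zero zero_fun_def)
  fix f g :: "'d::finite fn" assume "f \<in> rb m n" "g \<in> rb m n"
  then obtain P Q where P: "P \<in> bihom_polys m n" "f = sphere_restrict P" and Q: "Q \<in> bihom_polys m n" "g = sphere_restrict Q"
    by (auto simp: rb_def)
  have "f + g = sphere_restrict (%z. P z + Q z)" by (simp add: P(2) Q(2) sphere_restrict_add plus_fun_def)
  thus "f + g \<in> rb m n" unfolding rb_def using bihom_add[OF P(1) Q(1)] by blast
next
  fix c and f :: "'d::finite fn" assume "f \<in> rb m n"
  then obtain P where P: "P \<in> bihom_polys m n" "f = sphere_restrict P" by (auto simp: rb_def)
  have "(%z. c * f z) = sphere_restrict (%z. c * P z)" by (simp add: P(2) sphere_restrict_scale)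
  thus "(%z. c * f z) \<in> rb m n" unfolding rb_def using bihom_scale[OF P(1)] by blast
qed

lemma subspace_harmonic: "cfun.subspace (harmonic_space m n)"
proof (rule cfun.subspaceI)
  have "sphere_restrict (%z. 0) \<in> harmonic_space m n" unfolding harmonic_space_eq by (intro imageI) (simp add: lap_zero)
  thus "0 \<in> harmonic_space m n" by (simp add: sphere_restrict_zero zero_fun_def)
  fix f g :: "'d::finite fn" assume "f \<in> harmonic_space m n" "g \<in> harmonic_space m n"
  then obtain P Q where P: "P \<in> bihom_polys m n" "f = sphere_restrict P" "\<forall>z. lap P z = 0"
    and Q: "Q \<in> bihom_polys m n" "g = sphere_restrict Q" "\<forall>z. lap Q z = 0"
    by (auto simp: harmonic_space_eq)
  have "f + g = sphere_restrict (%z. P z + Q z)" by (simp add: P(2) Q(2) sphere_restrict_add plus_fun_def)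
  thus "f + g \<in> harmonic_space m n" unfolding harmonic_space_eq
    using bihom_add[OF P(1) Q(1)] lap_add[OF P(1) Q(1)] P(3) Q(3) by auto
next
  fix c and f :: "'d::finite fn" assume "f \<in> harmonic_space m n"
  then obtain P where P: "P \<in> bihom_polys m n" "f = sphere_restrict P" "\<forall>z. lap P z = 0" by (auto simp: harmonic_space_eq)
  have "(%z. c * f z) = sphere_restrict (%z. c * P z)" by (simp add: P(2) sphere_restrict_scale)
  thus "(%z. c * f z) \<in> harmonic_space m n" unfolding harmonic_space_eq
    using bihom_scale[OF P(1)] lap_scale[OF P(1)] P(3) by auto
qed

lemma harmonic_subset_rb: "harmonic_space m n \<subseteq> rb m n"
  by (auto simp: harmonic_space_eq rb_def)

lemma rb_sphere_fun: "f \<in> rb m n ==> sphere_fun f"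
  by (auto simp: rb_def intro!: sphere_fun_restrict bihom_continuous)

lemma rb_span: "rb m n \<subseteq> cfun.span (rmono ` {(\<alpha>, \<beta>). sum \<alpha> UNIV = m \<and> sum \<beta> UNIV = n})"
proof
  fix f :: "'d::finite fn" assume "f \<in> rb m n"
  then obtain P where P: "P \<in> bihom_polys m n" "f = sphere_restrict P" by (auto simp: rb_def)
  from P(1) have "sphere_restrict P \<in> cfun.span (rmono ` {(\<alpha>, \<beta>). sum \<alpha> UNIV = m \<and> sum \<beta> UNIV = n})"
  proof (induction rule: bihom_induct)
    case zero then show ?case using cfun.span_zero by (simp add: sphere_restrict_zero zero_fun_def)
  next
    case (step c \<alpha> \<beta> g)
    have "rmono (\<alpha>, \<beta>) \<in> cfun.span (rmono ` {(\<alpha>, \<beta>). sum \<alpha> UNIV = m \<and> sum \<beta> UNIV = n})"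
      using step(1,2) by (intro cfun.span_base imageI) simp
    from cfun.span_add[OF cfun.span_scale[OF this, of c] step.IH] show ?case
      by (simp add: sphere_restrict_add sphere_restrict_scale rmono_def plus_fun_def)
  qed
  thus "f \<in> cfun.span (rmono ` {(\<alpha>, \<beta>). sum \<alpha> UNIV = m \<and> sum \<beta> UNIV = n})" by (simp add: P(2))
qed

lemma finite_multiindex: "finite {\<alpha> :: 'd::finite => nat. sum \<alpha> UNIV <= m}"
proof (rule finite_subset)
  show "{\<alpha> :: 'd => nat. sum \<alpha> UNIV <= m} \<subseteq> PiE UNIV (%_. {..m})"
    by (auto intro: order_trans[OF member_le_sum[of _ UNIV]])
qed (intro finite_PiE, auto)

lemma finite_multiindex_pairs: "finite {(\<alpha> :: 'd::finite => nat, \<beta> :: 'd => nat). sum \<alpha> UNIV <= m \<and> sum \<beta> UNIV <= n}"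
proof -
  have "{(\<alpha> :: 'd => nat, \<beta> :: 'd => nat). sum \<alpha> UNIV <= m \<and> sum \<beta> UNIV <= n} = {\<alpha>. sum \<alpha> UNIV <= m} \<times> {\<beta>. sum \<beta> UNIV <= n}" by auto
  thus ?thesis by (simp add: finite_cartesian_product[OF finite_multiindex finite_multiindex])
qed

lemma rmono_sphere_fun: "sphere_fun (rmono p)"
  unfolding rmono_def by (rule sphere_fun_restrict[OF bihom_continuous[OF bmono_in_bihom[OF refl refl]]])

lemma orthonormal_basis_subspace:
  fixes V :: "('a::euclidean_space => complex) set"
  assumes V: "cfun.subspace V" "V \<subseteq> cfun.span G" and G: "finite G" "G \<subseteq> Collect sphere_fun"
  obtains B where "orthonormal B" "cfun.span B = V"
proof -
  obtain A where A: "A \<subseteq> V" "cfun.independent A" "V \<subseteq> cfun.span A"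
    using cfun.maximal_independent_subset[of V] by blast
  have "finite A" using cfun.independent_span_bound[OF G(1) A(2)] A(1) V(2) by blast
  moreover have "A \<subseteq> Collect sphere_fun" using sphere_fun_span[OF G(2)] A(1) V(2) by blast
  ultimately obtain B where B: "orthonormal B" "cfun.span B = cfun.span A" using gram_schmidt by blast
  have "cfun.span A \<subseteq> V" using cfun.span_minimal[OF A(1) V(1)] .
  hence "cfun.span B = V" using A(3) B(2) by blast
  with B(1) show thesis by (rule that)
qed

lemma rb_basis: obtains B where "orthonormal B" "cfun.span B = (rb m n :: 'd::finite fn set)"
proof (rule orthonormal_basis_subspace[OF subspace_rb rb_span])
  show "finite (rmono ` {(\<alpha> :: 'd => nat, \<beta> :: 'd => nat). sum \<alpha> UNIV = m \<and> sum \<beta> UNIV = n})"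
    by (intro finite_imageI finite_subset[OF _ finite_multiindex_pairs[of m n]]) auto
qed (auto simp: rmono_sphere_fun intro: that)

definition hbasis :: "nat => nat => 'd::finite fn set" where
  "hbasis m n = (SOME B. orthonormal B \<and> cfun.span B = harmonic_space m n)"

lemma hbasis:
  shows "orthonormal (hbasis m n :: 'd::finite fn set)"
    and "cfun.span (hbasis m n) = (harmonic_space m n :: 'd fn set)"
proof -
  obtain G where G: "orthonormal G" "cfun.span G = (rb m n :: 'd fn set)" by (rule rb_basis)
  have "\<exists>B. orthonormal B \<and> cfun.span B = (harmonic_space m n :: 'd fn set)"
    by (rule orthonormal_basis_subspace[OF subspace_harmonic, of m n G])
       (use G harmonic_subset_rb orthonormal_finite orthonormal_sphere_fun in auto)
  from someI_ex[OF this]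
  have "orthonormal (hbasis m n :: 'd fn set) \<and>
      cfun.span (hbasis m n) = (harmonic_space m n :: 'd fn set)"
    unfolding hbasis_def .
  thus "orthonormal (hbasis m n :: 'd fn set)"
    "cfun.span (hbasis m n) = (harmonic_space m n :: 'd fn set)" by blast+
qed

lemma hbasis_harmonic: "e \<in> hbasis m n ==> e \<in> harmonic_space m n"
  using hbasis(2) cfun.span_base by blast

text \<open>If the bidegrees differ, one of them exceeds the other in a component, and
  \<open>integral_harmonic_times_other\<close> applies to the function with that bidegree.\<close>

lemma harmonic_orthogonal:
  assumes f: "f \<in> harmonic_space m n" and g: "g \<in> harmonic_space m' n'" and ne: "(m, n) ~= (m', n')"
  shows "ip f g = 0"
proof -
  obtain P where P: "P \<in> bihom_polys m n" "f = sphere_restrict P" "!!z. lap P z = 0" using f by (auto simp: harmonic_space_eq)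
  obtain Q where Q: "Q \<in> bihom_polys m' n'" "g = sphere_restrict Q" "!!z. lap Q z = 0" using g by (auto simp: harmonic_space_eq)
  have "m' < m \<or> n' < n \<or> m < m' \<or> n < n'" using ne by auto
  then consider "m' < m \<or> n' < n" | "m < m' \<or> n < n'" by blast
  thus ?thesis
  proof cases
    case 1
    thus ?thesis unfolding P(2) Q(2) ip_restrict
      by (intro integral_harmonic_times_other[OF P(1,3) bihom_cnj[OF Q(1)]])
  next
    case 2
    hence "ip g f = 0" unfolding P(2) Q(2) ip_restrict
      by (intro integral_harmonic_times_other[OF Q(1,3) bihom_cnj[OF P(1)]])
    thus ?thesis using ip_commute[of f g] by simp
  qed
qed

text \<open>An orthonormal basis of \<open>harmonic_sum N\<close>.\<close>

definition E :: "nat => 'd::finite fn set" where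
  "E N = (\<Union>m\<le>N. \<Union>n\<le>N. hbasis m n)"

lemma hbasis_unique:
  assumes "e \<in> hbasis m n" "e \<in> hbasis m' n'"
  shows "(m, n) = (m', n')"
proof (rule ccontr)
  assume "(m, n) ~= (m', n')"
  hence "ip e e = 0" using harmonic_orthogonal[OF hbasis_harmonic[OF assms(1)] hbasis_harmonic[OF assms(2)]] by blast
  thus False using orthonormal_ip[OF hbasis(1) assms(1) assms(1)] by simp
qed

lemma orthonormal_E: "orthonormal (E N)"
  unfolding orthonormal_def
proof (intro conjI ballI)
  show "finite (E N)" unfolding E_def by (intro finite_UN_I finite_atMost orthonormal_finite[OF hbasis(1)])
  show "E N \<subseteq> Collect sphere_fun" unfolding E_def using orthonormal_sphere_fun[OF hbasis(1)] by auto
  fix e e' :: "'d::finite fn" assume "e \<in> E N" "e' \<in> E N"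
  then obtain m n m' n' where e: "e \<in> hbasis m n" "e' \<in> hbasis m' n'" by (auto simp: E_def)
  show "ip e e' = (if e = e' then 1 else 0)"
  proof (cases "(m, n) = (m', n')")
    case True
    thus ?thesis using e orthonormal_ip[OF hbasis(1) e(1), of e'] by auto
  next
    case False
    hence "ip e e' = 0" using harmonic_orthogonal[OF hbasis_harmonic[OF e(1)] hbasis_harmonic[OF e(2)]] by blast
    moreover have "e ~= e'" using False e hbasis_unique by blast
    ultimately show ?thesis by simp
  qed
qed

lemma harmonic_space_subset_sum: "max m n <= N ==> harmonic_space m n \<subseteq> harmonic_sum N"
  unfolding harmonic_sum_def by (intro subset_trans[OF _ cfun.span_superset] Union_upper) auto

lemma span_E: "cfun.span (E N) = (harmonic_sum N :: 'd::finite fn set)"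
proof
  have "E N \<subseteq> (harmonic_sum N :: 'd fn set)"
  proof
    fix e :: "'d fn" assume "e \<in> E N"
    then obtain m n where e: "m <= N" "n <= N" "e \<in> hbasis m n" by (auto simp: E_def)
    show "e \<in> harmonic_sum N" by (rule subsetD[OF harmonic_space_subset_sum hbasis_harmonic[OF e(3)]]) (use e in simp)
  qed
  thus "cfun.span (E N) \<subseteq> (harmonic_sum N :: 'd fn set)"
    by (rule cfun.span_minimal) (simp add: harmonic_sum_def)
  have "harmonic_space m n \<subseteq> cfun.span (E N :: 'd fn set)" if "max m n <= N" for m n
    unfolding hbasis(2)[symmetric] using that by (intro cfun.span_mono) (auto simp: E_def)
  thus "(harmonic_sum N :: 'd fn set) \<subseteq> cfun.span (E N)"
    unfolding harmonic_sum_def by (intro cfun.span_minimal) auto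
qed

lemma dim_harmonic_sum: "cfun.dim (harmonic_sum N :: 'd::finite fn set) = card (E N :: 'd fn set)"
  unfolding span_E[symmetric] by (rule cfun.dim_span_eq_card_independent[OF orthonormal_independent[OF orthonormal_E]])

lemma E_mono: "M <= N ==> E M \<subseteq> E N"
  unfolding E_def by (intro UN_mono) auto

lemma rb_shift: "rb m n \<subseteq> rb (m + k) (n + k)"
proof (induction k)
  case (Suc k)
  have "rb m n \<subseteq> (rb (Suc m) (Suc n) :: 'd::finite fn set)" for m n
  proof
    fix f :: "'d::finite fn" assume "f \<in> rb m n"
    then obtain P where P: "P \<in> bihom_polys m n" "f = sphere_restrict P" by (auto simp: rb_def)
    have "f = sphere_restrict (%z. (\<Sum>j\<in>UNIV. z $ j * cnj (z $ j)) * P z)"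
      unfolding P(2) by (rule sphere_restrict_cong) (simp only: sphere_norm_sq mult_1_left)
    thus "f \<in> rb (Suc m) (Suc n)" unfolding rb_def using bihom_mult_norm_sq[OF P(1)] by blast
  qed
  from this[of "m + k" "n + k"] Suc show ?case by auto
qed simp

lemma harmonic_sum_mono: "M <= N ==> harmonic_sum M \<subseteq> harmonic_sum N"
  unfolding span_E[symmetric] by (intro cfun.span_mono E_mono)

text \<open>The decomposition of a polynomial into harmonics times powers of the norm, obtained through orthogonality:
  after subtraction of the projection onto \<open>rb m n'\<close> the remainder is harmonic.\<close>

lemma rb_subset_harmonic_sum: "rb m n \<subseteq> (harmonic_sum (max m n) :: 'd::finite fn set)"
proof (induction m arbitrary: n)
  case 0
  have "rb 0 n \<subseteq> harmonic_space 0 n" unfolding rb_def harmonic_space_eq using lap_degree_0(1) by blast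
  thus ?case using harmonic_space_subset_sum[of 0 n "max 0 n"] by auto
next
  case (Suc m n)
  show ?case
  proof (cases n)
    case 0
    have "rb (Suc m) 0 \<subseteq> harmonic_space (Suc m) 0" unfolding rb_def harmonic_space_eq using lap_degree_0(2) by blast
    thus ?thesis using harmonic_space_subset_sum[of "Suc m" 0 "max (Suc m) n"] 0 by auto
  next
    case n: (Suc n')
    show ?thesis
    proof
      fix f :: "'d fn" assume "f \<in> rb (Suc m) n"
      then obtain P where P: "P \<in> bihom_polys (Suc m) (Suc n')" "f = sphere_restrict P" by (auto simp: rb_def n)
      obtain B where B: "orthonormal B" "cfun.span B = (rb m n' :: 'd fn set)" by (rule rb_basis)
      have sf: "sphere_fun f" unfolding P(2) by (intro sphere_fun_restrict bihom_continuous[OF P(1)])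
      define p where "p = (%z. \<Sum>e\<in>B. ip f e * e z)"
      have prb: "p \<in> rb m n'" unfolding p_def B(2)[symmetric] by (rule span_sumI) simp
      have sp: "sphere_fun p" using prb by (rule rb_sphere_fun)
      have "p \<in> rb (Suc m) (Suc n')" using prb rb_shift[of m n' 1] by auto
      then obtain Q where Q: "Q \<in> bihom_polys (Suc m) (Suc n')" "p = sphere_restrict Q" by (auto simp: rb_def)
      define D where "D = (%z. P z - Q z)"
      have D: "D \<in> bihom_polys (Suc m) (Suc n')" unfolding D_def by (rule bihom_diff[OF P(1) Q(1)])
      have rD: "sphere_restrict D = (%z. f z - p z)" unfolding D_def P(2) Q(2) by (auto simp: sphere_restrict_def)
      have DB: "ip (sphere_restrict D) e = 0" if "e \<in> B" for e
        unfolding rD using ip_diff_left[OF sf sp orthonormal_sphere_fun[OF B(1) that]]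
          ip_orthonormal_sum[OF B(1) subset_refl that, of "ip f"] that by (simp add: p_def)
      have sD: "sphere_fun (sphere_restrict D)" by (intro sphere_fun_restrict bihom_continuous[OF D])
      have lapD: "lap D z = 0" for z
      proof (rule harmonic_if_orthogonal_to_lower[OF D])
        fix g :: "'d fn" assume g: "g \<in> bihom_polys n' m"
        have "sphere_restrict (%z. cnj (g z)) \<in> cfun.span B" unfolding B(2) rb_def using bihom_cnj[OF g] by blast
        then obtain c where c: "sphere_restrict (%z. cnj (g z)) = (%z. \<Sum>e\<in>B. c e * e z)"
          using span_sum_representation[OF orthonormal_finite[OF B(1)]] by blast
        have "(\<integral>z. D z * g z \<partial>\<mu>) = ip (sphere_restrict D) (sphere_restrict (%z. cnj (g z)))"
          unfolding ip_restrict by simp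
        also have "... = (\<Sum>e\<in>B. ip (sphere_restrict D) (%z. c e * e z))"
          unfolding c by (rule ip_sum_right) (use sD orthonormal_sphere_fun[OF B(1)] in \<open>auto intro: sphere_fun_scale\<close>)
        also have "... = 0" using DB by (simp add: ip_scale_right)
        finally show "(\<integral>z. D z * g z \<partial>\<mu>) = 0" .
      qed
      have "sphere_restrict D \<in> harmonic_space (Suc m) (Suc n')" unfolding harmonic_space_eq using D lapD by blast
      hence "sphere_restrict D \<in> harmonic_sum (max (Suc m) n)"
        using harmonic_space_subset_sum[of "Suc m" "Suc n'" "max (Suc m) n"] n by auto
      moreover have "p \<in> harmonic_sum (max (Suc m) n)"
        by (rule subsetD[OF harmonic_sum_mono subsetD[OF Suc.IH prb]]) (use n in \<open>auto simp: max_def\<close>)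
      ultimately have "sphere_restrict D + p \<in> harmonic_sum (max (Suc m) n)"
        unfolding harmonic_sum_def by (rule cfun.span_add)
      moreover have "sphere_restrict D + p = f" unfolding rD by (simp add: fun_eq_iff)
      ultimately show "f \<in> harmonic_sum (max (Suc m) n)" by simp
    qed
  qed
qed

lemma rb_subset_harmonic_sum': "m <= N ==> n <= N ==> rb m n \<subseteq> harmonic_sum N"
  using rb_subset_harmonic_sum[of m n] harmonic_sum_mono[of "max m n" N] by auto

text \<open>Multiplication by powers of \<open>\<Sum>\<bar>z $ j\<bar>^2\<close> brings the larger degree up to \<open>N\<close>. Hence dimensions can be
  bounded by counting monomials with \<open>max m n = N\<close>.\<close>

lemma harmonic_sum_subset_top:
  "harmonic_sum N \<subseteq> cfun.span (rmono ` {(\<alpha>, \<beta>). max (sum \<alpha> UNIV) (sum \<beta> UNIV) = N})"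
proof -
  have "harmonic_space m n \<subseteq> cfun.span (rmono ` {(\<alpha>, \<beta>). max (sum \<alpha> UNIV) (sum \<beta> UNIV) = N})"
    if "max m n <= N" for m n
  proof -
    let ?k = "N - max m n"
    have "harmonic_space m n \<subseteq> rb (m + ?k) (n + ?k)" using harmonic_subset_rb rb_shift by blast
    also have "... \<subseteq> cfun.span (rmono ` {(\<alpha>, \<beta>). sum \<alpha> UNIV = m + ?k \<and> sum \<beta> UNIV = n + ?k})" by (rule rb_span)
    also have "... \<subseteq> cfun.span (rmono ` {(\<alpha>, \<beta>). max (sum \<alpha> UNIV) (sum \<beta> UNIV) = N})"
      using that by (intro cfun.span_mono image_mono) (auto simp: max_def)
    finally show ?thesis .
  qed
  thus ?thesis unfolding harmonic_sum_def by (intro cfun.span_minimal) auto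
qed

section \<open>Counting monomials\<close>

text \<open>Exponents vanish off \<open>I\<close>, so that these sets are finite and admit induction on \<open>I\<close>.\<close>

definition degree_eq :: "'i set => nat => ('i => nat) set" where
  "degree_eq I m = {\<alpha>. (\<forall>i. i \<notin> I --> \<alpha> i = 0) \<and> sum \<alpha> I = m}"

definition degree_le :: "'i set => nat => ('i => nat) set" where
  "degree_le I m = {\<alpha>. (\<forall>i. i \<notin> I --> \<alpha> i = 0) \<and> sum \<alpha> I <= m}"

lemma sum_if_notin: "x \<notin> I ==> (\<Sum>i\<in>I. if i = x then k else \<alpha> i) = sum \<alpha> I"
  by (intro sum.cong) auto

lemma degree_le_insert:
  assumes "finite I" "x \<notin> I"
  shows "degree_le (insert x I) m = (\<Union>k\<le>m. (%\<alpha>. \<alpha>(x := k)) ` degree_le I (m - k))"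
proof (intro equalityI subsetI)
  fix \<alpha> assume a: "\<alpha> \<in> degree_le (insert x I) m"
  hence "\<alpha> x + sum \<alpha> I <= m" using assms by (simp add: degree_le_def)
  moreover have "\<alpha> = (\<alpha>(x := 0))(x := \<alpha> x)" by simp
  moreover have "\<alpha>(x := 0) \<in> degree_le I (m - \<alpha> x)"
    using a assms by (auto simp: degree_le_def sum_if_notin)
  ultimately show "\<alpha> \<in> (\<Union>k\<le>m. (%\<alpha>. \<alpha>(x := k)) ` degree_le I (m - k))"
    by (intro UN_I[of "\<alpha> x"] image_eqI[of _ _ "\<alpha>(x := 0)"]) auto
next
  fix \<alpha> assume "\<alpha> \<in> (\<Union>k\<le>m. (%\<alpha>. \<alpha>(x := k)) ` degree_le I (m - k))"
  thus "\<alpha> \<in> degree_le (insert x I) m"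
    using assms by (auto simp: degree_le_def sum_if_notin)
qed

lemma finite_card_degree_le:
  fixes I :: "'i set"
  assumes "finite I"
  shows "finite (degree_le I m) \<and> card (degree_le I m) = (m + card I) choose card I"
  using assms
proof (induction I arbitrary: m rule: finite_induct)
  case empty
  have "(degree_le {} m :: ('i => nat) set) = {%_. 0}" by (auto simp: degree_le_def)
  thus ?case by simp
next
  case (insert x I)
  have inj: "inj_on (%\<alpha>. \<alpha>(x := k)) (degree_le I n)" for k n
  proof (rule inj_onI)
    fix \<alpha> \<beta> assume a: "\<alpha> \<in> degree_le I n" "\<beta> \<in> degree_le I n" and eq: "\<alpha>(x := k) = \<beta>(x := k)"
    show "\<alpha> = \<beta>"
    proof
      fix i show "\<alpha> i = \<beta> i"
        using fun_cong[OF eq, of i] a insert by (cases "i = x") (auto simp: degree_le_def)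
    qed
  qed
  have fin: "finite ((%\<alpha>. \<alpha>(x := k)) ` degree_le I (m - k))" for k using insert by blast
  have "card (degree_le (insert x I) m) = (\<Sum>k\<le>m. card ((%\<alpha>. \<alpha>(x := k)) ` degree_le I (m - k)))"
    unfolding degree_le_insert[OF insert(1,2)]
  proof (rule card_UN_disjoint)
    show "\<forall>i\<in>{..m}. \<forall>j\<in>{..m}. i ~= j -->
       (%\<alpha>. \<alpha>(x := i)) ` degree_le I (m - i) \<inter> (%\<alpha>. \<alpha>(x := j)) ` degree_le I (m - j) = {}"
      by (auto simp: fun_eq_iff) (metis fun_upd_same)
  qed (use fin in auto)
  also have "... = (\<Sum>k\<le>m. (m - k + card I) choose card I)"
    using insert by (intro sum.cong refl) (subst card_image[OF inj], simp)
  also have "... = (\<Sum>k\<le>m. (card I + k) choose card I)"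
    by (rule sum.reindex_bij_witness[of _ "%k. m - k" "%k. m - k"]) (auto simp: add.commute)
  also have "... = (card I + m + 1) choose (card I + 1)"
    by (rule choose_rising_sum(1))
  finally show ?case
    using insert fin by (simp add: degree_le_insert add.commute)
qed

lemma finite_card_degree_eq:
  assumes "finite I" "x \<notin> I"
  shows "finite (degree_eq (insert x I) m)" "card (degree_eq (insert x I) m) = (m + card I) choose card I"
proof -
  have b: "bij_betw (%\<alpha>. \<alpha>(x := 0)) (degree_eq (insert x I) m) (degree_le I m)"
  proof (rule bij_betwI[where g="%\<alpha>. \<alpha>(x := m - sum \<alpha> I)"])
    show "(%\<alpha>. \<alpha>(x := 0)) \<in> degree_eq (insert x I) m \<rightarrow> degree_le I m"
      using assms by (auto simp: degree_eq_def degree_le_def sum_if_notin)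
    show "(%\<alpha>. \<alpha>(x := m - sum \<alpha> I)) \<in> degree_le I m \<rightarrow> degree_eq (insert x I) m"
      using assms by (auto simp: degree_eq_def degree_le_def sum_if_notin)
    show "(\<alpha>(x := 0))(x := m - sum (\<alpha>(x := 0)) I) = \<alpha>" if "\<alpha> \<in> degree_eq (insert x I) m" for \<alpha>
      using that assms by (auto simp: degree_eq_def sum_if_notin fun_eq_iff)
    show "(\<alpha>(x := m - sum \<alpha> I))(x := 0) = \<alpha>" if "\<alpha> \<in> degree_le I m" for \<alpha>
      using that assms by (auto simp: degree_le_def fun_eq_iff)
  qed
  show "finite (degree_eq (insert x I) m)" "card (degree_eq (insert x I) m) = (m + card I) choose card I"
    using finite_card_degree_le[OF assms(1), of m] bij_betw_finite[OF b] bij_betw_same_card[OF b] by auto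
qed

lemma choose_le_power: "real (n choose k) <= real n ^ k / fact k"
proof -
  have "real ((n choose k) * fact k) <= real (n ^ k)"
    using binomial_fact_pow[of n k] by (simp only: of_nat_le_iff)
  thus ?thesis by (simp add: pos_le_divide_eq)
qed

definition top_pairs :: "nat => (('d::finite => nat) \<times> ('d => nat)) set" where
  "top_pairs N = {(\<alpha>, \<beta>). max (sum \<alpha> UNIV) (sum \<beta> UNIV) = N}"

lemma top_pairs_subset:
  "top_pairs N \<subseteq> degree_eq UNIV N \<times> degree_le UNIV N \<union> degree_le UNIV N \<times> degree_eq UNIV N"
  by (auto simp: top_pairs_def degree_eq_def degree_le_def max_def split: if_splits)

lemma finite_degree_UNIV: "finite (degree_eq (UNIV :: 'd::finite set) N)" "finite (degree_le (UNIV :: 'd::finite set) N)"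
proof -
  show "finite (degree_le (UNIV :: 'd::finite set) N)" using finite_card_degree_le[of "UNIV :: 'd set"] by simp
  thus "finite (degree_eq (UNIV :: 'd::finite set) N)" by (rule finite_subset[rotated]) (auto simp: degree_eq_def degree_le_def)
qed

lemma finite_top_pairs: "finite (top_pairs N)"
  by (rule finite_subset[OF top_pairs_subset]) (simp add: finite_degree_UNIV)

lemma card_degree_eq_UNIV: "card (degree_eq (UNIV :: 'd::finite set) N) = (N + (CARD('d) - 1)) choose (CARD('d) - 1)"
proof -
  obtain x :: 'd where True by simp
  have "insert x (UNIV - {x}) = UNIV" by auto
  thus ?thesis using finite_card_degree_eq(2)[of "UNIV - {x}" x N] by simp
qed

lemma card_degree_le_UNIV: "card (degree_le (UNIV :: 'd::finite set) N) = (N + CARD('d)) choose CARD('d)"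
  using finite_card_degree_le[of "UNIV :: 'd set"] by simp

lemma card_top_pairs_le:
  "real (card (top_pairs N :: (('d::finite => nat) \<times> ('d => nat)) set))
     <= 2 / (fact CARD('d) * fact (CARD('d) - 1)) * real (N + CARD('d)) ^ (2 * CARD('d) - 1)"
proof -
  let ?d = "CARD('d)"
  let ?F = "degree_eq (UNIV :: 'd set) N" and ?G = "degree_le (UNIV :: 'd set) N"
  have d: "?d >= 1" by (simp add: Suc_le_eq)
  have "card (top_pairs N :: (('d => nat) \<times> ('d => nat)) set) <= card (?F \<times> ?G \<union> ?G \<times> ?F)"
    by (rule card_mono[OF _ top_pairs_subset]) (simp add: finite_degree_UNIV)
  also have "... <= card (?F \<times> ?G) + card (?G \<times> ?F)" by (rule card_Un_le)
  also have "... = 2 * (card ?F * card ?G)" by (simp add: card_cartesian_product)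
  finally have "real (card (top_pairs N :: (('d => nat) \<times> ('d => nat)) set)) <= real (2 * (card ?F * card ?G))"
    by (simp only: of_nat_le_iff)
  also have "... = 2 * (real (card ?F) * real (card ?G))" by simp
  also have "... <= 2 * ((real (N + ?d) ^ (?d - 1) / fact (?d - 1)) * (real (N + ?d) ^ ?d / fact ?d))"
  proof (intro mult_left_mono mult_mono)
    have "real (card ?F) <= real (N + (?d - 1)) ^ (?d - 1) / fact (?d - 1)"
      unfolding card_degree_eq_UNIV by (rule choose_le_power)
    also have "... <= real (N + ?d) ^ (?d - 1) / fact (?d - 1)"
      by (intro divide_right_mono power_mono) auto
    finally show "real (card ?F) <= real (N + ?d) ^ (?d - 1) / fact (?d - 1)" .
    show "real (card ?G) <= real (N + ?d) ^ ?d / fact ?d"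
      unfolding card_degree_le_UNIV by (rule choose_le_power)
  qed auto
  also have "... = 2 / (fact ?d * fact (?d - 1)) * (real (N + ?d) ^ (?d - 1) * real (N + ?d) ^ ?d)" by simp
  also have "real (N + ?d) ^ (?d - 1) * real (N + ?d) ^ ?d = real (N + ?d) ^ (2 * ?d - 1)"
    using d by (simp add: mult_2 flip: power_add)
  finally show ?thesis .
qed

definition special_pairs :: "'d::finite => nat => (('d => nat) \<times> ('d => nat)) set" where
  "special_pairs k N = {(\<alpha>, \<beta>) \<in> top_pairs N. \<alpha> k = 0 \<or> \<beta> k = 0}"

lemma choose_le_pow: "n choose k <= n ^ k"
proof -
  have "1 * (n choose k) <= fact k * (n choose k)" by (intro mult_right_mono) (auto simp: fact_ge_1)
  also have "... <= n ^ k" using binomial_fact_pow[of n k] by (simp add: mult.commute)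
  finally show ?thesis by simp
qed

lemma card_special_pairs_le:
  fixes k :: "'d::finite"
  assumes d: "CARD('d) >= 2"
  shows "card (special_pairs k N) <= 4 * (N + CARD('d)) ^ (2 * CARD('d) - 2)"
proof -
  let ?d = "CARD('d)"
  let ?F = "degree_eq (UNIV :: 'd set) N" and ?G = "degree_le (UNIV :: 'd set) N"
  let ?Fz = "degree_eq (UNIV - {k}) N" and ?Gz = "degree_le (UNIV - {k}) N"
  define n where "n = N + ?d"
  obtain l where l: "l ~= k"
  proof -
    have "card (UNIV - {k}) >= 1" using d by simp
    hence "UNIV - {k} ~= {}" by (metis card.empty not_one_le_zero)
    thus thesis using that by blast
  qed
  have ins: "insert l (UNIV - {k, l}) = UNIV - {k}" using l by auto
  have cl: "card (UNIV - {k, l}) = ?d - 2" using l by (simp add: card_Diff_subset)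
  have F0f: "finite ?Fz" using finite_card_degree_eq(1)[of "UNIV - {k, l}" l N] unfolding ins by simp
  have F0: "card ?Fz <= n ^ (?d - 2)"
  proof -
    have "card ?Fz = (N + (?d - 2)) choose (?d - 2)"
      using finite_card_degree_eq(2)[of "UNIV - {k, l}" l N] unfolding ins cl by simp
    also have "... <= (N + (?d - 2)) ^ (?d - 2)" by (rule choose_le_pow)
    also have "... <= n ^ (?d - 2)" unfolding n_def by (intro power_mono) auto
    finally show ?thesis .
  qed
  have G0f: "finite ?Gz" and G0: "card ?Gz <= n ^ (?d - 1)"
  proof -
    have *: "finite ?Gz \<and> card ?Gz = (N + (?d - 1)) choose (?d - 1)"
      using finite_card_degree_le[of "UNIV - {k}" N] by simp
    have "(N + (?d - 1)) choose (?d - 1) <= (N + (?d - 1)) ^ (?d - 1)" by (rule choose_le_pow)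
    also have "... <= n ^ (?d - 1)" unfolding n_def by (intro power_mono) auto
    finally show "finite ?Gz" "card ?Gz <= n ^ (?d - 1)" using * by auto
  qed
  have F: "card ?F <= n ^ (?d - 1)"
  proof -
    have "card ?F <= (N + (?d - 1)) ^ (?d - 1)" unfolding card_degree_eq_UNIV by (rule choose_le_pow)
    also have "... <= n ^ (?d - 1)" unfolding n_def by (intro power_mono) auto
    finally show ?thesis .
  qed
  have G: "card ?G <= n ^ ?d" unfolding card_degree_le_UNIV n_def by (rule choose_le_pow)
  have z: "sum \<alpha> UNIV = sum \<alpha> (UNIV - {k})" if "\<alpha> k = 0" for \<alpha> :: "'d => nat"
    using that by (simp add: sum.remove[of UNIV k])
  have "special_pairs k N \<subseteq> (?Fz \<times> ?G \<union> ?G \<times> ?Fz) \<union> (?F \<times> ?Gz \<union> ?Gz \<times> ?F)"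
  proof
    fix p assume "p \<in> special_pairs k N"
    then obtain \<alpha> \<beta> where p: "p = (\<alpha>, \<beta>)" "max (sum \<alpha> UNIV) (sum \<beta> UNIV) = N" "\<alpha> k = 0 \<or> \<beta> k = 0"
      by (auto simp: special_pairs_def top_pairs_def)
    have m0: "\<gamma> \<in> ?Fz" if "\<gamma> k = 0" "sum \<gamma> UNIV = N" for \<gamma> using that z[of \<gamma>] by (auto simp: degree_eq_def)
    have m1: "\<gamma> \<in> ?Gz" if "\<gamma> k = 0" "sum \<gamma> UNIV <= N" for \<gamma> using that z[of \<gamma>] by (auto simp: degree_le_def)
    have m2: "\<gamma> \<in> ?F" if "sum \<gamma> UNIV = N" for \<gamma> using that by (auto simp: degree_eq_def)
    have m3: "\<gamma> \<in> ?G" if "sum \<gamma> UNIV <= N" for \<gamma> using that by (auto simp: degree_le_def)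
    have "(sum \<alpha> UNIV = N \<and> sum \<beta> UNIV <= N) \<or> (sum \<alpha> UNIV <= N \<and> sum \<beta> UNIV = N)" using p(2) by auto
    thus "p \<in> (?Fz \<times> ?G \<union> ?G \<times> ?Fz) \<union> (?F \<times> ?Gz \<union> ?Gz \<times> ?F)"
      using p(3) m0 m1 m2 m3 unfolding p(1) by auto
  qed
  hence "card (special_pairs k N) <= card ((?Fz \<times> ?G \<union> ?G \<times> ?Fz) \<union> (?F \<times> ?Gz \<union> ?Gz \<times> ?F))"
    by (rule card_mono[rotated]) (simp add: F0f G0f finite_degree_UNIV)
  also have "... <= card (?Fz \<times> ?G \<union> ?G \<times> ?Fz) + card (?F \<times> ?Gz \<union> ?Gz \<times> ?F)" by (rule card_Un_le)
  also have "... <= (card (?Fz \<times> ?G) + card (?G \<times> ?Fz)) + (card (?F \<times> ?Gz) + card (?Gz \<times> ?F))"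
    by (intro add_mono card_Un_le)
  also have "... = 2 * (card ?Fz * card ?G) + 2 * (card ?F * card ?Gz)" by (simp add: card_cartesian_product)
  also have "... <= 2 * (n ^ (?d - 2) * n ^ ?d) + 2 * (n ^ (?d - 1) * n ^ (?d - 1))"
    by (intro add_mono mult_left_mono mult_mono F0 F G0 G) auto
  also have "n ^ (?d - 2) * n ^ ?d = n ^ (2 * ?d - 2)"
    unfolding power_add[symmetric] by (rule arg_cong[where f="%k. n ^ k"]) (use d in arith)
  also have "n ^ (?d - 1) * n ^ (?d - 1) = n ^ (2 * ?d - 2)"
    unfolding power_add[symmetric] by (rule arg_cong[where f="%k. n ^ k"]) (use d in arith)
  finally show ?thesis by (simp add: n_def)
qed

section \<open>Dimensions and the reproducing kernel\<close>

text \<open>Counting the monomials whose larger degree is \<open>N\<close> gives the leading constant from which the constant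
  in the exponent of the final theorem arises.\<close>

lemma card_E_le:
  "real (card (E N :: 'd::finite fn set))
     <= 2 / (fact CARD('d) * fact (CARD('d) - 1)) * real (N + CARD('d)) ^ (2 * CARD('d) - 1)"
proof -
  have sub: "E N \<subseteq> cfun.span (rmono ` (top_pairs N :: (('d => nat) \<times> ('d => nat)) set))"
    using harmonic_sum_subset_top cfun.span_superset[of "E N"] unfolding span_E top_pairs_def by blast
  have "card (E N :: 'd fn set) <= card (rmono ` (top_pairs N :: (('d => nat) \<times> ('d => nat)) set))"
    using cfun.independent_span_bound[OF finite_imageI[OF finite_top_pairs] orthonormal_independent[OF orthonormal_E] sub] by blast
  also have "... <= card (top_pairs N :: (('d => nat) \<times> ('d => nat)) set)" by (rule card_image_le[OF finite_top_pairs])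
  finally have "real (card (E N :: 'd fn set)) <= real (card (top_pairs N :: (('d => nat) \<times> ('d => nat)) set))" by simp
  also have "... <= 2 / (fact CARD('d) * fact (CARD('d) - 1)) * real (N + CARD('d)) ^ (2 * CARD('d) - 1)"
    by (rule card_top_pairs_le)
  finally show ?thesis .
qed

text \<open>On the sphere \<open>\<bar>z $ k\<bar>^2 = 1 - (\<Sum>j\<noteq>k. \<bar>z $ j\<bar>^2)\<close>. Applying this repeatedly removes
  either \<open>z $ k\<close> or its conjugate from a monomial, modulo polynomials of lower level.\<close>

lemma rmono_in_span:
  fixes k :: "'d::finite"
  assumes "(\<alpha>, \<beta>) \<in> top_pairs (Suc N)"
  shows "rmono (\<alpha>, \<beta>) \<in> cfun.span (harmonic_sum N \<union> rmono ` special_pairs k (Suc N))" (is "_ \<in> ?S")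
  using assms
proof (induction "\<alpha> k" arbitrary: \<alpha> \<beta>)
  case 0
  hence "(\<alpha>, \<beta>) \<in> special_pairs k (Suc N)" by (simp add: special_pairs_def)
  thus ?case by (intro cfun.span_base) auto
next
  case (Suc a)
  show ?case
  proof (cases "\<beta> k = 0")
    case True
    hence "(\<alpha>, \<beta>) \<in> special_pairs k (Suc N)" using Suc.prems by (simp add: special_pairs_def)
    thus ?thesis by (intro cfun.span_base) auto
  next
    case False
    define \<alpha>' where "\<alpha>' = \<alpha>(k := a)"
    define \<beta>' where "\<beta>' = \<beta>(k := \<beta> k - 1)"
    have eqs: "\<alpha> = \<alpha>'(k := Suc (\<alpha>' k))" "\<beta> = \<beta>'(k := Suc (\<beta>' k))"
      using Suc(2) False by (auto simp: \<alpha>'_def \<beta>'_def)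
    have sums: "sum \<alpha> UNIV = Suc (sum \<alpha>' UNIV)" "sum \<beta> UNIV = Suc (sum \<beta>' UNIV)"
      using Suc(2) False by (auto simp: \<alpha>'_def \<beta>'_def sum.remove[of UNIV k])
    have inc: "sum (\<gamma>(j := Suc (\<gamma> j))) UNIV = Suc (sum \<gamma> UNIV)" for \<gamma> :: "'d => nat" and j
      by (simp add: sum.remove[of UNIV j])
    have top: "(\<alpha>'(j := Suc (\<alpha>' j)), \<beta>'(j := Suc (\<beta>' j))) \<in> top_pairs (Suc N)" for j
      using Suc.prems unfolding top_pairs_def by (simp add: inc sums del: fun_upd_apply)
    have prod: "bmono (\<alpha>'(j := Suc (\<alpha>' j))) (\<beta>'(j := Suc (\<beta>' j))) z = z $ j * cnj (z $ j) * bmono \<alpha>' \<beta>' z" for j z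
      by (simp only: bmono_incr mult_ac)
    have eq: "rmono (\<alpha>, \<beta>) = rmono (\<alpha>', \<beta>') - (\<Sum>j\<in>UNIV - {k}. rmono (\<alpha>'(j := Suc (\<alpha>' j)), \<beta>'(j := Suc (\<beta>' j))))"
    proof
      fix z :: "complex ^ 'd"
      have app: "(\<Sum>j\<in>J. F j) z = (\<Sum>j\<in>J. F j z)" for J and F :: "'d => 'd fn"
        by (induction J rule: infinite_finite_induct) auto
      show "rmono (\<alpha>, \<beta>) z = (rmono (\<alpha>', \<beta>') - (\<Sum>j\<in>UNIV - {k}. rmono (\<alpha>'(j := Suc (\<alpha>' j)), \<beta>'(j := Suc (\<beta>' j))))) z"
      proof (cases "z \<in> sphere 0 1")
        case True
        have "z $ k * cnj (z $ k) = 1 - (\<Sum>j\<in>UNIV - {k}. z $ j * cnj (z $ j))"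
          using sphere_norm_sq[OF True] by (simp add: sum.remove[of UNIV k] algebra_simps)
        moreover have "bmono \<alpha> \<beta> z = z $ k * cnj (z $ k) * bmono \<alpha>' \<beta>' z"
          by (subst eqs(1), subst eqs(2)) (rule prod)
        ultimately have "bmono \<alpha> \<beta> z = bmono \<alpha>' \<beta>' z - (\<Sum>j\<in>UNIV - {k}. z $ j * cnj (z $ j)) * bmono \<alpha>' \<beta>' z"
          by (simp only: left_diff_distrib mult_1_left)
        thus ?thesis using True
          by (simp only: rmono_def fst_conv snd_conv sphere_restrict_simps minus_apply fun_diff_def app prod sum_distrib_right)
      next
        case False
        thus ?thesis by (simp add: rmono_def fun_diff_def app)
      qed
    qed
    have "rmono (\<alpha>', \<beta>') \<in> harmonic_sum N"
    proof -
      have "rmono (\<alpha>', \<beta>') \<in> rb (sum \<alpha>' UNIV) (sum \<beta>' UNIV)" unfolding rmono_def rb_def by (auto intro: bmono_in_bihom)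
      moreover have "sum \<alpha>' UNIV <= N" "sum \<beta>' UNIV <= N" using Suc.prems unfolding top_pairs_def by (auto simp: sums max_def split: if_splits)
      ultimately show ?thesis using rb_subset_harmonic_sum' by blast
    qed
    hence 1: "rmono (\<alpha>', \<beta>') \<in> ?S" by (intro cfun.span_base) auto
    have "rmono (\<alpha>'(j := Suc (\<alpha>' j)), \<beta>'(j := Suc (\<beta>' j))) \<in> ?S" if "j \<in> UNIV - {k}" for j
      by (rule Suc.hyps(1)[OF _ top]) (use that in \<open>simp add: \<alpha>'_def\<close>)
    hence "(\<Sum>j\<in>UNIV - {k}. rmono (\<alpha>'(j := Suc (\<alpha>' j)), \<beta>'(j := Suc (\<beta>' j)))) \<in> ?S" by (rule cfun.span_sum)
    with 1 show ?thesis unfolding eq by (rule cfun.span_diff)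
  qed
qed

text \<open>New dimensions come only from monomials without \<open>z $ k\<close> or without its conjugate; there are fewer of
  them by a factor of order \<open>N\<close>.\<close>

lemma card_E_Suc_le:
  assumes d: "CARD('d::finite) >= 2"
  shows "card (E (Suc N) :: 'd fn set)
     <= card (E N :: 'd fn set) + 4 * (Suc N + CARD('d)) ^ (2 * CARD('d) - 2)"
proof -
  obtain k :: 'd where True by simp
  let ?S = "E N \<union> rmono ` special_pairs k (Suc N)"
  have fin: "finite ?S" using orthonormal_finite[OF orthonormal_E] finite_top_pairs
    by (auto simp: special_pairs_def intro: finite_subset)
  have "rmono ` top_pairs (Suc N) \<subseteq> cfun.span (harmonic_sum N \<union> rmono ` special_pairs k (Suc N))"
    using rmono_in_span[of _ _ N k] by auto
  also have "... \<subseteq> cfun.span ?S"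
  proof (rule cfun.span_minimal)
    have "harmonic_sum N \<subseteq> cfun.span ?S" unfolding span_E[symmetric] by (intro cfun.span_mono) auto
    thus "harmonic_sum N \<union> rmono ` special_pairs k (Suc N) \<subseteq> cfun.span ?S" by (auto intro: cfun.span_base)
  qed simp
  finally have "cfun.span (rmono ` top_pairs (Suc N)) \<subseteq> cfun.span ?S" by (rule cfun.span_minimal) simp
  hence "E (Suc N) \<subseteq> cfun.span ?S"
    using harmonic_sum_subset_top[of "Suc N"] cfun.span_superset[of "E (Suc N)"] unfolding span_E top_pairs_def by blast
  hence "card (E (Suc N) :: 'd fn set) <= card ?S"
    using cfun.independent_span_bound[OF fin orthonormal_independent[OF orthonormal_E]] by blast
  also have "... <= card (E N :: 'd fn set) + card (rmono ` special_pairs k (Suc N))" by (rule card_Un_le)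
  also have "card (rmono ` special_pairs k (Suc N)) <= card (special_pairs k (Suc N))"
    by (rule card_image_le) (use finite_top_pairs in \<open>auto simp: special_pairs_def intro: finite_subset\<close>)
  also have "... <= 4 * (Suc N + CARD('d)) ^ (2 * CARD('d) - 2)" by (rule card_special_pairs_le[OF d])
  finally show ?thesis by simp
qed

definition kernel_diag :: "nat => complex ^ 'd::finite => real" where
  "kernel_diag N w = (\<Sum>e\<in>E N. (cmod (e w))\<^sup>2)"

lemma rb_urot:
  assumes c: "cmod c = 1" "herm v v = 1" and f: "f \<in> rb m n"
  shows "(%z. f (urot c v z)) \<in> rb m n"
proof -
  obtain P where P: "P \<in> bihom_polys m n" "f = sphere_restrict P" using f by (auto simp: rb_def)
  have "(%z. f (urot c v z)) = sphere_restrict (%z. P (urot c v z))"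
    unfolding P(2) by (auto simp: sphere_restrict_def norm_urot[OF c] fun_eq_iff)
  thus ?thesis unfolding rb_def using bihom_urot[OF P(1)] by blast
qed

lemma harmonic_sum_urot:
  assumes c: "cmod c = 1" "herm v v = 1" and f: "f \<in> harmonic_sum N"
  shows "(%z. f (urot c v z)) \<in> harmonic_sum N"
  using f unfolding harmonic_sum_def
proof (induction rule: cfun.span_induct_alt)
  case base
  then show ?case using cfun.span_zero by (simp add: zero_fun_def)
next
  case (step b x y)
  then obtain m n where mn: "x \<in> harmonic_space m n" "max m n <= N" by auto
  hence "x \<in> rb m n" using harmonic_subset_rb by blast
  hence "(%z. x (urot c v z)) \<in> harmonic_sum N"
    using rb_urot[OF c] rb_subset_harmonic_sum'[of m N n] mn(2) by auto
  from cfun.span_add[OF cfun.span_scale[OF this[unfolded harmonic_sum_def], of b]] step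
  show ?case by (simp add: plus_fun_def)
qed

lemma harmonic_sum_sphere_fun: "f \<in> harmonic_sum N ==> sphere_fun f"
  unfolding span_E[symmetric] by (rule sphere_fun_span[of "E N"]) (auto intro: orthonormal_sphere_fun[OF orthonormal_E])

text \<open>The rotated basis is orthonormal too, and its values at \<open>x\<close> are its inner products with the
  reproducing kernel at \<open>x\<close>, so Bessel's inequality applies.\<close>

lemma kernel_diag_urot_le:
  fixes x v :: "complex ^ 'd::finite"
  assumes c: "cmod c = 1" "herm v v = 1"
  shows "kernel_diag N (urot c v x) <= kernel_diag N x"
proof -
  let ?U = "urot c v"
  have ipU: "ip (%z. f (?U z)) (%z. g (?U z)) = ip f g" if "sphere_fun f" "sphere_fun g" for f g
    unfolding ip_def
    by (rule integral_sphere_isometry[where f="%z. f z * cnj (g z)", OF urot_orthogonal[OF c]])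
       (intro sphere_measurable continuous_intros sphere_fun_continuous that)
  define C where "C e = (%z. e (?U z))" for e :: "'d fn"
  have EU: "C e \<in> harmonic_sum N" if "e \<in> E N" for e
    unfolding C_def using that by (intro harmonic_sum_urot[OF c]) (auto simp: span_E[symmetric] intro: cfun.span_base)
  have ipC: "ip (C e) (C e') = (if e = e' then 1 else 0)" if "e \<in> E N" "e' \<in> E N" for e e'
    unfolding C_def ipU[OF orthonormal_sphere_fun[OF orthonormal_E that(1)] orthonormal_sphere_fun[OF orthonormal_E that(2)]]
    by (rule orthonormal_ip[OF orthonormal_E that])
  have inj: "inj_on C (E N)"
  proof (rule inj_onI, rule ccontr)
    fix e e' assume e: "e \<in> E N" "e' \<in> E N" "C e = C e'" "e ~= e'"
    thus False using ipC[OF e(1,2)] ipC[OF e(1,1)] by simp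
  qed
  have on: "orthonormal (C ` E N)"
    unfolding orthonormal_def
    using orthonormal_finite[OF orthonormal_E] EU harmonic_sum_sphere_fun ipC inj by (auto simp: inj_on_eq_iff)
  define k where "k = (%z. \<Sum>e\<in>E N. cnj (e x) * e z)"
  have sk: "sphere_fun k" unfolding k_def by (intro sphere_fun_sum sphere_fun_scale orthonormal_sphere_fun[OF orthonormal_E])
  have rep: "ip f k = f x" if f: "f \<in> harmonic_sum N" for f
  proof -
    have "ip f k = (\<Sum>e\<in>E N. ip f (%z. cnj (e x) * e z))"
      unfolding k_def by (rule ip_sum_right) (auto intro: sphere_fun_scale orthonormal_sphere_fun[OF orthonormal_E] harmonic_sum_sphere_fun[OF f])
    also have "... = (\<Sum>e\<in>E N. ip f e * e x)" unfolding ip_scale_right by (simp add: mult.commute)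
    also have "... = f x" using orthonormal_expansion[OF orthonormal_E, of f N] f unfolding span_E by metis
    finally show ?thesis .
  qed
  have "kernel_diag N (?U x) = (\<Sum>e\<in>E N. (cmod (ip k (C e)))\<^sup>2)"
    unfolding kernel_diag_def
  proof (intro sum.cong refl)
    fix e :: "'d fn" assume "e \<in> E N"
    hence "ip k (C e) = cnj (e (?U x))" using rep[OF EU] ip_commute[of k "C e"] by (simp add: C_def)
    thus "(cmod (e (?U x)))\<^sup>2 = (cmod (ip k (C e)))\<^sup>2" by simp
  qed
  also have "... = (\<Sum>e\<in>C ` E N. (cmod (ip k e))\<^sup>2)" by (subst sum.reindex[OF inj]) simp
  also have "... <= (\<integral>z. (cmod (k z))\<^sup>2 \<partial>\<mu>)" by (rule bessel[OF on sk])
  also have "... = kernel_diag N x" unfolding k_def parseval[OF orthonormal_E] kernel_diag_def by simp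
  finally show ?thesis .
qed

lemma urot_transitive:
  fixes x y :: "complex ^ 'd::finite"
  assumes x: "norm x = 1" and y: "norm y = 1" and ne: "x ~= y"
  obtains c v where "cmod c = 1" "herm v v = 1" "urot c v x = y"
proof -
  define u where "u = y - x"
  define s where "s = 1 / norm u"
  define v where "v = s *\<^sub>R u"
  define a where "a = herm x y"
  define c where "c = - (1 - cnj a) / (1 - a)"
  have nu: "norm u > 0" using ne by (simp add: u_def)
  have xx: "herm x x = 1" "herm y y = 1" using x y by (simp_all add: herm_self)
  have hu: "herm u u = 2 - a - cnj a"
    using xx herm_commute[of y x] by (simp add: herm_def u_def a_def algebra_simps sum.distrib sum_subtractf)
  have hxu: "herm x u = a - 1"
    using xx by (simp add: herm_def u_def a_def algebra_simps sum.distrib sum_subtractf)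
  have hupos: "herm u u = of_real ((norm u)\<^sup>2)" by (rule herm_self)
  have a1: "a ~= 1" using hu hupos nu by auto
  have cc: "cmod c = 1"
  proof -
    have "cmod (1 - cnj a) = cmod (1 - a)" by (metis complex_cnj_diff complex_cnj_one complex_mod_cnj)
    thus ?thesis using a1 norm_minus_commute[of "cnj a" 1] by (simp add: c_def norm_divide)
  qed
  have vv: "herm v v = 1"
  proof -
    have "norm v = 1" using nu by (simp add: v_def s_def)
    thus ?thesis by (simp add: herm_self)
  qed
  have cm: "(c - 1) * (a - 1) = herm u u"
  proof -
    have "c * (1 - a) = - (1 - cnj a)" using a1 by (simp add: c_def)
    moreover have "(c - 1) * (a - 1) = - (c * (1 - a)) + (1 - a)" by (simp add: algebra_simps)
    ultimately show ?thesis unfolding hu by simp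
  qed
  have "urot c v x = y"
  proof (rule vec_eq_iff[THEN iffD2], rule allI)
    fix j
    have vj: "v $ j = of_real s * u $ j" by (simp add: v_def scaleR_conv_of_real[of _ "_::complex"])
    have hv: "herm x v = of_real s * herm x u"
      by (simp add: herm_def v_def scaleR_conv_of_real[of _ "_::complex"] sum_distrib_left mult_ac)
    have "(c - 1) * herm x v * v $ j = of_real s * of_real s * ((c - 1) * (a - 1)) * u $ j"
      unfolding vj hv hxu by (simp add: mult_ac)
    also have "... = of_real (s * s * (norm u)\<^sup>2) * u $ j" unfolding cm hupos by simp
    also have "s * s * (norm u)\<^sup>2 = 1" using nu by (simp add: s_def power2_eq_square)
    finally show "urot c v x $ j = y $ j" by (simp add: u_def)
  qed
  with cc vv show thesis by (rule that)
qed

lemma measure_sphere_pos: "measure \<mu> (sphere (0 :: complex ^ 'd::finite) 1) > 0"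
proof -
  have "emeasure \<mu> (UNIV \<inter> sphere (0 :: complex ^ 'd) 1) > 0"
    by (rule emeasure_sphere_open_pos[of UNIV "axis undefined 1"]) auto
  thus ?thesis by (simp add: sphere.emeasure_eq_measure)
qed

text \<open>Constant by transitivity, with the number of basis elements as integral.\<close>

lemma kernel_diag_eq:
  fixes w :: "complex ^ 'd::finite"
  assumes w: "norm w = 1"
  shows "kernel_diag N w = card (E N :: 'd fn set) / measure \<mu> (sphere (0 :: complex ^ 'd) 1)"
proof -
  have le: "kernel_diag N y <= kernel_diag N x" if xy: "norm x = 1" "norm y = 1" for x y :: "complex ^ 'd"
  proof (cases "x = y")
    case False
    obtain c v where "cmod c = 1" "herm v v = 1" "urot c v x = y" by (rule urot_transitive[OF xy False])
    thus ?thesis using kernel_diag_urot_le[of c v N x] by simp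
  qed simp
  have const: "kernel_diag N x = kernel_diag N w" if "norm x = 1" for x :: "complex ^ 'd" using le[OF that w] le[OF w that] by simp
  have int: "integrable \<mu> (%z. (cmod (e z))\<^sup>2)" if "e \<in> E N" for e :: "'d fn"
    using integrable_norm[OF ip_integrable[OF orthonormal_sphere_fun[OF orthonormal_E that] orthonormal_sphere_fun[OF orthonormal_E that]]]
    by (simp add: norm_mult power2_eq_square)
  have "(\<integral>z. kernel_diag N (z :: complex ^ 'd) \<partial>\<mu>) = (\<Sum>e\<in>E N. (\<integral>z. (cmod (e (z :: complex ^ 'd)))\<^sup>2 \<partial>\<mu>))"
    unfolding kernel_diag_def by (rule Bochner_Integration.integral_sum) (rule int)
  also have "... = (\<Sum>e\<in>(E N :: 'd fn set). 1)"
  proof (intro sum.cong refl)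
    fix e :: "'d fn" assume "e \<in> E N"
    hence "complex_of_real (\<integral>z. (cmod (e z))\<^sup>2 \<partial>\<mu>) = 1"
      using orthonormal_ip[OF orthonormal_E, of e N e] unfolding ip_self by simp
    thus "(\<integral>z. (cmod (e z))\<^sup>2 \<partial>\<mu>) = 1" by (simp only: of_real_eq_1_iff)
  qed
  finally have "(\<integral>z. kernel_diag N (z :: complex ^ 'd) \<partial>\<mu>) = card (E N :: 'd fn set)" by simp
  moreover have "(\<integral>z. kernel_diag N (z :: complex ^ 'd) \<partial>\<mu>) = (\<integral>z. kernel_diag N w \<partial>(\<mu> :: (complex ^ 'd) measure))"
    by (rule Bochner_Integration.integral_cong[OF refl]) (use const in simp)
  moreover have "... = measure \<mu> (sphere (0 :: complex ^ 'd) 1) * kernel_diag N w" by simp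
  ultimately show ?thesis using measure_sphere_pos[where 'd='d] by (simp add: field_simps)
qed

section \<open>Projections onto harmonics and completeness\<close>

lemma integrable_mult_sphere_fun:
  fixes \<phi> :: "'a::euclidean_space => complex"
  assumes \<phi>: "integrable \<mu> \<phi>" and g: "continuous_on (sphere 0 1) g"
  shows "integrable \<mu> (%z. \<phi> z * g z)"
proof -
  obtain B where B: "!!x. x \<in> sphere 0 1 ==> norm (g x) <= B" using sphere_bounded[OF g] by blast
  have [measurable]: "g \<in> borel_measurable \<mu>" by (rule sphere_measurable[OF g])
  have [measurable]: "\<phi> \<in> borel_measurable \<mu>" using \<phi> by auto
  show ?thesis
  proof (rule Bochner_Integration.integrable_bound)
    show "integrable \<mu> (%z. B *\<^sub>R \<phi> z)" using \<phi> by simp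
    show "(%z. \<phi> z * g z) \<in> borel_measurable \<mu>" by measurable
    show "AE z in \<mu>. norm (\<phi> z * g z) <= norm (B *\<^sub>R \<phi> z)"
    proof (rule AE_I2)
      fix z :: 'a assume "z \<in> space \<mu>"
      hence b: "norm (g z) <= B" using B by simp
      hence "norm (\<phi> z * g z) <= norm (\<phi> z) * B" unfolding norm_mult by (intro mult_left_mono) auto
      also have "... <= norm (B *\<^sub>R \<phi> z)" by (simp add: mult.commute mult_right_mono)
      finally show "norm (\<phi> z * g z) <= norm (B *\<^sub>R \<phi> z)" .
    qed
  qed
qed

lemma ip_sum_right_integrable:
  assumes \<phi>: "integrable \<mu> \<phi>" and F: "!!i. i \<in> I ==> sphere_fun (F i)"
  shows "ip \<phi> (%z. \<Sum>i\<in>I. c i * F i z) = (\<Sum>i\<in>I. cnj (c i) * ip \<phi> (F i))"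
proof -
  have int: "integrable \<mu> (%z. cnj (c i) * (\<phi> z * cnj (F i z)))" if "i \<in> I" for i
    by (intro integrable_mult_right integrable_mult_sphere_fun[OF \<phi>] continuous_intros sphere_fun_continuous F that)
  have "ip \<phi> (%z. \<Sum>i\<in>I. c i * F i z) = (\<integral>z. (\<Sum>i\<in>I. cnj (c i) * (\<phi> z * cnj (F i z))) \<partial>\<mu>)"
    unfolding ip_def by (simp add: sum_distrib_left mult_ac)
  also have "... = (\<Sum>i\<in>I. (\<integral>z. cnj (c i) * (\<phi> z * cnj (F i z)) \<partial>\<mu>))"
    by (rule Bochner_Integration.integral_sum) (rule int)
  finally show ?thesis by (simp add: ip_def)
qed

lemma ip_cong_AE:
  assumes "AE z in \<mu>. f z = g z" "f \<in> borel_measurable \<mu>" "g \<in> borel_measurable \<mu>" "sphere_fun h"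
  shows "ip f h = ip g h"
  unfolding ip_def
proof (rule integral_cong_AE)
  have [measurable]: "(%z. cnj (h z)) \<in> borel_measurable \<mu>"
    by (intro sphere_measurable continuous_intros sphere_fun_continuous assms)
  show "(%z. f z * cnj (h z)) \<in> borel_measurable \<mu>" "(%z. g z * cnj (h z)) \<in> borel_measurable \<mu>"
    using assms(2,3) by measurable
qed (use assms(1) in auto)

text \<open>Uniqueness in the definite description follows since the difference of two kernels is orthogonal
  to itself.\<close>

lemma reproducing_kernel_eq:
  fixes w :: "complex ^ 'd::finite"
  shows "reproducing_kernel m n w = (%z. \<Sum>e\<in>hbasis m n. cnj (e w) * e z)"
  unfolding reproducing_kernel_def
proof (rule the_equality)
  let ?Z = "%z. \<Sum>e\<in>hbasis m n. cnj (e w) * e z"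
  note sf = orthonormal_sphere_fun[OF hbasis(1)]
  have hsf: "sphere_fun f" if "f \<in> harmonic_space m n" for f :: "'d fn"
    using that harmonic_subset_rb rb_sphere_fun by blast
  have Z: "?Z \<in> harmonic_space m n" unfolding hbasis(2)[symmetric] by (rule span_sumI) simp
  have rep: "f w = ip f ?Z" if f: "f \<in> harmonic_space m n" for f
  proof -
    have "ip f ?Z = (\<Sum>e\<in>hbasis m n. ip f (%z. cnj (e w) * e z))"
      by (rule ip_sum_right) (use hsf[OF f] sf in \<open>auto intro: sphere_fun_scale\<close>)
    also have "... = (\<Sum>e\<in>hbasis m n. ip f e * e w)" unfolding ip_scale_right by (simp add: mult.commute)
    also have "... = f w" using orthonormal_expansion[OF hbasis(1), of f m n] f unfolding hbasis(2) by metis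
    finally show ?thesis by simp
  qed
  show "?Z \<in> harmonic_space m n \<and> (\<forall>f\<in>harmonic_space m n. f w = (\<integral>z. f z * cnj (?Z z) \<partial>\<mu>))"
    using Z rep by (simp add: ip_def)
  fix Y assume "Y \<in> harmonic_space m n \<and> (\<forall>f\<in>harmonic_space m n. f w = (\<integral>z. f z * cnj (Y z) \<partial>\<mu>))"
  hence Y: "Y \<in> harmonic_space m n" "!!f. f \<in> harmonic_space m n ==> f w = ip f Y" by (auto simp: ip_def)
  define D where "D = (%z. Y z - ?Z z)"
  have DH: "D \<in> harmonic_space m n"
    using cfun.subspace_diff[OF subspace_harmonic Y(1) Z] by (simp add: D_def fun_diff_def)
  have hD: "ip D g = ip Y g - ip ?Z g" if "sphere_fun g" for g
    unfolding D_def by (rule ip_diff_left[OF hsf[OF Y(1)] hsf[OF Z] that])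
  have "ip D D = cnj (ip D Y) - cnj (ip D ?Z)"
    unfolding hD[OF hsf[OF DH]] ip_commute[of Y D] ip_commute[of ?Z D] ..
  also have "ip D Y = ip D ?Z" using Y(2)[OF DH] rep[OF DH] by simp
  finally have "ip D D = 0" by simp
  hence "D = (%z. 0)" using ip_self_eq_0[OF hsf[OF DH]] by blast
  thus "Y = ?Z" by (simp add: D_def fun_eq_iff)
qed

lemma harmonic_proj_eq:
  assumes "integrable \<mu> \<phi>"
  shows "harmonic_proj m n \<phi> w = (\<Sum>e\<in>hbasis m n. ip \<phi> e * e w)"
proof -
  have "harmonic_proj m n \<phi> w = ip \<phi> (%z. \<Sum>e\<in>hbasis m n. cnj (e w) * e z)"
    unfolding harmonic_proj_def reproducing_kernel_eq ip_def ..
  also have "... = (\<Sum>e\<in>hbasis m n. cnj (cnj (e w)) * ip \<phi> e)"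
    by (rule ip_sum_right_integrable[OF assms orthonormal_sphere_fun[OF hbasis(1)]])
  finally show ?thesis by (simp add: mult.commute)
qed

text \<open>All polynomials in the coordinates and their conjugates, the algebra to which the
  Stone-Weierstrass theorem applies.\<close>

definition spoly :: "'d::finite fn set" where
  "spoly = cfun.span (\<Union>m. \<Union>n. bihom_polys m n)"

lemma spoly_bihom: "f \<in> bihom_polys m n ==> f \<in> spoly"
  unfolding spoly_def by (intro cfun.span_base) auto

lemma spoly_add: "f \<in> spoly ==> g \<in> spoly ==> (%z. f z + g z) \<in> spoly"
  unfolding spoly_def using cfun.span_add by (fastforce simp: plus_fun_def)

lemma spoly_scale: "f \<in> spoly ==> (%z. c * f z) \<in> spoly"
  unfolding spoly_def by (rule cfun.span_scale)

lemma spoly_induct [consumes 1, case_names zero step]: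
  assumes "f \<in> spoly" "h (%z. 0)"
    "!!c m n f g. f \<in> bihom_polys m n ==> g \<in> spoly ==> h g ==> h (%z. c * f z + g z)"
  shows "h f"
proof -
  have "f \<in> spoly \<and> h f"
    using assms(1) unfolding spoly_def
  proof (induction rule: cfun.span_induct_alt)
    case base
    then show ?case using assms(2) cfun.span_zero by (simp add: zero_fun_def)
  next
    case (step c x y)
    then obtain m n where x: "x \<in> bihom_polys m n" by blast
    have "y \<in> spoly" "h y" using step unfolding spoly_def by auto
    with assms(3)[OF x this, of c] spoly_add[OF spoly_scale[OF spoly_bihom[OF x], of c] this(1)]
    show ?case by (simp add: plus_fun_def spoly_def)
  qed
  thus ?thesis by blast
qed

lemma spoly_sum: "(!!i. i \<in> I ==> f i \<in> spoly) ==> (%z. \<Sum>i\<in>I. f i z) \<in> spoly"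
  by (induction I rule: infinite_finite_induct) (auto intro: spoly_add spoly_bihom[OF bihom_zero])

lemma spoly_mult:
  assumes f: "f \<in> spoly" and g: "g \<in> spoly"
  shows "(%z. f z * g z) \<in> spoly"
  using f
proof (induction rule: spoly_induct)
  case (step c m n f1 f2)
  have "(%z. f1 z * g z) \<in> spoly"
    using g
  proof (induction rule: spoly_induct)
    case (step c m' n' g1 g2)
    from spoly_add[OF spoly_scale[OF spoly_bihom[OF bihom_mult[OF \<open>f1 \<in> bihom_polys m n\<close> step(1)]], of c] step(3)]
    show ?case by (simp add: algebra_simps)
  qed (simp add: spoly_bihom[OF bihom_zero])
  from spoly_add[OF spoly_scale[OF this, of c] step(3)] show ?case by (simp add: algebra_simps)
qed (simp add: spoly_bihom[OF bihom_zero])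

lemma spoly_real_polynomial:
  fixes p :: "complex ^ 'd::finite => real"
  assumes "real_polynomial_function p"
  shows "(%z. complex_of_real (p z)) \<in> spoly"
  using assms
proof (induction rule: real_polynomial_function.induct)
  case (linear f)
  have lin: "linear f" using linear by (rule bounded_linear.linear)
  define a where "a j = complex_of_real (f (axis j 1) / 2)" for j
  define b where "b j = complex_of_real (f (axis j \<i>) / 2)" for j
  have f_eq: "complex_of_real (f z) = (\<Sum>j\<in>UNIV. (a j - \<i> * b j) * z $ j + (a j + \<i> * b j) * cnj (z $ j))" for z
  proof -
    have "z = (\<Sum>j\<in>UNIV. Re (z $ j) *\<^sub>R axis j 1 + Im (z $ j) *\<^sub>R axis j \<i>)"
    proof (rule vec_eq_iff[THEN iffD2], rule allI)
      fix i
      have "(\<Sum>j\<in>UNIV. Re (z $ j) *\<^sub>R axis j 1 + Im (z $ j) *\<^sub>R axis j \<i>) $ i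
         = (\<Sum>j\<in>UNIV. if j = i then Re (z $ i) *\<^sub>R 1 + Im (z $ i) *\<^sub>R \<i> else 0)"
        unfolding sum_component vector_add_component vector_scaleR_component by (intro sum.cong refl) (simp add: axis_def)
      also have "... = z $ i" by (simp add: complex_eq_iff)
      finally show "z $ i = (\<Sum>j\<in>UNIV. Re (z $ j) *\<^sub>R axis j 1 + Im (z $ j) *\<^sub>R axis j \<i>) $ i" by simp
    qed
    hence "f z = f (\<Sum>j\<in>UNIV. Re (z $ j) *\<^sub>R axis j 1 + Im (z $ j) *\<^sub>R axis j \<i>)" by simp
    also have "... = (\<Sum>j\<in>UNIV. Re (z $ j) * f (axis j 1) + Im (z $ j) * f (axis j \<i>))"
      by (simp add: linear_sum[OF lin] linear_add[OF lin] linear_scale[OF lin])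
    finally have "complex_of_real (f z) = (\<Sum>j\<in>UNIV. of_real (Re (z $ j) * f (axis j 1) + Im (z $ j) * f (axis j \<i>)))"
      by simp
    also have "... = (\<Sum>j\<in>UNIV. (a j - \<i> * b j) * z $ j + (a j + \<i> * b j) * cnj (z $ j))"
      by (intro sum.cong refl) (simp add: complex_eq_iff a_def b_def)
    finally show ?thesis .
  qed
  have "(%z. (\<Sum>j\<in>UNIV. (a j - \<i> * b j) * z $ j + (a j + \<i> * b j) * cnj (z $ j))) \<in> spoly"
    by (intro spoly_sum spoly_add spoly_scale spoly_bihom[OF bihom_coord] spoly_bihom[OF bihom_coord_cnj])
  thus ?case unfolding f_eq .
next
  case (const c)
  show ?case by (rule spoly_bihom[OF bihom_const])
next
  case (add f g)
  thus ?case using spoly_add by simp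
next
  case (mult f g)
  thus ?case using spoly_mult by simp
qed

context
  fixes \<psi> :: "'d::finite fn"
  assumes \<psi>: "integrable \<mu> \<psi>"
    and zero: "!!m n e. e \<in> hbasis m n ==> ip \<psi> e = 0"
begin

text \<open>In this context \<open>\<psi>\<close> is orthogonal to all harmonics and thus to all polynomials; the next lemmas
  extend this to continuous functions, to indicators of closed sets, and to Borel sets.\<close>

lemma complete_spoly:
  assumes "f \<in> spoly"
  shows "continuous_on S f \<and> (\<integral>z. \<psi> z * f z \<partial>\<mu>) = 0"
  using assms
proof (induction rule: spoly_induct)
  case (step c m n f g)
  have fc: "continuous_on S f" for S by (rule bihom_continuous[OF step(1)])
  have g_cont: "continuous_on (sphere 0 1) g" using step(2)
    by (induction rule: spoly_induct) (auto intro!: continuous_on_add continuous_on_mult continuous_on_const intro: bihom_continuous)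
  have "sphere_restrict (%z. cnj (f z)) \<in> rb n m" unfolding rb_def using bihom_cnj[OF step(1)] by blast
  hence "sphere_restrict (%z. cnj (f z)) \<in> cfun.span (E (max n m))"
    unfolding span_E using rb_subset_harmonic_sum by blast
  then obtain b where b: "sphere_restrict (%z. cnj (f z)) = (%z. \<Sum>e\<in>E (max n m). b e * e z)"
    using span_sum_representation[OF orthonormal_finite[OF orthonormal_E]] by blast
  have "ip \<psi> (sphere_restrict (%z. cnj (f z))) = 0"
    unfolding b using zero
    by (subst ip_sum_right_integrable[OF \<psi> orthonormal_sphere_fun[OF orthonormal_E]]) (auto intro!: sum.neutral simp: E_def)
  moreover have "ip \<psi> (sphere_restrict (%z. cnj (f z))) = (\<integral>z. \<psi> z * f z \<partial>\<mu>)"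
    unfolding ip_def by (rule Bochner_Integration.integral_cong) (auto simp: sphere_restrict_def)
  ultimately have "(\<integral>z. \<psi> z * f z \<partial>\<mu>) = 0" by simp
  moreover have "(\<integral>z. \<psi> z * (c * f z + g z) \<partial>\<mu>)
     = (\<integral>z. c * (\<psi> z * f z) + \<psi> z * g z \<partial>\<mu>)" by (simp add: algebra_simps)
  moreover have "... = c * (\<integral>z. \<psi> z * f z \<partial>\<mu>) + (\<integral>z. \<psi> z * g z \<partial>\<mu>)"
    using integrable_mult_sphere_fun[OF \<psi> fc] integrable_mult_sphere_fun[OF \<psi> g_cont] by simp
  ultimately show ?case using step(3) fc by (auto intro!: continuous_intros)
qed simp

lemma complete_continuous:
  fixes g :: "complex ^ 'd => real"
  assumes g: "continuous_on (sphere 0 1) g"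
  shows "(\<integral>z. \<psi> z * of_real (g z) \<partial>\<mu>) = 0"
proof -
  define I where "I = (\<integral>z. norm (\<psi> z) \<partial>\<mu>)"
  have I0: "I >= 0" unfolding I_def by (intro Bochner_Integration.integral_nonneg) auto
  have "norm (\<integral>z. \<psi> z * of_real (g z) \<partial>\<mu>) <= e * I" if e: "e > 0" for e
  proof -
    \<comment> \<open>Stone-Weierstrass; the error is integrated against \<open>\<psi>\<close>\<close>
    obtain p where p: "real_polynomial_function p" "!!z. z \<in> sphere 0 1 ==> \<bar>g z - p z\<bar> < e"
      using Stone_Weierstrass_real_polynomial_function[OF compact_sphere g e] by blast
    note sp = complete_spoly[OF spoly_real_polynomial[OF p(1)], of "sphere 0 1"]
    have gc: "continuous_on (sphere 0 1) (%z. complex_of_real (g z))" by (intro continuous_intros g)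
    have int1: "integrable \<mu> (%z. \<psi> z * of_real (g z))" by (rule integrable_mult_sphere_fun[OF \<psi> gc])
    have int2: "integrable \<mu> (%z. \<psi> z * of_real (p z))" by (rule integrable_mult_sphere_fun[OF \<psi>]) (use sp in blast)
    have "(\<integral>z. \<psi> z * of_real (g z) \<partial>\<mu>) = (\<integral>z. \<psi> z * of_real (g z) - \<psi> z * of_real (p z) \<partial>\<mu>)"
      using int1 int2 sp by simp
    also have "norm ... <= (\<integral>z. norm (\<psi> z * of_real (g z) - \<psi> z * of_real (p z)) \<partial>\<mu>)"
      by (rule integral_norm_bound)
    also have "... <= (\<integral>z. e * norm (\<psi> z) \<partial>\<mu>)"
    proof (rule integral_mono)
      show "integrable \<mu> (%z. norm (\<psi> z * of_real (g z) - \<psi> z * of_real (p z)))" using int1 int2 by simp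
      show "integrable \<mu> (%z. e * norm (\<psi> z))" using \<psi> by simp
      fix z :: "complex ^ 'd" assume "z \<in> space \<mu>"
      hence "\<bar>g z - p z\<bar> <= e" using p(2)[of z] by simp
      moreover have "\<psi> z * of_real (g z) - \<psi> z * of_real (p z) = \<psi> z * of_real (g z - p z)" by (simp add: algebra_simps)
      ultimately show "norm (\<psi> z * of_real (g z) - \<psi> z * of_real (p z)) <= e * norm (\<psi> z)"
        using mult_left_mono[of "\<bar>g z - p z\<bar>" e "norm (\<psi> z)"] by (simp add: norm_mult mult.commute del: of_real_diff)
    qed
    also have "... = e * I" by (simp add: I_def)
    finally show ?thesis .
  qed
  note H = this
  have "norm (\<integral>z. \<psi> z * of_real (g z) \<partial>\<mu>) <= 0 + e" if "e > 0" for e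
  proof -
    have "e / (I + 1) * I <= e" using that I0 by (simp add: field_simps)
    moreover have "norm (\<integral>z. \<psi> z * of_real (g z) \<partial>\<mu>) <= e / (I + 1) * I"
      using that I0 by (intro H) simp
    ultimately show ?thesis by simp
  qed
  hence "norm (\<integral>z. \<psi> z * of_real (g z) \<partial>\<mu>) <= 0" by (rule field_le_epsilon)
  thus ?thesis by simp
qed

lemma complete_closed:
  fixes C :: "(complex ^ 'd) set"
  assumes C: "closed C"
  shows "(\<integral>z. indicator C z *\<^sub>R \<psi> z \<partial>\<mu>) = 0"
proof (cases "C = {}")
  case False
  define g where "g k z = max 0 (1 - real k * infdist z C)" for k z
  have gc: "continuous_on S (g k)" for k S unfolding g_def by (intro continuous_intros)
  have [measurable]: "\<psi> \<in> borel_measurable \<mu>" using \<psi> by auto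
  have lim: "(%k. \<psi> z * of_real (g k z)) \<longlonglongrightarrow> indicator C z *\<^sub>R \<psi> z" for z
  proof (cases "z \<in> C")
    case True
    thus ?thesis by (simp add: g_def)
  next
    case False
    hence pos: "infdist z C > 0" using C \<open>C ~= {}\<close> in_closed_iff_infdist_zero[of C z] infdist_nonneg[of z C] by auto
    obtain K where K: "real K * infdist z C > 1" using reals_Archimedean3[OF pos] by blast
    have "eventually (%k. \<psi> z * of_real (g k z) = 0) sequentially"
      using eventually_ge_at_top[of K]
    proof eventually_elim
      case (elim k)
      have "real K * infdist z C <= real k * infdist z C" using elim pos by (intro mult_right_mono) auto
      thus ?case using K by (simp add: g_def)
    qed
    thus ?thesis using False by (simp add: tendsto_eventually)
  qed
  have "(%k. \<integral>z. \<psi> z * of_real (g k z) \<partial>\<mu>) \<longlonglongrightarrow> (\<integral>z. indicator C z *\<^sub>R \<psi> z \<partial>\<mu>)"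
  proof (rule integral_dominated_convergence[where w="%z. norm (\<psi> z)"])
    have "C \<inter> sphere 0 1 \<in> sets \<mu>" using C by (auto simp: sets_sphere_measure_iff)
    hence "(%z. indicator (C \<inter> sphere 0 1) z *\<^sub>R \<psi> z) \<in> borel_measurable \<mu>" by measurable
    thus "(%z. indicator C z *\<^sub>R \<psi> z) \<in> borel_measurable \<mu>"
      by (rule measurable_cong[THEN iffD1, rotated]) (auto simp: indicator_def)
    show "(%z. \<psi> z * of_real (g k z)) \<in> borel_measurable \<mu>" for k
      using borel_measurable_integrable[OF integrable_mult_sphere_fun[OF \<psi>, of "%z. of_real (g k z)"]] gc by (auto intro!: continuous_intros)
    show "AE z in \<mu>. norm (\<psi> z * of_real (g k z)) <= norm (\<psi> z)" for k
    proof (rule AE_I2)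
      fix z
      have "\<bar>g k z\<bar> <= 1" by (simp add: g_def infdist_nonneg)
      thus "norm (\<psi> z * of_real (g k z)) <= norm (\<psi> z)" by (simp add: norm_mult mult_left_le)
    qed
  qed (use lim \<psi> in auto)
  moreover have "(\<integral>z. \<psi> z * of_real (g k z) \<partial>\<mu>) = 0" for k by (rule complete_continuous[OF gc])
  ultimately show ?thesis by (simp add: LIMSEQ_const_iff)
qed simp

lemma complete_AE: "AE z in \<mu>. \<psi> z = 0"
proof (rule sphere.density_zero[OF \<psi>])
  fix A :: "(complex ^ 'd) set" assume A: "A \<in> sets \<mu>"
  let ?G = "{C :: (complex ^ 'd) set. closed C \<and> C \<subseteq> sphere 0 1}"
  have gen: "sets (\<mu> :: (complex ^ 'd) measure) = sigma_sets (sphere 0 1) ?G"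
  proof -
    have "sets (\<mu> :: (complex ^ 'd) measure) = (\<inter>) (sphere 0 1) ` sigma_sets UNIV (Collect closed)"
      unfolding sets_sphere_measure sets_restrict_space borel_eq_closed by simp
    also have "... = sigma_sets (sphere 0 1) ((\<inter>) (sphere 0 1) ` Collect closed)"
      by (rule sigma_sets_Int) auto
    also have "(\<inter>) (sphere 0 1) ` Collect closed = ?G"
    proof (intro equalityI subsetI)
      fix C assume "C \<in> ?G"
      thus "C \<in> (\<inter>) (sphere 0 1) ` Collect closed" by (intro image_eqI[of _ _ C]) auto
    qed auto
    finally show ?thesis .
  qed
  have stable: "Int_stable ?G" by (auto simp: Int_stable_def)
  have sub: "?G \<subseteq> Pow (sphere 0 1)" by auto
  have si: "set_integrable \<mu> A \<psi>" if "A \<in> sets \<mu>" for A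
    unfolding set_integrable_def by (rule integrable_mult_indicator[OF that \<psi>])
  have whole: "set_lebesgue_integral \<mu> (sphere 0 1) \<psi> = 0"
    unfolding set_lebesgue_integral_def by (rule complete_closed) simp
  have "A \<in> sigma_sets (sphere 0 1) ?G" using A gen by simp
  with stable sub show "set_lebesgue_integral \<mu> A \<psi> = 0"
  proof (induction rule: sigma_sets_induct_disjoint)
    case (basic A)
    thus ?case unfolding set_lebesgue_integral_def by (intro complete_closed) auto
  next
    case empty
    show ?case by (simp add: set_lebesgue_integral_def)
  next
    case (compl A)
    have As: "A \<in> sets \<mu>" using compl gen by simp
    have Bs: "sphere 0 1 - A \<in> sets \<mu>" using sets.compl_sets[OF As] by simp
    have "set_lebesgue_integral \<mu> (A \<union> (sphere 0 1 - A)) \<psi>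
       = set_lebesgue_integral \<mu> A \<psi> + set_lebesgue_integral \<mu> (sphere 0 1 - A) \<psi>"
      by (rule set_integral_Un) (use si[OF As] si[OF Bs] in auto)
    moreover have "A \<union> (sphere 0 1 - A) = sphere 0 1" using As by (auto simp: sets_sphere_measure_iff)
    ultimately show ?case using compl whole by simp
  next
    case (union F)
    have Fs: "F i \<in> sets \<mu>" for i using union gen by auto
    have "set_lebesgue_integral \<mu> (\<Union>i. F i) \<psi> = (\<Sum>i. set_lebesgue_integral \<mu> (F i) \<psi>)"
    proof (rule lebesgue_integral_countable_add[OF Fs])
      show "F i \<inter> F j = {}" if "i ~= j" for i j using union(1) that by (auto simp: disjoint_family_on_def)
      show "set_integrable \<mu> (\<Union>i. F i) \<psi>" by (rule si[OF sets.countable_UN]) (use Fs in auto)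
    qed
    thus ?case using union by simp
  qed
qed

end

section \<open>Expansion of a multiplier operator by shells\<close>

definition shell :: "nat => 'd::finite fn set" where
  "shell j = (\<Union>(m, n)\<in>{(m, n). max m n = j}. hbasis m n)"

text \<open>The orthogonal projection onto the span of a shell, for integrable \<open>\<phi>\<close>.\<close>

definition Q :: "nat => ('d::finite fn) => 'd fn" where
  "Q j \<phi> w = (\<Sum>e\<in>shell j. ip \<phi> e * e w)"

lemma shell_subset_E: "j <= N ==> shell j \<subseteq> E N"
proof
  fix e assume "j <= N" "e \<in> shell j"
  then obtain m n where "e \<in> hbasis m n" "m <= N" "n <= N" by (auto simp: shell_def)
  thus "e \<in> E N" unfolding E_def by blast
qed

lemma shell_disjoint: "e \<in> shell i ==> e \<in> shell j ==> i = j"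
  using hbasis_unique by (fastforce simp: shell_def)

lemma E_eq_shell: "(E N :: 'd::finite fn set) = (\<Union>j\<le>N. shell j)"
proof
  show "(E N :: 'd fn set) \<subseteq> (\<Union>j\<le>N. shell j)"
  proof
    fix e :: "'d fn" assume "e \<in> E N"
    then obtain m n where "m <= N" "n <= N" "e \<in> hbasis m n" by (auto simp: E_def)
    thus "e \<in> (\<Union>j\<le>N. shell j)" by (intro UN_I[of "max m n"]) (auto simp: shell_def)
  qed
  show "(\<Union>j\<le>N. shell j) \<subseteq> (E N :: 'd fn set)"
    by (intro UN_least shell_subset_E) simp
qed

lemma orthonormal_shell: "orthonormal (shell j)"
  by (rule orthonormal_subset[OF orthonormal_E shell_subset_E[OF order_refl]])

lemma finite_shell: "finite (shell j)"
  by (rule orthonormal_finite[OF orthonormal_shell])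

lemma shell_sphere_fun: "e \<in> shell j ==> sphere_fun e"
  by (rule orthonormal_sphere_fun[OF orthonormal_shell])

lemma E_Suc:
  shows "(E (Suc N) :: 'd::finite fn set) = E N \<union> shell (Suc N)"
    and "(E N :: 'd fn set) \<inter> shell (Suc N) = {}"
proof -
  show "(E (Suc N) :: 'd fn set) = E N \<union> shell (Suc N)" unfolding E_eq_shell by (auto simp: le_Suc_eq)
  show "(E N :: 'd fn set) \<inter> shell (Suc N) = {}"
  proof (intro equals0I)
    fix e :: "'d fn" assume e: "e \<in> E N \<inter> shell (Suc N)"
    then obtain j where "j <= N" "e \<in> shell j" unfolding E_eq_shell by auto
    thus False using shell_disjoint[of e j "Suc N"] e by auto
  qed
qed

lemma sum_E: "(\<Sum>e\<in>E N. F e) = (\<Sum>j\<le>N. \<Sum>e\<in>shell j. F e)"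
  unfolding E_eq_shell by (rule sum.UNION_disjoint) (auto simp: finite_shell dest: shell_disjoint)

lemma sum_E_diff:
  fixes F :: "('d::finite fn) => 'b::comm_monoid_add"
  assumes "N <= M"
  shows "(\<Sum>e\<in>E M - E N. F e) = (\<Sum>j\<in>{N<..M}. \<Sum>e\<in>shell j. F e)"
proof -
  have "E M - E N = (\<Union>j\<in>{N<..M}. (shell j :: 'd fn set))"
  proof (intro equalityI subsetI)
    fix e :: "'d fn" assume "e \<in> E M - E N"
    then obtain j where j: "j <= M" "e \<in> shell j" "e \<notin> E N" unfolding E_eq_shell[of M] by auto
    hence "\<not> j <= N" using shell_subset_E by blast
    thus "e \<in> (\<Union>j\<in>{N<..M}. shell j)" using j by auto
  next
    fix e :: "'d fn" assume "e \<in> (\<Union>j\<in>{N<..M}. shell j)"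
    then obtain j where j: "N < j" "j <= M" "e \<in> shell j" by auto
    have "e \<notin> E N" unfolding E_eq_shell using shell_disjoint[OF j(3)] j(1) by fastforce
    thus "e \<in> E M - E N" using shell_subset_E[OF j(2)] j(3) by blast
  qed
  thus ?thesis by (simp only:) (rule sum.UNION_disjoint, auto simp: finite_shell dest: shell_disjoint)
qed

abbreviation area :: "'d::finite itself => real" where
  "area _ \<equiv> measure \<mu> (sphere (0 :: complex ^ 'd) 1)"

lemma shell_kernel:
  fixes w :: "complex ^ 'd::finite"
  assumes w: "norm w = 1"
  shows "(\<Sum>e\<in>shell j. (cmod (e w))\<^sup>2) = card (shell j :: 'd fn set) / area TYPE('d)"
proof (cases j)
  case 0
  have "E 0 = (shell 0 :: 'd fn set)" unfolding E_eq_shell by simp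
  thus ?thesis using kernel_diag_eq[OF w, of 0] 0 by (simp add: kernel_diag_def)
next
  case (Suc N)
  have fin: "finite (E N :: 'd fn set)" by (rule orthonormal_finite[OF orthonormal_E])
  have "card (E (Suc N) :: 'd fn set) = card (E N :: 'd fn set) + card (shell (Suc N) :: 'd fn set)"
    unfolding E_Suc(1) by (rule card_Un_disjoint[OF fin finite_shell E_Suc(2)])
  moreover have "kernel_diag (Suc N) w = kernel_diag N w + (\<Sum>e\<in>shell (Suc N). (cmod (e w))\<^sup>2)"
    unfolding kernel_diag_def E_Suc(1) by (rule sum.union_disjoint[OF fin finite_shell E_Suc(2)])
  ultimately show ?thesis using Suc by (simp add: kernel_diag_eq[OF w] add_divide_distrib)
qed

text \<open>A shell is the increment of the basis \<open>E\<close>.\<close>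

lemma card_shell_le:
  assumes d: "CARD('d::finite) >= 2" and j: "j >= 1"
  shows "card (shell j :: 'd fn set) <= 4 * (j + CARD('d)) ^ (2 * CARD('d) - 2)"
proof -
  obtain N where N: "j = Suc N" using j by (cases j) auto
  have "card (E (Suc N) :: 'd fn set) = card (E N :: 'd fn set) + card (shell (Suc N) :: 'd fn set)"
    unfolding E_Suc(1) by (rule card_Un_disjoint[OF orthonormal_finite[OF orthonormal_E] finite_shell E_Suc(2)])
  thus ?thesis using card_E_Suc_le[OF d, of N] N by simp
qed

lemma cauchy_schwarz_sum:
  "cmod (\<Sum>e\<in>B. f e * g e) <= sqrt (\<Sum>e\<in>B. (cmod (f e))\<^sup>2) * sqrt (\<Sum>e\<in>B. (cmod (g e))\<^sup>2)"
proof -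
  have "cmod (\<Sum>e\<in>B. f e * g e) <= (\<Sum>e\<in>B. \<bar>cmod (f e)\<bar> * \<bar>cmod (g e)\<bar>)"
    by (rule order_trans[OF norm_sum]) (simp add: norm_mult)
  also have "... <= sqrt (\<Sum>e\<in>B. (cmod (f e))\<^sup>2) * sqrt (\<Sum>e\<in>B. (cmod (g e))\<^sup>2)"
    using L2_set_mult_ineq[of "%e. cmod (f e)" "%e. cmod (g e)" B] unfolding L2_set_def .
  finally show ?thesis .
qed

lemma Q_bound:
  fixes w :: "complex ^ 'd::finite"
  assumes \<phi>: "integrable \<mu> \<phi>"
  shows "cmod (Q j \<phi> w) <= card (shell j :: 'd fn set) / area TYPE('d) * (\<integral>z. cmod (\<phi> z) \<partial>\<mu>)"
proof (cases "norm w = 1")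
  case True
  let ?c = "card (shell j :: 'd fn set) / area TYPE('d)"
  have "Q j \<phi> w = ip \<phi> (%z. \<Sum>e\<in>shell j. cnj (e w) * e z)"
    unfolding Q_def by (subst ip_sum_right_integrable[OF \<phi> shell_sphere_fun]) (auto simp: mult.commute)
  also have "cmod ... <= (\<integral>z. cmod (\<phi> z * cnj (\<Sum>e\<in>shell j. cnj (e w) * e z)) \<partial>\<mu>)"
    unfolding ip_def by (rule integral_norm_bound)
  also have "... <= (\<integral>z. ?c * cmod (\<phi> z) \<partial>\<mu>)"
  proof (rule integral_mono)
    show "integrable \<mu> (%z. cmod (\<phi> z * cnj (\<Sum>e\<in>shell j. cnj (e w) * e z)))"
      by (intro integrable_norm integrable_mult_sphere_fun[OF \<phi>] continuous_intros sphere_fun_continuous shell_sphere_fun)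
    show "integrable \<mu> (%z. ?c * cmod (\<phi> z))" using \<phi> by simp
    fix z :: "complex ^ 'd" assume "z \<in> space \<mu>"
    hence z: "norm z = 1" by simp
    have "cmod (\<Sum>e\<in>shell j. cnj (e w) * e z) <= sqrt (\<Sum>e\<in>shell j. (cmod (cnj (e w)))\<^sup>2) * sqrt (\<Sum>e\<in>shell j. (cmod (e z))\<^sup>2)"
      by (rule cauchy_schwarz_sum)
    also have "... = ?c" using measure_sphere_pos[where 'd='d] by (simp add: shell_kernel[OF z] shell_kernel[OF True] flip: real_sqrt_mult)
    finally have "cmod (\<phi> z) * cmod (\<Sum>e\<in>shell j. cnj (e w) * e z) <= cmod (\<phi> z) * ?c" by (intro mult_left_mono) auto
    thus "cmod (\<phi> z * cnj (\<Sum>e\<in>shell j. cnj (e w) * e z)) <= ?c * cmod (\<phi> z)"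
      by (simp only: norm_mult complex_mod_cnj mult.commute)
  qed
  finally show ?thesis by simp
next
  case False
  have "e w = 0" if "e \<in> shell j" for e using shell_sphere_fun[OF that] False by (auto simp: sphere_fun_def)
  hence "Q j \<phi> w = 0" unfolding Q_def by (intro sum.neutral ballI) simp
  thus ?thesis by (auto intro!: mult_nonneg_nonneg divide_nonneg_nonneg Bochner_Integration.integral_nonneg)
qed

lemma sphere_fun_Q: "sphere_fun (Q j \<phi>)"
  unfolding Q_def[abs_def] by (intro sphere_fun_sum sphere_fun_scale shell_sphere_fun)

lemma ip_Q:
  assumes "e \<in> shell i"
  shows "ip (Q j \<phi>) e = (if i = j then ip \<phi> e else 0)"
proof -
  have "ip (Q j \<phi>) e = (if e \<in> shell j then ip \<phi> e else 0)"
    unfolding Q_def[abs_def]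
    by (rule ip_orthonormal_sum[OF orthonormal_E[of "max i j"]]) (use assms shell_subset_E[of i "max i j"] shell_subset_E[of j "max i j"] in auto)
  thus ?thesis using assms shell_disjoint by auto
qed

text \<open>The formal expansion determines a function up to a null set by completeness, and the uniformly
  convergent series has the required coefficients. So the function picked by the choice operator agrees
  with the series almost everywhere.\<close>

lemma multiplier_AE:
  fixes \<phi> :: "'d::finite fn" and a :: "nat => real"
  assumes \<phi>: "integrable \<mu> \<phi>"
    and a: "!!j. a j >= 0" "summable (%j. a j * card (shell j :: 'd fn set))"
    and l: "!!m n. l m n = complex_of_real (a (max m n))"
  shows "multiplier_operator l \<phi> \<in> borel_measurable \<mu>"
    and "!!w. summable (%j. a j *\<^sub>R Q j \<phi> w)"
    and "AE w in \<mu>. multiplier_operator l \<phi> w = (\<Sum>j. a j *\<^sub>R Q j \<phi> w)"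
proof -
  define I where "I = (\<integral>z. cmod (\<phi> z) \<partial>\<mu>)"
  define b where "b j = a j * card (shell j :: 'd fn set) * (I / area TYPE('d))" for j
  have b: "norm (a j *\<^sub>R Q j \<phi> w) <= b j" for j w
  proof -
    have "norm (a j *\<^sub>R Q j \<phi> w) = a j * cmod (Q j \<phi> w)" using a(1)[of j] by simp
    also have "... <= a j * (card (shell j :: 'd fn set) / area TYPE('d) * I)"
      unfolding I_def by (intro mult_left_mono Q_bound[OF \<phi>] a)
    finally show ?thesis by (simp add: b_def)
  qed
  have bs: "summable b" unfolding b_def by (intro summable_mult2 a)
  show summ: "summable (%j. a j *\<^sub>R Q j \<phi> w)" for w
    by (rule summable_comparison_test'[OF bs, of 0]) (use b in simp)
  define \<psi> where "\<psi> w = (\<Sum>j. a j *\<^sub>R Q j \<phi> w)" for w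
  have [measurable]: "Q j \<phi> \<in> borel_measurable \<mu>" for j
    by (rule sphere_measurable[OF sphere_fun_continuous[OF sphere_fun_Q]])
  have \<psi>m[measurable]: "\<psi> \<in> borel_measurable \<mu>"
    unfolding \<psi>_def[abs_def] by (intro borel_measurable_suminf borel_measurable_scaleR) auto
  have \<psi>b: "norm (\<psi> w) <= suminf b" for w
  proof -
    have sn: "summable (%j. norm (a j *\<^sub>R Q j \<phi> w))" by (rule summable_comparison_test'[OF bs, of 0]) (use b in simp)
    have "norm (\<psi> w) <= (\<Sum>j. norm (a j *\<^sub>R Q j \<phi> w))" unfolding \<psi>_def by (rule summable_norm[OF sn])
    also have "... <= suminf b" by (rule suminf_le[OF b sn bs])
    finally show ?thesis .
  qed
  have \<psi>i: "integrable \<mu> \<psi>"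
    by (rule sphere.integrable_const_bound[where B="suminf b"]) (use \<psi>b in auto)
  have coef: "ip \<psi> e = a i * ip \<phi> e" if e: "e \<in> shell i" for e i
  proof -
    define P where "P n z = (\<Sum>j<n. a j *\<^sub>R Q j \<phi> z)" for n z
    have ec: "continuous_on (sphere 0 1) (%z. cnj (e z))" by (intro continuous_intros sphere_fun_continuous shell_sphere_fun[OF e])
    obtain B where B: "!!z. z \<in> sphere 0 1 ==> norm (cnj (e z)) <= B" using sphere_bounded[OF ec] by blast
    have [measurable]: "(%z. cnj (e z)) \<in> borel_measurable \<mu>" by (rule sphere_measurable[OF ec])
    have [measurable]: "P n \<in> borel_measurable \<mu>" for n unfolding P_def[abs_def] by measurable
    have "(%n. \<integral>z. P n z * cnj (e z) \<partial>\<mu>) \<longlonglongrightarrow> (\<integral>z. \<psi> z * cnj (e z) \<partial>\<mu>)"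
    proof (rule integral_dominated_convergence[where w="%_. suminf b * B"])
      show "AE z in \<mu>. (%n. P n z * cnj (e z)) \<longlonglongrightarrow> \<psi> z * cnj (e z)"
        unfolding P_def \<psi>_def using summ by (intro AE_I2 tendsto_intros summable_LIMSEQ)
      show "AE z in \<mu>. norm (P n z * cnj (e z)) <= suminf b * B" for n
      proof (rule AE_I2)
        fix z :: "complex ^ 'd" assume "z \<in> space \<mu>"
        hence z: "norm (cnj (e z)) <= B" using B by simp
        have "norm (P n z) <= (\<Sum>j<n. b j)" unfolding P_def by (rule sum_norm_le) (rule b)
        also have "... <= suminf b"
          by (rule sum_le_suminf[OF bs]) (use b norm_ge_zero order_trans in \<open>blast+\<close>)
        finally have "norm (P n z) <= suminf b" .
        thus "norm (P n z * cnj (e z)) <= suminf b * B" unfolding norm_mult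
          using z order_trans[OF norm_ge_zero \<open>norm (P n z) <= suminf b\<close>] by (intro mult_mono) auto
      qed
    qed (auto)
    note A = this
    have "eventually (%n. (\<integral>z. P n z * cnj (e z) \<partial>\<mu>) = a i * ip \<phi> e) sequentially"
      using eventually_gt_at_top[of i]
    proof eventually_elim
      case (elim n)
      have "(\<integral>z. P n z * cnj (e z) \<partial>\<mu>) = ip (%z. \<Sum>j<n. of_real (a j) * Q j \<phi> z) e"
        unfolding ip_def P_def by (simp add: scaleR_conv_of_real)
      also have "... = (\<Sum>j<n. of_real (a j) * ip (Q j \<phi>) e)"
        by (subst ip_sum_left) (auto intro: sphere_fun_scale sphere_fun_Q shell_sphere_fun[OF e] simp: ip_scale_left)
      also have "... = (\<Sum>j<n. if j = i then of_real (a i) * ip \<phi> e else 0)"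
        unfolding ip_Q[OF e] by (intro sum.cong) auto
      finally show ?case using elim by simp
    qed
    hence "(%n. \<integral>z. P n z * cnj (e z) \<partial>\<mu>) \<longlonglongrightarrow> a i * ip \<phi> e"
      by (rule tendsto_eventually)
    from LIMSEQ_unique[OF A this] show ?thesis by (simp add: ip_def)
  qed
  have lp1: "f \<in> Lp_space \<mu> 1 \<longleftrightarrow> integrable \<mu> f" for f :: "'d fn"
  proof -
    have "Lp_norm \<mu> 1 f = (let I = (\<integral>\<^sup>+ x. ennreal (cmod (f x)) \<partial>\<mu>) in if I = \<infinity> then \<infinity> else ennreal (enn2real I))"
    proof -
      have "enn2real 1 = 1" by (metis ennreal_1 enn2real_ennreal zero_le_one)
      thus ?thesis by (simp add: Lp_norm_def Let_def)
    qed
    also have "... = (\<integral>\<^sup>+ x. ennreal (cmod (f x)) \<partial>\<mu>)" by (auto simp: Let_def less_top)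
    finally show ?thesis unfolding Lp_space_def by (auto simp: integrable_iff_bounded)
  qed
  have he: "has_formal_expansion \<psi> (%m n w. l m n * harmonic_proj m n \<phi> w)"
    unfolding has_formal_expansion_def
  proof (intro conjI allI ballI)
    show "\<psi> \<in> Lp_space \<mu> 1" using \<psi>i lp1 by simp
    fix m n and w :: "complex ^ 'd"
    have "ip \<psi> e = a (max m n) * ip \<phi> e" if "e \<in> hbasis m n" for e
      by (rule coef) (use that in \<open>auto simp: shell_def\<close>)
    thus "harmonic_proj m n \<psi> w = l m n * harmonic_proj m n \<phi> w"
      unfolding harmonic_proj_eq[OF \<psi>i] harmonic_proj_eq[OF \<phi>] l by (simp add: sum_distrib_left mult.assoc)
  qed
  define \<Psi> where "\<Psi> = multiplier_operator l \<phi>"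
  have "has_formal_expansion \<Psi> (%m n w. l m n * harmonic_proj m n \<phi> w)"
    unfolding \<Psi>_def multiplier_operator_def by (rule someI[of _ \<psi>]) (rule he)
  hence \<Psi>i: "integrable \<mu> \<Psi>"
    and \<Psi>e: "!!m n w. w \<in> sphere 0 1 ==> harmonic_proj m n \<Psi> w = harmonic_proj m n \<psi> w"
    using he lp1 by (auto simp: has_formal_expansion_def)
  show "multiplier_operator l \<phi> \<in> borel_measurable \<mu>" using \<Psi>i by (auto simp: \<Psi>_def)
  define D where "D = (%z. \<Psi> z - \<psi> z)"
  have Di: "integrable \<mu> D" unfolding D_def using \<Psi>i \<psi>i by simp
  have "AE z in \<mu>. D z = 0"
  proof (rule complete_AE[OF Di])
    fix m n and e :: "'d fn" assume e: "e \<in> hbasis m n"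
    have ipD: "ip D e' = ip \<Psi> e' - ip \<psi> e'" if "e' \<in> hbasis m n" for e'
    proof -
      have c: "continuous_on (sphere 0 1) (%z. cnj (e' z))"
        by (intro continuous_intros sphere_fun_continuous orthonormal_sphere_fun[OF hbasis(1) that])
      show ?thesis unfolding ip_def D_def
        using integrable_mult_sphere_fun[OF \<Psi>i c] integrable_mult_sphere_fun[OF \<psi>i c] by (simp add: algebra_simps)
    qed
    have z: "(%w. \<Sum>e\<in>hbasis m n. ip D e * e w) = (%w. 0)"
    proof
      fix w show "(\<Sum>e\<in>hbasis m n. ip D e * e w) = 0"
      proof (cases "w \<in> sphere 0 1")
        case True
        have "(\<Sum>e\<in>hbasis m n. ip D e * e w) = (\<Sum>e\<in>hbasis m n. ip \<Psi> e * e w) - (\<Sum>e\<in>hbasis m n. ip \<psi> e * e w)"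
          unfolding sum_subtractf[symmetric] by (intro sum.cong refl) (simp add: ipD algebra_simps)
        thus ?thesis using \<Psi>e[OF True, of m n] unfolding harmonic_proj_eq[OF \<Psi>i] harmonic_proj_eq[OF \<psi>i] by simp
      next
        case False
        have "e w = 0" if "e \<in> hbasis m n" for e
          using orthonormal_sphere_fun[OF hbasis(1) that] False by (auto simp: sphere_fun_def)
        thus ?thesis by (intro sum.neutral ballI) simp
      qed
    qed
    have "ip (%w. \<Sum>e\<in>hbasis m n. ip D e * e w) e = ip D e"
      using ip_orthonormal_sum[OF hbasis(1) subset_refl e, of "ip D"] e by simp
    thus "ip D e = 0" unfolding z by simp
  qed
  thus "AE w in \<mu>. multiplier_operator l \<phi> w = (\<Sum>j. a j *\<^sub>R Q j \<phi> w)"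
    by (rule AE_mp) (auto simp: D_def \<Psi>_def \<psi>_def)
qed

section \<open>Elementary estimates for the exponential weights\<close>

text \<open>Bernoulli's inequality in the form \<open>(1 + x) powr r \<ge> 1 + r * x / 2\<close> for \<open>0 \<le> x \<le> 1\<close>.\<close>

lemma powr_gap:
  fixes N i :: nat
  assumes r: "r > 0" and N: "N >= 1" and i: "i <= N"
  shows "real (N + i) powr r - real N powr r >= r / 2 * real i * real N powr (min 1 r - 1)"
proof -
  define x where "x = real i / real N"
  have x: "0 <= x" "x <= 1" using N i by (auto simp: x_def)
  have "x / 2 <= x / (1 + x)" using x by (intro divide_left_mono) auto
  also have "... <= ln (1 + x)"
  proof -
    have "ln (1 / (1 + x)) <= 1 / (1 + x) - 1" using x by (intro ln_le_minus_one) simp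
    moreover have "ln (1 / (1 + x)) = - ln (1 + x)" using x by (simp add: ln_div)
    moreover have "1 / (1 + x) - 1 = - (x / (1 + x))" using x by (simp add: field_simps)
    ultimately show ?thesis by simp
  qed
  finally have l: "r * (x / 2) <= r * ln (1 + x)" using r by (intro mult_left_mono) auto
  have "1 + r * (x / 2) <= exp (r * ln (1 + x))" using l exp_ge_add_one_self[of "r * ln (1 + x)"] by linarith
  also have "... = (1 + x) powr r" using x by (simp add: powr_def)
  finally have b: "1 + r * (x / 2) <= (1 + x) powr r" .
  have "real (N + i) = real N * (1 + x)" using N by (simp add: x_def field_simps)
  hence "real (N + i) powr r = real N powr r * (1 + x) powr r" using x by (simp add: powr_mult)
  also have "... >= real N powr r * (1 + r * (x / 2))" using b by (intro mult_left_mono) auto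
  finally have "real (N + i) powr r - real N powr r >= real N powr r * (r * (x / 2))" by (simp add: algebra_simps)
  also have "real N powr r * (r * (x / 2)) = r / 2 * real i * real N powr (r - 1)"
    using N by (simp add: x_def powr_diff field_simps)
  also have "... >= r / 2 * real i * real N powr (min 1 r - 1)"
    using r N by (intro mult_left_mono powr_mono) auto
  finally show ?thesis by simp
qed

lemma sum_geometric_le:
  assumes "x > 0"
  shows "(\<Sum>i=1..n. exp (- x * real i)) <= 1 / x"
proof -
  have q: "exp (-x) < 1" "exp (-x) > 0" using assms by auto
  have "(\<Sum>i=1..n. exp (- x * real i)) = (\<Sum>i=1..n. exp (-x) ^ i)"
    by (intro sum.cong refl) (simp add: exp_of_nat_mult[symmetric] mult.commute)
  also have "... = (\<Sum>i<n. exp (-x) ^ Suc i)"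
    by (rule sum.reindex_bij_witness[of _ Suc "%i. i - 1"]) auto
  also have "... = exp (-x) * (\<Sum>i<n. exp (-x) ^ i)" by (simp add: sum_distrib_left)
  also have "... = exp (-x) * ((1 - exp (-x) ^ n) / (1 - exp (-x)))" using q by (simp add: sum_gp_strict)
  also have "... <= exp (-x) * (1 / (1 - exp (-x)))"
    using q by (intro mult_left_mono divide_right_mono) auto
  also have "... = 1 / (exp x - 1)"
    using assms by (simp add: exp_minus field_simps)
  also have "... <= 1 / x"
  proof (rule divide_left_mono)
    show "x <= exp x - 1" using exp_ge_add_one_self[of x] by linarith
  qed (use assms in auto)
  finally show ?thesis .
qed

text \<open>The gap makes the sum comparable to a geometric series with ratio \<open>exp (- c * N powr (min 1 r - 1))\<close>,
  which contributes the factor \<open>N powr (1 - min 1 r)\<close>.\<close>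

lemma shell_sum_bound:
  fixes d a :: nat
  assumes g: "g > 0" and r: "r > 0"
  obtains C where "C > 0"
    "!!N. N >= 1 ==> (\<Sum>j\<in>{N<..2*N}. exp (- g * real j powr r) * real (j + d) ^ a)
        <= C * (exp (- g * real N powr r) * real N powr (real a + 1 - min 1 r))"
proof -
  define C where "C = real (d + 2) ^ a * (2 / (g * r))"
  have "C > 0" using g r by (auto simp: C_def)
  moreover have "(\<Sum>j\<in>{N<..2*N}. exp (- g * real j powr r) * real (j + d) ^ a)
        <= C * (exp (- g * real N powr r) * real N powr (real a + 1 - min 1 r))" if N: "N >= 1" for N
  proof -
    define x where "x = g * (r / 2) * real N powr (min 1 r - 1)"
    have x: "x > 0" using g r N by (auto simp: x_def)
    have "(\<Sum>j\<in>{N<..2*N}. exp (- g * real j powr r) * real (j + d) ^ a)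
       = (\<Sum>i=1..N. exp (- g * real (N + i) powr r) * real (N + i + d) ^ a)"
      by (rule sum.reindex_bij_witness[of _ "%i. N + i" "%j. j - N"]) auto
    also have "... <= (\<Sum>i=1..N. (exp (- g * real N powr r) * (real (d + 2) ^ a * real N ^ a)) * exp (- x * real i))"
    proof (intro sum_mono)
      fix i assume i: "i \<in> {1..N}"
      have "- g * real (N + i) powr r <= - g * real N powr r - x * real i"
      proof -
        have "g * (r / 2 * real i * real N powr (min 1 r - 1)) <= g * (real (N + i) powr r - real N powr r)"
          using g r N i by (intro mult_left_mono powr_gap) auto
        thus ?thesis by (simp add: x_def algebra_simps)
      qed
      hence "exp (- g * real (N + i) powr r) <= exp (- g * real N powr r - x * real i)" by simp
      also have "... = exp (- g * real N powr r) * exp (- x * real i)" by (simp add: exp_diff exp_minus field_simps)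
      finally have e: "exp (- g * real (N + i) powr r) <= exp (- g * real N powr r) * exp (- x * real i)" .
      have "N + i + d <= (d + 2) * N"
      proof -
        have "N + i + d <= N + N + d * N" by (intro add_mono) (use i N in auto)
        thus ?thesis by (simp add: algebra_simps)
      qed
      hence "real (N + i + d) <= real ((d + 2) * N)" by (simp only: of_nat_le_iff)
      hence "real (N + i + d) ^ a <= real ((d + 2) * N) ^ a" by (intro power_mono) auto
      also have "... = real (d + 2) ^ a * real N ^ a" by (simp only: of_nat_mult power_mult_distrib)
      finally have "exp (- g * real (N + i) powr r) * real (N + i + d) ^ a
          <= (exp (- g * real N powr r) * exp (- x * real i)) * (real (d + 2) ^ a * real N ^ a)"
        by (intro mult_mono e) auto
      thus "exp (- g * real (N + i) powr r) * real (N + i + d) ^ a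
          <= (exp (- g * real N powr r) * (real (d + 2) ^ a * real N ^ a)) * exp (- x * real i)" by (simp only: mult_ac)
    qed
    also have "... = (exp (- g * real N powr r) * (real (d + 2) ^ a * real N ^ a)) * (\<Sum>i=1..N. exp (- x * real i))"
      by (simp only: sum_distrib_left)
    also have "... <= (exp (- g * real N powr r) * (real (d + 2) ^ a * real N ^ a)) * (1 / x)"
      by (intro mult_left_mono sum_geometric_le x) auto
    also have "1 / x = 2 / (g * r) * real N powr (1 - min 1 r)"
      using g r N by (simp add: x_def powr_diff powr_minus field_simps)
    also have "(exp (- g * real N powr r) * (real (d + 2) ^ a * real N ^ a)) * (2 / (g * r) * real N powr (1 - min 1 r))
        = C * (exp (- g * real N powr r) * (real N powr real a * real N powr (1 - min 1 r)))"
      using N by (simp add: C_def powr_realpow mult_ac)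
    also have "real N powr real a * real N powr (1 - min 1 r) = real N powr (real a + 1 - min 1 r)"
      by (simp add: powr_add[symmetric] add_diff_eq)
    finally show ?thesis .
  qed
  ultimately show thesis by (rule that)
qed

lemma summable_exp_powr:
  fixes d a :: nat
  assumes g: "g > 0" and r: "r > 0"
  shows "summable (%j. exp (- g * real j powr r) * real (j + d) ^ a)"
proof -
  have lim: "((%x::real. exp (- g * x powr r) * (x + real d) ^ a * x ^ 2) \<longlongrightarrow> 0) at_top"
    using g r by real_asymp
  have "filterlim real at_top sequentially" by (rule filterlim_real_sequentially)
  from filterlim_compose[OF lim this]
  have "(%j. exp (- g * real j powr r) * (real j + real d) ^ a * real j ^ 2) \<longlonglongrightarrow> 0" .
  hence "eventually (%j. exp (- g * real j powr r) * (real j + real d) ^ a * real j ^ 2 < 1) sequentially"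
    by (rule order_tendstoD) simp
  hence "eventually (%j. norm (exp (- g * real j powr r) * real (j + d) ^ a) <= 1 / real j ^ 2) sequentially"
    using eventually_gt_at_top[of 0]
  proof eventually_elim
    case (elim j)
    thus ?case by (simp add: field_simps)
  qed
  moreover have "summable (%j. 1 / real j ^ 2)" using inverse_power_summable[of 2, where 'a=real] by (simp add: inverse_eq_divide)
  ultimately show ?thesis by (rule summable_comparison_test_ev)
qed

text \<open>For \<open>j > 2 * N\<close> a fixed fraction \<open>1 - (1/2) powr r\<close> of the exponent is left over for convergence.\<close>

lemma tail_sum_bound:
  fixes d a :: nat
  assumes g: "g > 0" and r: "r > 0"
  obtains B :: "nat => real" where "summable B" "!!j. B j >= 0"
    "!!N j. j > 2 * N ==> exp (- g * real j powr r) * real (j + d) ^ a <= exp (- g * real N powr r) * B j"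
proof -
  define q where "q = (1 / 2) powr r"
  have q: "q < 1" "q > 0" using r powr_less_mono2[of r "1/2" 1] by (auto simp: q_def)
  define B where "B j = exp (- (g * (1 - q)) * real j powr r) * real (j + d) ^ a" for j
  have "summable B" unfolding B_def using g q r by (intro summable_exp_powr) auto
  moreover have "B j >= 0" for j by (simp add: B_def)
  moreover have "exp (- g * real j powr r) * real (j + d) ^ a <= exp (- g * real N powr r) * B j" if j: "j > 2 * N" for N j
  proof -
    have "real N powr r <= (real j * (1 / 2)) powr r" using j r by (intro powr_mono2) auto
    also have "... = q * real j powr r" by (simp only: powr_mult q_def mult.commute)
    finally have "g * real N powr r <= g * (q * real j powr r)" using g by (intro mult_left_mono) auto
    hence "- g * real j powr r <= - g * real N powr r + - (g * (1 - q)) * real j powr r" by (simp add: algebra_simps)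
    hence "exp (- g * real j powr r) <= exp (- g * real N powr r) * exp (- (g * (1 - q)) * real j powr r)"
      by (simp only: exp_add[symmetric] exp_le_cancel_iff)
    thus ?thesis unfolding B_def by (simp add: mult_right_mono mult.assoc[symmetric])
  qed
  ultimately show thesis by (rule that)
qed

lemma power_shift_le:
  fixes x y :: real
  assumes "x >= 0" "y > 0"
  shows "(x + y) ^ D - x ^ D <= real D * y * (x + y) ^ (D - 1)"
proof (cases D)
  case (Suc n)
  have p: "x + y > 0" using assms by simp
  have "1 + real D * (- y / (x + y)) <= (1 + (- y / (x + y))) ^ D"
    by (rule Bernoulli_inequality) (use assms in \<open>simp add: field_simps\<close>)
  also have "1 + (- y / (x + y)) = x / (x + y)" using p by (simp add: field_simps)
  finally have "(1 + real D * (- y / (x + y))) * (x + y) ^ D <= (x / (x + y)) ^ D * (x + y) ^ D"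
    using p by (intro mult_right_mono) auto
  moreover have "(x / (x + y)) ^ D * (x + y) ^ D = x ^ D" using p by (simp add: power_divide)
  moreover have "(1 + real D * (- y / (x + y))) * (x + y) ^ D = (x + y) ^ D - real D * y * (x + y) ^ (D - 1)"
    using p by (simp add: Suc field_simps)
  ultimately show ?thesis by simp
qed simp

text \<open>The shift by \<open>d\<close> costs only \<open>O(N^(D - 1))\<close>, which is below \<open>N powr (D - r)\<close> as \<open>r \<le> 1\<close>.\<close>

lemma dimension_count_bound:
  fixes d D :: nat
  assumes c: "c > 0" and r: "0 < r" "r <= 1" and D: "D >= 1"
  obtains C where "C > 0"
    "!!N. N >= 1 ==> c * real (N + d) ^ D + 2 * real N powr (real D - r) + 1 <= c * real N ^ D + C * real N powr (real D - r)"
proof -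
  define C where "C = c * real D * real d * real (d + 1) ^ (D - 1) + 3"
  have "C > 0" using c by (auto simp: C_def intro!: add_nonneg_pos)
  moreover have "c * real (N + d) ^ D + 2 * real N powr (real D - r) + 1 <= c * real N ^ D + C * real N powr (real D - r)" if N: "N >= 1" for N
  proof -
    have s1: "1 <= real N powr (real D - r)" using N r D by (intro ge_one_powr_ge_zero) auto
    have "real (N + d) ^ D - real N ^ D <= real D * real d * real (N + d) ^ (D - 1)"
    proof (cases "d = 0")
      case False
      thus ?thesis using power_shift_le[of "real N" "real d" D] by simp
    qed simp
    also have "... <= real D * real d * (real (d + 1) ^ (D - 1) * real N powr (real D - r))"
    proof (intro mult_left_mono)
      have "d * 1 <= d * N" using N by (intro mult_left_mono) auto
      hence "N + d <= (d + 1) * N" by (simp add: algebra_simps)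
      hence "real (N + d) <= real ((d + 1) * N)" by (simp only: of_nat_le_iff)
      hence "real (N + d) ^ (D - 1) <= real ((d + 1) * N) ^ (D - 1)" by (intro power_mono) auto
      also have "... = real (d + 1) ^ (D - 1) * real N ^ (D - 1)" by (simp only: of_nat_mult power_mult_distrib)
      also have "real N ^ (D - 1) = real N powr (real (D - 1))" using N by (simp add: powr_realpow)
      also have "... <= real N powr (real D - r)" using N r D by (intro powr_mono) (auto simp: of_nat_diff)
      finally show "real (N + d) ^ (D - 1) <= real (d + 1) ^ (D - 1) * real N powr (real D - r)"
        by (simp add: mult_left_mono)
    qed auto
    finally have "c * (real (N + d) ^ D - real N ^ D) <= c * (real D * real d * (real (d + 1) ^ (D - 1) * real N powr (real D - r)))"
      using c by (intro mult_left_mono) auto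
    thus ?thesis using s1 by (simp add: C_def algebra_simps)
  qed
  ultimately show thesis by (rule that)
qed

text \<open>Take the largest admissible \<open>N\<close>; then \<open>k\<close> is below the expression at \<open>N + 1\<close>. Raised to the power
  \<open>r / D\<close>, the second order term and the step from \<open>N\<close> to \<open>N + 1\<close> each change the exponent by a
  bounded amount. This is where \<open>r \<le> 1\<close> enters.\<close>

lemma choose_level:
  fixes D :: nat
  assumes c: "c > 0" and C: "C > 0" and r: "0 < r" "r <= 1" and D: "D >= 1" and \<gamma>: "\<gamma> > 0"
    and k: "c + C <= real k"
  obtains N where "N >= 1" "c * real N ^ D + C * real N powr (real D - r) <= real k"
    "exp (- \<gamma> * real N powr r) <= exp (\<gamma> * (1 + C / c)) * exp (- (\<gamma> * (1 / c) powr (r / D)) * real k powr (r / D))"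
proof -
  define F where "F N = c * real N ^ D + C * real N powr (real D - r)" for N :: nat
  define A where "A = {N. N >= 1 \<and> F N <= real k}"
  have "1 \<in> A" using k by (simp add: A_def F_def)
  have bound: "N <= nat \<lceil>real k / c\<rceil>" if "N \<in> A" for N
  proof -
    have "N >= 1" using that by (simp add: A_def)
    have "c * real N <= c * real N ^ D" using c D \<open>N >= 1\<close> by (intro mult_left_mono self_le_power) auto
    also have "... <= F N" using C by (simp add: F_def)
    also have "... <= real k" using that by (simp add: A_def)
    finally have "real N <= real k / c" using c by (simp add: field_simps)
    thus ?thesis by linarith
  qed
  have fin: "finite A" by (rule finite_subset[of _ "{..nat \<lceil>real k / c\<rceil>}"]) (use bound in auto)
  define N where "N = Max A"
  have NA: "N \<in> A" unfolding N_def using fin \<open>1 \<in> A\<close> by (intro Max_in) auto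
  have "Suc N \<notin> A"
  proof
    assume "Suc N \<in> A"
    hence "Suc N <= N" unfolding N_def using fin by (intro Max_ge)
    thus False by simp
  qed
  hence kF: "real k < F (Suc N)" by (auto simp: A_def)
  have N1: "N >= 1" and FN: "F N <= real k" using NA by (auto simp: A_def)
  define M where "M = real (Suc N)"
  have M: "M >= 1" by (simp add: M_def)
  define \<theta> where "\<theta> = r / D"
  have \<theta>: "0 < \<theta>" "\<theta> <= 1" using r D by (auto simp: \<theta>_def field_simps)
  have FM: "F (Suc N) = c * M powr D * (1 + C / c * M powr (- r))"
  proof -
    have "F (Suc N) = c * M ^ D + C * M powr (real D - r)" by (simp only: F_def M_def)
    thus ?thesis using c M by (simp add: powr_realpow powr_diff powr_minus field_simps)
  qed
  have "real k powr \<theta> <= (c * M powr D * (1 + C / c * M powr (- r))) powr \<theta>"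
    using kF \<theta> unfolding FM by (intro powr_mono2) auto
  also have "... = c powr \<theta> * M powr r * (1 + C / c * M powr (- r)) powr \<theta>"
    using c C D by (simp add: powr_mult powr_powr \<theta>_def)
  also have "... <= c powr \<theta> * M powr r * (1 + C / c * M powr (- r)) powr 1"
    using \<theta> c C by (intro mult_left_mono powr_mono) auto
  also have "... = c powr \<theta> * (M powr r + C / c)"
    using c C M by (simp add: algebra_simps powr_minus add_pos_nonneg)
  also have "... <= c powr \<theta> * (real N powr r + 1 + C / c)"
  proof (intro mult_left_mono add_right_mono)
    have x: "0 <= 1 / real N" by simp
    have "M = real N * (1 + 1 / real N)" using N1 by (simp add: M_def field_simps)
    hence "M powr r = real N powr r * (1 + 1 / real N) powr r" using N1 by (simp add: powr_mult)
    also have "... <= real N powr r + 1"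
    proof -
      have "(1 + 1 / real N) powr r <= 1 + r * (1 / real N)"
      proof -
        have "(1 + 1 / real N) powr r <= 1 + r * ((1 + 1 / real N) - 1)"
        proof -
          have "(1 + 1 / real N) powr r * 1 powr (1 - r) <= r * (1 + 1 / real N) + (1 - r) * 1"
            by (rule Youngs_inequality_0) (use r in \<open>auto intro: add_pos_nonneg\<close>)
          thus ?thesis by (simp add: algebra_simps)
        qed
        thus ?thesis by simp
      qed
      hence "real N powr r * (1 + 1 / real N) powr r <= real N powr r * (1 + r * (1 / real N))" by (intro mult_left_mono) auto
      also have "... = real N powr r + r * real N powr (r - 1)" using N1 by (simp add: algebra_simps powr_diff)
      also have "r * real N powr (r - 1) <= 1 * 1"
      proof (intro mult_mono r)
        have "real N powr (r - 1) <= real N powr 0" using N1 r by (intro powr_mono) auto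
        thus "real N powr (r - 1) <= 1" using N1 by simp
      qed auto
      finally show ?thesis by simp
    qed
    finally show "M powr r <= real N powr r + 1" .
  qed auto
  finally have "(1 / c) powr \<theta> * real k powr \<theta> <= (1 / c) powr \<theta> * (c powr \<theta> * (real N powr r + 1 + C / c))"
    by (intro mult_left_mono) auto
  also have "... = real N powr r + 1 + C / c"
    using c by (simp add: powr_mult[symmetric] mult.assoc[symmetric])
  finally have "\<gamma> * ((1 / c) powr \<theta> * real k powr \<theta>) <= \<gamma> * (real N powr r + 1 + C / c)"
    using \<gamma> by (intro mult_left_mono) auto
  hence "- \<gamma> * real N powr r <= \<gamma> * (1 + C / c) + - (\<gamma> * (1 / c) powr \<theta>) * real k powr \<theta>"
    by (simp add: algebra_simps)
  hence "exp (- \<gamma> * real N powr r) <= exp (\<gamma> * (1 + C / c)) * exp (- (\<gamma> * (1 / c) powr \<theta>) * real k powr \<theta>)"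
    by (simp only: exp_add[symmetric] exp_le_cancel_iff)
  with N1 FN show thesis unfolding F_def \<theta>_def by (rule that)
qed

section \<open>Weighted coefficients of functions in the unit ball\<close>

lemma Lp_ball_finite_exponent:
  fixes \<phi> :: "'d::finite fn"
  assumes p: "1 <= p" "p ~= \<infinity>" and \<phi>: "\<phi> \<in> Lp_ball \<mu> p"
  shows "integrable \<mu> (%z. cmod (\<phi> z) powr enn2real p)"
    "(\<integral>z. cmod (\<phi> z) powr enn2real p \<partial>\<mu>) <= 1"
proof -
  define P where "P = enn2real p"
  have P: "P >= 1"
  proof -
    have "enn2real 1 <= enn2real p" using p by (intro enn2real_mono) (auto simp: less_top)
    moreover have "enn2real 1 = 1" by (metis ennreal_1 enn2real_ennreal zero_le_one)
    ultimately show ?thesis by (simp add: P_def)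
  qed
  have m[measurable]: "\<phi> \<in> borel_measurable \<mu>" and nrm: "Lp_norm \<mu> p \<phi> <= 1"
    using \<phi> by (auto simp: Lp_ball_def)
  define I where "I = (\<integral>\<^sup>+ x. ennreal (cmod (\<phi> x) powr P) \<partial>\<mu>)"
  have eq: "Lp_norm \<mu> p \<phi> = (if I = \<infinity> then \<infinity> else ennreal (enn2real I powr (1 / P)))"
    using p by (simp add: Lp_norm_def Let_def I_def P_def)
  have I: "I ~= \<infinity>" using nrm unfolding eq by (auto split: if_splits simp: top_unique)
  hence "ennreal (enn2real I powr (1 / P)) <= ennreal 1" using nrm unfolding eq by simp
  hence "enn2real I powr (1 / P) <= 1" by (subst (asm) ennreal_le_iff) auto
  hence "(enn2real I powr (1 / P)) powr P <= 1 powr P" using P by (intro powr_mono2) auto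
  hence I1: "enn2real I <= 1" using P by (simp add: powr_powr)
  show int: "integrable \<mu> (%z. cmod (\<phi> z) powr enn2real p)"
    unfolding integrable_iff_bounded using I by (auto simp: I_def P_def less_top)
  have "(\<integral>z. cmod (\<phi> z) powr P \<partial>\<mu>) = enn2real I"
    unfolding I_def by (rule integral_eq_nn_integral) (auto simp: P_def)
  thus "(\<integral>z. cmod (\<phi> z) powr enn2real p \<partial>\<mu>) <= 1" using I1 by (simp add: P_def)
qed

lemma Lp_ball_infinity:
  fixes \<phi> :: "'d::finite fn"
  assumes \<phi>: "\<phi> \<in> Lp_ball \<mu> \<infinity>"
  shows "AE z in \<mu>. cmod (\<phi> z) <= 1"
proof -
  have sup1: "esssup \<mu> (%x. ennreal (cmod (\<phi> x))) <= 1" using \<phi> by (simp add: Lp_ball_def Lp_norm_def)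
  have "AE x in \<mu>. ennreal (cmod (\<phi> x)) <= esssup \<mu> (%x. ennreal (cmod (\<phi> x)))"
    by (rule esssup_AE)
  thus ?thesis
  proof (elim eventually_mono)
    fix x assume "ennreal (cmod (\<phi> x)) <= esssup \<mu> (%x. ennreal (cmod (\<phi> x)))"
    hence "ennreal (cmod (\<phi> x)) <= 1" using sup1 by (rule order_trans)
    thus "cmod (\<phi> x) <= 1" by simp
  qed
qed

lemma area_pos: "area TYPE('d::finite) > 0"
  by (rule measure_sphere_pos)

lemma Lp_ball_measurable: "\<phi> \<in> Lp_ball M p ==> \<phi> \<in> borel_measurable M"
  by (simp add: Lp_ball_def)

text \<open>A common form for finite and infinite \<open>p\<close>: the variable \<open>P\<close> stands for \<open>\<bar>\<phi> z\<bar>^p\<close>, or for \<open>1\<close>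
  together with \<open>\<bar>\<phi> z\<bar> \<le> 1\<close> if \<open>p = \<infinity>\<close>.\<close>

lemma Lp_ball_dominated:
  fixes \<phi> :: "'d::finite fn" and u :: "complex ^ 'd => real"
  assumes p: "1 <= p" and \<phi>: "\<phi> \<in> Lp_ball \<mu> p" and u: "u \<in> borel_measurable \<mu>" "!!z. u z >= 0"
    and le: "!!z P. (p = \<infinity> --> P = 1 \<and> cmod (\<phi> z) <= 1) ==> (p ~= \<infinity> --> P = cmod (\<phi> z) powr enn2real p) ==>
        norm (z) = 1 ==> P >= 0 ==> u z <= a * P + v z"
    and v: "integrable \<mu> v" and a: "a >= 0"
  shows "integrable \<mu> u" "(\<integral>z. u z \<partial>\<mu>) <= a * (1 + area TYPE('d)) + (\<integral>z. v z \<partial>\<mu>)"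
proof -
  define P where "P z = (if p = \<infinity> then 1 else cmod (\<phi> z) powr enn2real p)" for z
  have Pi: "integrable \<mu> P" and PI: "(\<integral>z. P z \<partial>\<mu>) <= 1 + area TYPE('d)"
    using Lp_ball_finite_exponent[OF p _ \<phi>] area_pos[where 'd='d] unfolding P_def by (cases "p = \<infinity>"; simp)+
  have P0: "P z >= 0" for z by (simp add: P_def)
  have ae: "AE z in \<mu>. u z <= a * P z + v z"
  proof (cases "p = \<infinity>")
    case True
    hence "AE z in \<mu>. cmod (\<phi> z) <= 1" using Lp_ball_infinity \<phi> by blast
    moreover have "AE z in \<mu>. norm (z :: complex ^ 'd) = 1" by (rule AE_I2) simp
    ultimately show ?thesis
    proof eventually_elim
      case (elim z)
      show ?case by (rule le) (use True elim P0 in \<open>auto simp: P_def\<close>)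
    qed
  next
    case False
    show ?thesis by (rule AE_I2, rule le) (use False P0 in \<open>auto simp: P_def\<close>)
  qed
  have Vi: "integrable \<mu> (%z. a * P z + v z)" using Pi v by simp
  show ui: "integrable \<mu> u"
    by (rule Bochner_Integration.integrable_bound[OF Vi u(1)]) (use ae u(2) in \<open>auto elim!: eventually_mono\<close>)
  have "(\<integral>z. u z \<partial>\<mu>) <= (\<integral>z. a * P z + v z \<partial>\<mu>)"
    by (rule integral_mono_AE[OF ui Vi ae])
  also have "... = a * (\<integral>z. P z \<partial>\<mu>) + (\<integral>z. v z \<partial>\<mu>)" using Pi v by simp
  also have "... <= a * (1 + area TYPE('d)) + (\<integral>z. v z \<partial>\<mu>)" using PI a by (intro add_right_mono mult_left_mono)
  finally show "(\<integral>z. u z \<partial>\<mu>) <= a * (1 + area TYPE('d)) + (\<integral>z. v z \<partial>\<mu>)" .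
qed

lemma enn2real_ge: "1 <= p ==> p ~= \<infinity> ==> 1 <= enn2real p"
proof -
  assume p: "1 <= p" "p ~= \<infinity>"
  have "enn2real 1 <= enn2real p" using p by (intro enn2real_mono) (auto simp: less_top)
  moreover have "enn2real 1 = 1" by (metis ennreal_1 enn2real_ennreal zero_le_one)
  ultimately show ?thesis by simp
qed

lemma enn2real_inverse: "p ~= 0 ==> p ~= \<infinity> ==> enn2real (1 / p) = 1 / enn2real p"
proof -
  assume p: "p ~= 0" "p ~= \<infinity>"
  then obtain x where x: "p = ennreal x" "x >= 0" by (cases p) auto
  have "x > 0" using p x by (cases "x = 0") auto
  have "1 / ennreal x = ennreal 1 / ennreal x" by simp
  also have "... = ennreal (1 / x)" using \<open>x > 0\<close> by (intro divide_ennreal) auto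
  finally show ?thesis using x by simp
qed

lemma Lp_ball_integrable:
  fixes \<phi> :: "'d::finite fn"
  assumes p: "1 <= p" and \<phi>: "\<phi> \<in> Lp_ball \<mu> p"
  shows "integrable \<mu> \<phi>" "(\<integral>z. cmod (\<phi> z) \<partial>\<mu>) <= 1 + 2 * area TYPE('d)"
proof -
  have [measurable]: "\<phi> \<in> borel_measurable \<mu>" using \<phi> by (rule Lp_ball_measurable)
  have le: "cmod (\<phi> z) <= 1 * P + 1" if "p = \<infinity> --> P = 1 \<and> cmod (\<phi> z) <= 1" "p ~= \<infinity> --> P = cmod (\<phi> z) powr enn2real p" "P >= 0" for z and P :: real
  proof (cases "p = \<infinity> \<or> cmod (\<phi> z) <= 1")
    case True
    thus ?thesis using that(3) that(1) by (cases "p = \<infinity>") auto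
  next
    case False
    hence "cmod (\<phi> z) powr 1 <= cmod (\<phi> z) powr enn2real p" using enn2real_ge[OF p] by (intro powr_mono) auto
    thus ?thesis using False that by simp
  qed
  have "integrable \<mu> (%z. cmod (\<phi> z))"
    by (rule Lp_ball_dominated(1)[OF p \<phi>, where a=1 and v="%_. 1"]) (use le in auto)
  thus "integrable \<mu> \<phi>" by (rule integrable_norm_cancel) measurable
  have "(\<integral>z. cmod (\<phi> z) \<partial>\<mu>) <= 1 * (1 + area TYPE('d)) + (\<integral>z. 1 \<partial>(\<mu> :: (complex ^ 'd) measure))"
    by (rule Lp_ball_dominated(2)[OF p \<phi>, where a=1 and v="%_. 1"]) (use le in auto)
  thus "(\<integral>z. cmod (\<phi> z) \<partial>\<mu>) <= 1 + 2 * area TYPE('d)" by simp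
qed

text \<open>Where \<open>f\<close> exceeds the threshold \<open>t\<close> the bound \<open>H\<close> for \<open>h\<close> is used, elsewhere Young's inequality.\<close>

lemma split_pointwise:
  fixes f h H t \<kappa> :: real
  assumes "0 <= f" "0 <= h" "h <= H" "t > 0" "\<kappa> > 0" "1 <= P" "P <= 2"
  shows "f * h <= (H * t powr (1 - P) + \<kappa> / 2 * t powr (2 - P)) * f powr P + h\<^sup>2 / (2 * \<kappa>)"
proof (cases "f > t")
  case True
  have "f powr (1 - P) <= t powr (1 - P)" using True assms by (intro powr_mono2') auto
  hence "f powr (1 - P) * f powr P <= t powr (1 - P) * f powr P" by (intro mult_right_mono) auto
  hence f: "f <= t powr (1 - P) * f powr P" using True assms by (simp add: powr_add[symmetric])
  have "f * h <= (t powr (1 - P) * f powr P) * H" using f assms by (intro mult_mono) auto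
  moreover have "0 <= \<kappa> / 2 * t powr (2 - P) * f powr P" using assms by simp
  moreover have "0 <= h\<^sup>2 / (2 * \<kappa>)" using assms by simp
  ultimately show ?thesis by (simp add: algebra_simps)
next
  case False
  have sq: "f\<^sup>2 <= t powr (2 - P) * f powr P"
  proof (cases "f = 0")
    case False
    with assms have "f > 0" by simp
    have "f powr (2 - P) <= t powr (2 - P)" using \<open>\<not> f > t\<close> assms by (intro powr_mono2) auto
    hence "f powr (2 - P) * f powr P <= t powr (2 - P) * f powr P" by (intro mult_right_mono) auto
    thus ?thesis using \<open>f > 0\<close> by (simp add: powr_add[symmetric])
  qed simp
  have "0 <= (\<kappa> * f - h)\<^sup>2" by simp
  hence "2 * \<kappa> * (f * h) <= \<kappa>\<^sup>2 * f\<^sup>2 + h\<^sup>2" by (simp add: power2_eq_square algebra_simps)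
  hence "f * h <= (\<kappa>\<^sup>2 * f\<^sup>2 + h\<^sup>2) / (2 * \<kappa>)" using assms by (simp add: field_simps)
  also have "... = \<kappa> / 2 * f\<^sup>2 + h\<^sup>2 / (2 * \<kappa>)" using assms by (simp add: add_divide_distrib power2_eq_square)
  also have "... <= \<kappa> / 2 * (t powr (2 - P) * f powr P) + h\<^sup>2 / (2 * \<kappa>)" using sq assms by (intro add_right_mono mult_left_mono) auto
  also have "... <= (H * t powr (1 - P) + \<kappa> / 2 * t powr (2 - P)) * f powr P + h\<^sup>2 / (2 * \<kappa>)"
    using assms by (simp add: algebra_simps)
  finally show ?thesis .
qed

text \<open>Let \<open>g\<close> be the left side and \<open>h = \<Sum>(\<alpha> e)^2 * \<langle>\<phi>, e\<rangle> * e\<close>. Then \<open>g^2 = \<langle>\<phi>, h\<rangle>\<close>, while \<open>\<bar>h\<bar> \<le> A * g\<close> pointwise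
  and \<open>amax * g\<close> bounds \<open>h\<close> in \<open>L2\<close>. Splitting \<open>\<phi>\<close> at the threshold \<open>t\<close> that balances these two bounds
  yields \<open>g^2 \<le> C * g\<close> with the interpolated constant.\<close>

lemma coefficient_bound:
  fixes \<phi> :: "'d::finite fn" and \<alpha> :: "('d fn) => real"
  assumes p: "1 <= p" and \<phi>: "\<phi> \<in> Lp_ball \<mu> p"
    and B: "orthonormal B" and \<alpha>: "!!e. e \<in> B ==> 0 <= \<alpha> e \<and> \<alpha> e <= amax" and amax: "amax > 0"
    and A: "A > 0" "!!w. norm w = 1 ==> (\<Sum>e\<in>B. (\<alpha> e)\<^sup>2 * (cmod (e w))\<^sup>2) <= A\<^sup>2"
  shows "sqrt (\<Sum>e\<in>B. (\<alpha> e)\<^sup>2 * (cmod (ip \<phi> e))\<^sup>2)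
    <= (3 + 2 * area TYPE('d)) * amax * (A / amax) powr (2 * max 0 (enn2real (1 / p) - 1 / 2))"
proof -
  define g where "g = sqrt (\<Sum>e\<in>B. (\<alpha> e)\<^sup>2 * (cmod (ip \<phi> e))\<^sup>2)"
  define s where "s = area TYPE('d)"
  have s: "s > 0" unfolding s_def by (rule area_pos)
  define E where "E = 2 * max 0 (enn2real (1 / p) - 1 / 2)"
  have g0: "g >= 0" unfolding g_def by (intro real_sqrt_ge_zero sum_nonneg) auto
  have gg: "g\<^sup>2 = (\<Sum>e\<in>B. (\<alpha> e)\<^sup>2 * (cmod (ip \<phi> e))\<^sup>2)" unfolding g_def by (intro real_sqrt_pow2 sum_nonneg) auto
  have \<phi>i: "integrable \<mu> \<phi>" by (rule Lp_ball_integrable(1)[OF p \<phi>])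
  have [measurable]: "\<phi> \<in> borel_measurable \<mu>" using \<phi> by (rule Lp_ball_measurable)
  define b where "b e = complex_of_real ((\<alpha> e)\<^sup>2) * ip \<phi> e" for e
  define h where "h = (%z. \<Sum>e\<in>B. b e * e z)"
  have sh: "sphere_fun h" unfolding h_def by (intro sphere_fun_sum sphere_fun_scale orthonormal_sphere_fun[OF B])
  have hc: "continuous_on (sphere 0 1) h" by (rule sphere_fun_continuous[OF sh])
  have [measurable]: "h \<in> borel_measurable \<mu>" by (rule sphere_measurable[OF hc])
  have h_sup: "cmod (h w) <= A * g" if w: "norm w = 1" for w
  proof -
    have "h w = (\<Sum>e\<in>B. (of_real (\<alpha> e) * ip \<phi> e) * (of_real (\<alpha> e) * e w))"
      unfolding h_def b_def by (simp add: power2_eq_square mult_ac)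
    also have "cmod ... <= (\<Sum>e\<in>B. \<bar>\<alpha> e * cmod (ip \<phi> e)\<bar> * \<bar>\<alpha> e * cmod (e w)\<bar>)"
      by (rule order_trans[OF norm_sum]) (simp add: norm_mult abs_mult)
    also have "... <= sqrt (\<Sum>e\<in>B. (\<alpha> e * cmod (ip \<phi> e))\<^sup>2) * sqrt (\<Sum>e\<in>B. (\<alpha> e * cmod (e w))\<^sup>2)"
      using L2_set_mult_ineq[of "%e. \<alpha> e * cmod (ip \<phi> e)" "%e. \<alpha> e * cmod (e w)" B] unfolding L2_set_def .
    also have "... = g * sqrt (\<Sum>e\<in>B. (\<alpha> e)\<^sup>2 * (cmod (e w))\<^sup>2)" by (simp add: g_def power_mult_distrib)
    also have "... <= g * A"
    proof (rule mult_left_mono[OF _ g0])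
      have "sqrt (\<Sum>e\<in>B. (\<alpha> e)\<^sup>2 * (cmod (e w))\<^sup>2) <= sqrt (A\<^sup>2)" by (rule real_sqrt_le_mono[OF A(2)[OF w]])
      thus "sqrt (\<Sum>e\<in>B. (\<alpha> e)\<^sup>2 * (cmod (e w))\<^sup>2) <= A" using A(1) by simp
    qed
    finally show ?thesis by (simp add: mult.commute)
  qed
  have h_L2: "(\<integral>z. (cmod (h z))\<^sup>2 \<partial>\<mu>) <= (amax * g)\<^sup>2"
  proof -
    have "(\<integral>z. (cmod (h z))\<^sup>2 \<partial>\<mu>) = (\<Sum>e\<in>B. (cmod (b e))\<^sup>2)" unfolding h_def by (rule parseval[OF B])
    also have "... = (\<Sum>e\<in>B. (\<alpha> e)\<^sup>2 * ((\<alpha> e)\<^sup>2 * (cmod (ip \<phi> e))\<^sup>2))"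
      by (intro sum.cong refl) (simp add: b_def norm_mult power_mult_distrib power2_eq_square)
    also have "... <= (\<Sum>e\<in>B. amax\<^sup>2 * ((\<alpha> e)\<^sup>2 * (cmod (ip \<phi> e))\<^sup>2))"
      using \<alpha> by (intro sum_mono mult_right_mono power_mono) auto
    also have "... = (amax * g)\<^sup>2" unfolding power_mult_distrib gg sum_distrib_left ..
    finally show ?thesis .
  qed
  have h2i: "integrable \<mu> (%z. (cmod (h z))\<^sup>2)"
    using integrable_norm[OF ip_integrable[OF sh sh]] by (simp add: norm_mult power2_eq_square)
  have "complex_of_real (g\<^sup>2) = ip \<phi> h"
  proof -
    have "ip \<phi> h = (\<Sum>e\<in>B. cnj (b e) * ip \<phi> e)" unfolding h_def
      by (rule ip_sum_right_integrable[OF \<phi>i orthonormal_sphere_fun[OF B]])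
    also have "... = (\<Sum>e\<in>B. complex_of_real ((\<alpha> e)\<^sup>2 * (cmod (ip \<phi> e))\<^sup>2))"
      unfolding b_def of_real_mult complex_norm_square by (simp add: mult_ac)
    finally show ?thesis unfolding gg by simp
  qed
  hence "g\<^sup>2 = cmod (ip \<phi> h)" by (metis norm_of_real abs_of_nonneg zero_le_power2)
  also have "... <= (\<integral>z. cmod (\<phi> z * cnj (h z)) \<partial>\<mu>)" unfolding ip_def by (rule integral_norm_bound)
  also have "... = (\<integral>z. cmod (\<phi> z) * cmod (h z) \<partial>\<mu>)" by (simp add: norm_mult)
  finally have g_le: "g\<^sup>2 <= (\<integral>z. cmod (\<phi> z) * cmod (h z) \<partial>\<mu>)" .
  have "g <= (3 + 2 * s) * amax * (A / amax) powr E"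
  proof (cases "g = 0")
    case True
    thus ?thesis using s amax A(1) by simp
  next
    case False
    with g0 have g: "g > 0" by simp
    have fin: "g <= X" if "g\<^sup>2 <= X * g" for X using that g by (simp add: power2_eq_square)
    show ?thesis
    proof (cases "p < 2")
      case True
      define P where "P = enn2real p"
      have pfin: "p ~= \<infinity>" using True by auto
      have P: "1 <= P" "P <= 2"
      proof -
        show "1 <= P" unfolding P_def by (rule enn2real_ge[OF p pfin])
        have "enn2real p <= enn2real 2" using True by (intro enn2real_mono) auto
        moreover have "enn2real 2 = 2" using enn2real_ennreal[of 2] by simp
        ultimately show "P <= 2" by (simp add: P_def)
      qed
      have pinv: "enn2real (1 / p) = 1 / P" unfolding P_def using p pfin by (intro enn2real_inverse) auto
      have E_eq: "E = 2 / P - 1" using P by (simp add: E_def pinv max_def field_simps)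
      define \<rho> where "\<rho> = A / amax"
      have \<rho>: "\<rho> > 0" using A(1) amax by (simp add: \<rho>_def)
      \<comment> \<open>the level at which the bounds for large and for small values of \<open>\<phi>\<close> coincide\<close>
      define t where "t = \<rho> powr (2 / P)"
      have t: "t > 0" using \<rho> by (simp add: t_def)
      define \<kappa> where "\<kappa> = amax * g * t powr (P / 2 - 1)"
      have \<kappa>: "\<kappa> > 0" using amax g t by (simp add: \<kappa>_def)
      define H where "H = A * g"
      define a where "a = H * t powr (1 - P) + \<kappa> / 2 * t powr (2 - P)"
      have a0: "a >= 0" using A(1) g \<kappa> by (auto simp: a_def H_def)
      have "(\<integral>z. cmod (\<phi> z) * cmod (h z) \<partial>\<mu>) <= a * (1 + s) + (\<integral>z. (cmod (h z))\<^sup>2 / (2 * \<kappa>) \<partial>\<mu>)"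
        unfolding s_def
      proof (rule Lp_ball_dominated(2)[OF p \<phi>])
        show "integrable \<mu> (%z. (cmod (h z))\<^sup>2 / (2 * \<kappa>))" using h2i by simp
        fix z :: "complex ^ 'd" and X :: real
        assume "p ~= \<infinity> --> X = cmod (\<phi> z) powr enn2real p" "norm z = 1"
        thus "cmod (\<phi> z) * cmod (h z) <= a * X + (cmod (h z))\<^sup>2 / (2 * \<kappa>)"
          using split_pointwise[OF _ _ _ t \<kappa> P, of "cmod (\<phi> z)" "cmod (h z)" H] h_sup[of z] pfin
          by (simp add: P_def H_def a_def)
      qed (use a0 in auto)
      also have "(\<integral>z. (cmod (h z))\<^sup>2 / (2 * \<kappa>) \<partial>\<mu>) <= (amax * g)\<^sup>2 / (2 * \<kappa>)"
        using h_L2 \<kappa> by (simp add: divide_right_mono)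
      finally have "g\<^sup>2 <= a * (1 + s) + (amax * g)\<^sup>2 / (2 * \<kappa>)" using g_le by linarith
      also have "a = 3 / 2 * (amax * \<rho> powr E) * g"
      proof -
        have "H * t powr (1 - P) = amax * g * (\<rho> powr 1 * \<rho> powr (2 / P * (1 - P)))"
          using A(1) amax \<rho> by (simp add: H_def t_def powr_powr \<rho>_def)
        also have "\<rho> powr 1 * \<rho> powr (2 / P * (1 - P)) = \<rho> powr E"
          unfolding powr_add[symmetric] by (rule arg_cong[of _ _ "(powr) \<rho>"]) (use P in \<open>simp add: E_eq field_simps\<close>)
        finally have 1: "H * t powr (1 - P) = amax * \<rho> powr E * g" by simp
        have "\<kappa> / 2 * t powr (2 - P) = amax * g / 2 * (\<rho> powr (2 / P * (P / 2 - 1)) * \<rho> powr (2 / P * (2 - P)))"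
          by (simp add: \<kappa>_def t_def powr_powr)
        also have "\<rho> powr (2 / P * (P / 2 - 1)) * \<rho> powr (2 / P * (2 - P)) = \<rho> powr E"
          unfolding powr_add[symmetric] by (rule arg_cong[of _ _ "(powr) \<rho>"]) (use P in \<open>simp add: E_eq field_simps\<close>)
        finally have 2: "\<kappa> / 2 * t powr (2 - P) = amax * \<rho> powr E * g / 2" by simp
        show ?thesis unfolding a_def 1 2 by simp
      qed
      also have "(amax * g)\<^sup>2 / (2 * \<kappa>) = amax * \<rho> powr E * g / 2"
      proof -
        have tE: "t powr (P / 2 - 1) = \<rho> powr (- E)"
          unfolding t_def powr_powr by (rule arg_cong[of _ _ "(powr) \<rho>"]) (use P in \<open>simp add: E_eq field_simps\<close>)
        have *: "1 / t powr (P / 2 - 1) = \<rho> powr E" unfolding tE powr_minus by (simp only: divide_inverse inverse_inverse_eq mult_1_left)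
        have "(amax * g)\<^sup>2 / (2 * \<kappa>) = amax * g / 2 * (1 / t powr (P / 2 - 1))"
          using amax g by (simp add: \<kappa>_def power2_eq_square)
        thus ?thesis unfolding * by simp
      qed
      also have "3 / 2 * (amax * \<rho> powr E) * g * (1 + s) + amax * \<rho> powr E * g / 2 = ((2 + 3 / 2 * s) * amax * \<rho> powr E) * g"
        by (simp add: field_simps)
      also have "... <= ((3 + 2 * s) * amax * \<rho> powr E) * g"
        using s amax g by (intro mult_right_mono) auto
      finally show ?thesis unfolding \<rho>_def by (rule fin)
    next
      case False
      hence p2: "2 <= p" by simp
      have E0: "E = 0"
      proof (cases "p = \<infinity>")
        case False
        have "enn2real 2 <= enn2real p" using p2 False by (intro enn2real_mono) (auto simp: less_top)
        moreover have "enn2real 2 = 2" using enn2real_ennreal[of 2] by simp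
        ultimately have "2 <= enn2real p" by simp
        hence "1 / enn2real p <= 1 / 2" by (intro divide_left_mono) auto
        moreover have "enn2real (1 / p) = 1 / enn2real p" using p False by (intro enn2real_inverse) auto
        ultimately show ?thesis by (simp add: E_def)
      qed (simp add: E_def)
      define \<kappa> where "\<kappa> = amax * g"
      have \<kappa>: "\<kappa> > 0" using amax g by (simp add: \<kappa>_def)
      have "(\<integral>z. cmod (\<phi> z) * cmod (h z) \<partial>\<mu>) <= \<kappa> / 2 * (1 + s) + (\<integral>z. \<kappa> / 2 + (cmod (h z))\<^sup>2 / (2 * \<kappa>) \<partial>\<mu>)"
        unfolding s_def
      proof (rule Lp_ball_dominated(2)[OF p \<phi>])
        show "integrable \<mu> (%z. \<kappa> / 2 + (cmod (h z))\<^sup>2 / (2 * \<kappa>))" using h2i by simp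
        fix z :: "complex ^ 'd" and X :: real
        assume X: "p = \<infinity> --> X = 1 \<and> cmod (\<phi> z) <= 1" "p ~= \<infinity> --> X = cmod (\<phi> z) powr enn2real p" "X >= 0"
        have sq: "(cmod (\<phi> z))\<^sup>2 <= X + 1"
        proof (cases "cmod (\<phi> z) <= 1")
          case True
          hence "(cmod (\<phi> z))\<^sup>2 <= 1" by (simp add: power_le_one)
          thus ?thesis using X by simp
        next
          case False
          hence pf: "p ~= \<infinity>" using X by auto
          have "enn2real 2 <= enn2real p" using p2 pf by (intro enn2real_mono) (auto simp: less_top)
          moreover have "enn2real 2 = 2" using enn2real_ennreal[of 2] by simp
          ultimately have "cmod (\<phi> z) powr 2 <= cmod (\<phi> z) powr enn2real p" using False by (intro powr_mono) auto
          thus ?thesis using X pf False by simp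
        qed
        have "0 <= (\<kappa> * cmod (\<phi> z) - cmod (h z))\<^sup>2" by simp
        hence "2 * \<kappa> * (cmod (\<phi> z) * cmod (h z)) <= \<kappa>\<^sup>2 * (cmod (\<phi> z))\<^sup>2 + (cmod (h z))\<^sup>2"
          by (simp add: power2_eq_square algebra_simps)
        hence "cmod (\<phi> z) * cmod (h z) <= (\<kappa>\<^sup>2 * (cmod (\<phi> z))\<^sup>2 + (cmod (h z))\<^sup>2) / (2 * \<kappa>)"
          using \<kappa> by (simp add: field_simps)
        also have "... = \<kappa> / 2 * (cmod (\<phi> z))\<^sup>2 + (cmod (h z))\<^sup>2 / (2 * \<kappa>)"
          using \<kappa> by (simp add: add_divide_distrib power2_eq_square)
        also have "... <= \<kappa> / 2 * (X + 1) + (cmod (h z))\<^sup>2 / (2 * \<kappa>)"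
          using sq \<kappa> by (intro add_right_mono mult_left_mono) auto
        finally show "cmod (\<phi> z) * cmod (h z) <= \<kappa> / 2 * X + (\<kappa> / 2 + (cmod (h z))\<^sup>2 / (2 * \<kappa>))"
          by (simp add: algebra_simps add_divide_distrib)
      qed (use \<kappa> in auto)
      also have "(\<integral>z. \<kappa> / 2 + (cmod (h z))\<^sup>2 / (2 * \<kappa>) \<partial>\<mu>) = s * (\<kappa> / 2) + (\<integral>z. (cmod (h z))\<^sup>2 \<partial>\<mu>) / (2 * \<kappa>)"
        using h2i by (simp add: s_def)
      also have "(\<integral>z. (cmod (h z))\<^sup>2 \<partial>\<mu>) / (2 * \<kappa>) <= \<kappa> / 2"
      proof -
        have "(\<integral>z. (cmod (h z))\<^sup>2 \<partial>\<mu>) / (2 * \<kappa>) <= \<kappa>\<^sup>2 / (2 * \<kappa>)"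
          using h_L2 \<kappa> by (intro divide_right_mono) (auto simp: \<kappa>_def)
        thus ?thesis using \<kappa> by (simp add: power2_eq_square)
      qed
      finally have "g\<^sup>2 <= \<kappa> / 2 * (1 + s) + (s * (\<kappa> / 2) + \<kappa> / 2)" using g_le by linarith
      also have "... = ((1 + s) * amax) * g" by (simp add: \<kappa>_def algebra_simps add_divide_distrib)
      also have "... <= ((3 + 2 * s) * amax) * g" using s amax g by (intro mult_right_mono) auto
      finally have "g <= (3 + 2 * s) * amax" by (rule fin)
      thus ?thesis using E0 A(1) amax by simp
    qed
  qed
  thus ?thesis unfolding g_def s_def E_def .
qed

section \<open>Norm estimates and an inequality between norms of polynomials\<close>

lemma Lp_norm_cong_AE:
  assumes "AE x in M. f x = g x" "f \<in> borel_measurable M" "g \<in> borel_measurable M"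
  shows "Lp_norm M q f = Lp_norm M q g"
proof -
  have "esssup M (%x. ennreal (cmod (f x))) = esssup M (%x. ennreal (cmod (g x)))"
    using assms by (intro esssup_AE_cong) auto
  moreover have "(\<integral>\<^sup>+ x. ennreal (cmod (f x) powr enn2real q) \<partial>M) = (\<integral>\<^sup>+ x. ennreal (cmod (g x) powr enn2real q) \<partial>M)"
    by (rule nn_integral_cong_AE) (use assms(1) in \<open>auto elim!: eventually_mono\<close>)
  ultimately show ?thesis by (simp add: Lp_norm_def)
qed

lemma Lp_norm_finite_le:
  assumes q: "q ~= \<infinity>" "enn2real q > 0" and u: "integrable M u" and le: "!!x. x \<in> space M ==> cmod (f x) powr enn2real q <= u x"
    and K: "(\<integral>x. u x \<partial>M) <= K"
  shows "Lp_norm M q f <= ennreal (K powr (1 / enn2real q))"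
proof -
  define I where "I = (\<integral>\<^sup>+ x. ennreal (cmod (f x) powr enn2real q) \<partial>M)"
  have u0: "AE x in M. 0 <= u x" by (rule AE_I2) (use le in \<open>force intro: order_trans[OF powr_ge_zero]\<close>)
  have K0: "0 <= K" using integral_nonneg_AE[OF u0] K by linarith
  have "I <= (\<integral>\<^sup>+ x. ennreal (u x) \<partial>M)" unfolding I_def by (intro nn_integral_mono ennreal_leI le)
  also have "... = ennreal (\<integral>x. u x \<partial>M)" by (rule nn_integral_eq_integral[OF u u0])
  also have "... <= ennreal K" using K by (rule ennreal_leI)
  finally have I: "I <= ennreal K" .
  hence If: "I ~= \<infinity>" using ennreal_less_top[of K] by (auto simp: top_unique)
  have "enn2real I <= K" using I K0 by (metis enn2real_leI)
  hence "enn2real I powr (1 / enn2real q) <= K powr (1 / enn2real q)" using q by (intro powr_mono2) auto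
  moreover have "Lp_norm M q f = ennreal (enn2real I powr (1 / enn2real q))"
    using q(1) If by (simp add: Lp_norm_def Let_def I_def)
  ultimately show ?thesis by (simp add: ennreal_leI)
qed

lemma enn2real_ge_two: "2 <= q ==> q ~= \<infinity> ==> 2 <= enn2real q"
proof -
  assume q: "2 <= q" "q ~= \<infinity>"
  have "enn2real 2 <= enn2real q" using q by (intro enn2real_mono) (auto simp: less_top)
  moreover have "enn2real 2 = 2" using enn2real_ennreal[of 2] by simp
  ultimately show ?thesis by simp
qed

lemma Lp_norm_infinity_le:
  assumes "f \<in> borel_measurable M" "!!x. x \<in> space M ==> cmod (f x) <= F"
  shows "Lp_norm M \<infinity> f <= ennreal F"
  unfolding Lp_norm_def using assms by (simp, intro esssup_I) (auto intro!: AE_I2 ennreal_leI)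

lemma Lp_norm_interpolate:
  fixes f :: "'a::euclidean_space => complex"
  assumes q: "2 <= q" and f: "f \<in> borel_measurable \<mu>" and F1: "F1 > 0" "!!x. norm x = 1 ==> cmod (f x) <= F1"
    and F2: "F2 > 0" "(\<integral>x. (cmod (f x))\<^sup>2 \<partial>\<mu>) <= F2\<^sup>2"
  shows "Lp_norm \<mu> q f <= ennreal (F1 powr (1 - 2 * enn2real (1 / q)) * F2 powr (2 * enn2real (1 / q)))"
proof (cases "q = \<infinity>")
  case True
  thus ?thesis using Lp_norm_infinity_le[OF f, of F1] F1 F2 by simp
next
  case False
  define Q where "Q = enn2real q"
  have Q: "Q >= 2" unfolding Q_def by (rule enn2real_ge_two[OF q False])
  have Qi: "enn2real (1 / q) = 1 / Q"
  proof -
    obtain x where x: "q = ennreal x" "x >= 0" using False by (cases q) auto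
    with Q have "x > 0" by (simp add: Q_def)
    have "1 / ennreal x = ennreal 1 / ennreal x" by simp
    also have "... = ennreal (1 / x)" using \<open>x > 0\<close> by (intro divide_ennreal) auto
    finally show ?thesis using x by (simp add: Q_def)
  qed
  have f2: "integrable \<mu> (%x. (cmod (f x))\<^sup>2)"
    by (rule sphere.integrable_const_bound[where B="F1\<^sup>2"]) (use F1 f in \<open>auto intro!: AE_I2 power_mono\<close>)
  have "Lp_norm \<mu> q f <= ennreal ((F1 powr (Q - 2) * F2 powr 2) powr (1 / Q))"
    unfolding Q_def
  proof (rule Lp_norm_finite_le[OF False])
    show "0 < enn2real q" using Q by (simp add: Q_def)
    show "integrable \<mu> (%x. F1 powr (enn2real q - 2) * (cmod (f x))\<^sup>2)" using f2 by simp
    show "cmod (f x) powr enn2real q <= F1 powr (enn2real q - 2) * (cmod (f x))\<^sup>2" if "x \<in> space \<mu>" for x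
    proof (cases "f x = 0")
      case False
      have "cmod (f x) powr Q = cmod (f x) powr (Q - 2) * cmod (f x) powr 2" by (simp only: powr_add[symmetric]) simp
      also have "... = cmod (f x) powr (Q - 2) * (cmod (f x))\<^sup>2" using False by simp
      also have "... <= F1 powr (Q - 2) * (cmod (f x))\<^sup>2"
        using F1(2)[of x] that Q by (intro mult_right_mono powr_mono2) auto
      finally show ?thesis by (simp add: Q_def)
    qed (use F1 in simp)
    have "(\<integral>x. F1 powr (enn2real q - 2) * (cmod (f x))\<^sup>2 \<partial>\<mu>) = F1 powr (enn2real q - 2) * (\<integral>x. (cmod (f x))\<^sup>2 \<partial>\<mu>)" by simp
    also have "... <= F1 powr (enn2real q - 2) * F2\<^sup>2" using F2 by (intro mult_left_mono) auto
    finally show "(\<integral>x. F1 powr (enn2real q - 2) * (cmod (f x))\<^sup>2 \<partial>\<mu>) <= F1 powr (enn2real q - 2) * F2 powr 2" using F2 by simp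
  qed
  also have "(F1 powr (Q - 2) * F2 powr 2) powr (1 / Q) = F1 powr ((Q - 2) * (1 / Q)) * F2 powr (2 * (1 / Q))"
    by (simp only: powr_mult powr_powr)
  also have "(Q - 2) * (1 / Q) = 1 - 2 * enn2real (1 / q)" using Q by (simp add: Qi field_simps)
  finally show ?thesis by (simp add: Qi)
qed

text \<open>Pointwise, \<open>\<bar>f\<bar>^q \<le> L^q + L^(q - 2j) * \<bar>f\<bar>^(2j)\<close>.\<close>

lemma Lp_norm_le_even_moment:
  fixes f :: "'d::finite fn"
  assumes q: "2 <= q" "q ~= \<infinity>" and j: "enn2real q <= 2 * real j" and L: "L > 0"
    and i: "integrable \<mu> (%x. cmod (f x) ^ (2 * j))"
    and le: "(\<integral>x. cmod (f x) ^ (2 * j) \<partial>\<mu>) <= L ^ (2 * j)"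
  shows "Lp_norm \<mu> q f <= ennreal (L * (1 + area TYPE('d)))"
proof -
  define Q where "Q = enn2real q"
  have Q: "Q >= 2" unfolding Q_def by (rule enn2real_ge_two[OF q])
  have Lp: "L powr (Q - 2 * real j) * L ^ (2 * j) = L powr Q"
  proof -
    have "L ^ (2 * j) = L powr (2 * real j)" using L by (simp add: powr_realpow[symmetric])
    thus ?thesis by (simp only: powr_add[symmetric]) simp
  qed
  have "Lp_norm \<mu> q f <= ennreal ((L powr Q * (1 + area TYPE('d))) powr (1 / Q))"
    unfolding Q_def
  proof (rule Lp_norm_finite_le[OF q(2)])
    show "0 < enn2real q" using Q by (simp add: Q_def)
    show "integrable \<mu> (%x. L powr enn2real q + L powr (enn2real q - 2 * real j) * cmod (f x) ^ (2 * j))" using i by simp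
    show "cmod (f x) powr enn2real q <= L powr enn2real q + L powr (enn2real q - 2 * real j) * cmod (f x) ^ (2 * j)" for x
    proof (cases "cmod (f x) <= L")
      case True
      hence "cmod (f x) powr Q <= L powr Q" using Q by (intro powr_mono2) auto
      moreover have "0 <= L powr (Q - 2 * real j) * cmod (f x) ^ (2 * j)" by simp
      ultimately show ?thesis unfolding Q_def by linarith
    next
      case False
      hence pos: "cmod (f x) > 0" using L by linarith
      have "cmod (f x) powr Q = cmod (f x) powr (Q - 2 * real j) * cmod (f x) powr (2 * real j)" by (simp only: powr_add[symmetric]) simp
      also have "... <= L powr (Q - 2 * real j) * cmod (f x) powr (2 * real j)"
        using False L j by (intro mult_right_mono powr_mono2') (auto simp: Q_def)
      also have "cmod (f x) powr (2 * real j) = cmod (f x) ^ (2 * j)" using pos by (simp add: powr_realpow[symmetric])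
      also have "L powr (Q - 2 * real j) * cmod (f x) ^ (2 * j) <= L powr Q + L powr (Q - 2 * real j) * cmod (f x) ^ (2 * j)" by simp
      finally show ?thesis by (simp add: Q_def)
    qed
    have "(\<integral>x. L powr Q + L powr (Q - 2 * real j) * cmod (f x) ^ (2 * j) \<partial>\<mu>) =
        area TYPE('d) * L powr Q + L powr (Q - 2 * real j) * (\<integral>x. cmod (f x) ^ (2 * j) \<partial>\<mu>)" using i by simp
    also have "... <= area TYPE('d) * L powr Q + L powr (Q - 2 * real j) * L ^ (2 * j)"
      using le by (intro add_left_mono mult_left_mono) auto
    also have "... = L powr Q * (1 + area TYPE('d))" unfolding Lp by (simp add: algebra_simps)
    finally show "(\<integral>x. L powr enn2real q + L powr (enn2real q - 2 * real j) * cmod (f x) ^ (2 * j) \<partial>\<mu>)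
        <= L powr enn2real q * (1 + area TYPE('d))" by (simp add: Q_def)
  qed
  also have "(L powr Q * (1 + area TYPE('d))) powr (1 / Q) = L * (1 + area TYPE('d)) powr (1 / Q)"
    using L Q by (simp add: powr_mult powr_powr)
  also have "... <= L * (1 + area TYPE('d)) powr 1" using L Q by (intro mult_left_mono powr_mono) auto
  finally show ?thesis using L by (simp add: ennreal_leI order_trans)
qed

lemma power_convex:
  fixes a b u v :: real
  assumes "u >= 0" "v >= 0" "u + v = 1"
  shows "(u * a + v * b) ^ (2 * j) <= u * a ^ (2 * j) + v * b ^ (2 * j)"
proof -
  have u: "u = 1 - v" using assms by simp
  show ?thesis unfolding u using convex_onD[OF convex_power_even[of "2 * j"], of v a b] assms by simp
qed

text \<open>For \<open>n > 0\<close> this is the norm of \<open>L^n\<close>.\<close>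

definition Lnorm :: "nat => ('a::euclidean_space => complex) => real" where
  "Lnorm n f = root n (\<integral>z. cmod (f z) ^ n \<partial>\<mu>)"

lemma power_norm_integrable:
  fixes f :: "'a::euclidean_space => complex"
  assumes "sphere_fun f"
  shows "integrable \<mu> (%z. cmod (f z) ^ n)"
proof -
  have "continuous_on (sphere 0 1) (%z. complex_of_real (cmod (f z) ^ n))"
    by (intro continuous_intros sphere_fun_continuous assms)
  from integrable_Re[OF sphere_integrable[OF this]] show ?thesis by (simp only: Re_complex_of_real)
qed

lemma Lnorm_nonneg: "Lnorm n f >= 0"
  unfolding Lnorm_def by (cases "n = 0") (auto intro!: real_root_ge_zero integral_nonneg_AE)

lemma Lnorm_power: "n > 0 ==> Lnorm n f ^ n = (\<integral>z. cmod (f z) ^ n \<partial>\<mu>)"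
  unfolding Lnorm_def by (intro real_root_pow_pos2 integral_nonneg_AE) auto

lemma Lnorm_le_iff: "n > 0 ==> L >= 0 ==> Lnorm n f <= L \<longleftrightarrow> (\<integral>z. cmod (f z) ^ n \<partial>\<mu>) <= L ^ n"
  using Lnorm_power[of n f] Lnorm_nonneg[of n f] by (metis power_mono power_mono_iff)

lemma Lnorm_scale: "n > 0 ==> Lnorm n (%z. c * f z) = cmod c * Lnorm n f"
  unfolding Lnorm_def by (simp add: norm_mult power_mult_distrib real_root_mult real_root_power_cancel)

text \<open>Minkowski's inequality from the convexity of the power, applied to the normalised functions. The
  small \<open>e\<close> avoids a division by zero.\<close>

lemma Lnorm_add:
  fixes f g :: "'a::euclidean_space => complex"
  assumes f: "sphere_fun f" and g: "sphere_fun g" and j: "j > 0"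
  shows "Lnorm (2 * j) (%z. f z + g z) <= Lnorm (2 * j) f + Lnorm (2 * j) g"
proof (rule field_le_epsilon)
  fix e :: real assume e: "e > 0"
  define a where "a = Lnorm (2 * j) f + e / 2"
  define b where "b = Lnorm (2 * j) g + e / 2"
  have a: "a > 0" and b: "b > 0" using Lnorm_nonneg[of "2*j" f] Lnorm_nonneg[of "2*j" g] e by (auto simp: a_def b_def)
  have ia: "(\<integral>z. cmod (f z) ^ (2 * j) \<partial>\<mu>) <= a ^ (2 * j)"
    using a e j by (subst Lnorm_le_iff[symmetric]) (auto simp: a_def)
  have ib: "(\<integral>z. cmod (g z) ^ (2 * j) \<partial>\<mu>) <= b ^ (2 * j)"
    using b e j by (subst Lnorm_le_iff[symmetric]) (auto simp: b_def)
  define u where "u = a / (a + b)"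
  define v where "v = b / (a + b)"
  have uv: "u >= 0" "v >= 0" "u + v = 1" using a b by (auto simp: u_def v_def add_divide_distrib[symmetric])
  have "(\<integral>z. cmod (f z + g z) ^ (2 * j) \<partial>\<mu>)
     <= (\<integral>z. (a + b) ^ (2 * j) * (u * (1 / a) ^ (2 * j) * cmod (f z) ^ (2 * j) + v * (1 / b) ^ (2 * j) * cmod (g z) ^ (2 * j)) \<partial>\<mu>)"
  proof (rule integral_mono)
    show "integrable \<mu> (%z. cmod (f z + g z) ^ (2 * j))" by (intro power_norm_integrable sphere_fun_add f g)
    show "integrable \<mu> (%z. (a + b) ^ (2 * j) * (u * (1 / a) ^ (2 * j) * cmod (f z) ^ (2 * j) + v * (1 / b) ^ (2 * j) * cmod (g z) ^ (2 * j)))"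
      using power_norm_integrable[OF f] power_norm_integrable[OF g] by simp
    fix z
    have "cmod (f z + g z) ^ (2 * j) <= (cmod (f z) + cmod (g z)) ^ (2 * j)" by (intro power_mono norm_triangle_ineq) auto
    also have "cmod (f z) + cmod (g z) = (a + b) * (u * (1 / a * cmod (f z)) + v * (1 / b * cmod (g z)))"
    proof -
      have "(a + b) * u = a" "(a + b) * v = b" using a b by (auto simp: u_def v_def)
      hence "((a + b) * u) * (1 / a * cmod (f z)) + ((a + b) * v) * (1 / b * cmod (g z)) = cmod (f z) + cmod (g z)" using a b by simp
      thus ?thesis by (simp only: mult.assoc distrib_left)
    qed
    also have "... ^ (2 * j) <= (a + b) ^ (2 * j) * (u * (1 / a * cmod (f z)) ^ (2 * j) + v * (1 / b * cmod (g z)) ^ (2 * j))"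
      unfolding power_mult_distrib[of "a + b"] using a b by (intro mult_left_mono power_convex uv) auto
    finally show "cmod (f z + g z) ^ (2 * j) <= (a + b) ^ (2 * j) * (u * (1 / a) ^ (2 * j) * cmod (f z) ^ (2 * j) + v * (1 / b) ^ (2 * j) * cmod (g z) ^ (2 * j))"
      unfolding power_mult_distrib[of "1 / a"] power_mult_distrib[of "1 / b"] by (simp only: mult.assoc)
  qed
  also have "... = (a + b) ^ (2 * j) * (u * (1 / a) ^ (2 * j) * (\<integral>z. cmod (f z) ^ (2 * j) \<partial>\<mu>) + v * (1 / b) ^ (2 * j) * (\<integral>z. cmod (g z) ^ (2 * j) \<partial>\<mu>))"
    using power_norm_integrable[OF f] power_norm_integrable[OF g] by simp
  also have "... <= (a + b) ^ (2 * j) * (u * (1 / a) ^ (2 * j) * a ^ (2 * j) + v * (1 / b) ^ (2 * j) * b ^ (2 * j))"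
    using a b uv ia ib by (intro mult_left_mono add_mono) auto
  also have "u * (1 / a) ^ (2 * j) * a ^ (2 * j) = u" using a by (simp add: power_mult_distrib[symmetric])
  also have "v * (1 / b) ^ (2 * j) * b ^ (2 * j) = v" using b by (simp add: power_mult_distrib[symmetric])
  finally have "(\<integral>z. cmod (f z + g z) ^ (2 * j) \<partial>\<mu>) <= (a + b) ^ (2 * j)" using uv by simp
  hence "Lnorm (2 * j) (%z. f z + g z) <= a + b" using a b j by (subst Lnorm_le_iff) auto
  thus "Lnorm (2 * j) (%z. f z + g z) <= Lnorm (2 * j) f + Lnorm (2 * j) g + e" by (simp add: a_def b_def)
qed

lemma rb_mult:
  assumes "f \<in> rb m n" "g \<in> rb m' n'"
  shows "(%z. f z * g z) \<in> rb (m + m') (n + n')"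
proof -
  obtain F G where F: "F \<in> bihom_polys m n" "f = sphere_restrict F" and G: "G \<in> bihom_polys m' n'" "g = sphere_restrict G"
    using assms by (auto simp: rb_def)
  have "(%z. f z * g z) = sphere_restrict (%z. F z * G z)" by (auto simp: F G sphere_restrict_def fun_eq_iff)
  thus ?thesis using bihom_mult[OF F(1) G(1)] by (auto simp: rb_def)
qed

lemma span_mult:
  fixes G G' H :: "('a => complex) set"
  assumes f: "f \<in> cfun.span G" and g: "g \<in> cfun.span G'"
    and GG: "!!a b. a \<in> G ==> b \<in> G' ==> (%z. a z * b z) \<in> cfun.span H"
  shows "(%z. f z * g z) \<in> cfun.span H"
proof -
  have 1: "(%z. a z * g z) \<in> cfun.span H" if a: "a \<in> G" for a
    using g
  proof (induction rule: cfun.span_induct_alt)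
    case base
    have "(%z. a z * (0 :: 'a => complex) z) = 0" by (simp add: fun_eq_iff)
    thus ?case by (simp only: cfun.span_zero)
  next
    case (step c b y)
    have "(%z. a z * ((%z. c * b z) + y) z) = (%z. c * (a z * b z)) + (%z. a z * y z)" by (simp add: fun_eq_iff algebra_simps)
    thus ?case using cfun.span_add[OF cfun.span_scale[OF GG[OF a step(1)]] step(2)] by simp
  qed
  show ?thesis using f
  proof (induction rule: cfun.span_induct_alt)
    case base
    have "(%z. (0 :: 'a => complex) z * g z) = 0" by (simp add: fun_eq_iff)
    thus ?case by (simp only: cfun.span_zero)
  next
    case (step c b y)
    have "(%z. ((%z. c * b z) + y) z * g z) = (%z. c * (b z * g z)) + (%z. y z * g z)" by (simp add: fun_eq_iff algebra_simps)
    thus ?case using cfun.span_add[OF cfun.span_scale[OF 1[OF step(1)]] step(2)] by simp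
  qed
qed

lemma span_harmonic_sum: "cfun.span (harmonic_sum N) = harmonic_sum N"
  unfolding harmonic_sum_def by (rule cfun.span_span)

lemma harmonic_sum_mult:
  assumes f: "f \<in> harmonic_sum M" and g: "g \<in> (harmonic_sum M' :: 'd::finite fn set)"
  shows "(%z. f z * g z) \<in> harmonic_sum (M + M')"
proof -
  have "(%z. f z * g z) \<in> cfun.span (harmonic_sum (M + M'))"
  proof (rule span_mult[OF f[unfolded harmonic_sum_def] g[unfolded harmonic_sum_def]])
    fix a b :: "'d fn"
    assume "a \<in> \<Union> {harmonic_space m n | m n. max m n <= M}" "b \<in> \<Union> {harmonic_space m n | m n. max m n <= M'}"
    then obtain m n m' n' where *: "a \<in> harmonic_space m n" "b \<in> harmonic_space m' n'" "max m n <= M" "max m' n' <= M'" by auto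
    hence "(%z. a z * b z) \<in> rb (m + m') (n + n')" using rb_mult harmonic_subset_rb by blast
    moreover have "rb (m + m') (n + n') \<subseteq> (harmonic_sum (M + M') :: 'd fn set)" using * by (intro rb_subset_harmonic_sum') auto
    ultimately show "(%z. a z * b z) \<in> cfun.span (harmonic_sum (M + M'))" by (intro cfun.span_base) (rule subsetD)
  qed
  thus ?thesis by (simp only: span_harmonic_sum)
qed

lemma harmonic_sum_power:
  assumes f: "f \<in> (harmonic_sum M :: 'd::finite fn set)" and j: "j > 0"
  shows "(%z. f z ^ j) \<in> harmonic_sum (j * M)"
  using j
proof (induction j rule: nat_induct_non_zero)
  case 1 show ?case using f by simp
next
  case (Suc j)
  thus ?case using harmonic_sum_mult[OF f Suc.IH] by simp
qed

lemma harmonic_sum_pointwise: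
  fixes w :: "complex ^ 'd::finite"
  assumes f: "f \<in> harmonic_sum N" and w: "norm w = 1"
  shows "(cmod (f w))\<^sup>2 <= card (E N :: 'd fn set) / area TYPE('d) * (\<integral>z. (cmod (f z))\<^sup>2 \<partial>\<mu>)"
proof -
  have fs: "f \<in> cfun.span (E N)" using f by (simp add: span_E)
  have eq: "f = (%z. \<Sum>e\<in>E N. ip f e * e z)" by (rule orthonormal_expansion[OF orthonormal_E fs])
  have "(\<integral>z. (cmod (f z))\<^sup>2 \<partial>\<mu>) = (\<integral>z. (cmod (\<Sum>e\<in>E N. ip f e * e z))\<^sup>2 \<partial>\<mu>)" by (subst eq) (rule refl)
  also have "... = (\<Sum>e\<in>E N. (cmod (ip f e))\<^sup>2)" by (rule parseval[OF orthonormal_E])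
  finally have P: "(\<integral>z. (cmod (f z))\<^sup>2 \<partial>\<mu>) = (\<Sum>e\<in>E N. (cmod (ip f e))\<^sup>2)" .
  have "cmod (f w) = cmod (\<Sum>e\<in>E N. ip f e * e w)" by (subst eq) (rule refl)
  also have "... <= sqrt (\<Sum>e\<in>E N. (cmod (ip f e))\<^sup>2) * sqrt (\<Sum>e\<in>E N. (cmod (e w))\<^sup>2)" by (rule cauchy_schwarz_sum)
  finally have "(cmod (f w))\<^sup>2 <= (sqrt (\<Sum>e\<in>E N. (cmod (ip f e))\<^sup>2) * sqrt (\<Sum>e\<in>E N. (cmod (e w))\<^sup>2))\<^sup>2" by (intro power_mono) auto
  also have "... = (\<Sum>e\<in>E N. (cmod (ip f e))\<^sup>2) * kernel_diag N w" by (simp add: power_mult_distrib sum_nonneg kernel_diag_def)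
  finally show ?thesis unfolding P kernel_diag_eq[OF w] by (simp only: mult.commute)
qed

text \<open>Powers of a polynomial of level \<open>M\<close> have level \<open>j * M\<close>, so the reproducing kernel bound for \<open>L2\<close>
  can be applied to \<open>f^j\<close>.\<close>

lemma nikolskii:
  fixes w :: "complex ^ 'd::finite"
  assumes f: "f \<in> harmonic_sum M" and w: "norm w = 1" and j: "j > 0"
  shows "cmod (f w) ^ (2 * j) <= card (E (j * M) :: 'd fn set) / area TYPE('d) * (\<integral>z. cmod (f z) ^ (2 * j) \<partial>\<mu>)"
  using harmonic_sum_pointwise[OF harmonic_sum_power[OF f j] w] by (simp add: norm_power power_mult[symmetric] mult.commute)

section \<open>Random approximation of weighted orthonormal sums\<close>

lemma row_avg_integral:
  assumes "!!rs. integrable M (F rs)"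
  shows "integrable M (%z. row_avg S m (%rs. F rs z))"
    and "row_avg S m (%rs. \<integral>z. F rs z \<partial>M) = (\<integral>z. row_avg S m (%rs. F rs z) \<partial>M)"
proof -
  have "integrable M (%z. row_avg S m (%rs. F rs z)) \<and>
      row_avg S m (%rs. \<integral>z. F rs z \<partial>M) = (\<integral>z. row_avg S m (%rs. F rs z) \<partial>M)"
    using assms
  proof (induction m arbitrary: F)
    case 0 thus ?case by simp
  next
    case (Suc m)
    have 1: "integrable M (%z. row_avg S m (%rs. F (s # rs) z))"
      "row_avg S m (%rs. \<integral>z. F (s # rs) z \<partial>M) = (\<integral>z. row_avg S m (%rs. F (s # rs) z) \<partial>M)" for s
      using Suc.IH[of "%rs. F (s # rs)"] Suc.prems by auto
    show ?case using 1(1) by (simp add: 1(2) Bochner_Integration.integral_sum)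
  qed
  thus "integrable M (%z. row_avg S m (%rs. F rs z))"
    and "row_avg S m (%rs. \<integral>z. F rs z \<partial>M) = (\<integral>z. row_avg S m (%rs. F rs z) \<partial>M)" by auto
qed

lemma cmod_power_le: "cmod x ^ (2 * j) <= 4 ^ j * (Re x ^ (2 * j) + Im x ^ (2 * j))"
proof -
  have key: "cmod x ^ (2 * j) <= 4 ^ j * y ^ (2 * j)" if "cmod x <= 2 * \<bar>y\<bar>" for y
  proof -
    have "cmod x ^ (2 * j) <= (2 * \<bar>y\<bar>) ^ (2 * j)" using that by (intro power_mono) auto
    also have "... = 4 ^ j * y ^ (2 * j)" by (simp add: power_mult_distrib power_mult)
    finally show ?thesis .
  qed
  have "cmod x <= 2 * \<bar>Re x\<bar> \<or> cmod x <= 2 * \<bar>Im x\<bar>" using cmod_le[of x] by linarith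
  moreover have n: "0 <= (4::real) ^ j * y ^ (2 * j)" for y by (auto simp: power_mult)
  ultimately show ?thesis unfolding distrib_left
    using key[of "Re x"] key[of "Im x"] n[of "Re x"] n[of "Im x"] by linarith
qed

lemma sum_list_swap: "(\<Sum>e\<in>J. (\<Sum>s\<leftarrow>rs. s e) * a e) = (\<Sum>s\<leftarrow>rs. \<Sum>e\<in>J. s e * (a e :: real))"
  by (induction rs) (auto simp: distrib_right sum.distrib)

text \<open>At each point the sum is a random sign sum of variance at most \<open>m * A^2\<close>. Its \<open>2j\<close>-th moment is
  integrated over the sphere, and \<open>x \<le> L + x^(2j) / L^(2j-1)\<close> passes from the moment to the mean of the norm.\<close>

lemma random_moment:
  fixes J :: "'d::finite fn set"
  assumes J: "finite J" "!!e. e \<in> J ==> sphere_fun e"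
    and A: "A > 0" "!!w. norm w = 1 ==> (\<Sum>e\<in>J. (\<alpha> e)\<^sup>2 * (cmod (e w))\<^sup>2) <= A\<^sup>2"
    and j: "j > 0" and m: "m > 0"
  shows "row_avg (signs J) m (%rs. Lnorm (2 * j) (%z. \<Sum>e\<in>J. of_real ((\<Sum>s\<leftarrow>rs. s e) * \<alpha> e) * e z))
    <= 2 * (sqrt ((1 + 2 * area TYPE('d)) * (8 * exp 1 * real j * real m)) * A)"
proof -
  define a where "a = area TYPE('d)"
  have a: "a > 0" unfolding a_def by (rule measure_sphere_pos)
  define L where "L = sqrt ((1 + 2 * a) * (8 * exp 1 * real j * real m)) * A"
  have L: "L > 0" using a A j m by (simp add: L_def)
  define X where "X rs z = (\<Sum>e\<in>J. complex_of_real ((\<Sum>s\<leftarrow>rs. s e) * \<alpha> e) * e z)" for rs :: "(('d fn) => real) list" and z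
  have sX: "sphere_fun (X rs)" for rs unfolding X_def by (intro sphere_fun_sum sphere_fun_scale J)
  have iX: "integrable \<mu> (%z. cmod (X rs z) ^ (2 * j))" for rs by (rule power_norm_integrable[OF sX])
  have ReX: "Re (X rs z) = (\<Sum>s\<leftarrow>rs. \<Sum>e\<in>J. s e * (\<alpha> e * Re (e z)))" for rs z
    unfolding X_def sum_list_swap[symmetric] by (simp add: mult.assoc)
  have ImX: "Im (X rs z) = (\<Sum>s\<leftarrow>rs. \<Sum>e\<in>J. s e * (\<alpha> e * Im (e z)))" for rs z
    unfolding X_def sum_list_swap[symmetric] by (simp add: mult.assoc)
  define V where "V = (2 * real j * exp 1 * (real m * A\<^sup>2)) ^ j"
  have mom: "row_avg (signs J) m (%rs. (\<Sum>s\<leftarrow>rs. \<Sum>e\<in>J. s e * b e) ^ (2 * j)) <= V"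
    if b: "!!e. e \<in> J ==> \<bar>b e\<bar> <= \<bar>\<alpha> e * cmod (e z)\<bar>" and z: "norm z = 1" for b z
  proof -
    have "(\<Sum>e\<in>J. (b e)\<^sup>2) <= (\<Sum>e\<in>J. (\<alpha> e * cmod (e z))\<^sup>2)" using b by (intro sum_mono) (simp add: abs_le_square_iff)
    also have "... <= A\<^sup>2" using A(2)[OF z] by (simp add: power_mult_distrib)
    finally have "(\<Sum>e\<in>J. (b e)\<^sup>2) <= A\<^sup>2" .
    hence "(2 * real j * exp 1 * (real m * (\<Sum>e\<in>J. (b e)\<^sup>2))) ^ j <= V" unfolding V_def
      by (intro power_mono mult_left_mono) (auto intro!: mult_nonneg_nonneg sum_nonneg)
    thus ?thesis using row_avg_even_moment[OF J(1) j, of m b] by simp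
  qed
  have pt: "row_avg (signs J) m (%rs. cmod (X rs z) ^ (2 * j)) <= 4 ^ j * (V + V)" if z: "norm z = 1" for z
  proof -
    have "row_avg (signs J) m (%rs. cmod (X rs z) ^ (2 * j)) <= row_avg (signs J) m (%rs. 4 ^ j * (Re (X rs z) ^ (2 * j) + Im (X rs z) ^ (2 * j)))"
      by (intro row_avg_mono cmod_power_le)
    also have "... = 4 ^ j * (row_avg (signs J) m (%rs. Re (X rs z) ^ (2 * j)) + row_avg (signs J) m (%rs. Im (X rs z) ^ (2 * j)))"
      by (simp only: row_avg_cmult row_avg_add)
    also have "... <= 4 ^ j * (V + V)" unfolding ReX ImX
      by (intro mult_left_mono add_mono mom[OF _ z]) (auto simp: abs_mult intro!: mult_left_mono abs_Re_le_cmod abs_Im_le_cmod)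
    finally show ?thesis .
  qed
  have "row_avg (signs J) m (%rs. \<integral>z. cmod (X rs z) ^ (2 * j) \<partial>\<mu>) = (\<integral>z. row_avg (signs J) m (%rs. cmod (X rs z) ^ (2 * j)) \<partial>\<mu>)"
    by (rule row_avg_integral(2)[OF iX])
  also have "... <= (\<integral>z. 4 ^ j * (V + V) \<partial>(\<mu> :: (complex ^ 'd) measure))"
    by (rule integral_mono[OF row_avg_integral(1)[OF iX]]) (use pt in auto)
  also have "... = (2 * a) * (4 ^ j * V)" by (simp add: a_def)
  also have "4 ^ j * V = (8 * exp 1 * real j * real m * A\<^sup>2) ^ j" unfolding V_def power_mult_distrib[symmetric] by (simp add: mult_ac)
  also have "2 * a * (8 * exp 1 * real j * real m * A\<^sup>2) ^ j <= (1 + 2 * a) ^ j * (8 * exp 1 * real j * real m * A\<^sup>2) ^ j"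
  proof (rule mult_right_mono)
    have "2 * a <= (1 + 2 * a) ^ 1" by simp
    also have "... <= (1 + 2 * a) ^ j" using a j by (intro power_increasing) auto
    finally show "2 * a <= (1 + 2 * a) ^ j" .
  qed auto
  also have "... = L ^ (2 * j)"
  proof -
    have "L\<^sup>2 = (1 + 2 * a) * (8 * exp 1 * real j * real m * A\<^sup>2)" using a by (simp add: L_def power_mult_distrib)
    thus ?thesis by (simp only: power_mult power_mult_distrib)
  qed
  finally have I: "row_avg (signs J) m (%rs. \<integral>z. cmod (X rs z) ^ (2 * j) \<partial>\<mu>) <= L ^ (2 * j)" .
  have LL: "L ^ (2 * j) = L ^ (2 * j - 1) * L" using j by (metis power_minus_mult mult_pos_pos zero_less_numeral)
  have "row_avg (signs J) m (%rs. Lnorm (2 * j) (X rs)) <= row_avg (signs J) m (%rs. L + (1 / L ^ (2 * j - 1)) * (\<integral>z. cmod (X rs z) ^ (2 * j) \<partial>\<mu>))"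
  proof (rule row_avg_mono)
    fix rs
    define x where "x = Lnorm (2 * j) (X rs)"
    have x0: "x >= 0" unfolding x_def by (rule Lnorm_nonneg)
    have xI: "(\<integral>z. cmod (X rs z) ^ (2 * j) \<partial>\<mu>) = x ^ (2 * j)" using j by (simp add: x_def Lnorm_power)
    have xx: "x ^ (2 * j) = x ^ (2 * j - 1) * x" using j by (metis power_minus_mult mult_pos_pos zero_less_numeral)
    show "Lnorm (2 * j) (X rs) <= L + (1 / L ^ (2 * j - 1)) * (\<integral>z. cmod (X rs z) ^ (2 * j) \<partial>\<mu>)"
      unfolding xI x_def[symmetric]
    proof (cases "x <= L")
      case True
      thus "x <= L + 1 / L ^ (2 * j - 1) * x ^ (2 * j)" using x0 L by (simp add: add_increasing2)
    next
      case False
      have "L ^ (2 * j - 1) * x <= x ^ (2 * j)" unfolding xx using False L by (intro mult_right_mono power_mono) auto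
      hence "x <= 1 / L ^ (2 * j - 1) * x ^ (2 * j)" using L by (simp add: field_simps)
      thus "x <= L + 1 / L ^ (2 * j - 1) * x ^ (2 * j)" using L by linarith
    qed
  qed
  also have "... = L + (1 / L ^ (2 * j - 1)) * row_avg (signs J) m (%rs. \<integral>z. cmod (X rs z) ^ (2 * j) \<partial>\<mu>)"
    by (simp only: row_avg_add row_avg_cmult row_avg_const[OF signs_finite[OF J(1)] signs_ne])
  also have "... <= L + (1 / L ^ (2 * j - 1)) * L ^ (2 * j)" using I L by (intro add_left_mono mult_left_mono) auto
  also have "... = 2 * L" unfolding LL using L by simp
  finally show ?thesis unfolding X_def[abs_def] L_def a_def .
qed

text \<open>The factor lost in \<open>random_approximation\<close>; it depends on the dimension only.\<close>

definition section_constant :: "'d::finite itself => real" where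
  "section_constant _ = 2 * (8 * sqrt (32 * exp 2) * sqrt ((1 + 2 * area TYPE('d)) * (8 * exp 1)) + 1)"

lemma section_constant_pos: "section_constant TYPE('d::finite) > 0"
  unfolding section_constant_def by (auto intro!: add_nonneg_pos mult_nonneg_nonneg)

text \<open>Apply \<open>random_sections\<close> to the seminorm \<open>c \<mapsto> Lnorm (2 * j) (\<Sum>c e * \<alpha> e * e)\<close> on real coefficients; complex
  coefficients are treated through their real and imaginary parts.\<close>

lemma random_approximation:
  fixes J :: "'d::finite fn set" and \<alpha> :: "('d fn) => real"
  assumes J: "finite J" "!!e. e \<in> J ==> sphere_fun e"
    and A: "A > 0" "!!w. norm w = 1 ==> (\<Sum>e\<in>J. (\<alpha> e)\<^sup>2 * (cmod (e w))\<^sup>2) <= A\<^sup>2"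
    and j: "j > 0" and m: "m > 0"
  obtains W where "finite W" "card W <= m" "W \<subseteq> cfun.span J"
    "!!c b. b > 0 ==> (\<Sum>e\<in>J. (cmod (c e))\<^sup>2) <= b\<^sup>2 ==>
      \<exists>h\<in>cfun.span W. Lnorm (2 * j) (%z. (\<Sum>e\<in>J. c e * complex_of_real (\<alpha> e) * e z) - h z)
        <= section_constant TYPE('d) * sqrt (real j / real m) * A * b"
proof -
  define f where "f c z = (\<Sum>e\<in>J. complex_of_real (c e * \<alpha> e) * e z)" for c :: "('d fn) => real" and z
  have sf: "sphere_fun (f c)" for c unfolding f_def by (intro sphere_fun_sum sphere_fun_scale J)
  define N where "N c = Lnorm (2 * j) (f c)" for c
  have f_add: "f (%i. x i + y i) = (%z. f x z + f y z)" for x y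
    unfolding f_def by (simp add: fun_eq_iff distrib_right sum.distrib)
  have f_scale: "f (%i. t * x i) = (%z. of_real t * f x z)" for t x
    unfolding f_def by (simp add: fun_eq_iff sum_distrib_left mult_ac)
  have subl: "sublinear N"
  proof (rule sublinearI)
    show "N (%i. x i + y i) <= N x + N y" for x y unfolding N_def f_add by (rule Lnorm_add[OF sf sf j])
    have sc: "N (%i. t * x i) = \<bar>t\<bar> * N x" for t x unfolding N_def f_scale using j by (simp add: Lnorm_scale)
    show "N (%i. 0 * x i) = 0" for x using sc[of 0 x] by simp
    show "N (%i. t * x i) <= t * N x" if "t > 0" for t x using sc[of t x] that by simp
  qed
  have loc: "N c = N c'" if "!!i. i \<in> J ==> c i = c' i" for c c'
  proof -
    have "f c = f c'" unfolding f_def using that by (simp add: fun_eq_iff)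
    thus ?thesis by (simp add: N_def)
  qed
  define \<eta> where "\<eta> = sqrt (real j / real m) * A"
  have \<eta>: "\<eta> > 0" using A j m by (simp add: \<eta>_def)
  have N0: "N c >= 0" for c unfolding N_def by (rule Lnorm_nonneg)
  define \<kappa> :: real where "\<kappa> = 1 / (2 * sqrt (32 * exp 2))"
  have \<kappa>: "\<kappa> > 0" by (simp add: \<kappa>_def)
  obtain rs where rs: "length rs = m" "set rs \<subseteq> signs J"
    and app: "!!c. \<exists>t. N (%i. c i - (\<Sum>l<m. t l * (rs ! l) i))
       <= 2 / (\<kappa> * m) * row_avg (signs J) m (%rs. N (%i. \<Sum>s\<leftarrow>rs. s i)) * sqrt (\<Sum>i\<in>J. (c i)\<^sup>2) + \<eta>"
    by (rule random_sections[OF J(1) subl N0 loc signs_finite[OF J(1)] signs_ne signs_negate _ \<kappa> _ m \<eta>])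
       (use khinchine_L1[OF J(1)] in \<open>auto simp: \<kappa>_def\<close>)
  define a where "a = area TYPE('d)"
  have a: "a > 0" unfolding a_def by (rule measure_sphere_pos)
  define G where "G = section_constant TYPE('d) / 2 * sqrt (real j / real m) * A"
  have avg: "row_avg (signs J) m (%rs. N (%i. \<Sum>s\<leftarrow>rs. s i)) <= 2 * (sqrt ((1 + 2 * a) * (8 * exp 1 * real j * real m)) * A)"
    unfolding N_def f_def[abs_def] a_def by (rule random_moment[OF J A j m])
  have G: "\<exists>t. N (%i. c i - (\<Sum>l<m. t l * (rs ! l) i)) <= G" if c: "(\<Sum>i\<in>J. (c i)\<^sup>2) <= 1" for c
  proof -
    obtain t where t: "N (%i. c i - (\<Sum>l<m. t l * (rs ! l) i))
       <= 2 / (\<kappa> * m) * row_avg (signs J) m (%rs. N (%i. \<Sum>s\<leftarrow>rs. s i)) * sqrt (\<Sum>i\<in>J. (c i)\<^sup>2) + \<eta>" using app by blast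
    have "2 / (\<kappa> * m) * row_avg (signs J) m (%rs. N (%i. \<Sum>s\<leftarrow>rs. s i)) * sqrt (\<Sum>i\<in>J. (c i)\<^sup>2)
      <= 2 / (\<kappa> * m) * (2 * (sqrt ((1 + 2 * a) * (8 * exp 1 * real j * real m)) * A)) * 1"
      using avg \<kappa> m c A a by (intro mult_mono mult_left_mono) (auto intro!: sum_nonneg mult_nonneg_nonneg)
    also have "... = (4 / \<kappa>) * sqrt ((1 + 2 * a) * (8 * exp 1)) * (sqrt (real j) * sqrt (real m) / real m) * A"
      using m \<kappa> by (simp add: real_sqrt_mult)
    also have "sqrt (real j) * sqrt (real m) / real m = sqrt (real j / real m)"
      using m by (simp add: real_sqrt_divide field_simps)
    also have "4 / \<kappa> = 8 * sqrt (32 * exp 2)" by (simp add: \<kappa>_def)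
    finally have "2 / (\<kappa> * m) * row_avg (signs J) m (%rs. N (%i. \<Sum>s\<leftarrow>rs. s i)) * sqrt (\<Sum>i\<in>J. (c i)\<^sup>2) + \<eta> <= G"
      unfolding G_def \<eta>_def section_constant_def a_def by (simp add: algebra_simps)
    with t show ?thesis by (intro exI[of _ t]) linarith
  qed
  define w where "w l = f (rs ! l)" for l
  define W where "W = w ` {..<m}"
  have diff: "f (%i. c i - (\<Sum>l<m. t l * (rs ! l) i)) = (%z. f c z - (\<Sum>l<m. complex_of_real (t l) * w l z))" for c and t :: "nat => real"
  proof
    fix z
    have "(\<Sum>l<m. complex_of_real (t l) * w l z) = (\<Sum>e\<in>J. \<Sum>l<m. complex_of_real (t l) * (complex_of_real ((rs ! l) e * \<alpha> e) * e z))"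
      unfolding w_def f_def sum_distrib_left by (rule sum.swap)
    also have "... = (\<Sum>e\<in>J. complex_of_real ((\<Sum>l<m. t l * (rs ! l) e) * \<alpha> e) * e z)"
      by (simp add: sum_distrib_right sum_distrib_left mult_ac)
    finally show "f (%i. c i - (\<Sum>l<m. t l * (rs ! l) i)) z = f c z - (\<Sum>l<m. complex_of_real (t l) * w l z)"
      unfolding f_def by (simp add: left_diff_distrib sum_subtractf)
  qed
  have spanW: "(%z. \<Sum>l<m. u l * w l z) \<in> cfun.span W" for u :: "nat => complex"
  proof -
    have "(\<Sum>l<m. (%z. u l * w l z)) \<in> cfun.span W"
      by (intro cfun.span_sum cfun.span_scale cfun.span_base) (auto simp: W_def)
    moreover have "(\<Sum>l<m. (%z. u l * w l z)) = (%z. \<Sum>l<m. u l * w l z)" by (induction m) (auto simp: fun_eq_iff)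
    ultimately show ?thesis by simp
  qed
  show ?thesis
  proof (rule that[of W])
    show "finite W" "card W <= m" by (auto simp: W_def intro: card_image_le[THEN order_trans])
    show "W \<subseteq> cfun.span J" unfolding W_def w_def f_def by (auto intro!: span_sumI)
    fix c :: "('d fn) => complex" and b :: real
    assume b: "b > 0" and c: "(\<Sum>e\<in>J. (cmod (c e))\<^sup>2) <= b\<^sup>2"
    define x where "x e = Re (c e) / b" for e
    define y where "y e = Im (c e) / b" for e
    have "(\<Sum>e\<in>J. (cmod (c e))\<^sup>2) / b\<^sup>2 <= 1" using c b by simp
    moreover have "(\<Sum>e\<in>J. (x e)\<^sup>2) <= (\<Sum>e\<in>J. (cmod (c e))\<^sup>2) / b\<^sup>2" unfolding sum_divide_distrib
      by (intro sum_mono) (simp add: x_def power_divide cmod_power2 divide_right_mono)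
    moreover have "(\<Sum>e\<in>J. (y e)\<^sup>2) <= (\<Sum>e\<in>J. (cmod (c e))\<^sup>2) / b\<^sup>2" unfolding sum_divide_distrib
      by (intro sum_mono) (simp add: y_def power_divide cmod_power2 divide_right_mono)
    ultimately have "(\<Sum>e\<in>J. (x e)\<^sup>2) <= 1" "(\<Sum>e\<in>J. (y e)\<^sup>2) <= 1" by linarith+
    then obtain t u where t: "N (%i. x i - (\<Sum>l<m. t l * (rs ! l) i)) <= G" and u: "N (%i. y i - (\<Sum>l<m. u l * (rs ! l) i)) <= G"
      using G by blast
    define F1 where "F1 = (%z. f x z - (\<Sum>l<m. complex_of_real (t l) * w l z))"
    define F2 where "F2 = (%z. f y z - (\<Sum>l<m. complex_of_real (u l) * w l z))"
    have F: "Lnorm (2 * j) F1 <= G" "Lnorm (2 * j) F2 <= G" using t u unfolding N_def diff F1_def F2_def .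
    have sF: "sphere_fun F1" "sphere_fun F2" unfolding F1_def F2_def diff[symmetric] by (rule sf)+
    define h where "h = (%z. \<Sum>l<m. (of_real b * (of_real (t l) + \<i> * of_real (u l))) * w l z)"
    have cb: "c e = of_real b * (of_real (x e) + \<i> * of_real (y e))" for e
      using b by (simp add: x_def y_def complex_eq_iff)
    have "(%z. (\<Sum>e\<in>J. c e * complex_of_real (\<alpha> e) * e z) - h z) = (%z. of_real b * F1 z + (\<i> * of_real b) * F2 z)"
    proof
      fix z
      have "(\<Sum>e\<in>J. c e * complex_of_real (\<alpha> e) * e z) = of_real b * f x z + (\<i> * of_real b) * f y z"
        unfolding f_def sum_distrib_left sum.distrib[symmetric] by (intro sum.cong refl) (simp add: cb algebra_simps)
      moreover have "h z = of_real b * (\<Sum>l<m. complex_of_real (t l) * w l z) + (\<i> * of_real b) * (\<Sum>l<m. complex_of_real (u l) * w l z)"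
        unfolding h_def sum_distrib_left sum.distrib[symmetric] by (intro sum.cong refl) (simp add: algebra_simps)
      ultimately show "(\<Sum>e\<in>J. c e * complex_of_real (\<alpha> e) * e z) - h z = of_real b * F1 z + (\<i> * of_real b) * F2 z"
        by (simp add: F1_def F2_def algebra_simps)
    qed
    hence "Lnorm (2 * j) (%z. (\<Sum>e\<in>J. c e * complex_of_real (\<alpha> e) * e z) - h z) = Lnorm (2 * j) (%z. of_real b * F1 z + (\<i> * of_real b) * F2 z)" by simp
    also have "... <= Lnorm (2 * j) (%z. of_real b * F1 z) + Lnorm (2 * j) (%z. (\<i> * of_real b) * F2 z)"
      by (intro Lnorm_add sphere_fun_scale sF j)
    also have "... = b * Lnorm (2 * j) F1 + b * Lnorm (2 * j) F2" using b j by (simp add: Lnorm_scale norm_mult)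
    also have "... <= b * G + b * G" using F b by (intro add_mono mult_left_mono) auto
    also have "... = section_constant TYPE('d) * sqrt (real j / real m) * A * b" by (simp add: G_def)
    finally have *: "Lnorm (2 * j) (%z. (\<Sum>e\<in>J. c e * complex_of_real (\<alpha> e) * e z) - h z)
        <= section_constant TYPE('d) * sqrt (real j / real m) * A * b" .
    have "h \<in> cfun.span W" unfolding h_def by (rule spanW)
    with * show "\<exists>h\<in>cfun.span W. Lnorm (2 * j) (%z. (\<Sum>e\<in>J. c e * complex_of_real (\<alpha> e) * e z) - h z)
        <= section_constant TYPE('d) * sqrt (real j / real m) * A * b" by (intro bexI[of _ h])
  qed
qed

section \<open>Widths and the splitting of a multiplier operator\<close>

lemma Lp_norm_bounded:
  fixes f :: "'d::finite fn"
  assumes q: "2 <= q" and f: "f \<in> borel_measurable \<mu>" and F: "F > 0" "!!x. norm x = 1 ==> cmod (f x) <= F"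
  shows "Lp_norm \<mu> q f
    <= ennreal (F powr (1 - 2 * enn2real (1 / q)) * (F * sqrt (area TYPE('d))) powr (2 * enn2real (1 / q)))"
proof (rule Lp_norm_interpolate[OF q f F])
  have a: "area TYPE('d) > 0" by (rule measure_sphere_pos)
  show "0 < F * sqrt (area TYPE('d))" using a F by simp
  have i: "integrable \<mu> (%x. (cmod (f x))\<^sup>2)"
    by (rule sphere.integrable_const_bound[where B="F\<^sup>2"]) (use F f in \<open>auto intro!: AE_I2 power_mono\<close>)
  have "(\<integral>x. (cmod (f x))\<^sup>2 \<partial>\<mu>) <= (\<integral>x. F\<^sup>2 \<partial>(\<mu> :: (complex ^ 'd) measure))"
    by (rule integral_mono[OF i]) (use F in \<open>auto intro!: power_mono\<close>)
  thus "(\<integral>x. (cmod (f x))\<^sup>2 \<partial>\<mu>) <= (F * sqrt (area TYPE('d)))\<^sup>2"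
    using a by (simp add: power_mult_distrib mult.commute)
qed auto

lemma sphere_fun_in_Lp_space:
  fixes f :: "'d::finite fn"
  assumes q: "2 <= q" and f: "sphere_fun f"
  shows "f \<in> Lp_space \<mu> q"
proof -
  have c: "continuous_on (sphere 0 1) f" by (rule sphere_fun_continuous[OF f])
  obtain B where B: "!!x. x \<in> sphere 0 1 ==> norm (f x) <= B" using sphere_bounded[OF c] by blast
  have m: "f \<in> borel_measurable \<mu>" by (rule sphere_measurable[OF c])
  have "cmod (f x) <= \<bar>B\<bar> + 1" if "norm x = 1" for x using B[of x] that by simp
  from order_le_less_trans[OF Lp_norm_bounded[OF q m _ this] ennreal_less_top]
  have "Lp_norm \<mu> q f < \<infinity>" by simp
  thus ?thesis using m by (simp add: Lp_space_def)
qed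

text \<open>Independence modulo null sets is automatic for an orthonormal set, since inner products do not see
  null sets.\<close>

lemma kolmogorov_width_le:
  fixes B :: "'d::finite fn set"
  assumes q: "2 <= q" and B: "orthonormal B" "card B = k"
    and le: "!!f. f \<in> A ==> \<exists>g\<in>cfun.span B. Lp_norm \<mu> q (%x. f x - g x) <= \<epsilon>"
  shows "kolmogorov_width k A \<mu> q <= \<epsilon>"
proof -
  have "cfun.span B \<in> Lp_subspaces \<mu> q k"
    unfolding Lp_subspaces_def
  proof (intro CollectI exI conjI allI impI ballI)
    show "B \<subseteq> Lp_space \<mu> q" using sphere_fun_in_Lp_space[OF q] orthonormal_sphere_fun[OF B(1)] by blast
    show "finite B" by (rule orthonormal_finite[OF B(1)])
    fix c e assume ae: "AE x in \<mu>. (\<Sum>b\<in>B. c b * b x) = 0" and e: "e \<in> B"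
    have sf: "sphere_fun (%x. \<Sum>b\<in>B. c b * b x)" by (intro sphere_fun_sum sphere_fun_scale orthonormal_sphere_fun[OF B(1)])
    have "c e = ip (%x. \<Sum>b\<in>B. c b * b x) e" using ip_orthonormal_sum[OF B(1) subset_refl e, of c] e by simp
    also have "... = ip (%x. 0) e"
      by (rule ip_cong_AE[OF ae sphere_measurable[OF sphere_fun_continuous[OF sf]] _ orthonormal_sphere_fun[OF B(1) e]]) simp
    finally show "c e = 0" by simp
  qed (use B in auto)
  moreover have "(SUP f\<in>A. INF g\<in>cfun.span B. Lp_norm \<mu> q (%x. f x - g x)) <= \<epsilon>"
  proof (rule SUP_least)
    fix f assume "f \<in> A"
    then obtain g where "g \<in> cfun.span B" "Lp_norm \<mu> q (%x. f x - g x) <= \<epsilon>" using le by blast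
    thus "(INF g\<in>cfun.span B. Lp_norm \<mu> q (%x. f x - g x)) <= \<epsilon>"
      by (meson INF_lower order_trans)
  qed
  ultimately show ?thesis unfolding kolmogorov_width_def by (rule INF_lower2)
qed

text \<open>Every level contains a nonzero harmonic, the power of a coordinate.\<close>

lemma card_E_ge: "N < card (E N :: 'd::finite fn set)"
proof -
  have ne: "hbasis j 0 ~= ({} :: 'd fn set)" for j
  proof
    assume e: "hbasis j 0 = ({} :: 'd fn set)"
    fix k :: 'd
    define P where "P = (%z :: complex ^ 'd. (z $ k) ^ j)"
    have P: "P \<in> bihom_polys j 0" using bihom_power[OF bihom_coord[of k], of j] by (simp add: P_def)
    hence "sphere_restrict P \<in> harmonic_space j 0" unfolding harmonic_space_eq using lap_degree_0(2)[OF P] by blast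
    hence "sphere_restrict P \<in> cfun.span (hbasis j 0)" by (simp only: hbasis(2))
    hence z: "sphere_restrict P = (%z. 0)" unfolding e cfun.span_empty by (simp add: fun_eq_iff)
    have "sphere_restrict P (axis k 1) = 1" by (simp add: P_def sphere_restrict_def norm_axis_1)
    thus False using z by simp
  qed
  define g :: "nat => 'd fn" where "g j = (SOME e. e \<in> hbasis j 0)" for j
  have g: "g j \<in> hbasis j 0" for j using ne[of j] by (simp add: g_def some_in_eq)
  have "inj_on g {..N}"
    by (rule inj_onI) (metis g hbasis_unique prod.inject)
  moreover have "g ` {..N} \<subseteq> E N" using g unfolding E_def by blast
  ultimately have "card {..N} <= card (E N :: 'd fn set)"
    by (rule card_inj_on_le[OF _ _ orthonormal_finite[OF orthonormal_E]])
  thus ?thesis by simp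
qed

text \<open>Widths are taken over subspaces of dimension exactly \<open>k\<close>, while the constructions give at most \<open>k\<close>.\<close>

lemma extend_orthonormal:
  fixes B :: "'d::finite fn set"
  assumes B: "orthonormal B" and k: "card B <= k"
  shows "\<exists>B'. orthonormal B' \<and> card B' = k \<and> cfun.span B \<subseteq> (cfun.span B' :: 'd fn set)"
  using k
proof (induction k rule: dec_induct)
  case base
  thus ?case using B by blast
next
  case (step n)
  then obtain B' :: "'d fn set" where B': "orthonormal B'" "card B' = n" "cfun.span B \<subseteq> cfun.span B'" by blast
  have "\<not> E n \<subseteq> cfun.span B'"
  proof
    assume s: "E n \<subseteq> cfun.span B'"
    have "card (E n :: 'd fn set) <= card B'"
      using cfun.independent_span_bound[OF orthonormal_finite[OF B'(1)] orthonormal_independent[OF orthonormal_E] s] by blast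
    thus False using card_E_ge[of n, where 'd='d] B'(2) by simp
  qed
  then obtain e where e: "e \<in> E n" "e \<notin> cfun.span B'" by blast
  have fin: "finite (insert e B')" using orthonormal_finite[OF B'(1)] by simp
  have sf: "insert e B' \<subseteq> Collect sphere_fun"
    using orthonormal_sphere_fun[OF B'(1)] orthonormal_sphere_fun[OF orthonormal_E e(1)] by blast
  obtain B2 where B2: "orthonormal B2" "cfun.span B2 = cfun.span (insert e B')" using gram_schmidt[OF fin sf] by blast
  have ind: "cfun.independent (insert e B')" by (rule cfun.independent_insertI[OF e(2) orthonormal_independent[OF B'(1)]])
  have "e \<notin> B'" using e(2) cfun.span_base by blast
  hence "card (insert e B') = Suc n" using orthonormal_finite[OF B'(1)] B'(2) by simp
  moreover have "card B2 = cfun.dim (insert e B')"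
    using cfun.dim_eq_card[OF B2(2) orthonormal_independent[OF B2(1)]] by simp
  moreover have "cfun.dim (insert e B') = card (insert e B')" by (rule cfun.dim_eq_card_independent[OF ind])
  ultimately have "card B2 = Suc n" by simp
  moreover have "cfun.span B \<subseteq> cfun.span B2" unfolding B2(2) using B'(3) cfun.span_mono[OF subset_insertI, of B' e] by blast
  ultimately show ?case using B2(1) by blast
qed

lemma kolmogorov_width_le_generated:
  fixes G :: "'d::finite fn set"
  assumes q: "2 <= q" and G: "finite G" "G \<subseteq> Collect sphere_fun" "card G <= k"
    and le: "!!f. f \<in> A ==> \<exists>g\<in>cfun.span G. Lp_norm \<mu> q (%x. f x - g x) <= \<epsilon>"
  shows "kolmogorov_width k A \<mu> q <= \<epsilon>"
proof -
  obtain B0 where B0: "orthonormal B0" "cfun.span B0 = cfun.span G" using gram_schmidt[OF G(1,2)] by blast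
  have s: "B0 \<subseteq> cfun.span G" unfolding B0(2)[symmetric] by (rule cfun.span_superset)
  have "card B0 <= card G" using cfun.independent_span_bound[OF G(1) orthonormal_independent[OF B0(1)] s] by blast
  then obtain B where "orthonormal B" "card B = k" "cfun.span B0 \<subseteq> cfun.span B"
    using extend_orthonormal[OF B0(1)] G(3) by (meson order_trans)
  with le show ?thesis unfolding B0(2) by (intro kolmogorov_width_le[OF q, of B]) blast+
qed

definition level :: "('d::finite fn) => nat" where
  "level e = (SOME j. e \<in> shell j)"

lemma level_eq: "e \<in> shell j ==> level e = j"
  unfolding level_def by (rule some_equality) (auto intro: shell_disjoint)

lemma enn2real_inverse_le: "1 <= p ==> enn2real (1 / p) <= 1"
proof (cases "p = \<infinity>")
  case False
  assume p: "1 <= p"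
  have "p ~= 0" using p by auto
  thus ?thesis using enn2real_ge[OF p False] by (simp add: enn2real_inverse[OF _ False])
qed simp

lemma multiplier_expansion:
  fixes \<phi> :: "'d::finite fn"
  assumes d: "CARD('d) >= 2" and \<gamma>: "\<gamma> > 0" and r: "r > 0" and p: "1 <= p" and \<phi>: "\<phi> \<in> Lp_ball \<mu> p"
  defines "a \<equiv> (%j. exp (- \<gamma> * real j powr r))"
  shows "multiplier_operator (exp_multiplier \<gamma> r) \<phi> \<in> borel_measurable \<mu>"
    and "summable (%j. a j * card (shell j :: 'd fn set))"
    and "!!w. summable (%j. a j *\<^sub>R Q j \<phi> w)"
    and "AE w in \<mu>. multiplier_operator (exp_multiplier \<gamma> r) \<phi> w = (\<Sum>j. a j *\<^sub>R Q j \<phi> w)"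
    and "!!j w. cmod (a j *\<^sub>R Q j \<phi> w) <= (1 + 2 * area TYPE('d)) / area TYPE('d) * (a j * card (shell j :: 'd fn set))"
proof -
  have ar: "area TYPE('d) > 0" by (rule measure_sphere_pos)
  note \<phi>i = Lp_ball_integrable[OF p \<phi>]
  have a0: "a j >= 0" for j by (simp add: a_def)
  have s0: "summable (%j. 4 * (exp (- \<gamma> * real j powr r) * real (j + CARD('d)) ^ (2 * CARD('d) - 2)))"
    by (intro summable_mult summable_exp_powr \<gamma> r)
  show s: "summable (%j. a j * card (shell j :: 'd fn set))"
  proof (rule summable_comparison_test'[OF s0, of 1])
    fix n :: nat assume n: "n >= 1"
    have "real (card (shell n :: 'd fn set)) <= 4 * real (n + CARD('d)) ^ (2 * CARD('d) - 2)"
      using of_nat_mono[OF card_shell_le[OF d n], where 'a=real] by simp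
    hence "a n * card (shell n :: 'd fn set) <= a n * (4 * real (n + CARD('d)) ^ (2 * CARD('d) - 2))" by (rule mult_left_mono[OF _ a0])
    thus "norm (a n * card (shell n :: 'd fn set)) <= 4 * (exp (- \<gamma> * real n powr r) * real (n + CARD('d)) ^ (2 * CARD('d) - 2))"
      using a0[of n] by (simp add: a_def abs_mult mult_ac)
  qed
  have l: "exp_multiplier \<gamma> r m n = complex_of_real (a (max m n))" for m n by (simp add: exp_multiplier_def a_def)
  show "multiplier_operator (exp_multiplier \<gamma> r) \<phi> \<in> borel_measurable \<mu>"
    "!!w. summable (%j. a j *\<^sub>R Q j \<phi> w)"
    "AE w in \<mu>. multiplier_operator (exp_multiplier \<gamma> r) \<phi> w = (\<Sum>j. a j *\<^sub>R Q j \<phi> w)"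
    using multiplier_AE[OF \<phi>i(1) a0 s l] by auto
  fix j w
  have "cmod (Q j \<phi> w) <= card (shell j :: 'd fn set) / area TYPE('d) * (\<integral>z. cmod (\<phi> z) \<partial>\<mu>)" by (rule Q_bound[OF \<phi>i(1)])
  also have "... <= card (shell j :: 'd fn set) / area TYPE('d) * (1 + 2 * area TYPE('d))" using \<phi>i(2) by (rule mult_left_mono) simp
  finally have "a j * cmod (Q j \<phi> w) <= a j * (card (shell j :: 'd fn set) / area TYPE('d) * (1 + 2 * area TYPE('d)))" by (rule mult_left_mono[OF _ a0])
  thus "cmod (a j *\<^sub>R Q j \<phi> w) <= (1 + 2 * area TYPE('d)) / area TYPE('d) * (a j * card (shell j :: 'd fn set))"
    using a0[of j] by (simp add: mult_ac)
qed

lemma multiplier_bounded: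
  assumes d: "CARD('d::finite) >= 2" and \<gamma>: "\<gamma> > 0" and r: "r > 0"
  obtains F where "F > 0" "!!p \<phi>. 1 <= p ==> \<phi> \<in> Lp_ball \<mu> p ==>
    \<exists>\<psi>. \<psi> \<in> borel_measurable \<mu> \<and> (AE w in \<mu>. multiplier_operator (exp_multiplier \<gamma> r) \<phi> w = \<psi> w) \<and>
      (\<forall>w :: complex ^ 'd. cmod (\<psi> w) <= F)"
proof -
  have ar: "area TYPE('d) > 0" by (rule measure_sphere_pos)
  define a where "a j = exp (- \<gamma> * real j powr r)" for j
  define S where "S = (\<Sum>j. (1 + 2 * area TYPE('d)) / area TYPE('d) * (a j * card (shell j :: 'd fn set)))"
  show ?thesis
  proof (rule that[of "\<bar>S\<bar> + 1"])
    fix p and \<phi> :: "'d fn" assume p: "1 <= p" and \<phi>: "\<phi> \<in> Lp_ball \<mu> p"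
    note ex = multiplier_expansion[OF d \<gamma> r p \<phi>, folded a_def]
    define \<psi> where "\<psi> w = (\<Sum>j. a j *\<^sub>R Q j \<phi> w)" for w
    have "\<psi> \<in> borel_measurable \<mu>" unfolding \<psi>_def
      by (intro borel_measurable_suminf borel_measurable_scaleR borel_measurable_const sphere_measurable sphere_fun_continuous sphere_fun_Q)
    moreover have "cmod (\<psi> w) <= \<bar>S\<bar> + 1" for w
    proof -
      have "cmod (\<psi> w) <= S" unfolding \<psi>_def S_def
        by (rule norm_suminf_le[OF ex(5)]) (intro summable_mult ex(2))
      thus ?thesis by linarith
    qed
    ultimately show "\<exists>\<psi>. \<psi> \<in> borel_measurable \<mu> \<and> (AE w in \<mu>. multiplier_operator (exp_multiplier \<gamma> r) \<phi> w = \<psi> w) \<and>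
      (\<forall>w :: complex ^ 'd. cmod (\<psi> w) <= \<bar>S\<bar> + 1)" using ex(4) unfolding \<psi>_def by blast
  qed simp
qed

text \<open>The square root of the multiplier on the shell of \<open>e\<close>.\<close>

abbreviation weight :: "real => real => ('d::finite fn) => real" where
  "weight \<gamma> r e \<equiv> exp (- (\<gamma> / 2) * real (level e) powr r)"

lemma weight_square: "e \<in> shell j ==> weight \<gamma> r e * weight \<gamma> r e = exp (- \<gamma> * real j powr r)"
  by (simp add: level_eq exp_add[symmetric])

lemma weight_le:
  assumes "\<gamma> > 0" "r > 0" and e: "e \<in> E M - E N"
  shows "weight \<gamma> r e <= exp (- (\<gamma> / 2) * real N powr r)"
proof -
  obtain j where j: "e \<in> shell j" using e unfolding E_eq_shell by blast
  have "\<not> j <= N" using e j unfolding E_eq_shell by blast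
  hence "real N powr r <= real j powr r" using assms by (intro powr_mono2) auto
  thus ?thesis using assms by (simp add: level_eq[OF j])
qed

abbreviation smooth_class :: "'d::finite itself => real => real => ennreal => 'd fn set" where
  "smooth_class _ \<gamma> r p \<equiv> multiplier_operator (exp_multiplier \<gamma> r) ` Lp_ball \<mu> p"

abbreviation gain :: "ennreal => real" where
  "gain p \<equiv> max 0 (enn2real (1 / p) - 1 / 2)"

text \<open>The effective number of basis elements above level \<open>N\<close> on which the multiplier is comparable to its
  value at \<open>N\<close>.\<close>

definition bulk :: "'d::finite itself => real => nat => real" where
  "bulk _ r N = real N powr (2 * real CARD('d) - 1 - min 1 r)"

text \<open>Membership of \<open>f\<close> in \<open>harmonic_sum N\<close> up to two errors: a weighted sum over the middle shells, which is to be
  approximated further, and a tail that is small enough already.\<close>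

definition splits_at :: "real => real => real => ennreal => nat => ('d::finite fn) => bool" where
  "splits_at C \<gamma> r p N f \<longleftrightarrow> (\<exists>g\<in>harmonic_sum N. \<exists>c T.
     T \<in> borel_measurable \<mu> \<and> (\<forall>w. cmod (T w) <= C * exp (- \<gamma> * real N powr r)) \<and>
     (\<Sum>e\<in>E (2 * N) - E N. (cmod (c e))\<^sup>2) <= (C * exp (- (\<gamma> / 2) * real N powr r) * bulk TYPE('d) r N powr gain p)\<^sup>2 \<and>
     (AE w in \<mu>. f w = g w + (\<Sum>e\<in>E (2 * N) - E N. c e * complex_of_real (weight \<gamma> r e) * e w) + T w))"

lemma smooth_class_measurable:
  assumes "CARD('d::finite) >= 2" "\<gamma> > 0" "r > 0" "1 <= p" "f \<in> smooth_class TYPE('d) \<gamma> r p"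
  shows "f \<in> borel_measurable \<mu>"
  using assms multiplier_expansion(1) by blast

lemma multiplier_decomposition:
  assumes d: "CARD('d::finite) >= 2" and \<gamma>: "\<gamma> > 0" and r: "r > 0"
  obtains C where "C > 0"
    "!!N w. N >= 1 ==> norm w = 1 ==> (\<Sum>e\<in>E (2 * N) - E N. (weight \<gamma> r e)\<^sup>2 * (cmod (e (w :: complex ^ 'd)))\<^sup>2)
       <= (C * exp (- (\<gamma> / 2) * real N powr r) * bulk TYPE('d) r N powr (1 / 2))\<^sup>2"
    "!!N p f. N >= 1 ==> 1 <= p ==> f \<in> smooth_class TYPE('d) \<gamma> r p ==> splits_at C \<gamma> r p N f"
proof -
  define ar where "ar = area TYPE('d)"
  have ar: "ar > 0" unfolding ar_def by (rule measure_sphere_pos)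
  define D where "D = CARD('d)"
  define a where "a j = exp (- \<gamma> * real j powr r)" for j
  have a0: "a j >= 0" for j by (simp add: a_def)
  define s where "s = bulk TYPE('d) r"
  have s_eq: "s N = real N powr (2 * real D - 1 - min 1 r)" for N by (simp add: s_def bulk_def D_def)
  obtain C1 where C1: "C1 > 0" "!!N. N >= 1 ==> (\<Sum>j\<in>{N<..2*N}. exp (- \<gamma> * real j powr r) * real (j + D) ^ (2 * D - 2))
        <= C1 * (exp (- \<gamma> * real N powr r) * real N powr (real (2 * D - 2) + 1 - min 1 r))"
    by (rule shell_sum_bound[OF \<gamma> r, where d=D and a="2 * D - 2"]) blast
  obtain B where B: "summable B" "!!j. B j >= 0"
    "!!N j. j > 2 * N ==> exp (- \<gamma> * real j powr r) * real (j + D) ^ (2 * D - 2) <= exp (- \<gamma> * real N powr r) * B j"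
    by (rule tail_sum_bound[OF \<gamma> r, where d=D and a="2 * D - 2"]) blast
  have cSh: "real (card (shell n :: 'd fn set)) <= 4 * real (n + D) ^ (2 * D - 2)" if "n >= 1" for n
    using of_nat_mono[OF card_shell_le[OF d that], where 'a=real] by (simp add: D_def)
  define C2 where "C2 = sqrt (4 * C1 / ar) + 1"
  have C2: "C2 >= 1" "4 * C1 / ar <= C2\<^sup>2"
  proof -
    show "C2 >= 1" using C1 ar by (simp add: C2_def)
    have "sqrt (4 * C1 / ar) ^ 2 <= C2\<^sup>2" using C1 ar by (intro power_mono) (auto simp: C2_def)
    thus "4 * C1 / ar <= C2\<^sup>2" using C1 ar by simp
  qed
  have D2: "D >= 2" using d by (simp add: D_def)
  have expo: "real (2 * D - 2) + 1 - min 1 r = 2 * real D - 1 - min 1 r" using D2 by (simp add: of_nat_diff)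
  have kernel: "(\<Sum>e\<in>E (2 * N) - E N. (weight \<gamma> r e)\<^sup>2 * (cmod (e (w :: complex ^ 'd)))\<^sup>2)
       <= (C2 * exp (- (\<gamma> / 2) * real N powr r) * s N powr (1 / 2))\<^sup>2" if N: "N >= 1" and w: "norm w = 1" for N w
  proof -
    have "(\<Sum>e\<in>E (2 * N) - E N. (weight \<gamma> r e)\<^sup>2 * (cmod (e w))\<^sup>2) = (\<Sum>j\<in>{N<..2*N}. \<Sum>e\<in>shell j. (weight \<gamma> r e)\<^sup>2 * (cmod (e w))\<^sup>2)"
      by (rule sum_E_diff) simp
    also have "... = (\<Sum>j\<in>{N<..2*N}. a j * (card (shell j :: 'd fn set) / ar))"
    proof (intro sum.cong refl)
      fix j
      have "(\<Sum>e\<in>shell j. (weight \<gamma> r e)\<^sup>2 * (cmod (e w))\<^sup>2) = (\<Sum>e\<in>shell j. a j * (cmod (e w))\<^sup>2)"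
        by (intro sum.cong refl) (simp only: power2_eq_square[of "weight \<gamma> r _"] weight_square a_def)
      also have "... = a j * (card (shell j :: 'd fn set) / ar)"
        unfolding sum_distrib_left[symmetric] shell_kernel[OF w] ar_def ..
      finally show "(\<Sum>e\<in>shell j. (weight \<gamma> r e)\<^sup>2 * (cmod (e w))\<^sup>2) = a j * (card (shell j :: 'd fn set) / ar)" .
    qed
    also have "... <= (\<Sum>j\<in>{N<..2*N}. a j * (4 * real (j + D) ^ (2 * D - 2) / ar))"
      using ar a0 N by (intro sum_mono mult_left_mono divide_right_mono cSh) auto
    also have "... = 4 / ar * (\<Sum>j\<in>{N<..2*N}. exp (- \<gamma> * real j powr r) * real (j + D) ^ (2 * D - 2))"
      unfolding sum_distrib_left a_def by (intro sum.cong refl) simp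
    also have "... <= 4 / ar * (C1 * (exp (- \<gamma> * real N powr r) * s N))"
      using C1(2)[OF N] ar unfolding expo s_eq by (intro mult_left_mono) auto
    also have "... = 4 * C1 / ar * (exp (- \<gamma> * real N powr r) * s N)" by simp
    also have "... <= C2\<^sup>2 * (exp (- \<gamma> * real N powr r) * s N)" using C2(2) by (rule mult_right_mono) (simp add: s_eq)
    also have "exp (- \<gamma> * real N powr r) = (exp (- (\<gamma> / 2) * real N powr r))\<^sup>2" by (simp add: exp_double[symmetric])
    also have "s N = (s N powr (1 / 2))\<^sup>2"
      by (simp add: s_eq powr_half_sqrt)
    finally show ?thesis by (simp add: power_mult_distrib mult_ac)
  qed
  define Ct where "Ct = (1 + 2 * ar) / ar * 4 * suminf B"
  have Ct: "Ct >= 0" unfolding Ct_def using ar suminf_nonneg[OF B(1,2)] by simp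
  define C where "C = (3 + 2 * ar) * C2 + Ct"
  have CC: "C > 0" "C2 <= C" "Ct <= C" "(3 + 2 * ar) * C2 <= C"
  proof -
    have 1: "C2 * 1 <= C2 * (3 + 2 * ar)" using ar C2 by (intro mult_left_mono) auto
    have 2: "0 < (3 + 2 * ar) * C2" using ar C2 by simp
    show "C > 0" "C2 <= C" "Ct <= C" "(3 + 2 * ar) * C2 <= C" unfolding C_def using 1 2 Ct by (simp_all add: mult.commute)
  qed
  show ?thesis
  proof (rule that[of C])
    show "C > 0" by (rule CC)
    fix N :: nat assume N: "N >= 1"
    define amax where "amax = exp (- (\<gamma> / 2) * real N powr r)"
    have amax: "amax > 0" by (simp add: amax_def)
    have sN: "s N > 0" using N by (simp add: s_eq)
    show "(\<Sum>e\<in>E (2 * N) - E N. (weight \<gamma> r e)\<^sup>2 * (cmod (e w))\<^sup>2)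
       <= (C * exp (- (\<gamma> / 2) * real N powr r) * bulk TYPE('d) r N powr (1 / 2))\<^sup>2" if w: "norm w = 1" for w :: "complex ^ 'd"
    proof -
      have "(C2 * amax * s N powr (1 / 2))\<^sup>2 <= (C * amax * s N powr (1 / 2))\<^sup>2" using CC C2 amax by (intro power_mono mult_right_mono) auto
      with kernel[OF N w] show ?thesis unfolding s_def amax_def by linarith
    qed
    fix p f assume p: "1 <= p" and "f \<in> smooth_class TYPE('d) \<gamma> r p"
    then obtain \<phi> :: "'d fn" where \<phi>: "\<phi> \<in> Lp_ball \<mu> p"
      and f: "f = multiplier_operator (exp_multiplier \<gamma> r) \<phi>" by blast
    note ex = multiplier_expansion[OF d \<gamma> r p \<phi>, folded a_def ar_def]
    define xp where "xp = max 0 (enn2real (1 / p) - 1 / 2)"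
    have xp: "0 <= xp" "2 * xp <= 1" using enn2real_inverse_le[OF p] by (auto simp: xp_def max_def)
    define J where "J = E (2 * N) - (E N :: 'd fn set)"
    have oJ: "orthonormal J" unfolding J_def by (rule orthonormal_subset[OF orthonormal_E[of "2 * N"]]) auto
    \<comment> \<open>one square root of the multiplier goes into the coefficient, the other one remains as weight\<close>
    define c where "c e = complex_of_real (weight \<gamma> r e) * ip \<phi> e" for e
    define g where "g w = (\<Sum>j\<le>N. a j *\<^sub>R Q j \<phi> w)" for w
    define T where "T w = (\<Sum>n. a (n + Suc (2 * N)) *\<^sub>R Q (n + Suc (2 * N)) \<phi> w)" for w
    have "g = (%w. \<Sum>e\<in>E N. (complex_of_real (a (level e)) * ip \<phi> e) * e w)"
      unfolding g_def sum_E Q_def scaleR_sum_right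
      by (intro ext sum.cong refl) (simp add: level_eq scaleR_conv_of_real[where 'a=complex] mult.assoc)
    hence gS: "g \<in> harmonic_sum N" unfolding span_E[symmetric] by (simp add: span_sumI)
    have Tm: "T \<in> borel_measurable \<mu>" unfolding T_def
      by (intro borel_measurable_suminf borel_measurable_scaleR borel_measurable_const sphere_measurable sphere_fun_continuous sphere_fun_Q)
    have Tb: "cmod (T w) <= C * exp (- \<gamma> * real N powr r)" for w
    proof -
      have sB: "summable (%n. B (n + Suc (2 * N)))" using B(1) by (rule summable_ignore_initial_segment)
      have "cmod (T w) <= (\<Sum>n. (1 + 2 * ar) / ar * (4 * (exp (- \<gamma> * real N powr r) * B (n + Suc (2 * N)))))"
        unfolding T_def
      proof (rule norm_suminf_le)
        show "summable (%n. (1 + 2 * ar) / ar * (4 * (exp (- \<gamma> * real N powr r) * B (n + Suc (2 * N)))))" by (intro summable_mult sB)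
        fix n
        let ?j = "n + Suc (2 * N)"
        have "a ?j * card (shell ?j :: 'd fn set) <= a ?j * (4 * real (?j + D) ^ (2 * D - 2))" by (intro mult_left_mono cSh a0) simp
        also have "... = 4 * (exp (- \<gamma> * real ?j powr r) * real (?j + D) ^ (2 * D - 2))" by (simp add: a_def)
        also have "... <= 4 * (exp (- \<gamma> * real N powr r) * B ?j)" by (intro mult_left_mono B(3)) auto
        finally have "(1 + 2 * ar) / ar * (a ?j * card (shell ?j :: 'd fn set)) <= (1 + 2 * ar) / ar * (4 * (exp (- \<gamma> * real N powr r) * B ?j))"
          using ar by (intro mult_left_mono) auto
        with ex(5)[of ?j w] show "cmod (a ?j *\<^sub>R Q ?j \<phi> w) <= (1 + 2 * ar) / ar * (4 * (exp (- \<gamma> * real N powr r) * B ?j))" by linarith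
      qed
      also have "... = (1 + 2 * ar) / ar * (4 * (exp (- \<gamma> * real N powr r) * (\<Sum>n. B (n + Suc (2 * N)))))"
        by (simp only: mult.assoc[symmetric] suminf_mult[OF sB])
      also have "... <= (1 + 2 * ar) / ar * (4 * (exp (- \<gamma> * real N powr r) * suminf B))"
      proof -
        have "suminf B = (\<Sum>n. B (n + Suc (2 * N))) + (\<Sum>i<Suc (2 * N). B i)" by (rule suminf_split_initial_segment[OF B(1)])
        moreover have "0 <= (\<Sum>i<Suc (2 * N). B i)" by (intro sum_nonneg B(2))
        ultimately have "(\<Sum>n. B (n + Suc (2 * N))) <= suminf B" by linarith
        thus ?thesis using ar by (intro mult_left_mono) auto
      qed
      also have "... = Ct * exp (- \<gamma> * real N powr r)" by (simp add: Ct_def)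
      also have "... <= C * exp (- \<gamma> * real N powr r)" using CC by (intro mult_right_mono) auto
      finally show ?thesis .
    qed
    have cb: "(\<Sum>e\<in>J. (cmod (c e))\<^sup>2) <= (C * amax * s N powr xp)\<^sup>2"
    proof -
      have al: "0 <= weight \<gamma> r e \<and> weight \<gamma> r e <= amax" if "e \<in> J" for e
        using weight_le[OF \<gamma> r that[unfolded J_def]] by (simp add: amax_def)
      define A where "A = C2 * amax * s N powr (1 / 2)"
      have A: "A > 0" using C2 amax sN by (simp add: A_def)
      have k: "(\<Sum>e\<in>J. (weight \<gamma> r e)\<^sup>2 * (cmod (e w))\<^sup>2) <= A\<^sup>2" if "norm w = 1" for w
        using kernel[OF N that] unfolding J_def A_def amax_def .
      have "sqrt (\<Sum>e\<in>J. (weight \<gamma> r e)\<^sup>2 * (cmod (ip \<phi> e))\<^sup>2) <= (3 + 2 * ar) * amax * (A / amax) powr (2 * xp)"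
        unfolding ar_def xp_def by (rule coefficient_bound[OF p \<phi> oJ al amax A k])
      also have "A / amax = C2 * s N powr (1 / 2)" using amax by (simp add: A_def)
      also have "(C2 * s N powr (1 / 2)) powr (2 * xp) = C2 powr (2 * xp) * s N powr xp" by (simp add: powr_mult powr_powr)
      also have "C2 powr (2 * xp) <= C2 powr 1" using xp C2 by (intro powr_mono) auto
      also have "(3 + 2 * ar) * amax * (C2 powr 1 * s N powr xp) = ((3 + 2 * ar) * C2) * amax * s N powr xp" using C2 by simp
      also have "... <= C * amax * s N powr xp" using CC amax by (intro mult_right_mono) auto
      finally have "sqrt (\<Sum>e\<in>J. (weight \<gamma> r e)\<^sup>2 * (cmod (ip \<phi> e))\<^sup>2) <= C * amax * s N powr xp"
        using ar amax by (simp add: mult_left_mono mult_right_mono)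
      hence "(\<Sum>e\<in>J. (weight \<gamma> r e)\<^sup>2 * (cmod (ip \<phi> e))\<^sup>2) <= (C * amax * s N powr xp)\<^sup>2"
        by (rule sqrt_le_D)
      moreover have "(\<Sum>e\<in>J. (cmod (c e))\<^sup>2) = (\<Sum>e\<in>J. (weight \<gamma> r e)\<^sup>2 * (cmod (ip \<phi> e))\<^sup>2)"
        by (simp only: c_def norm_mult power_mult_distrib norm_of_real power2_abs)
      ultimately show ?thesis by simp
    qed
    have split: "(\<Sum>j. a j *\<^sub>R Q j \<phi> w) = g w + (\<Sum>e\<in>J. c e * complex_of_real (weight \<gamma> r e) * e w) + T w" for w
    proof -
      have "(\<Sum>j. a j *\<^sub>R Q j \<phi> w) = T w + (\<Sum>j<Suc (2 * N). a j *\<^sub>R Q j \<phi> w)"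
        unfolding T_def by (rule suminf_split_initial_segment[OF ex(3)])
      also have "{..<Suc (2 * N)} = {..N} \<union> {N<..2*N}" by auto
      also have "(\<Sum>j\<in>{..N} \<union> {N<..2*N}. a j *\<^sub>R Q j \<phi> w) = g w + (\<Sum>j\<in>{N<..2*N}. a j *\<^sub>R Q j \<phi> w)"
        unfolding g_def by (rule sum.union_disjoint) auto
      also have "(\<Sum>j\<in>{N<..2*N}. a j *\<^sub>R Q j \<phi> w) = (\<Sum>j\<in>{N<..2*N}. \<Sum>e\<in>shell j. c e * complex_of_real (weight \<gamma> r e) * e w)"
      proof (intro sum.cong refl)
        fix j
        have "a j *\<^sub>R (ip \<phi> e * e w) = c e * complex_of_real (weight \<gamma> r e) * e w" if "e \<in> shell j" for e
        proof -
          have "complex_of_real (a j) = complex_of_real (weight \<gamma> r e) * complex_of_real (weight \<gamma> r e)"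
            unfolding a_def weight_square[OF that, symmetric] by simp
          thus ?thesis by (simp only: c_def scaleR_conv_of_real mult_ac)
        qed
        thus "a j *\<^sub>R Q j \<phi> w = (\<Sum>e\<in>shell j. c e * complex_of_real (weight \<gamma> r e) * e w)"
          unfolding Q_def scaleR_sum_right by (rule sum.cong[OF refl])
      qed
      also have "... = (\<Sum>e\<in>J. c e * complex_of_real (weight \<gamma> r e) * e w)" unfolding J_def by (rule sum_E_diff[symmetric]) simp
      finally show ?thesis by (simp only: add.commute)
    qed
    show "splits_at C \<gamma> r p N f" unfolding splits_at_def f
      using gS Tm Tb cb[unfolded s_def amax_def xp_def J_def] ex(4)[unfolded split J_def] by blast
  qed
qed

section \<open>Widths for fast decay\<close>

text \<open>The exponents add up to \<open>(1/p - 1/2)_+ + (1/2) * (1 - 2/q)\<close>.\<close>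

lemma width_fast_decay:
  fixes p q :: ennreal
  assumes d: "CARD('d::finite) >= 2" and \<gamma>: "\<gamma> > 0" and r: "r > 1" and p: "1 <= p" and q: "2 <= q"
  shows "\<exists>C>0. \<forall>k\<ge>1. kolmogorov_width (card (E k :: 'd fn set))
      (smooth_class TYPE('d) \<gamma> r p) \<mu> q
    <= ennreal (C * (exp (- \<gamma> * real k powr r) *
        real k powr ((2 * real CARD('d) - 2) * (gain p + 1 / 2 - enn2real (1 / q)))))"
proof -
  define ar where "ar = area TYPE('d)"
  have ar: "ar > 0" unfolding ar_def by (rule measure_sphere_pos)
  have r0: "r > 0" "min 1 r = 1" using r by auto
  define s where "s = bulk TYPE('d) r"
  have s_eq: "s N = real N powr (2 * real CARD('d) - 2)" for N by (simp add: s_def bulk_def r0)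
  define xp where "xp = gain p"
  have xp: "xp >= 0" by (simp add: xp_def)
  obtain C where C: "C > 0"
    and kernel0: "!!N w. N >= 1 ==> norm w = 1 ==> (\<Sum>e\<in>E (2 * N) - E N. (weight \<gamma> r e)\<^sup>2 * (cmod (e (w :: complex ^ 'd)))\<^sup>2)
       <= (C * exp (- (\<gamma> / 2) * real N powr r) * bulk TYPE('d) r N powr (1 / 2))\<^sup>2"
    and dec0: "!!N p f. N >= 1 ==> 1 <= p ==> f \<in> smooth_class TYPE('d) \<gamma> r p ==> splits_at C \<gamma> r p N f"
    by (rule multiplier_decomposition[OF d \<gamma> r0(1)]) (rule that)
  note kernel = kernel0[folded s_def]
  define K where "K = C\<^sup>2 + C + 2 * (1 + ar) * C"
  have K: "K > 0" "C\<^sup>2 + C <= K" "2 * (1 + ar) * C <= K"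
  proof -
    have "C\<^sup>2 > 0" "ar * C > 0" using C ar by auto
    moreover have k: "2 * (1 + ar) * C = 2 * C + 2 * (ar * C)" by (simp add: algebra_simps)
    ultimately show "K > 0" "C\<^sup>2 + C <= K" "2 * (1 + ar) * C <= K" unfolding K_def k using C by linarith+
  qed
  show ?thesis
  proof (intro exI[of _ K] conjI K allI impI kolmogorov_width_le[OF q orthonormal_E refl])
    fix N :: nat and f assume N: "N >= 1" and f: "f \<in> smooth_class TYPE('d) \<gamma> r p"
    have fm: "f \<in> borel_measurable \<mu>" by (rule smooth_class_measurable[OF d \<gamma> r0(1) p f])
    define J where "J = E (2 * N) - (E N :: 'd fn set)"
    have oJ: "orthonormal J" unfolding J_def by (rule orthonormal_subset[OF orthonormal_E[of "2 * N"]]) auto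
    define amax where "amax = exp (- (\<gamma> / 2) * real N powr r)"
    have amax: "amax > 0" by (simp add: amax_def)
    define X where "X = exp (- \<gamma> * real N powr r)"
    have X: "X > 0" "X = amax * amax" by (simp_all add: X_def amax_def exp_add[symmetric])
    have s1: "s N >= 1" unfolding s_eq using N d by (intro ge_one_powr_ge_zero) auto
    obtain g c T where g: "g \<in> harmonic_sum N" and T: "T \<in> borel_measurable \<mu>" "!!w. cmod (T w) <= C * X"
      and c: "(\<Sum>e\<in>J. (cmod (c e))\<^sup>2) <= (C * amax * s N powr xp)\<^sup>2"
      and ae: "AE w in \<mu>. f w = g w + (\<Sum>e\<in>J. c e * complex_of_real (weight \<gamma> r e) * e w) + T w"
      using dec0[OF N p f] unfolding splits_at_def J_def X_def amax_def s_def xp_def by blast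
    define M where "M w = (\<Sum>e\<in>J. (c e * complex_of_real (weight \<gamma> r e)) * e w)" for w
    have sM: "sphere_fun M" unfolding M_def by (intro sphere_fun_sum sphere_fun_scale orthonormal_sphere_fun[OF oJ])
    have Mm: "M \<in> borel_measurable \<mu>" by (rule sphere_measurable[OF sphere_fun_continuous[OF sM]])
    have gm: "g \<in> borel_measurable \<mu>" by (rule sphere_measurable[OF sphere_fun_continuous[OF harmonic_sum_sphere_fun[OF g]]])
    define h where "h w = M w + T w" for w
    have hm: "h \<in> borel_measurable \<mu>" unfolding h_def using Mm T by measurable
    have eq: "Lp_norm \<mu> q (%x. f x - g x) = Lp_norm \<mu> q h"
    proof (rule Lp_norm_cong_AE[OF _ _ hm])
      show "AE x in \<mu>. f x - g x = h x" using ae by eventually_elim (simp add: h_def M_def)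
      show "(%x. f x - g x) \<in> borel_measurable \<mu>" using fm gm by measurable
    qed
    have Mb: "cmod (M w) <= C\<^sup>2 * X * s N powr (xp + 1 / 2)" if w: "norm w = 1" for w
    proof -
      have "M w = (\<Sum>e\<in>J. c e * (complex_of_real (weight \<gamma> r e) * e w))" unfolding M_def by (simp only: mult.assoc)
      also have "cmod ... <= sqrt (\<Sum>e\<in>J. (cmod (c e))\<^sup>2) * sqrt (\<Sum>e\<in>J. (cmod (complex_of_real (weight \<gamma> r e) * e w))\<^sup>2)" by (rule cauchy_schwarz_sum)
      also have "(\<Sum>e\<in>J. (cmod (complex_of_real (weight \<gamma> r e) * e w))\<^sup>2) = (\<Sum>e\<in>J. (weight \<gamma> r e)\<^sup>2 * (cmod (e w))\<^sup>2)"
        by (simp only: norm_mult power_mult_distrib norm_of_real power2_abs)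
      also have "sqrt (\<Sum>e\<in>J. (cmod (c e))\<^sup>2) * sqrt (\<Sum>e\<in>J. (weight \<gamma> r e)\<^sup>2 * (cmod (e w))\<^sup>2)
        <= sqrt ((C * amax * s N powr xp)\<^sup>2) * sqrt ((C * amax * s N powr (1 / 2))\<^sup>2)"
        using c kernel[OF N w] unfolding J_def amax_def by (intro mult_mono real_sqrt_le_mono) (auto intro!: sum_nonneg)
      also have "... = C\<^sup>2 * X * s N powr (xp + 1 / 2)" using C amax by (simp add: X power2_eq_square powr_add)
      finally show ?thesis .
    qed
    have M2: "(\<integral>x. (cmod (M x))\<^sup>2 \<partial>\<mu>) <= (C * X * s N powr xp)\<^sup>2"
    proof -
      have "(\<integral>x. (cmod (M x))\<^sup>2 \<partial>\<mu>) = (\<Sum>e\<in>J. (cmod (c e * complex_of_real (weight \<gamma> r e)))\<^sup>2)" unfolding M_def by (rule parseval[OF oJ])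
      also have "... = (\<Sum>e\<in>J. (weight \<gamma> r e)\<^sup>2 * (cmod (c e))\<^sup>2)" by (simp only: norm_mult power_mult_distrib norm_of_real power2_abs mult.commute)
      also have "... <= (\<Sum>e\<in>J. amax\<^sup>2 * (cmod (c e))\<^sup>2)"
        using weight_le[OF \<gamma> r0(1)] unfolding J_def amax_def by (intro sum_mono mult_right_mono power_mono) auto
      also have "... = amax\<^sup>2 * (\<Sum>e\<in>J. (cmod (c e))\<^sup>2)" by (simp add: sum_distrib_left)
      also have "... <= amax\<^sup>2 * (C * amax * s N powr xp)\<^sup>2" using c by (intro mult_left_mono) auto
      finally show ?thesis by (simp add: X(2) power_mult_distrib power2_eq_square mult_ac)
    qed
    have s_xp: "1 <= s N powr xp" "1 <= s N powr (xp + 1 / 2)" using s1 xp by (auto intro!: ge_one_powr_ge_zero)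
    have Ts: "cmod (T w) <= C * X * s N powr xp" "cmod (T w) <= C * X * s N powr (xp + 1 / 2)" for w
    proof -
      have "C * X * 1 <= C * X * s N powr xp" "C * X * 1 <= C * X * s N powr (xp + 1 / 2)" using C X(1) s_xp by (auto intro!: mult_left_mono)
      with T(2)[of w] show "cmod (T w) <= C * X * s N powr xp" "cmod (T w) <= C * X * s N powr (xp + 1 / 2)" by linarith+
    qed
    have F1: "cmod (h w) <= K * X * s N powr (xp + 1 / 2)" if w: "norm w = 1" for w
    proof -
      have "cmod (h w) <= cmod (M w) + cmod (T w)" unfolding h_def by (rule norm_triangle_ineq)
      also have "... <= C\<^sup>2 * X * s N powr (xp + 1 / 2) + C * X * s N powr (xp + 1 / 2)" by (rule add_mono[OF Mb[OF w] Ts(2)])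
      also have "... = (C\<^sup>2 + C) * X * s N powr (xp + 1 / 2)" by (simp add: algebra_simps)
      also have "... <= K * X * s N powr (xp + 1 / 2)" using K X(1) by (intro mult_right_mono) auto
      finally show ?thesis .
    qed
    have F2: "(\<integral>x. (cmod (h x))\<^sup>2 \<partial>\<mu>) <= (K * X * s N powr xp)\<^sup>2"
    proof -
      define V where "V = C * X * s N powr xp"
      have V: "V > 0" using C X(1) s1 by (simp add: V_def)
      have iM: "integrable \<mu> (%x. (cmod (M x))\<^sup>2)" by (rule power_norm_integrable[OF sM])
      have ih: "integrable \<mu> (%x. (cmod (h x))\<^sup>2)"
        by (rule sphere.integrable_const_bound[where B="(K * X * s N powr (xp + 1 / 2))\<^sup>2"]) (use F1 hm in \<open>auto intro!: AE_I2 power_mono\<close>)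
      have "(cmod (h x))\<^sup>2 <= 2 * (cmod (M x))\<^sup>2 + 2 * V\<^sup>2" for x
      proof -
        have "cmod (h x) <= cmod (M x) + V" unfolding h_def using norm_triangle_ineq[of "M x" "T x"] Ts(1)[of x] unfolding V_def by linarith
        hence "(cmod (h x))\<^sup>2 <= (cmod (M x) + V)\<^sup>2" by (rule power_mono) simp
        also have "... <= 2 * (cmod (M x))\<^sup>2 + 2 * V\<^sup>2" using zero_le_power2[of "cmod (M x) - V"] by (simp add: power2_eq_square algebra_simps)
        finally show ?thesis .
      qed
      hence "(\<integral>x. (cmod (h x))\<^sup>2 \<partial>\<mu>) <= (\<integral>x. 2 * (cmod (M x))\<^sup>2 + 2 * V\<^sup>2 \<partial>\<mu>)"
        using iM by (intro integral_mono ih) auto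
      also have "... = 2 * (\<integral>x. (cmod (M x))\<^sup>2 \<partial>\<mu>) + ar * (2 * V\<^sup>2)" using iM by (simp add: ar_def)
      also have "... <= 2 * V\<^sup>2 + ar * (2 * V\<^sup>2)" using M2 by (simp add: V_def)
      also have "... = (2 * (1 + ar)) ^ 1 * V\<^sup>2" by (simp add: algebra_simps)
      also have "... <= (2 * (1 + ar)) ^ 2 * V\<^sup>2" using ar by (intro mult_right_mono power_increasing) auto
      also have "... = (2 * (1 + ar) * V) ^ 2" by (simp only: power_mult_distrib)
      also have "... <= (K * X * s N powr xp)\<^sup>2"
      proof (rule power_mono)
        have "2 * (1 + ar) * V = (2 * (1 + ar) * C) * (X * s N powr xp)" by (simp add: V_def)
        also have "... <= K * (X * s N powr xp)" using K X(1) by (intro mult_right_mono) auto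
        finally show "2 * (1 + ar) * V <= K * X * s N powr xp" by (simp only: mult.assoc)
      qed (use V ar in auto)
      finally show ?thesis .
    qed
    define x where "x = enn2real (1 / q)"
    have "Lp_norm \<mu> q h <= ennreal ((K * X * s N powr (xp + 1 / 2)) powr (1 - 2 * x) * (K * X * s N powr xp) powr (2 * x))"
      unfolding x_def by (rule Lp_norm_interpolate[OF q hm _ F1 _ F2]) (use K X s1 in auto)
    also have "(K * X * s N powr (xp + 1 / 2)) powr (1 - 2 * x) * (K * X * s N powr xp) powr (2 * x)
      = ((K * X) powr (1 - 2 * x) * (K * X) powr (2 * x)) * (s N powr ((xp + 1 / 2) * (1 - 2 * x)) * s N powr (xp * (2 * x)))"
      unfolding powr_mult powr_powr by (simp only: mult_ac)
    also have "... = (K * X) powr ((1 - 2 * x) + 2 * x) * s N powr ((xp + 1 / 2) * (1 - 2 * x) + xp * (2 * x))"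
      by (simp only: powr_add)
    also have "(1 - 2 * x) + 2 * x = 1" by simp
    also have "(xp + 1 / 2) * (1 - 2 * x) + xp * (2 * x) = xp + 1 / 2 - x" by (simp add: algebra_simps)
    also have "(K * X) powr 1 = K * X" using K X(1) by simp
    also have "s N powr (xp + 1 / 2 - x) = real N powr ((2 * real CARD('d) - 2) * (xp + 1 / 2 - x))"
      unfolding s_eq powr_powr by simp
    finally have "Lp_norm \<mu> q (%x. f x - g x) <= ennreal (K * (X * real N powr ((2 * real CARD('d) - 2) * (xp + 1 / 2 - x))))"
      unfolding eq by (simp only: mult.assoc)
    thus "\<exists>g\<in>cfun.span (E N). Lp_norm \<mu> q (%x. f x - g x) <= ennreal (K * (exp (- \<gamma> * real N powr r) *
        real N powr ((2 * real CARD('d) - 2) * (gain p + 1 / 2 - enn2real (1 / q)))))"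
      unfolding span_E X_def x_def xp_def using g by blast
  qed
qed

section \<open>Approximation at a given level\<close>

lemma width_uniformly_bounded:
  fixes p q :: ennreal
  assumes d: "CARD('d::finite) >= 2" and \<gamma>: "\<gamma> > 0" and r: "r > 0" and p: "1 <= p" and q: "2 <= q"
  obtains C where "!!k. kolmogorov_width k
      (smooth_class TYPE('d) \<gamma> r p) \<mu> q <= ennreal C"
proof -
  obtain F where F: "F > 0" and bd: "!!p \<phi>. 1 <= p ==> \<phi> \<in> Lp_ball \<mu> p ==>
    \<exists>\<psi>. \<psi> \<in> borel_measurable \<mu> \<and> (AE w in \<mu>. multiplier_operator (exp_multiplier \<gamma> r) \<phi> w = \<psi> w) \<and>
      (\<forall>w :: complex ^ 'd. cmod (\<psi> w) <= F)"
    by (rule multiplier_bounded[OF d \<gamma> r]) (rule that)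
  define C where "C = F powr (1 - 2 * enn2real (1 / q)) * (F * sqrt (area TYPE('d))) powr (2 * enn2real (1 / q))"
  show ?thesis
  proof (rule that[of C], rule kolmogorov_width_le_generated[OF q, of "{}"])
    fix f assume "f \<in> smooth_class TYPE('d) \<gamma> r p"
    then obtain \<phi> where \<phi>: "\<phi> \<in> Lp_ball \<mu> p" and f: "f = multiplier_operator (exp_multiplier \<gamma> r) \<phi>" by blast
    obtain \<psi> where \<psi>: "\<psi> \<in> borel_measurable \<mu>" "AE w in \<mu>. f w = \<psi> w" "!!w. cmod (\<psi> w) <= F"
      using bd[OF p \<phi>] unfolding f by blast
    have fm: "f \<in> borel_measurable \<mu>" unfolding f by (rule multiplier_expansion(1)[OF d \<gamma> r p \<phi>])
    have "Lp_norm \<mu> q (%x. f x - 0 x) = Lp_norm \<mu> q \<psi>"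
    proof (rule Lp_norm_cong_AE[OF _ _ \<psi>(1)])
      show "AE x in \<mu>. f x - 0 x = \<psi> x" using \<psi>(2) by eventually_elim simp
      show "(%x. f x - 0 x) \<in> borel_measurable \<mu>" using fm by simp
    qed
    also have "... <= ennreal C" unfolding C_def by (rule Lp_norm_bounded[OF q \<psi>(1) F \<psi>(3)])
    finally have "Lp_norm \<mu> q (%x. f x - 0 x) <= ennreal C" .
    thus "\<exists>g\<in>cfun.span {}. Lp_norm \<mu> q (%x. f x - g x) <= ennreal C" by (intro bexI[of _ 0]) (auto simp: cfun.span_zero)
  qed auto
qed

text \<open>The finitely many small \<open>k\<close> are absorbed by the constant, because \<open>f\<close> is positive.\<close>

lemma bound_from_eventual_bound:
  fixes W :: "nat => ennreal" and f :: "nat => real"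
  assumes f: "!!k. k >= 2 ==> f k > 0" and C0: "!!k. k >= k0 ==> k >= 2 ==> W k <= ennreal (C0 * f k)"
    and C1: "!!k. W k <= ennreal C1"
  shows "\<exists>C>0. \<forall>k\<ge>2. W k <= ennreal (C * f k)"
proof -
  define S where "S = (\<Sum>k\<in>{2..<k0}. \<bar>C1\<bar> / f k)"
  have S0: "S >= 0" unfolding S_def using f by (intro sum_nonneg) (auto intro!: divide_nonneg_pos)
  show ?thesis
  proof (intro exI[of _ "\<bar>C0\<bar> + 1 + S"] conjI allI impI)
    show "\<bar>C0\<bar> + 1 + S > 0" using S0 by linarith
    fix k :: nat assume k: "k >= 2"
    show "W k <= ennreal ((\<bar>C0\<bar> + 1 + S) * f k)"
    proof (cases "k >= k0")
      case True
      have "C0 * f k <= (\<bar>C0\<bar> + 1 + S) * f k" using f[OF k] S0 by (intro mult_right_mono) auto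
      thus ?thesis using C0[OF True k] by (meson ennreal_leI order_trans)
    next
      case False
      have "\<bar>C1\<bar> / f k <= S" unfolding S_def using f k False by (intro member_le_sum) (auto intro!: divide_nonneg_pos)
      hence "\<bar>C1\<bar> / f k * f k <= (\<bar>C0\<bar> + 1 + S) * f k" using f[OF k] by (intro mult_right_mono) auto
      hence "C1 <= (\<bar>C0\<bar> + 1 + S) * f k" using f[OF k] by simp
      thus ?thesis using C1[of k] by (meson ennreal_leI order_trans)
    qed
  qed
qed

text \<open>The error has a polynomial part, bounded in \<open>L^(2j)\<close>, and a uniformly bounded part; they are kept
  apart since only the first one obeys the inequality between norms of polynomials.\<close>

definition approximable :: "real => nat => nat => 'd::finite fn set => ('d fn) => bool" where
  "approximable X N j G f \<longleftrightarrow> (\<exists>h\<in>cfun.span G. \<exists>u\<in>harmonic_sum (2 * N). \<exists>T.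
     T \<in> borel_measurable \<mu> \<and> (\<forall>w. cmod (T w) <= X) \<and> Lnorm (2 * j) u <= X * sqrt (real j) \<and>
     (AE w in \<mu>. f w - h w = u w + T w))"

lemma level_approximation:
  fixes p :: ennreal
  assumes d: "CARD('d::finite) >= 2" and \<gamma>: "\<gamma> > 0" and r: "0 < r" "r <= 1" and p: "1 <= p"
  defines "X \<equiv> (%N. exp (- \<gamma> * real N powr r) * bulk TYPE('d) r N powr gain p)"
  obtains K where "K > 0" "!!N j k. N >= 1 ==> j >= 1 ==>
    real (card (E N :: 'd fn set)) + bulk TYPE('d) r N + 1 <= real k ==>
    \<exists>G. finite G \<and> G \<subseteq> Collect sphere_fun \<and> card G <= k \<and> (\<forall>f \<in> smooth_class TYPE('d) \<gamma> r p. approximable (K * X N) N j G f)"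
proof -
  define s where "s = bulk TYPE('d) r"
  have s_eq: "s N = real N powr (2 * real CARD('d) - 1 - r)" for N using r by (simp add: s_def bulk_def)
  define xp where "xp = gain p"
  obtain C where C: "C > 0"
    and kernel0: "!!N w. N >= 1 ==> norm w = 1 ==> (\<Sum>e\<in>E (2 * N) - E N. (weight \<gamma> r e)\<^sup>2 * (cmod (e (w :: complex ^ 'd)))\<^sup>2)
       <= (C * exp (- (\<gamma> / 2) * real N powr r) * bulk TYPE('d) r N powr (1 / 2))\<^sup>2"
    and dec0: "!!N p f. N >= 1 ==> 1 <= p ==> f \<in> smooth_class TYPE('d) \<gamma> r p ==> splits_at C \<gamma> r p N f"
    by (rule multiplier_decomposition[OF d \<gamma> r(1)]) (rule that)
  have xp: "xp >= 0" by (simp add: xp_def)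
  define sc where "sc = section_constant TYPE('d)"
  have sc: "sc > 0" unfolding sc_def by (rule section_constant_pos)
  define K where "K = C + sc * C\<^sup>2"
  have K: "K > 0" "C <= K" "sc * C\<^sup>2 <= K" using C sc by (auto simp: K_def intro!: add_pos_pos)
  show ?thesis
  proof (rule that[of K])
    show "K > 0" by (rule K)
    fix N j k :: nat
    assume N: "N >= 1" and j: "j >= 1" and k: "real (card (E N :: 'd fn set)) + bulk TYPE('d) r N + 1 <= real k"
    note kernel = kernel0[OF N, folded s_def]
    note k = k[folded s_def]
    have s1: "s N >= 1" unfolding s_eq using N d r by (intro ge_one_powr_ge_zero) auto
    \<comment> \<open>as many random functions as the effective dimension of the middle shells, which cancels \<open>sqrt (s N)\<close> in \<open>A\<close>\<close>
    define m where "m = nat \<lceil>s N\<rceil>"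
    have m: "s N <= real m" "real m <= s N + 1" "m > 0" using s1 unfolding m_def by linarith+
    define amax where "amax = exp (- (\<gamma> / 2) * real N powr r)"
    have amax: "amax > 0" by (simp add: amax_def)
    define x where "x = exp (- \<gamma> * real N powr r)"
    have x: "x > 0" "x = amax * amax" by (simp_all add: x_def amax_def exp_add[symmetric])
    have XN: "X N = x * s N powr xp" by (simp add: X_def x_def s_def xp_def)
    define J where "J = E (2 * N) - (E N :: 'd fn set)"
    have oJ: "orthonormal J" unfolding J_def by (rule orthonormal_subset[OF orthonormal_E[of "2 * N"]]) auto
    define A where "A = C * amax * s N powr (1 / 2)"
    have A: "A > 0" using C amax s1 by (simp add: A_def)
    define b where "b = C * amax * s N powr xp"
    have b: "b > 0" using C amax s1 by (simp add: b_def)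
    have j0: "j > 0" using j by simp
    have kA: "!!w. norm w = 1 ==> (\<Sum>e\<in>J. (weight \<gamma> r e)\<^sup>2 * (cmod (e w))\<^sup>2) <= A\<^sup>2"
      using kernel unfolding J_def A_def amax_def .
    obtain W where W: "finite W" "card W <= m" "W \<subseteq> cfun.span J"
      and app: "!!c b. b > 0 ==> (\<Sum>e\<in>J. (cmod (c e))\<^sup>2) <= b\<^sup>2 ==>
      \<exists>h\<in>cfun.span W. Lnorm (2 * j) (%z. (\<Sum>e\<in>J. c e * complex_of_real (weight \<gamma> r e) * e z) - h z)
        <= section_constant TYPE('d) * sqrt (real j / real m) * A * b"
      by (rule random_approximation[OF orthonormal_finite[OF oJ] orthonormal_sphere_fun[OF oJ] A kA j0 m(3)]) (assumption, assumption, rule that)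
    have spanJ: "cfun.span J \<subseteq> harmonic_sum (2 * N)" unfolding span_E[symmetric] by (rule cfun.span_mono) (auto simp: J_def)
    have WH: "W \<subseteq> harmonic_sum (2 * N)" using W(3) spanJ by blast
    have spanW: "cfun.span W \<subseteq> harmonic_sum (2 * N)" using cfun.span_mono[OF WH] unfolding span_harmonic_sum .
    have bound: "sc * sqrt (real j / real m) * A * b <= K * (x * s N powr xp) * sqrt (real j)"
    proof -
      have "A / sqrt (real m) <= C * amax"
      proof -
        have "s N powr (1 / 2) <= sqrt (real m)" using m(1) s1 by (simp add: powr_half_sqrt)
        hence "C * amax * s N powr (1 / 2) <= C * amax * sqrt (real m)" using C amax by (intro mult_left_mono) auto
        thus ?thesis using m(3) by (simp add: A_def pos_divide_le_eq)
      qed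
      hence "sc * sqrt (real j) * b * (A / sqrt (real m)) <= sc * sqrt (real j) * b * (C * amax)" using sc b by (intro mult_left_mono) auto
      hence "sc * sqrt (real j / real m) * A * b <= sc * sqrt (real j) * b * (C * amax)" by (simp add: real_sqrt_divide mult_ac)
      also have "... = (sc * C\<^sup>2) * ((x * s N powr xp) * sqrt (real j))" by (simp add: b_def x(2) power2_eq_square mult_ac)
      also have "... <= K * ((x * s N powr xp) * sqrt (real j))" using K x(1) by (intro mult_right_mono) auto
      finally show ?thesis by (simp only: mult.assoc)
    qed
    define G where "G = E N \<union> W"
    have "finite G" unfolding G_def using W(1) orthonormal_finite[OF orthonormal_E] by blast
    moreover have "G \<subseteq> Collect sphere_fun" unfolding G_def using WH orthonormal_sphere_fun[OF orthonormal_E] harmonic_sum_sphere_fun by blast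
    moreover have "card G <= k"
    proof -
      have "card G <= card (E N :: 'd fn set) + m" unfolding G_def using card_Un_le[of "E N" W] W(2) by linarith
      also have "... <= k" using k m(2) by linarith
      finally show ?thesis .
    qed
    moreover have "approximable (K * X N) N j G f" if f: "f \<in> smooth_class TYPE('d) \<gamma> r p" for f
    proof -
      obtain g c T where g: "g \<in> harmonic_sum N" and T: "T \<in> borel_measurable \<mu>" "!!w. cmod (T w) <= C * x"
        and c: "(\<Sum>e\<in>J. (cmod (c e))\<^sup>2) <= b\<^sup>2"
        and ae: "AE w in \<mu>. f w = g w + (\<Sum>e\<in>J. c e * complex_of_real (weight \<gamma> r e) * e w) + T w"
        using dec0[OF N p f] unfolding splits_at_def J_def x_def amax_def b_def s_def xp_def by blast
      obtain h where h: "h \<in> cfun.span W" and hL: "Lnorm (2 * j) (%z. (\<Sum>e\<in>J. c e * complex_of_real (weight \<gamma> r e) * e z) - h z)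
        <= sc * sqrt (real j / real m) * A * b" using app[OF b c] unfolding sc_def by blast
      define u where "u = (%z. (\<Sum>e\<in>J. c e * complex_of_real (weight \<gamma> r e) * e z) - h z)"
      show ?thesis unfolding approximable_def XN
      proof (intro bexI exI conjI allI)
        show "T \<in> borel_measurable \<mu>" by (rule T)
        show "cmod (T w) <= K * (x * s N powr xp)" for w
        proof -
          have "C * (x * 1) <= K * (x * s N powr xp)"
            using K C x(1) s1 xp by (intro mult_mono) (auto intro!: ge_one_powr_ge_zero mult_left_mono)
          thus ?thesis using T(2)[of w] by simp
        qed
        show "Lnorm (2 * j) u <= K * (x * s N powr xp) * sqrt (real j)" using hL bound unfolding u_def by linarith
        show "AE w in \<mu>. f w - (%z. g z + h z) w = u w + T w" using ae by eventually_elim (simp add: u_def)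
        have "g + h \<in> cfun.span G"
        proof (rule cfun.span_add)
          have "g \<in> cfun.span (E N)" using g by (simp only: span_E)
          thus "g \<in> cfun.span G" using cfun.span_mono[of "E N" G] by (auto simp: G_def)
          show "h \<in> cfun.span G" using h cfun.span_mono[of W G] by (auto simp: G_def)
        qed
        thus "(%z. g z + h z) \<in> cfun.span G" by (simp add: plus_fun_def)
        have "(%z. \<Sum>e\<in>J. (c e * complex_of_real (weight \<gamma> r e)) * e z) \<in> harmonic_sum (2 * N)" by (rule subsetD[OF spanJ span_sumI[OF subset_refl]])
        hence "(%z. \<Sum>e\<in>J. (c e * complex_of_real (weight \<gamma> r e)) * e z) - h \<in> cfun.span (harmonic_sum (2 * N))"
          using h spanW by (intro cfun.span_diff[OF cfun.span_base cfun.span_base]) (assumption, rule subsetD)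
        thus "u \<in> harmonic_sum (2 * N)" unfolding span_harmonic_sum u_def by (simp add: fun_diff_def)
      qed
    qed
    ultimately show "\<exists>G. finite G \<and> G \<subseteq> Collect sphere_fun \<and> card G <= k \<and>
        (\<forall>f \<in> smooth_class TYPE('d) \<gamma> r p. approximable (K * X N) N j G f)"
      by (intro exI[of _ G]) simp
  qed
qed

section \<open>Widths for slow decay\<close>

lemma sum_power_le:
  fixes a b :: real
  assumes "a >= 0" "b >= 0"
  shows "(a + b) ^ (2 * j) <= 4 ^ j * (a ^ (2 * j) + b ^ (2 * j))"
proof -
  have "(a + b) ^ (2 * j) = (2 * (1 / 2 * a + 1 / 2 * b)) ^ (2 * j)" by (rule arg_cong[where f="%x. x ^ (2 * j)"]) simp
  also have "... = 4 ^ j * (1 / 2 * a + 1 / 2 * b) ^ (2 * j)" by (simp only: power_mult_distrib) (simp add: power_mult)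
  also have "... <= 4 ^ j * (1 / 2 * a ^ (2 * j) + 1 / 2 * b ^ (2 * j))" by (intro mult_left_mono power_convex) auto
  also have "... <= 4 ^ j * (a ^ (2 * j) + b ^ (2 * j))" using assms by (intro mult_left_mono add_mono) auto
  finally show ?thesis .
qed

lemma error_norm_finite_exponent:
  fixes u T :: "'d::finite fn"
  assumes q: "2 <= q" "q ~= \<infinity>" and j: "j >= 1" "enn2real q <= 2 * real j" and X: "X > 0"
    and su: "sphere_fun u" and uL: "Lnorm (2 * j) u <= X * sqrt (real j)"
    and T: "T \<in> borel_measurable \<mu>" "!!w. cmod (T w) <= X"
  shows "Lp_norm \<mu> q (%w. u w + T w) <= ennreal (2 * (1 + area TYPE('d))\<^sup>2 * (sqrt (real j) + 1) * X)"
proof -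
  define ar where "ar = area TYPE('d)"
  have ar: "ar > 0" unfolding ar_def by (rule measure_sphere_pos)
  have um: "u \<in> borel_measurable \<mu>" by (rule sphere_measurable[OF sphere_fun_continuous[OF su]])
  define Z where "Z = X * (sqrt (real j) + 1)"
  have Z: "Z > 0" "X <= Z" "X * sqrt (real j) <= Z"
  proof -
    have "0 <= X * sqrt (real j)" using X by simp
    thus "Z > 0" "X <= Z" "X * sqrt (real j) <= Z" using X unfolding Z_def distrib_left mult_1_right by linarith+
  qed
  have iu: "integrable \<mu> (%x. cmod (u x) ^ (2 * j))" by (rule power_norm_integrable[OF su])
  have uI: "(\<integral>x. cmod (u x) ^ (2 * j) \<partial>\<mu>) <= Z ^ (2 * j)"
    using order_trans[OF uL Z(3)] j Z(1) by (subst Lnorm_le_iff[symmetric]) auto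
  have pt: "cmod (u x + T x) ^ (2 * j) <= 4 ^ j * (cmod (u x) ^ (2 * j) + Z ^ (2 * j))" for x
  proof -
    have "cmod (u x + T x) <= cmod (u x) + Z" using norm_triangle_ineq[of "u x" "T x"] T(2)[of x] Z(2) by linarith
    hence "cmod (u x + T x) ^ (2 * j) <= (cmod (u x) + Z) ^ (2 * j)" by (rule power_mono) simp
    also have "... <= 4 ^ j * (cmod (u x) ^ (2 * j) + Z ^ (2 * j))" using Z by (intro sum_power_le) auto
    finally show ?thesis .
  qed
  have ib: "integrable \<mu> (%x. 4 ^ j * (cmod (u x) ^ (2 * j) + Z ^ (2 * j)))" using iu by simp
  have iuT: "integrable \<mu> (%x. cmod (u x + T x) ^ (2 * j))"
    by (rule Bochner_Integration.integrable_bound[OF ib]) (use um T(1) in measurable, use pt in \<open>auto intro!: AE_I2 order_trans[OF pt]\<close>)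
  have "(\<integral>x. cmod (u x + T x) ^ (2 * j) \<partial>\<mu>) <= (\<integral>x. 4 ^ j * (cmod (u x) ^ (2 * j) + Z ^ (2 * j)) \<partial>\<mu>)"
    by (rule integral_mono[OF iuT ib pt])
  also have "... = 4 ^ j * ((\<integral>x. cmod (u x) ^ (2 * j) \<partial>\<mu>) + ar * Z ^ (2 * j))" using iu by (simp add: ar_def)
  also have "... <= 4 ^ j * (Z ^ (2 * j) + ar * Z ^ (2 * j))" using uI by simp
  also have "... = 4 ^ j * ((1 + ar) ^ 1 * Z ^ (2 * j))" by (simp add: algebra_simps)
  also have "... <= 4 ^ j * ((1 + ar) ^ (2 * j) * Z ^ (2 * j))"
    using ar j(1) Z by (intro mult_left_mono mult_right_mono power_increasing) auto
  also have "... = (2 * (1 + ar) * Z) ^ (2 * j)"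
  proof -
    have "(4::real) ^ j = 2 ^ (2 * j)" by (simp add: power_mult)
    thus ?thesis unfolding power_mult_distrib by (simp only: mult.assoc)
  qed
  finally have "Lp_norm \<mu> q (%w. u w + T w) <= ennreal (2 * (1 + ar) * Z * (1 + ar))"
    unfolding ar_def by (intro Lp_norm_le_even_moment[OF q j(2) _ iuT]) (use ar Z in \<open>auto simp: ar_def\<close>)
  also have "2 * (1 + ar) * Z * (1 + ar) = 2 * (1 + ar)\<^sup>2 * (sqrt (real j) + 1) * X" by (simp add: Z_def power2_eq_square mult_ac)
  finally show ?thesis by (simp add: ar_def)
qed

text \<open>For \<open>j\<close> about \<open>ln N\<close> the dimension, polynomial in \<open>N\<close>, is at most exponential in \<open>j\<close>, so its \<open>2j\<close>-th root is bounded.\<close>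

lemma card_E_le_exp:
  obtains Y where "Y > 0" "!!N j. real N + 2 <= exp (real j) ==> real j <= real N + 2 ==> j >= 1 ==>
    real (card (E (j * (2 * N)) :: 'd::finite fn set)) / area TYPE('d) <= Y ^ (2 * j)"
proof -
  define ar where "ar = area TYPE('d)"
  have ar: "ar > 0" unfolding ar_def by (rule measure_sphere_pos)
  define D where "D = 2 * CARD('d) - 1"
  define c :: real where "c = 2 / (fact CARD('d) * fact (CARD('d) - 1))"
  have c: "c > 0" by (simp add: c_def)
  define B where "B = (1 + c / ar) * (2 + real CARD('d)) ^ D"
  have "1 * 1 <= B" unfolding B_def using c ar by (intro mult_mono one_le_power) auto
  hence B: "B >= 1" by simp
  show ?thesis
  proof (rule that[of "B * exp (real D)"])
    show "B * exp (real D) > 0" using B by simp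
    fix N j assume Nj: "real N + 2 <= exp (real j)" and jN: "real j <= real N + 2" and j: "j >= 1"
    have "real (j * (2 * N) + CARD('d)) = real j * (2 * real N) + real CARD('d) * 1" by simp
    also have "... <= (real N + 2) * (2 * (real N + 2)) + real CARD('d) * (real N + 2)\<^sup>2"
      using jN by (intro add_mono mult_mono) auto
    also have "... = (2 + real CARD('d)) * (real N + 2)\<^sup>2" by (simp add: power2_eq_square algebra_simps)
    also have "... <= (2 + real CARD('d)) * (exp (real j))\<^sup>2" using Nj by (intro mult_left_mono power_mono) auto
    finally have "c * real (j * (2 * N) + CARD('d)) ^ D <= c * ((2 + real CARD('d)) * (exp (real j))\<^sup>2) ^ D"
      using c by (intro mult_left_mono power_mono) auto
    with card_E_le[of "j * (2 * N)", where 'd='d]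
    have "real (card (E (j * (2 * N)) :: 'd fn set)) / ar <= c * ((2 + real CARD('d)) * (exp (real j))\<^sup>2) ^ D / ar"
      using ar unfolding c_def D_def by (intro divide_right_mono) auto
    also have "... = (c / ar * (2 + real CARD('d)) ^ D) * exp (real D) ^ (2 * j)"
      by (simp add: power_mult_distrib exp_of_nat_mult[symmetric] mult_ac)
    also have "... <= B ^ (2 * j) * exp (real D) ^ (2 * j)"
    proof (rule mult_right_mono)
      have "c / ar * (2 + real CARD('d)) ^ D <= B ^ 1" unfolding B_def power_one_right by (intro mult_right_mono) auto
      also have "... <= B ^ (2 * j)" using B j by (intro power_increasing) auto
      finally show "c / ar * (2 + real CARD('d)) ^ D <= B ^ (2 * j)" .
    qed simp
    also have "... = (B * exp (real D)) ^ (2 * j)" by (rule power_mult_distrib[symmetric])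
    finally show "real (card (E (j * (2 * N)) :: 'd fn set)) / area TYPE('d) <= (B * exp (real D)) ^ (2 * j)" by (simp add: ar_def)
  qed
qed

lemma error_norm_infinity:
  fixes u T :: "'d::finite fn"
  assumes j: "j >= 1" and Y: "Y > 0" "real (card (E (j * M) :: 'd fn set)) / area TYPE('d) <= Y ^ (2 * j)"
    and X: "X > 0" and u: "u \<in> harmonic_sum M" and uL: "Lnorm (2 * j) u <= X * sqrt (real j)"
    and T: "T \<in> borel_measurable \<mu>" "!!w. cmod (T w) <= X"
  shows "Lp_norm \<mu> \<infinity> (%w. u w + T w) <= ennreal ((Y * sqrt (real j) + 1) * X)"
proof (rule Lp_norm_infinity_le)
  have um: "u \<in> borel_measurable \<mu>" by (rule sphere_measurable[OF sphere_fun_continuous[OF harmonic_sum_sphere_fun[OF u]]])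
  show "(%w. u w + T w) \<in> borel_measurable \<mu>" by (rule borel_measurable_add[OF um T(1)])
  fix w :: "complex ^ 'd" assume "w \<in> space \<mu>"
  hence w: "norm w = 1" by simp
  have "(\<integral>x. cmod (u x) ^ (2 * j) \<partial>\<mu>) <= (X * sqrt (real j)) ^ (2 * j)"
    using uL j X by (subst Lnorm_le_iff[symmetric]) auto
  hence "real (card (E (j * M) :: 'd fn set)) / area TYPE('d) * (\<integral>z. cmod (u z) ^ (2 * j) \<partial>\<mu>)
      <= Y ^ (2 * j) * (X * sqrt (real j)) ^ (2 * j)" using Y by (intro mult_mono) auto
  with nikolskii[OF u w, of j] j have "cmod (u w) ^ (2 * j) <= (Y * (X * sqrt (real j))) ^ (2 * j)"
    unfolding power_mult_distrib[of Y] by linarith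
  hence "cmod (u w) <= Y * (X * sqrt (real j))" using j Y X by (subst (asm) power_mono_iff) auto
  with norm_triangle_ineq[of "u w" "T w"] T(2)[of w] show "cmod (u w + T w) <= (Y * sqrt (real j) + 1) * X" by (simp add: algebra_simps)
qed

text \<open>Both ranges of \<open>q\<close> share the choice of the level and of the subspace; they differ in the moment \<open>j\<close>
  and in the norm estimate for the error.\<close>

lemma width_slow_decay:
  fixes p q :: ennreal
  assumes d: "CARD('d::finite) >= 2" and \<gamma>: "\<gamma> > 0" and r: "0 < r" "r <= 1" and p: "1 <= p" and q: "2 <= q"
  defines "D \<equiv> 2 * CARD('d) - 1" and "xp \<equiv> gain p"
  shows "\<exists>C>0. \<forall>k\<ge>2. kolmogorov_width k (smooth_class TYPE('d) \<gamma> r p) \<mu> q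
    <= ennreal (C * (exp (- (\<gamma> * (fact CARD('d) * fact (CARD('d) - 1) / 2) powr (r / real D)) * real k powr (r / real D)) *
        real k powr ((1 - r / real D) * xp) * (if q < \<infinity> then 1 else sqrt (ln (real k)))))"
proof -
  have D: "D >= 1" "real D = 2 * real CARD('d) - 1" using d by (auto simp: D_def)
  define c :: real where "c = 2 / (fact CARD('d) * fact (CARD('d) - 1))"
  have c: "c > 0" by (simp add: c_def)
  have c_inv: "fact CARD('d) * fact (CARD('d) - 1) / 2 = 1 / c" by (simp add: c_def)
  define s where "s = bulk TYPE('d) r"
  have s_eq: "s N = real N powr (real D - r)" for N using r by (simp add: s_def bulk_def D)
  have xp: "xp >= 0" by (simp add: xp_def)
  have rD: "r / real D <= 1" using r D by simp
  obtain C3 where C3: "C3 > 0"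
    "!!N. N >= 1 ==> c * real (N + CARD('d)) ^ D + 2 * real N powr (real D - r) + 1 <= c * real N ^ D + C3 * real N powr (real D - r)"
    by (rule dimension_count_bound[OF c r D(1), where d="CARD('d)"]) (rule that)
  define X where "X N = exp (- \<gamma> * real N powr r) * s N powr xp" for N
  obtain K where K: "K > 0" and appr0: "!!N j k. N >= 1 ==> j >= 1 ==>
    real (card (E N :: 'd fn set)) + bulk TYPE('d) r N + 1 <= real k ==>
    \<exists>G. finite G \<and> G \<subseteq> Collect sphere_fun \<and> card G <= k \<and>
      (\<forall>f \<in> smooth_class TYPE('d) \<gamma> r p. approximable (K * (exp (- \<gamma> * real N powr r) * bulk TYPE('d) r N powr gain p)) N j G f)"
    by (rule level_approximation[OF d \<gamma> r p]) (rule that)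
  note appr = appr0[folded s_def xp_def, folded X_def]
  define L where "L = (%k :: nat. if q < \<infinity> then 1 else sqrt (ln (real k)))"
  define F where "F k = exp (- (\<gamma> * (1 / c) powr (r / real D)) * real k powr (r / real D)) * real k powr ((1 - r / real D) * xp)" for k :: nat
  define W where "W k = kolmogorov_width k (smooth_class TYPE('d) \<gamma> r p) \<mu> q" for k
  define M where "M = exp (\<gamma> * (1 + C3 / c)) * (1 / c) powr ((1 - r / real D) * xp)"
  have level: "\<exists>N\<ge>1. real (card (E N :: 'd fn set)) + s N + 1 <= real k \<and> c * real N ^ D <= real k \<and> X N <= M * F k"
    if k: "c + C3 <= real k" for k
  proof -
    obtain N where N: "N >= 1" "c * real N ^ D + C3 * real N powr (real D - r) <= real k"
      "exp (- \<gamma> * real N powr r) <= exp (\<gamma> * (1 + C3 / c)) * exp (- (\<gamma> * (1 / c) powr (r / D)) * real k powr (r / D))"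
      by (rule choose_level[OF c C3(1) r D(1) \<gamma> k]) (rule that)
    have s0: "s N >= 0" "0 <= C3 * s N" using C3(1) by (auto simp: s_eq)
    have 1: "real (card (E N :: 'd fn set)) + s N + 1 <= real k"
      using card_E_le[of N, where 'd='d, folded c_def D_def] C3(2)[OF N(1)] N(2) s0 unfolding s_eq by linarith
    have 2: "c * real N ^ D <= real k" using N(2) s0 unfolding s_eq by linarith
    have "real D > 0" using D(1) by simp
    hence e: "(real D - r) * xp = real D * ((1 - r / real D) * xp)" by (simp add: field_simps)
    have "s N powr xp = (real N powr real D) powr ((1 - r / real D) * xp)" unfolding s_eq powr_powr e ..
    also have "... = (real N ^ D) powr ((1 - r / real D) * xp)" using N(1) by (simp add: powr_realpow)
    also have "... <= (1 / c * real k) powr ((1 - r / real D) * xp)"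
    proof (rule powr_mono2)
      show "0 <= (1 - r / real D) * xp" using rD xp by (intro mult_nonneg_nonneg) auto
      show "real N ^ D <= 1 / c * real k" using 2 c by (simp add: pos_le_divide_eq mult.commute)
    qed simp
    also have "... = (1 / c) powr ((1 - r / real D) * xp) * real k powr ((1 - r / real D) * xp)" by (rule powr_mult)
    finally have "X N <= (exp (\<gamma> * (1 + C3 / c)) * exp (- (\<gamma> * (1 / c) powr (r / D)) * real k powr (r / D)))
        * ((1 / c) powr ((1 - r / real D) * xp) * real k powr ((1 - r / real D) * xp))"
      unfolding X_def using N(3) by (intro mult_mono) auto
    also have "... = M * F k" unfolding F_def M_def by (simp only: mult_ac)
    finally show ?thesis using N(1) 1 2 by blast
  qed
  have step: "W k <= ennreal (Y * K * M * F k)"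
    if k: "k >= nat \<lceil>c + C3\<rceil>" and Y: "Y >= 0" and j: "!!N. j N >= 1"
      and err: "!!N u T. N >= 1 ==> c * real N ^ D <= real k ==> K * X N > 0 ==> u \<in> harmonic_sum (2 * N) ==>
        Lnorm (2 * j N) u <= K * X N * sqrt (real (j N)) ==> T \<in> borel_measurable \<mu> ==> (!!w. cmod (T w) <= K * X N) ==>
        Lp_norm \<mu> q (%w :: complex ^ 'd. u w + T w) <= ennreal (Y * (K * X N))"
    for k j Y
  proof -
    have "c + C3 <= real k" using k by linarith
    from level[OF this] obtain N where N: "N >= 1" "real (card (E N :: 'd fn set)) + s N + 1 <= real k"
      and Nk: "c * real N ^ D <= real k" and XF: "X N <= M * F k" by blast
    have X: "K * X N > 0" using K N(1) by (simp add: X_def s_eq)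
    from appr[OF N(1) j[of N] N(2)] obtain G where G: "finite G" "G \<subseteq> Collect sphere_fun" "card G <= k"
      and Gf: "\<forall>f \<in> smooth_class TYPE('d) \<gamma> r p. approximable (K * X N) N (j N) G f" by (elim exE conjE) (rule that)
    have "W k <= ennreal (Y * (K * X N))" unfolding W_def
    proof (rule kolmogorov_width_le_generated[OF q G])
      fix f assume f: "f \<in> smooth_class TYPE('d) \<gamma> r p"
      obtain h u T where h: "h \<in> cfun.span G" and u: "u \<in> harmonic_sum (2 * N)"
        and T: "T \<in> borel_measurable \<mu>" "!!w. cmod (T w) <= K * X N" and uL: "Lnorm (2 * j N) u <= K * X N * sqrt (real (j N))"
        and ae: "AE w in \<mu>. f w - h w = u w + T w"
        using bspec[OF Gf f] unfolding approximable_def by (elim exE conjE bexE) blast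
      have fm: "f \<in> borel_measurable \<mu>" by (rule smooth_class_measurable[OF d \<gamma> r(1) p f])
      have um: "u \<in> borel_measurable \<mu>" by (rule sphere_measurable[OF sphere_fun_continuous[OF harmonic_sum_sphere_fun[OF u]]])
      have hm: "h \<in> borel_measurable \<mu>" by (rule sphere_measurable[OF sphere_fun_continuous[OF sphere_fun_span[OF G(2) h]]])
      have "Lp_norm \<mu> q (%x. f x - h x) = Lp_norm \<mu> q (%w. u w + T w)"
        by (rule Lp_norm_cong_AE[OF ae borel_measurable_diff[OF fm hm] borel_measurable_add[OF um T(1)]])
      also have "... <= ennreal (Y * (K * X N))" by (rule err[OF N(1) Nk X u uL T])
      finally show "\<exists>g\<in>cfun.span G. Lp_norm \<mu> q (%x. f x - g x) <= ennreal (Y * (K * X N))" using h by (intro bexI[of _ h])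
    qed
    also have "Y * (K * X N) <= Y * (K * (M * F k))" using XF Y K by (intro mult_left_mono) auto
    finally show ?thesis by (simp only: mult.assoc ennreal_leI)
  qed
  have "\<exists>C0. \<forall>k. k >= nat \<lceil>c + C3\<rceil> --> k >= 2 --> W k <= ennreal (C0 * (F k * L k))"
  proof (cases "q = \<infinity>")
    case False
    define j where "j = nat \<lceil>enn2real q\<rceil>"
    have j: "j >= 1" "enn2real q <= 2 * real j" using enn2real_ge_two[OF q False] unfolding j_def by linarith+
    define Y where "Y = 2 * (1 + area TYPE('d))\<^sup>2 * (sqrt (real j) + 1)"
    have Y: "Y >= 0" by (simp add: Y_def)
    have "W k <= ennreal (Y * K * M * F k)" if "k >= nat \<lceil>c + C3\<rceil>" for k
      by (rule step[OF that Y, of "%_. j"], rule j(1), unfold Y_def,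
          rule error_norm_finite_exponent[OF q False j _ harmonic_sum_sphere_fun])
    thus ?thesis using False by (intro exI[of _ "Y * K * M"]) (simp add: L_def less_top mult.assoc)
  next
    case True
    obtain Y where Y: "Y > 0" "!!N j. real N + 2 <= exp (real j) ==> real j <= real N + 2 ==> j >= 1 ==>
      real (card (E (j * (2 * N)) :: 'd fn set)) / area TYPE('d) <= Y ^ (2 * j)"
      by (rule card_E_le_exp[where 'd='d]) (rule that)
    define H where "H = 1 + (ln (1 / c + 2) + 1) / ln 2"
    have l2: "ln (2::real) > 0" by simp
    define C0 where "C0 = Y * sqrt H + 1 / sqrt (ln 2)"
    \<comment> \<open>logarithmic in \<open>N\<close>, hence in \<open>k\<close>, and large enough for \<open>card_E_le_exp\<close>\<close>
    define j where "j N = nat \<lceil>ln (real N + 2)\<rceil>" for N :: nat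
    have j: "j N >= 1" "ln (real N + 2) <= real (j N)" "real (j N) <= ln (real N + 2) + 1" for N
    proof -
      have "ln (real N + 2) > 0" by simp
      thus "j N >= 1" "ln (real N + 2) <= real (j N)" "real (j N) <= ln (real N + 2) + 1" unfolding j_def by linarith+
    qed
    have Nj: "real N + 2 <= exp (real (j N))" for N
      using j(2)[of N] by (metis exp_le_cancel_iff exp_ln add_nonneg_pos of_nat_0_le_iff zero_less_numeral)
    have jN: "real (j N) <= real N + 2" for N using j(3)[of N] ln_le_minus_one[of "real N + 2"] by simp
    have "W k <= ennreal (C0 * sqrt (ln (real k)) * K * M * F k)" if k: "k >= nat \<lceil>c + C3\<rceil>" and k2: "k >= 2" for k
    proof (rule step[OF k _ j(1)])
      have lk: "ln 2 <= ln (real k)" using k2 by simp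
      have H0: "H >= 0" unfolding H_def using c l2 by (auto intro!: add_nonneg_nonneg divide_nonneg_pos ln_ge_zero)
      show "0 <= C0 * sqrt (ln (real k))" using Y(1) H0 l2 k2 by (auto simp: C0_def intro!: mult_nonneg_nonneg add_nonneg_nonneg)
      fix N and u T :: "'d fn"
      assume N: "N >= 1" and Nk: "c * real N ^ D <= real k" and X: "K * X N > 0" and u: "u \<in> harmonic_sum (2 * N)"
        and uL: "Lnorm (2 * j N) u <= K * X N * sqrt (real (j N))"
        and T: "T \<in> borel_measurable \<mu>" "!!w. cmod (T w) <= K * X N"
      have "real N ^ 1 <= real N ^ D" using N D(1) by (intro power_increasing) simp_all
      hence "c * real N <= c * real N ^ D" using c by (intro mult_left_mono) (simp_all only: power_one_right less_imp_le)
      hence "c * real N <= real k" using Nk by linarith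
      hence "real N <= real k * (1 / c)" using c by (simp add: field_simps)
      moreover have "2 <= real k * 2" using k2 by simp
      ultimately have "real N + 2 <= real k * (1 / c + 2)" by (simp only: distrib_left)
      hence "ln (real N + 2) <= ln (real k * (1 / c + 2))" using c k2 by (subst ln_le_cancel_iff) (auto intro!: mult_pos_pos add_pos_pos)
      also have "... = ln (real k) + ln (1 / c + 2)" using c k2 by (intro ln_mult_pos) (auto intro!: add_pos_pos)
      finally have 1: "real (j N) <= ln (real k) + (ln (1 / c + 2) + 1)" using j(3)[of N] by linarith
      have "1 <= ln (real k) / ln 2" using lk l2 by simp
      hence "(ln (1 / c + 2) + 1) * 1 <= (ln (1 / c + 2) + 1) * (ln (real k) / ln 2)"
        using c by (intro mult_left_mono) (auto intro!: add_nonneg_nonneg ln_ge_zero)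
      with 1 have "real (j N) <= ln (real k) * H" unfolding H_def by (simp add: algebra_simps add_divide_distrib)
      hence "sqrt (real (j N)) <= sqrt (ln (real k)) * sqrt H" by (simp add: real_sqrt_mult[symmetric])
      hence "Y * sqrt (real (j N)) <= Y * (sqrt (ln (real k)) * sqrt H)" using Y(1) by (intro mult_left_mono) auto
      moreover have "1 <= 1 / sqrt (ln 2) * sqrt (ln (real k))" using lk l2 by simp
      ultimately have "Y * sqrt (real (j N)) + 1 <= C0 * sqrt (ln (real k))" unfolding C0_def distrib_right by (simp only: mult_ac add_mono)
      hence "(Y * sqrt (real (j N)) + 1) * (K * X N) <= C0 * sqrt (ln (real k)) * (K * X N)" using X by (intro mult_right_mono) auto
      with error_norm_infinity[OF j(1) Y(1) Y(2)[OF Nj[of N] jN j(1)] X u uL T]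
      show "Lp_norm \<mu> q (%w. u w + T w) <= ennreal (C0 * sqrt (ln (real k)) * (K * X N))"
        unfolding True by (meson ennreal_leI order_trans)
    qed
    thus ?thesis using True by (intro exI[of _ "C0 * K * M"]) (simp add: L_def mult_ac)
  qed
  then obtain C0 where C0: "!!k. k >= nat \<lceil>c + C3\<rceil> ==> k >= 2 ==> W k <= ennreal (C0 * (F k * L k))" by blast
  obtain C1 where C1: "!!k. kolmogorov_width k (smooth_class TYPE('d) \<gamma> r p) \<mu> q <= ennreal C1"
    by (rule width_uniformly_bounded[OF d \<gamma> r(1) p q]) (rule that)
  have "\<exists>C>0. \<forall>k\<ge>2. W k <= ennreal (C * (F k * L k))"
  proof (rule bound_from_eventual_bound)
    show "F k * L k > 0" if "k >= 2" for k using that by (simp add: F_def L_def)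
    show "W k <= ennreal (C0 * (F k * L k))" if "k >= nat \<lceil>c + C3\<rceil>" "k >= 2" for k by (rule C0[OF that])
    show "W k <= ennreal C1" for k unfolding W_def by (rule C1)
  qed
  thus ?thesis unfolding W_def F_def L_def c_inv .
qed

theorem theorem6p6:
  fixes \<gamma> r R :: real and d :: nat
    and \<sigma> :: "(complex ^ 'd::finite) measure"
    and \<Lambda> :: "(complex ^ 'd \<Rightarrow> complex) \<Rightarrow> (complex ^ 'd \<Rightarrow> complex)"
    and \<phi> :: "nat \<Rightarrow> nat"
  defines "d \<equiv> CARD('d)"
    and "\<sigma> \<equiv> sphere_measure"
    and "\<Lambda> \<equiv> multiplier_operator (exp_multiplier \<gamma> r)"
    and "\<phi> \<equiv> (\<lambda>k. cfun.dim (harmonic_sum k :: (complex ^ 'd \<Rightarrow> complex) set))"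
    and "R \<equiv> \<gamma> * (fact d * fact (d - 1) / 2) powr (r / (2 * real d - 1))"
  assumes "d \<ge> 2" and "\<gamma> > 0" and "r > 0"
  shows
    "(r \<le> 1 \<longrightarrow> (\<forall>p q :: ennreal. 1 \<le> p \<and> 2 \<le> q \<longrightarrow>
       (\<exists>C>0. \<forall>k\<ge>2. kolmogorov_width k (\<Lambda> ` Lp_ball \<sigma> p) \<sigma> q \<le>
          ennreal (C * (exp (- R * real k powr (r / (2 * real d - 1))) *
            real k powr ((1 - r / (2 * real d - 1)) * max 0 (enn2real (1 / p) - 1 / 2)) *
            (if q < \<infinity> then 1 else sqrt (ln (real k)))))))) \<and>
     (r > 1 \<longrightarrow> (\<forall>p q :: ennreal.
       (1 \<le> p \<and> p \<le> 2 \<and> 2 \<le> q \<longrightarrow>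
         (\<exists>C>0. \<forall>k\<ge>2. kolmogorov_width (\<phi> k) (\<Lambda> ` Lp_ball \<sigma> p) \<sigma> q \<le>
            ennreal (C * (exp (- \<gamma> * real k powr r) *
              real k powr ((2 * real d - 2) * (enn2real (1 / p) - enn2real (1 / q))))))) \<and>
       (2 \<le> p \<and> 2 \<le> q \<longrightarrow>
         (\<exists>C>0. \<forall>k\<ge>2. kolmogorov_width (\<phi> k) (\<Lambda> ` Lp_ball \<sigma> p) \<sigma> q \<le>
            ennreal (C * (exp (- \<gamma> * real k powr r) *
              real k powr ((2 * real d - 2) * (1 / 2 - enn2real (1 / q)))))))))"
proof (intro conjI impI allI)
  have D: "real (2 * CARD('d) - 1) = 2 * real d - 1" using \<open>d >= 2\<close> by (simp add: d_def)
  fix p q :: ennreal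
  assume "r <= 1" and pq: "1 <= p \<and> 2 <= q"
  show "\<exists>C>0. \<forall>k\<ge>2. kolmogorov_width k (\<Lambda> ` Lp_ball \<sigma> p) \<sigma> q <=
          ennreal (C * (exp (- R * real k powr (r / (2 * real d - 1))) *
            real k powr ((1 - r / (2 * real d - 1)) * max 0 (enn2real (1 / p) - 1 / 2)) *
            (if q < \<infinity> then 1 else sqrt (ln (real k)))))"
    using width_slow_decay[OF \<open>d >= 2\<close>[unfolded d_def] \<open>\<gamma> > 0\<close> \<open>r > 0\<close> \<open>r <= 1\<close> conjunct1[OF pq] conjunct2[OF pq], unfolded D]
    unfolding R_def \<Lambda>_def \<sigma>_def d_def .
next
  fix p q :: ennreal
  assume r: "r > 1" and pq: "1 <= p \<and> p <= 2 \<and> 2 <= q"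
  have "enn2real (1 / p) >= 1 / 2"
  proof -
    have pf: "p ~= \<infinity>" "p ~= 0" using pq by (auto simp: top_unique)
    have "enn2real p <= enn2real 2" using pq by (intro enn2real_mono) auto
    moreover have "enn2real 2 = 2" using enn2real_ennreal[of 2] by simp
    moreover have "enn2real p >= 1" using pq pf by (intro enn2real_ge) auto
    ultimately show ?thesis unfolding enn2real_inverse[OF pf(2,1)] by (simp add: field_simps)
  qed
  hence *: "max 0 (enn2real (1 / p) - 1 / 2) + 1 / 2 - enn2real (1 / q) = enn2real (1 / p) - enn2real (1 / q)" by simp
  show "\<exists>C>0. \<forall>k\<ge>2. kolmogorov_width (\<phi> k) (\<Lambda> ` Lp_ball \<sigma> p) \<sigma> q <=
            ennreal (C * (exp (- \<gamma> * real k powr r) *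
              real k powr ((2 * real d - 2) * (enn2real (1 / p) - enn2real (1 / q)))))"
    using width_fast_decay[OF \<open>d >= 2\<close>[unfolded d_def] \<open>\<gamma> > 0\<close> r conjunct1[OF pq] conjunct2[OF conjunct2[OF pq]], unfolded *]
    unfolding \<phi>_def dim_harmonic_sum \<Lambda>_def \<sigma>_def d_def
    by (elim exE conjE) (intro exI conjI allI impI, assumption, simp)
next
  fix p q :: ennreal
  assume r: "r > 1" and pq: "2 <= p \<and> 2 <= q"
  have p1: "1 <= p" using pq by (meson order_trans one_le_numeral)
  have "enn2real (1 / p) <= 1 / 2"
  proof (cases "p = \<infinity>")
    case False
    have "p ~= 0" using pq by auto
    have "enn2real p >= 2" using pq False by (intro enn2real_ge_two) auto
    thus ?thesis unfolding enn2real_inverse[OF \<open>p ~= 0\<close> False] by (simp add: field_simps)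
  qed simp
  hence *: "max 0 (enn2real (1 / p) - 1 / 2) + 1 / 2 - enn2real (1 / q) = 1 / 2 - enn2real (1 / q)" by simp
  show "\<exists>C>0. \<forall>k\<ge>2. kolmogorov_width (\<phi> k) (\<Lambda> ` Lp_ball \<sigma> p) \<sigma> q <=
            ennreal (C * (exp (- \<gamma> * real k powr r) *
              real k powr ((2 * real d - 2) * (1 / 2 - enn2real (1 / q)))))"
    using width_fast_decay[OF \<open>d >= 2\<close>[unfolded d_def] \<open>\<gamma> > 0\<close> r p1 conjunct2[OF pq], unfolded *]
    unfolding \<phi>_def dim_harmonic_sum \<Lambda>_def \<sigma>_def d_def
    by (elim exE conjE) (intro exI conjI allI impI, assumption, simp)
qed

end
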